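(* Let $d\geq 2$ be an integer. For every $\nu\in(1/2,1]$ there exist an elliptic coefficient function $B:[0,1]\times \mathbb{R}^d\to \mathbb{C}^{d\times d}$ and $f \in L^\infty(0,1;L^2(\mathbb{R}^d))$ such that the unique solution $u\in L^2(0,1;H^1(\mathbb{R}^d))\cap H^1(0,1;H^{-1}(\mathbb{R}^d))$ to $$u' - \operatorname{div}(B\nabla u) = f \ \text{ on } (0,1), \qquad u(0)=0,$$ satisfies $u\notin H^{\nu}(0,1;L^2(\mathbb{R}^d))$.
   Context: All function spaces consist of complex-valued functions. $H^1(\mathbb{R}^d)$ is the usual $L^2$-based Sobolev space and $H^{-1}(\mathbb{R}^d)$ is its (anti)dual, with $H^1(\mathbb{R}^d)\hookrightarrow L^2(\mathbb{R}^d)\hookrightarrow H^{-1}(\mathbb{R}^d)$. For a Banach space $X$, $L^p(0,1;X)$ is the Bochner space and $H^1(0,1;X)$ is the space of $u\in L^2(0,1;X)$ with weak derivative $u'\in L^2(0,1;X)$. For $\nu\in(0,1)$ and a Hilbert space $X$, $H^\nu(0,1;X)$ is the $L^2$-based fractional (Bessel potential) Sobolev space of order $\nu$ of $X$-valued functions on $(0,1)$. Elliptic: a measurable function $B \colon [0,1] \times \mathbb{R}^d \to \mathbb{C}^{d\times d}$ is called elliptic if there exist constants $\Lambda, \lambda > 0$ such that for all $t \in [0,1]$, $x\in \mathbb{R}^d$ and $\xi \in \mathbb{C}^d$ one has $|B(t,x)\xi| \leq \Lambda |\xi|$ and $\operatorname{Re}\big(B(t,x)\xi\cdot\overline{\xi}\big)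 \geq \lambda|\xi|^2$. Here $\operatorname{div}(B(t)\nabla \cdot)\colon H^1(\mathbb{R}^d)\to H^{-1}(\mathbb{R}^d)$ is defined weakly by $\langle -\operatorname{div}(B(t)\nabla v), w\rangle = \int_{\mathbb{R}^d} B(t,x)\nabla v(x)\cdot\overline{\nabla w(x)}\,dx$. Solution: for $f\in L^2(0,1;H^{-1}(\mathbb{R}^d))$, a solution of the problem is a function $u\in L^2(0,1;H^1(\mathbb{R}^d))\cap H^1(0,1;H^{-1}(\mathbb{R}^d))$ such that for all $t\in[0,1]$ one has $u(t) - \int_0^t \operatorname{div}(B(\tau)\nabla u(\tau))\,d\tau = \int_0^t f(\tau)\,d\tau$, as Bochner integrals in $H^{-1}(\mathbb{R}^d)$ (using the continuous representative of $u$). By Lions' theorem, for every elliptic $B$ and every $f\in L^2(0,1;H^{-1}(\mathbb{R}^d))$ there is exactly one solution. *)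

theory Defs
  imports "HOL-Analysis.Analysis"
begin

lemma second_countable_if_dense:
  assumes "countable (D :: 'a::metric_space set)" "\<forall>x. \<forall>e>0. \<exists>d\<in>D. dist d x < e"
  shows "\<exists>B :: 'a set set. countable B \<and> open = generate_topology B"
proof -
  define B where "B = (\<lambda>(d, n). ball d (1 / real (Suc n))) ` (D \<times> (UNIV :: nat set))"
  have cB: "countable B" unfolding B_def using assms(1) by auto
  have "topological_basis B"
  proof (rule topological_basisI)
    fix B' assume "B' \<in> B" then show "open B'" by (auto simp: B_def)
  next
    fix O' :: "'a set" and x assume "open O'" "x \<in> O'"
    then obtain e where e: "e > 0" "ball x e \<subseteq> O'" by (meson openE)
    obtain n where n: "1 / real (Suc n) < e / 2"
      using e(1) nat_approx_posE[of "e/2"] by (metis half_gt_zero inverse_eq_divide)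
    obtain d where d: "d \<in> D" "dist d x < 1 / real (Suc n)"
      using assms(2)[rule_format, of "1 / real (Suc n)" x] by auto
    have "ball d (1 / real (Suc n)) \<subseteq> ball x e"
    proof
      fix y assume "y \<in> ball d (1 / real (Suc n))"
      then have "dist x y < e / 2 + e / 2"
        using d n dist_triangle[of x y d] by (simp add: dist_commute)
      then show "y \<in> ball x e" by simp
    qed
    then show "\<exists>B'\<in>B. x \<in> B' \<and> B' \<subseteq> O'"
      using d e by (intro bexI[of _ "ball d (1 / real (Suc n))"]) (auto simp: B_def)
  qed
  then show ?thesis using cB topological_basis_imp_subbasis by blast
qed

lemma dense_pullback:
  fixes J :: "'a::metric_space \<Rightarrow> 'b::metric_space" and C :: real and D :: "'b set"
  assumes D: "countable D" "\<forall>x. \<forall>e>0. \<exists>d\<in>D. dist d x < e"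
    and C: "C > 0" "\<And>x y. dist x y \<le> C * dist (J x) (J y)"
  shows "\<exists>E :: 'a set. countable E \<and> (\<forall>x. \<forall>e>0. \<exists>d\<in>E. dist d x < e)"
proof -
  define P where "P = (\<lambda>p::'b\<times>nat. \<lambda>x. dist (fst p) (J x) < 1 / real (Suc (snd p)))"
  define E where "E = (\<lambda>p. SOME x. P p x) ` {p \<in> D \<times> UNIV. \<exists>x. P p x}"
  have cE: "countable E" unfolding E_def
    by (rule countable_image, rule countable_subset[of _ "D \<times> UNIV"]) (blast, rule countable_SIGMA, use D(1) in simp_all)
  have dE: "\<exists>d\<in>E. dist d x < e" if "e > 0" for x e
  proof -
    have "e / (2 * C) > 0" using that C by simp
    then obtain n where n: "1 / real (Suc n) < e / (2 * C)"
      using nat_approx_posE[of "e/(2*C)"] by (metis inverse_eq_divide)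
    obtain d where d: "d \<in> D" "dist d (J x) < 1 / real (Suc n)"
      using D(2)[rule_format, of "1 / real (Suc n)" "J x"] by auto
    then have P: "P (d, n) x" by (simp add: P_def)
    define y where "y = (SOME x. P (d, n) x)"
    have y: "P (d, n) y" unfolding y_def using P by (rule someI)
    have "(d, n) \<in> {p \<in> D \<times> UNIV. \<exists>x. P p x}" using d(1) P by blast
    then have "y \<in> E" unfolding E_def y_def by (rule imageI)
    have "dist (J y) (J x) < 2 * (e / (2 * C))"
      using y d n dist_triangle[of "J y" "J x" d] by (simp add: P_def dist_commute)
    then have "C * dist (J y) (J x) < C * (2 * (e / (2 * C)))"
      using C(1) by (rule mult_strict_left_mono)
    also have "\<dots> = e" using C by simp
    finally have "dist y x < e" using C(2)[of y x] by linarith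
    then show ?thesis using \<open>y \<in> E\<close> by blast
  qed
  show ?thesis using cE dE by (intro exI[of _ E] conjI allI impI)
qed

lemma countable_dense_ex:
  "\<exists>D :: 'a::{metric_space, second_countable_topology} set. countable D \<and> (\<forall>x. \<forall>e>0. \<exists>d\<in>D. dist d x < e)"
proof -
  obtain D :: "'a set" where D: "countable D" "\<And>X. open X \<Longrightarrow> X \<noteq> {} \<Longrightarrow> \<exists>d\<in>D. d \<in> X"
    using countable_dense_exists by blast
  have "\<exists>d\<in>D. dist d x < e" if "e > 0" for x e
    using D(2)[of "ball x e"] that by (auto simp: dist_commute)
  then show ?thesis using D(1) by (intro exI[of _ D] conjI allI impI)
qed

lemma norm_diff_scaleR_squared: "(norm (a - t *\<^sub>R b))\<^sup>2 = (norm a)\<^sup>2 - 2 * t * inner a b + t * t * inner b b"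
  for a b :: "'a::real_inner"
  unfolding power2_norm_eq_inner by (simp add: algebra_simps inner_commute[of b a])

lemma closed_subspace_projection:
  fixes M :: "'a::{real_inner, complete_space} set"
  assumes "subspace M" "closed M"
  obtains m where "m \<in> M" "\<And>y. y \<in> M \<Longrightarrow> inner (x - m) y = 0"
proof -
  have ne: "M \<noteq> {}" using assms(1) subspace_0 by blast
  define d where "d = infdist x M"
  have d0: "d \<ge> 0" by (simp add: d_def infdist_nonneg)
  have dle: "d \<le> norm (x - y)" if "y \<in> M" for y
    using infdist_le[OF that, of x] by (simp add: d_def dist_norm)
  have "\<exists>y\<in>M. norm (x - y) < d + 1 / real (Suc n)" for n
  proof -
    have "infdist x M < d + 1 / real (Suc n)" by (simp add: d_def)
    then show ?thesis using ne unfolding infdist_notempty[OF ne] dist_norm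
      by (subst (asm) cINF_less_iff) (auto intro!: bdd_belowI[of _ 0])
  qed
  then obtain f where f: "\<And>n. f n \<in> M" "\<And>n. norm (x - f n) < d + 1 / real (Suc n)" by metis
  have key: "(norm (f n - f k))\<^sup>2 \<le> 2 * (norm (x - f n))\<^sup>2 + 2 * (norm (x - f k))\<^sup>2 - 4 * d\<^sup>2" for n k
  proof -
    let ?z = "(1/2) *\<^sub>R (f n + f k)"
    have "?z \<in> M" using assms(1) f by (simp add: subspace_add subspace_scale)
    then have "d\<^sup>2 \<le> (norm (x - ?z))\<^sup>2" using dle d0 by (simp add: power_mono)
    moreover have "(norm (f n - f k))\<^sup>2 + 4 * (norm (x - ?z))\<^sup>2 = 2 * (norm (x - f n))\<^sup>2 + 2 * (norm (x - f k))\<^sup>2"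
      by (simp add: power2_norm_eq_inner inner_diff inner_add inner_commute algebra_simps)
    ultimately show ?thesis by linarith
  qed
  have up: "(\<lambda>n. norm (x - f n)) \<longlonglongrightarrow> d"
  proof (rule tendsto_sandwich[where f = "\<lambda>_. d" and h = "\<lambda>n. d + 1 / real (Suc n)"])
    show "(\<lambda>n. d + 1 / real (Suc n)) \<longlonglongrightarrow> d"
      using tendsto_add[OF tendsto_const LIMSEQ_inverse_real_of_nat, of d] by (simp add: inverse_eq_divide)
    show "\<forall>\<^sub>F n in sequentially. d \<le> norm (x - f n)" using dle f(1) by simp
    show "\<forall>\<^sub>F n in sequentially. norm (x - f n) \<le> d + 1 / real (Suc n)"
      using f(2) by (simp add: less_imp_le)
  qed auto
  have "Cauchy f"
  proof (rule CauchyI)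
    fix e :: real assume e: "e > 0"
    have "(\<lambda>n. 2 * (norm (x - f n))\<^sup>2 - 2 * d\<^sup>2) \<longlonglongrightarrow> 2 * d\<^sup>2 - 2 * d\<^sup>2"
      by (intro tendsto_intros up)
    then have "\<forall>\<^sub>F n in sequentially. 2 * (norm (x - f n))\<^sup>2 - 2 * d\<^sup>2 < e\<^sup>2 / 2"
      by (rule order_tendstoD(2)) (use e in simp)
    then obtain N where N: "\<And>n. n \<ge> N \<Longrightarrow> 2 * (norm (x - f n))\<^sup>2 - 2 * d\<^sup>2 < e\<^sup>2 / 2"
      by (auto simp: eventually_sequentially)
    have "norm (f m - f n) < e" if "m \<ge> N" "n \<ge> N" for m n
    proof -
      have "(norm (f m - f n))\<^sup>2 < e\<^sup>2" using key[of m n] N[OF that(1)] N[OF that(2)] by linarith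
      then show ?thesis using e by (simp add: power_less_imp_less_base)
    qed
    then show "\<exists>M. \<forall>m\<ge>M. \<forall>n\<ge>M. norm (f m - f n) < e" by blast
  qed
  then obtain m where m: "f \<longlonglongrightarrow> m" by (auto simp: Cauchy_convergent_iff convergent_def)
  have mM: "m \<in> M" using assms(2) f(1) m closed_sequentially by blast
  have "(\<lambda>n. norm (x - f n)) \<longlonglongrightarrow> norm (x - m)" by (intro tendsto_intros m)
  then have nm: "norm (x - m) = d" using up LIMSEQ_unique by blast
  have "inner (x - m) y = 0" if y: "y \<in> M" for y
  proof (cases "y = 0")
    case False
    define t where "t = inner (x - m) y / inner y y"
    have yy: "inner y y > 0" using False by simp
    have "m + t *\<^sub>R y \<in> M" using assms(1) mM y by (simp add: subspace_add subspace_scale)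
    then have "d\<^sup>2 \<le> (norm (x - (m + t *\<^sub>R y)))\<^sup>2" using dle d0 by (simp add: power_mono)
    also have "\<dots> = (norm ((x - m) - t *\<^sub>R y))\<^sup>2" by (simp add: algebra_simps)
    also have "\<dots> = (norm (x - m))\<^sup>2 - 2 * t * inner (x - m) y + t * t * inner y y"
      by (rule norm_diff_scaleR_squared)
    finally have "2 * t * inner (x - m) y \<le> t * t * inner y y" using nm by simp
    moreover have "t * t * inner y y = t * inner (x - m) y" using yy by (simp add: t_def)
    ultimately have "t * inner (x - m) y \<le> 0" by linarith
    then have "(inner (x - m) y)\<^sup>2 / inner y y \<le> 0" by (simp add: t_def power2_eq_square)
    then have "(inner (x - m) y)\<^sup>2 \<le> 0" using yy by (simp add: divide_le_0_iff)
    then show ?thesis by simp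
  qed simp
  then show ?thesis using mM that by blast
qed

lemma riesz_representation:
  fixes F :: "'a::{real_inner, complete_space} \<Rightarrow> real"
  assumes "bounded_linear F"
  shows "\<exists>v. \<forall>w. F w = inner v w"
proof (cases "\<forall>w. F w = 0")
  case True then show ?thesis by (intro exI[of _ 0]) simp
next
  case False
  then obtain x where x: "F x \<noteq> 0" by blast
  interpret bounded_linear F by fact
  have sub: "subspace {w. F w = 0}" by (auto simp: subspace_def add scale zero)
  have cl: "closed {w. F w = 0}"
    by (rule closed_Collect_eq[OF continuous_on[OF continuous_on_id] continuous_on_const])
  obtain m where m: "m \<in> {w. F w = 0}" "\<And>y. y \<in> {w. F w = 0} \<Longrightarrow> inner (x - m) y = 0"
    using closed_subspace_projection[OF sub cl] by blast
  define p where "p = x - m"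
  have Fp: "F p \<noteq> 0" using x m by (simp add: p_def diff)
  have "F w = inner ((F p / inner p p) *\<^sub>R p) w" for w
  proof -
    have "F (w - (F w / F p) *\<^sub>R p) = 0" using Fp by (simp add: diff scale)
    then have "inner p (w - (F w / F p) *\<^sub>R p) = 0" using m(2) by (simp add: p_def)
    then have "inner p w = F w / F p * inner p p" by (simp add: inner_diff_right)
    moreover have "inner p p \<noteq> 0" using Fp zero by auto
    ultimately show ?thesis using Fp by (simp add: field_simps)
  qed
  then show ?thesis by blast
qed

lemma separable_if_total:
  fixes S :: "'a::{real_inner, complete_space} set"
  assumes S: "countable S" and tot: "\<And>x. (\<And>s. s \<in> S \<Longrightarrow> inner x s = 0) \<Longrightarrow> x = 0"
  shows "\<exists>D :: 'a set. countable D \<and> (\<forall>x. \<forall>e>0. \<exists>d\<in>D. dist d x < e)"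
proof -
  define c where "c = (\<lambda>l :: (rat \<times> 'a) list. \<Sum>(q, s)\<leftarrow>l. of_rat q *\<^sub>R s)"
  define D where "D = c ` lists (UNIV \<times> S)"
  have cD: "countable D" unfolding D_def using S by auto
  have c_app: "c (k @ l) = c k + c l" for k l by (simp add: c_def)
  have c_scale: "c (map (\<lambda>(q, s). (r * q, s)) l) = of_rat r *\<^sub>R c l" for r l
    by (induction l) (auto simp: c_def of_rat_mult scaleR_add_right)
  have DI: "c l \<in> D" if "l \<in> lists (UNIV \<times> S)" for l
    unfolding D_def using that by (rule imageI)
  have DE: "\<exists>l. l \<in> lists (UNIV \<times> S) \<and> x = c l" if "x \<in> D" for x
    using that unfolding D_def image_iff by metis
  have addD: "x + y \<in> D" if "x \<in> D" "y \<in> D" for x y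
  proof -
    from DE[OF that(1)] obtain k where k: "k \<in> lists (UNIV \<times> S)" "x = c k" by metis
    from DE[OF that(2)] obtain l where l: "l \<in> lists (UNIV \<times> S)" "y = c l" by metis
    have "k @ l \<in> lists (UNIV \<times> S)" using k l by simp
    from DI[OF this] show ?thesis by (simp add: c_app k l)
  qed
  have scaleD: "of_rat r *\<^sub>R x \<in> D" if "x \<in> D" for r x
  proof -
    from DE[OF that] obtain l where l: "l \<in> lists (UNIV \<times> S)" "x = c l" by metis
    have "map (\<lambda>(q, s). (r * q, s)) l \<in> lists (UNIV \<times> S)" using l(1) by (induction l) auto
    from DI[OF this] show ?thesis by (simp only: c_scale l(2))
  qed
  have sub: "subspace (closure D)"
  proof (rule subspaceI)
    have "c [] \<in> D" by (rule DI) simp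
    then show "0 \<in> closure D" using closure_subset by (auto simp: c_def)
    fix x y assume x: "x \<in> closure D"
    then obtain xs where xs: "\<And>n. xs n \<in> D" "xs \<longlonglongrightarrow> x" by (auto simp: closure_sequential)
    {
      assume "y \<in> closure D"
      then obtain ys where ys: "\<And>n. ys n \<in> D" "ys \<longlonglongrightarrow> y" by (auto simp: closure_sequential)
      have "(\<lambda>n. xs n + ys n) \<longlonglongrightarrow> x + y" using xs ys by (intro tendsto_intros)
      then show "x + y \<in> closure D" 
        unfolding closure_sequential by (intro exI[of _ "\<lambda>n. xs n + ys n"] conjI allI addD xs(1) ys(1))
    }
    fix r :: real
    have "\<exists>q. dist (of_rat q) r < 1 / real (Suc n)" for n
    proof -
      obtain q where "r < of_rat q" "of_rat q < r + 1 / real (Suc n)"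
        using of_rat_dense[of r "r + 1 / real (Suc n)"] by auto
      then show ?thesis by (intro exI[of _ q]) (auto simp: dist_real_def)
    qed
    then obtain q where q: "\<And>n. dist (of_rat (q n)) r < 1 / real (Suc n)" by metis
    have "(\<lambda>n. of_rat (q n)) \<longlonglongrightarrow> r"
    proof (rule metric_tendsto_imp_tendsto[OF LIMSEQ_inverse_real_of_nat])
      show "\<forall>\<^sub>F n in sequentially. dist (real_of_rat (q n)) r \<le> dist (inverse (real (Suc n))) 0"
        using q by (auto simp: less_imp_le inverse_eq_divide intro!: always_eventually)
    qed
    then have "(\<lambda>n. of_rat (q n) *\<^sub>R xs n) \<longlonglongrightarrow> r *\<^sub>R x" using xs by (intro tendsto_intros)
    then show "r *\<^sub>R x \<in> closure D" 
      unfolding closure_sequential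
      by (intro exI[of _ "\<lambda>n. of_rat (q n) *\<^sub>R xs n"] conjI allI scaleD xs(1))
  qed
  have SD: "S \<subseteq> D"
  proof
    fix s assume "s \<in> S"
    then have "[(1, s)] \<in> lists (UNIV \<times> S)" by simp
    from DI[OF this] show "s \<in> D" by (simp add: c_def)
  qed
  have "x \<in> closure D" for x
  proof -
    obtain m where m: "m \<in> closure D" "\<And>y. y \<in> closure D \<Longrightarrow> inner (x - m) y = 0"
      using closed_subspace_projection[OF sub closed_closure] by blast
    have "x - m = 0" using m(2) SD closure_subset[of D] by (intro tot m(2)) auto
    then show ?thesis using m(1) by simp
  qed
  then have "\<exists>d\<in>D. dist d x < e" if "e > 0" for x e
    using that closure_approachable by blast
  then show ?thesis using cD by (intro exI[of _ D] conjI allI impI)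
qed

(* Separable complex Hilbert spaces. The inner product of the class is the real part of the
   complex one; the latter is recovered from it since scalars of modulus one act isometrically. *)
class chilbert = real_inner + complete_space + second_countable_topology +
  fixes scaleC :: "complex \<Rightarrow> 'a \<Rightarrow> 'a"  (infixr "*\<^sub>C" 75)
  assumes scaleC_add_right: "c *\<^sub>C (x + y) = c *\<^sub>C x + c *\<^sub>C y"
    and scaleC_add_left: "(a + b) *\<^sub>C x = a *\<^sub>C x + b *\<^sub>C x"
    and scaleC_scaleC: "a *\<^sub>C b *\<^sub>C x = (a * b) *\<^sub>C x"
    and scaleC_of_real: "complex_of_real r *\<^sub>C x = r *\<^sub>R x"
    and norm_scaleC: "norm (c *\<^sub>C x) = cmod c * norm x"

definition square_integrable :: "('a::euclidean_space \<Rightarrow> complex) \<Rightarrow> bool" where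
  "square_integrable f \<longleftrightarrow>
     f \<in> borel_measurable lborel \<and> integrable lborel (\<lambda>x. (cmod (f x))\<^sup>2)"

(* The space L2 of complex-valued functions is the type of classes modulo equality almost everywhere
   of square-integrable Borel functions.  Every Lebesgue measurable function has a Borel version, so
   nothing is lost by using lborel. *)
definition l2_eq :: "('a::euclidean_space \<Rightarrow> complex) \<Rightarrow> ('a \<Rightarrow> complex) \<Rightarrow> bool" where
  "l2_eq f g \<longleftrightarrow> square_integrable f \<and> square_integrable g \<and> (AE x in lborel. f x = g x)"

lemma sqint_measurable [measurable_dest]: "square_integrable f \<Longrightarrow> f \<in> borel_measurable lborel"
  by (simp add: square_integrable_def)

lemma sqint_zero: "square_integrable (\<lambda>x. 0)" by (simp add: square_integrable_def)

lemma sqint_prod: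
  assumes "square_integrable f" "square_integrable g"
  shows "integrable lborel (\<lambda>x. f x * g x)"
proof (rule Bochner_Integration.integrable_bound)
  show "integrable lborel (\<lambda>x. (cmod (f x))\<^sup>2 + (cmod (g x))\<^sup>2)"
    using assms by (simp add: square_integrable_def)
  show "(\<lambda>x. f x * g x) \<in> borel_measurable lborel"
    using assms by (intro borel_measurable_times sqint_measurable)
  have "2 * (cmod (f x) * cmod (g x)) \<le> (cmod (f x))\<^sup>2 + (cmod (g x))\<^sup>2" for x
    using sum_squares_bound[of "cmod (f x)" "cmod (g x)"] by simp
  moreover have "0 \<le> cmod (f x) * cmod (g x)" for x by simp
  ultimately have "cmod (f x) * cmod (g x) \<le> (cmod (f x))\<^sup>2 + (cmod (g x))\<^sup>2" for x
    by (smt (verit))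
  then show "AE x in lborel. norm (f x * g x) \<le> norm ((cmod (f x))\<^sup>2 + (cmod (g x))\<^sup>2)"
    by (simp add: norm_mult)
qed

lemma sqint_cnj: "square_integrable f \<Longrightarrow> square_integrable (\<lambda>x. cnj (f x))"
  unfolding square_integrable_def by (auto intro: borel_measurable_continuous_onI[THEN measurable_compose_rev] continuous_intros)

lemma sqint_scale: "square_integrable f \<Longrightarrow> square_integrable (\<lambda>x. c * f x)"
  unfolding square_integrable_def
  by (auto simp: norm_mult power_mult_distrib intro!: borel_measurable_times)

lemma sqint_add:
  assumes "square_integrable f" "square_integrable g"
  shows "square_integrable (\<lambda>x. f x + g x)"
  unfolding square_integrable_def
proof
  show m: "(\<lambda>x. f x + g x) \<in> borel_measurable lborel"
    using assms by (intro borel_measurable_add sqint_measurable)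
  show "integrable lborel (\<lambda>x. (cmod (f x + g x))\<^sup>2)"
  proof (rule Bochner_Integration.integrable_bound)
    show "integrable lborel (\<lambda>x. 2 * (cmod (f x))\<^sup>2 + 2 * (cmod (g x))\<^sup>2)"
      using assms by (simp add: square_integrable_def)
    show "(\<lambda>x. (cmod (f x + g x))\<^sup>2) \<in> borel_measurable lborel" using m by measurable
    have "(cmod (f x + g x))\<^sup>2 \<le> 2 * (cmod (f x))\<^sup>2 + 2 * (cmod (g x))\<^sup>2" for x
    proof -
      have "(cmod (f x + g x))\<^sup>2 \<le> (cmod (f x) + cmod (g x))\<^sup>2"
        by (intro power_mono norm_triangle_ineq norm_ge_zero)
      then show ?thesis using sum_squares_bound[of "cmod (f x)" "cmod (g x)"]
        by (simp add: power2_sum)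
    qed
    then show "AE x in lborel. norm ((cmod (f x + g x))\<^sup>2) \<le> norm (2 * (cmod (f x))\<^sup>2 + 2 * (cmod (g x))\<^sup>2)"
      by simp
  qed
qed

lemma sqint_diff:
  assumes "square_integrable f" "square_integrable g"
  shows "square_integrable (\<lambda>x. f x - g x)"
  using sqint_add[OF assms(1) sqint_scale[OF assms(2), of "-1"]] by simp

quotient_type (overloaded) 'a l2 = "'a::euclidean_space \<Rightarrow> complex" / partial: l2_eq
proof (rule part_equivpI)
  show "\<exists>f. l2_eq f (f :: 'a \<Rightarrow> complex)"
    by (rule exI[of _ "\<lambda>x. 0"]) (simp add: l2_eq_def sqint_zero)
  show "symp (l2_eq :: ('a \<Rightarrow> complex) \<Rightarrow> _)" by (auto simp: symp_def l2_eq_def)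
  show "transp (l2_eq :: ('a \<Rightarrow> complex) \<Rightarrow> _)" by (auto simp: transp_def l2_eq_def)
qed

lemma integral_cong_l2_eq:
  assumes "l2_eq f f'" "l2_eq g g'"
  shows "(\<integral>x. Re (f x * cnj (g x)) \<partial>lborel) = (\<integral>x. Re (f' x * cnj (g' x)) \<partial>lborel)"
proof (rule integral_cong_AE)
  have *: "(\<lambda>x. Re (f x * cnj (g x))) \<in> borel_measurable lborel"
    if "square_integrable f" "square_integrable g" for f g :: "'a::euclidean_space \<Rightarrow> complex"
    using borel_measurable_integrable[OF integrable_Re[OF sqint_prod[OF that(1) sqint_cnj[OF that(2)]]]] .
  show "(\<lambda>x. Re (f x * cnj (g x))) \<in> borel_measurable lborel" "(\<lambda>x. Re (f' x * cnj (g' x))) \<in> borel_measurable lborel"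
    using assms * by (auto simp: l2_eq_def)
  show "AE x in lborel. Re (f x * cnj (g x)) = Re (f' x * cnj (g' x))"
    using assms by (auto simp: l2_eq_def)
qed

instantiation l2 :: (euclidean_space) real_inner
begin

lift_definition zero_l2 :: "'a l2" is "\<lambda>x. 0" by (simp add: l2_eq_def sqint_zero)

lift_definition plus_l2 :: "'a l2 \<Rightarrow> 'a l2 \<Rightarrow> 'a l2" is "\<lambda>f g x. f x + g x"
  by (auto simp: l2_eq_def sqint_add)

lift_definition minus_l2 :: "'a l2 \<Rightarrow> 'a l2 \<Rightarrow> 'a l2" is "\<lambda>f g x. f x - g x"
  by (auto simp: l2_eq_def sqint_diff)

lift_definition uminus_l2 :: "'a l2 \<Rightarrow> 'a l2" is "\<lambda>f x. - f x"
  by (auto simp: l2_eq_def square_integrable_def)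

lift_definition scaleR_l2 :: "real \<Rightarrow> 'a l2 \<Rightarrow> 'a l2" is "\<lambda>r f x. complex_of_real r * f x"
  by (auto simp: l2_eq_def sqint_scale)

lift_definition inner_l2 :: "'a l2 \<Rightarrow> 'a l2 \<Rightarrow> real"
  is "\<lambda>f g. \<integral>x. Re (f x * cnj (g x)) \<partial>lborel"
  by (rule integral_cong_l2_eq)

definition norm_l2 :: "'a l2 \<Rightarrow> real" where "norm_l2 f = sqrt (inner f f)"
definition sgn_l2 :: "'a l2 \<Rightarrow> 'a l2" where "sgn_l2 f = scaleR (inverse (norm f)) f"
definition dist_l2 :: "'a l2 \<Rightarrow> 'a l2 \<Rightarrow> real" where "dist_l2 f g = norm (f - g)"
definition uniformity_l2 :: "('a l2 \<times> 'a l2) filter"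
  where "uniformity_l2 = (INF e\<in>{0<..}. principal {(x, y). dist x y < e})"
definition open_l2 :: "'a l2 set \<Rightarrow> bool"
  where "open_l2 U = (\<forall>x\<in>U. \<forall>\<^sub>F (x', y) in uniformity. x' = x \<longrightarrow> y \<in> U)"

instance
proof
  fix f g h :: "'a l2" and r s :: real
  show "f + g + h = f + (g + h)" by transfer (auto simp: l2_eq_def sqint_add algebra_simps)
  show "f + g = g + f" by transfer (auto simp: l2_eq_def sqint_add algebra_simps)
  show "0 + f = f" by transfer (auto simp: l2_eq_def)
  show "- f + f = 0" by transfer (auto simp: l2_eq_def sqint_zero)
  show "f - g = f + - g" by transfer (auto simp: l2_eq_def sqint_diff)
  show "r *\<^sub>R (f + g) = r *\<^sub>R f + r *\<^sub>R g"
    by transfer (auto simp: l2_eq_def sqint_add sqint_scale distrib_left)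
  show "(r + s) *\<^sub>R f = r *\<^sub>R f + s *\<^sub>R f"
    by transfer (auto simp: l2_eq_def sqint_add sqint_scale distrib_right)
  show "r *\<^sub>R s *\<^sub>R f = (r * s) *\<^sub>R f"
    by transfer (auto simp: l2_eq_def sqint_scale mult.assoc)
  show "1 *\<^sub>R f = f" by transfer (auto simp: l2_eq_def)
  show "dist f g = norm (f - g)" by (rule dist_l2_def)
  show "sgn f = scaleR (inverse (norm f)) f" by (rule sgn_l2_def)
  show "norm f = sqrt (inner f f)" by (rule norm_l2_def)
  show "uniformity = (INF e\<in>{0<..}. principal {(x, y::'a l2). dist x y < e})" by (rule uniformity_l2_def)
  show "open U = (\<forall>x\<in>U. \<forall>\<^sub>F (x', y) in uniformity. x' = x \<longrightarrow> y \<in> U)" for U :: "'a l2 set"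
    by (rule open_l2_def)
  show "inner f g = inner g f" by transfer (simp add: mult.commute)
  show "inner (f + g) h = inner f h + inner g h"
  proof transfer
    fix f g h :: "'a \<Rightarrow> complex" assume "l2_eq f f" "l2_eq g g" "l2_eq h h"
    then have "integrable lborel (\<lambda>x. Re (f x * cnj (h x)))" "integrable lborel (\<lambda>x. Re (g x * cnj (h x)))"
      by (auto simp: l2_eq_def intro!: integrable_Re sqint_prod sqint_cnj simp del: times_complex.sel)
    then show "(\<integral>x. Re ((f x + g x) * cnj (h x)) \<partial>lborel) =
        (\<integral>x. Re (f x * cnj (h x)) \<partial>lborel) + (\<integral>x. Re (g x * cnj (h x)) \<partial>lborel)"
      by (subst Bochner_Integration.integral_add[symmetric]) (auto simp: algebra_simps)
  qed
  show "inner (r *\<^sub>R f) g = r * inner f g"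
  proof transfer
    fix r and f g :: "'a \<Rightarrow> complex"
    have "(\<integral>x. Re (complex_of_real r * f x * cnj (g x)) \<partial>lborel) = (\<integral>x. r * Re (f x * cnj (g x)) \<partial>lborel)"
      by (simp add: algebra_simps)
    then show "(\<integral>x. Re (complex_of_real r * f x * cnj (g x)) \<partial>lborel) = r * (\<integral>x. Re (f x * cnj (g x)) \<partial>lborel)"
      by simp
  qed
  show "0 \<le> inner f f" by transfer (auto intro!: integral_nonneg_AE)
  show "(inner f f = 0) = (f = 0)"
  proof transfer
    fix f :: "'a \<Rightarrow> complex" assume f: "l2_eq f f"
    have "integrable lborel (\<lambda>x. Re (f x * cnj (f x)))"
      using f by (auto simp: l2_eq_def intro!: integrable_Re sqint_prod sqint_cnj simp del: times_complex.sel)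
    then have "((\<integral>x. Re (f x * cnj (f x)) \<partial>lborel) = 0) = (AE x in lborel. Re (f x * cnj (f x)) = 0)"
      by (intro integral_nonneg_eq_0_iff_AE) auto
    also have "\<dots> = (AE x in lborel. f x = 0)"
      by (intro AE_cong) (auto simp: complex_eq_iff sum_squares_eq_zero_iff)
    finally show "((\<integral>x. Re (f x * cnj (f x)) \<partial>lborel) = 0) = l2_eq f (\<lambda>x. 0)"
      using f by (simp add: l2_eq_def sqint_zero)
  qed
qed

end

(* An arbitrary Borel representative of the class; it is used under integrals only. *)
definition l2_rep :: "'a::euclidean_space l2 \<Rightarrow> 'a \<Rightarrow> complex" where
  "l2_rep f = (SOME g. l2_eq g g \<and> abs_l2 g = f)"

lemma l2_rep: "l2_eq (l2_rep f) (l2_rep f)" "abs_l2 (l2_rep f) = f"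
proof -
  have "\<exists>g. l2_eq g g \<and> abs_l2 g = f"
    using Quotient_l2 by (metis Quotient_abs_rep Quotient_rep_reflp)
  then have "l2_eq (l2_rep f) (l2_rep f) \<and> abs_l2 (l2_rep f) = f"
    unfolding l2_rep_def by (rule someI_ex)
  then show "l2_eq (l2_rep f) (l2_rep f)" "abs_l2 (l2_rep f) = f" by auto
qed

lemma l2_rep_sqint: "square_integrable (l2_rep f)" using l2_rep(1)[of f] by (simp add: l2_eq_def)

lemma abs_l2_eq_iff:
  assumes "square_integrable f" "square_integrable g"
  shows "abs_l2 f = abs_l2 g \<longleftrightarrow> (AE x in lborel. f x = g x)"
  using assms Quotient_rel_abs[OF Quotient_l2, of f g] Quotient_rel[OF Quotient_l2, of f g]
  by (auto simp: l2_eq_def)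

lemma l2_rep_abs:
  assumes "square_integrable f" shows "AE x in lborel. l2_rep (abs_l2 f) x = f x"
  using abs_l2_eq_iff[OF l2_rep_sqint assms] l2_rep(2)[of "abs_l2 f"] by simp

lemma l2_rep_plus: "AE x in lborel. l2_rep (f + g) x = l2_rep f x + l2_rep g x"
proof -
  have "f + g = abs_l2 (\<lambda>x. l2_rep f x + l2_rep g x)"
    using plus_l2.abs_eq[OF l2_rep(1) l2_rep(1), of f g] by (simp add: l2_rep(2))
  then show ?thesis using l2_rep_abs sqint_add[OF l2_rep_sqint l2_rep_sqint] by metis
qed

lemma l2_rep_diff: "AE x in lborel. l2_rep (f - g) x = l2_rep f x - l2_rep g x"
proof -
  have "f - g = abs_l2 (\<lambda>x. l2_rep f x - l2_rep g x)"
    using minus_l2.abs_eq[OF l2_rep(1) l2_rep(1), of f g] by (simp add: l2_rep(2))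
  then show ?thesis using l2_rep_abs sqint_diff[OF l2_rep_sqint l2_rep_sqint] by metis
qed

lemma inner_l2_abs:
  assumes "square_integrable f" "square_integrable g"
  shows "inner (abs_l2 f) (abs_l2 g) = (\<integral>x. Re (f x * cnj (g x)) \<partial>lborel)"
  using assms by (simp add: inner_l2.abs_eq l2_eq_def)

lemma inner_l2_rep: "inner f g = (\<integral>x. Re (l2_rep f x * cnj (l2_rep g x)) \<partial>lborel)"
  using inner_l2_abs[OF l2_rep_sqint l2_rep_sqint, of f g] by (simp only: l2_rep(2))

lemma norm_l2_abs:
  assumes "square_integrable f"
  shows "(norm (abs_l2 f))\<^sup>2 = (\<integral>x. (cmod (f x))\<^sup>2 \<partial>lborel)"
  unfolding power2_norm_eq_inner[of "abs_l2 f"] inner_l2_abs[OF assms assms]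
  by (simp only: complex_mult_cnj cmod_power2 Re_complex_of_real)

lemma norm_l2_rep: "(norm f)\<^sup>2 = (\<integral>x. (cmod (l2_rep f x))\<^sup>2 \<partial>lborel)"
  using norm_l2_abs[OF l2_rep_sqint, of f] by (simp only: l2_rep(2))

lemma positive_weight:
  obtains \<rho> :: "'a::euclidean_space \<Rightarrow> real"
  where "\<And>x. \<rho> x > 0" "square_integrable (\<lambda>x. complex_of_real (\<rho> x))"
proof -
  obtain \<rho> :: "'a \<Rightarrow> real" where \<rho>: "\<rho> \<in> borel_measurable lborel" "\<And>x. \<rho> x > 0" "\<And>x. \<rho> x \<le> 1" "integrable lborel \<rho>"
    using sigma_finite_measure.obtain_positive_integrable_function[OF sigma_finite_lborel] by blast
  have "integrable lborel (\<lambda>x. (cmod (complex_of_real (\<rho> x)))\<^sup>2)"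
  proof (rule Bochner_Integration.integrable_bound[OF \<rho>(4)])
    show "(\<lambda>x. (cmod (complex_of_real (\<rho> x)))\<^sup>2) \<in> borel_measurable lborel"
      using \<rho>(1) by simp
    have "(\<rho> x)\<^sup>2 \<le> \<rho> x" for x
      using mult_left_le[OF \<rho>(3), of "\<rho> x" x] \<rho>(2)[of x] by (simp add: power2_eq_square)
    then show "AE x in lborel. norm ((cmod (complex_of_real (\<rho> x)))\<^sup>2) \<le> norm (\<rho> x)"
      using \<rho>(2) by (simp add: less_imp_le)
  qed
  then have "square_integrable (\<lambda>x. complex_of_real (\<rho> x))"
    using \<rho>(1) by (simp add: square_integrable_def)
  then show ?thesis using that \<rho>(2) by blast
qed

lemma l2_cauchy_bound:
  assumes "square_integrable f" "square_integrable g"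
  shows "(\<integral>x. cmod (f x * g x) \<partial>lborel) \<le> norm (abs_l2 f) * norm (abs_l2 g)"
proof -
  define a b where "a = (\<lambda>x. complex_of_real (cmod (f x)))" and "b = (\<lambda>x. complex_of_real (cmod (g x)))"
  have ab: "square_integrable a" "square_integrable b"
    using assms by (auto simp: square_integrable_def a_def b_def)
  have "(norm (abs_l2 a))\<^sup>2 = (norm (abs_l2 f))\<^sup>2" "(norm (abs_l2 b))\<^sup>2 = (norm (abs_l2 g))\<^sup>2"
    unfolding norm_l2_abs[OF ab(1)] norm_l2_abs[OF ab(2)] norm_l2_abs[OF assms(1)] norm_l2_abs[OF assms(2)]
    by (simp_all add: a_def b_def)
  then have n: "norm (abs_l2 a) = norm (abs_l2 f)" "norm (abs_l2 b) = norm (abs_l2 g)" by simp_all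
  have "(\<integral>x. cmod (f x * g x) \<partial>lborel) = inner (abs_l2 a) (abs_l2 b)"
    unfolding inner_l2_abs[OF ab] by (simp add: a_def b_def norm_mult)
  also have "\<dots> \<le> norm (abs_l2 a) * norm (abs_l2 b)" by (rule norm_cauchy_schwarz)
  finally show ?thesis by (simp only: n)
qed

lemma minus_l2_abs:
  assumes "square_integrable f" "square_integrable g"
  shows "abs_l2 f - abs_l2 g = abs_l2 (\<lambda>x. f x - g x)"
  using assms by (simp add: minus_l2.abs_eq l2_eq_def)

lemma nn_integral_l2_diff:
  "(\<integral>\<^sup>+x. ennreal ((cmod (l2_rep f x - l2_rep g x))\<^sup>2) \<partial>lborel) = ennreal ((norm (f - g))\<^sup>2)"
proof -
  have s: "square_integrable (\<lambda>x. l2_rep f x - l2_rep g x)"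
    by (intro sqint_diff l2_rep_sqint)
  have "f - g = abs_l2 (\<lambda>x. l2_rep f x - l2_rep g x)"
    using minus_l2_abs[OF l2_rep_sqint l2_rep_sqint, of f g] by (simp only: l2_rep(2))
  then show ?thesis using norm_l2_abs[OF s] s
    by (subst nn_integral_eq_integral) (auto simp: square_integrable_def)
qed

lemma l2_complete:
  fixes X :: "nat \<Rightarrow> 'a::euclidean_space l2"
  assumes "Cauchy X" shows "convergent X"
proof -
  obtain \<rho> :: "'a \<Rightarrow> real" where \<rho>: "\<And>x. \<rho> x > 0" "square_integrable (\<lambda>x. complex_of_real (\<rho> x))"
    using positive_weight by blast
  define F where "F = (\<lambda>n. l2_rep (X n))"
  have F: "square_integrable (F n)" for n by (simp add: F_def l2_rep_sqint)
  have XF: "X n = abs_l2 (F n)" for n by (simp add: F_def l2_rep(2))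
  define K where "K = norm (abs_l2 (\<lambda>x. complex_of_real (\<rho> x))) + 1"
  have K: "K > 0" by (simp add: K_def add_nonneg_pos)
  define G where "G = (\<lambda>n x. F n x * complex_of_real (\<rho> x))"
  have Gint: "integrable lborel (G n)" for n unfolding G_def by (intro sqint_prod F \<rho>)
  have Gbd: "(\<integral>x. norm (G i x - G j x) \<partial>lborel) \<le> norm (X i - X j) * K" for i j
  proof -
    have "(\<integral>x. norm (G i x - G j x) \<partial>lborel) = (\<integral>x. norm ((F i x - F j x) * complex_of_real (\<rho> x)) \<partial>lborel)"
      by (simp only: G_def left_diff_distrib)
    also have "\<dots> \<le> norm (abs_l2 (\<lambda>x. F i x - F j x)) * norm (abs_l2 (\<lambda>x. complex_of_real (\<rho> x)))"
      by (intro l2_cauchy_bound sqint_diff F \<rho>)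
    also have "\<dots> \<le> norm (abs_l2 (\<lambda>x. F i x - F j x)) * K"
      by (intro mult_left_mono) (auto simp: K_def)
    finally show ?thesis by (simp only: XF minus_l2_abs[OF F F])
  qed
  obtain r where r: "strict_mono r" "AE x in lborel. Cauchy (\<lambda>i. G (r i) x)"
  proof (rule cauchy_L1_AE_cauchy_subseq[of lborel G])
    show "integrable lborel (G n)" for n by (rule Gint)
    fix e :: real assume "e > 0"
    then have "e / K > 0" using K by simp
    then obtain N where "\<forall>i\<ge>N. \<forall>j\<ge>N. norm (X i - X j) < e / K" using CauchyD[OF assms] by blast
    then have NK: "norm (X i - X j) * K < e" if "i \<ge> N" "j \<ge> N" for i j
      using that K by (simp add: pos_less_divide_eq)
    show "\<exists>N. \<forall>i\<ge>N. \<forall>j\<ge>N. (\<integral>x. norm (G i x - G j x) \<partial>lborel) < e"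
      by (intro exI[of _ N] allI impI le_less_trans[OF Gbd NK])
  qed
  define f where "f = (\<lambda>x. lim (\<lambda>i. F (r i) x))"
  have fm: "f \<in> borel_measurable lborel"
    unfolding f_def by (intro borel_measurable_lim_metric sqint_measurable F)
  have lim: "AE x in lborel. (\<lambda>i. F (r i) x) \<longlonglongrightarrow> f x"
    using r(2)
  proof (rule AE_mp, intro AE_I2 impI)
    fix x assume "Cauchy (\<lambda>i. G (r i) x)"
    then have "convergent (\<lambda>i. G (r i) x)" by (simp add: Cauchy_convergent)
    then obtain l where "(\<lambda>i. G (r i) x) \<longlonglongrightarrow> l" by (auto simp: convergent_def)
    then have "(\<lambda>i. G (r i) x * inverse (complex_of_real (\<rho> x))) \<longlonglongrightarrow> l * inverse (complex_of_real (\<rho> x))"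
      by (intro tendsto_intros)
    moreover have "G (r i) x * inverse (complex_of_real (\<rho> x)) = F (r i) x" for i
      using \<rho>(1)[of x] by (simp add: G_def)
    ultimately have "convergent (\<lambda>i. F (r i) x)" by (auto simp: convergent_def)
    then show "(\<lambda>i. F (r i) x) \<longlonglongrightarrow> f x" by (simp add: convergent_LIMSEQ_iff f_def)
  qed
  have bd: "(\<integral>\<^sup>+x. ennreal ((cmod (f x - F m x))\<^sup>2) \<partial>lborel) \<le> ennreal (e\<^sup>2)"
    if N: "\<forall>i\<ge>N. \<forall>j\<ge>N. norm (X i - X j) < e" and m: "m \<ge> N" for N m e
  proof -
    have "(\<integral>\<^sup>+x. ennreal ((cmod (f x - F m x))\<^sup>2) \<partial>lborel)
        \<le> (\<integral>\<^sup>+x. liminf (\<lambda>i. ennreal ((cmod (F (r i) x - F m x))\<^sup>2)) \<partial>lborel)"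
    proof (rule nn_integral_mono_AE, rule AE_mp[OF lim], intro AE_I2 impI)
      fix x assume "(\<lambda>i. F (r i) x) \<longlonglongrightarrow> f x"
      then have "(\<lambda>i. ennreal ((cmod (F (r i) x - F m x))\<^sup>2)) \<longlonglongrightarrow> ennreal ((cmod (f x - F m x))\<^sup>2)"
        by (intro tendsto_ennrealI tendsto_intros)
      from lim_imp_Liminf[OF trivial_limit_sequentially this]
      show "ennreal ((cmod (f x - F m x))\<^sup>2) \<le> liminf (\<lambda>i. ennreal ((cmod (F (r i) x - F m x))\<^sup>2))"
        by (rule eq_refl[OF sym])
    qed
    also have "\<dots> \<le> liminf (\<lambda>i. \<integral>\<^sup>+x. ennreal ((cmod (F (r i) x - F m x))\<^sup>2) \<partial>lborel)"
      using sqint_measurable[OF F] by (intro nn_integral_liminf) auto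
    also have "\<dots> = liminf (\<lambda>i. ennreal ((norm (X (r i) - X m))\<^sup>2))"
      by (simp only: F_def nn_integral_l2_diff)
    also have "\<dots> \<le> liminf (\<lambda>i::nat. ennreal (e\<^sup>2))"
    proof (rule Liminf_mono, unfold eventually_sequentially, intro exI allI impI)
      fix i assume "N \<le> i"
      then have "N \<le> r i" using seq_suble[OF r(1), of i] by linarith
      then show "ennreal ((norm (X (r i) - X m))\<^sup>2) \<le> ennreal (e\<^sup>2)"
        using N[rule_format, of "r i" m] m by (intro ennreal_leI power_mono) auto
    qed
    also have "\<dots> = ennreal (e\<^sup>2)" by (simp add: Liminf_const)
    finally show ?thesis .
  qed
  have sqd: "square_integrable (\<lambda>x. f x - F m x)"
    if N: "\<forall>i\<ge>N. \<forall>j\<ge>N. norm (X i - X j) < e" and m: "m \<ge> N" for N m e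
    unfolding square_integrable_def
  proof
    show mm: "(\<lambda>x. f x - F m x) \<in> borel_measurable lborel"
      by (intro borel_measurable_diff fm sqint_measurable F)
    have "(\<integral>\<^sup>+x. ennreal ((cmod (f x - F m x))\<^sup>2) \<partial>lborel) < \<infinity>"
      using bd[OF N m] ennreal_less_top[of "e\<^sup>2"] by (simp only: infinity_ennreal_def le_less_trans)
    then show "integrable lborel (\<lambda>x. (cmod (f x - F m x))\<^sup>2)"
      using mm by (intro integrableI_nonneg) auto
  qed
  obtain N where "\<forall>i\<ge>N. \<forall>j\<ge>N. norm (X i - X j) < 1" using CauchyD[OF assms, of 1] by auto
  from sqint_add[OF sqd[OF this order_refl] F[of N]] have f: "square_integrable f" by simp
  have "X \<longlonglongrightarrow> abs_l2 f"
  proof (rule LIMSEQ_I)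
    fix e :: real assume e: "e > 0"
    then obtain N where N: "\<forall>i\<ge>N. \<forall>j\<ge>N. norm (X i - X j) < e / 2"
      using CauchyD[OF assms, of "e/2"] by auto
    have "norm (X m - abs_l2 f) < e" if m: "m \<ge> N" for m
    proof -
      have s: "square_integrable (\<lambda>x. f x - F m x)" by (rule sqd[OF N m])
      have "ennreal ((norm (abs_l2 f - X m))\<^sup>2) = (\<integral>\<^sup>+x. ennreal ((cmod (f x - F m x))\<^sup>2) \<partial>lborel)"
        unfolding XF minus_l2_abs[OF f F] norm_l2_abs[OF s]
        using s by (subst nn_integral_eq_integral) (auto simp: square_integrable_def)
      also have "\<dots> \<le> ennreal ((e / 2)\<^sup>2)" by (rule bd[OF N m])
      finally have "(norm (abs_l2 f - X m))\<^sup>2 \<le> (e / 2)\<^sup>2" by (subst (asm) ennreal_le_iff) auto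
      then have "norm (abs_l2 f - X m) \<le> e / 2" by (rule power2_le_imp_le) (use e in simp)
      then show ?thesis using e by (simp add: norm_minus_commute)
    qed
    then show "\<exists>N. \<forall>m\<ge>N. norm (X m - abs_l2 f) < e" by blast
  qed
  then show ?thesis by (auto simp: convergent_def)
qed

instance l2 :: (euclidean_space) complete_space
  by standard (rule l2_complete)

lemma l2_total:
  obtains S :: "'a::euclidean_space l2 set"
  where "countable S" "\<And>f. (\<And>s. s \<in> S \<Longrightarrow> inner f s = 0) \<Longrightarrow> f = 0"
proof -
  obtain B :: "'a set set" where B: "countable B" "topological_basis B"
    using ex_countable_basis by blast
  define E where "E = (\<lambda>F. \<Inter>F) ` {F. F \<subseteq> B \<and> finite F}"
  have cE: "countable E" unfolding E_def
    by (rule countable_image) (use countable_Collect_finite_subset[OF B(1)] in \<open>simp only: conj_commute\<close>)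
  have iE: "Int_stable E"
  proof (rule Int_stableI)
    fix a b assume "a \<in> E" "b \<in> E"
    then obtain F1 F2 where F: "F1 \<subseteq> B" "finite F1" "a = \<Inter>F1" "F2 \<subseteq> B" "finite F2" "b = \<Inter>F2"
      by (auto simp: E_def)
    then have "a \<inter> b = \<Inter>(F1 \<union> F2)" "F1 \<union> F2 \<in> {F. F \<subseteq> B \<and> finite F}" by auto
    then show "a \<inter> b \<in> E" unfolding E_def by blast
  qed
  have sB: "sets borel = sigma_sets UNIV B"
    by (subst borel_eq_countable_basis[OF B]) (rule sets_measure_of, simp)
  have EB: "A \<in> sets borel" if AE: "A \<in> E" for A
  proof -
    obtain F where F: "F \<subseteq> B" "finite F" "A = \<Inter>F" using AE unfolding E_def by blast
    have "C \<in> sets (borel :: 'a measure)" if "C \<in> F" for C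
      by (rule borel_open, rule topological_basis_open[OF B(2)]) (use that F(1) in auto)
    then have "F \<subseteq> sets (borel :: 'a measure)" by blast
    with F(2) have "\<Inter>F \<in> sets (borel :: 'a measure)"
      by (induction rule: finite_induct) (simp_all add: sets.Int)
    then show ?thesis by (simp only: F(3))
  qed
  have "B \<subseteq> E"
  proof
    fix C assume "C \<in> B"
    then have "{C} \<in> {F. F \<subseteq> B \<and> finite F}" "C = \<Inter>{C}" by auto
    then show "C \<in> E" unfolding E_def by blast
  qed
  then have sE: "sets borel \<subseteq> sigma_sets UNIV E" unfolding sB by (rule sigma_sets_mono')
  have Es: "sigma_sets UNIV E \<subseteq> sets borel"
    using sets.sigma_sets_subset[of E "borel :: 'a measure"] EB by auto
  have UE: "UNIV \<in> E"
    unfolding E_def by (rule image_eqI[of _ _ "{}"]) auto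
  obtain \<rho> :: "'a \<Rightarrow> real" where \<rho>: "\<And>x. \<rho> x > 0" "square_integrable (\<lambda>x. complex_of_real (\<rho> x))"
    using positive_weight by blast
  define w where "w = (\<lambda>(c::complex) A x. c * (indicator A x * complex_of_real (\<rho> x)))"
  have w: "square_integrable (w c A)" if "A \<in> sets borel" for c A
  proof -
    have "square_integrable (\<lambda>x. indicator A x * complex_of_real (\<rho> x))"
      unfolding square_integrable_def
    proof
      show m: "(\<lambda>x. indicator A x * complex_of_real (\<rho> x)) \<in> borel_measurable lborel"
        using that \<rho>(2) by (intro borel_measurable_times borel_measurable_indicator sqint_measurable) auto
      show "integrable lborel (\<lambda>x. (cmod (indicator A x * complex_of_real (\<rho> x)))\<^sup>2)"
      proof (rule Bochner_Integration.integrable_bound)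
        show "integrable lborel (\<lambda>x. (cmod (complex_of_real (\<rho> x)))\<^sup>2)"
          using \<rho>(2) by (simp add: square_integrable_def)
        show "(\<lambda>x. (cmod (indicator A x * complex_of_real (\<rho> x)))\<^sup>2) \<in> borel_measurable lborel"
          by (intro borel_measurable_power borel_measurable_norm[THEN measurable_compose_rev] measurable_compose[OF m]) auto
      qed (auto simp: indicator_def)
    qed
    then show ?thesis unfolding w_def by (rule sqint_scale)
  qed
  define S where "S = (\<lambda>(c, A). abs_l2 (w c A)) ` ({1, \<i>} \<times> E)"
  have "countable S" unfolding S_def using cE by (intro countable_image countable_SIGMA) auto
  moreover have "f = 0" if z: "\<And>s. s \<in> S \<Longrightarrow> inner f s = 0" for f
  proof -
    define g where "g = (\<lambda>x. l2_rep f x * complex_of_real (\<rho> x))"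
    have g: "integrable lborel g" unfolding g_def by (intro sqint_prod l2_rep_sqint \<rho>)
    have gA: "set_integrable lborel A g" if "A \<in> sets borel" for A
      unfolding set_integrable_def using that g by (intro integrable_mult_indicator) auto
    have gE: "(LINT x:A|lborel. g x) = 0" if A: "A \<in> E" for A
    proof -
      have i: "integrable lborel (\<lambda>x. indicator A x *\<^sub>R g x)"
        using gA[OF EB[OF A]] by (simp add: set_integrable_def)
      have "inner f (abs_l2 (w c A)) = Re (cnj c * (LINT x:A|lborel. g x))" for c
      proof -
        have "inner f (abs_l2 (w c A)) = (\<integral>x. Re (l2_rep f x * cnj (w c A x)) \<partial>lborel)"
          using inner_l2_abs[OF l2_rep_sqint[of f] w[OF EB[OF A]], of c] by (simp only: l2_rep(2))
        also have "\<dots> = (\<integral>x. Re (cnj c * (indicator A x *\<^sub>R g x)) \<partial>lborel)"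
          by (intro Bochner_Integration.integral_cong refl)
            (simp add: w_def g_def scaleR_conv_of_real indicator_def)
        also have "\<dots> = Re (\<integral>x. cnj c * (indicator A x *\<^sub>R g x) \<partial>lborel)"
          using i by (intro integral_Re integrable_mult_right)
        finally show ?thesis by (simp only: set_lebesgue_integral_def integral_mult_right_zero)
      qed
      moreover have "inner f (abs_l2 (w c A)) = 0" if "c \<in> {1, \<i>}" for c
        by (rule z) (use that A in \<open>auto simp: S_def\<close>)
      ultimately have "Re (cnj 1 * (LINT x:A|lborel. g x)) = 0" "Re (cnj \<i> * (LINT x:A|lborel. g x)) = 0"
        by (metis insertI1, metis insertI1 insertI2)
      then show ?thesis by (simp add: complex_eq_iff)
    qed
    have "(LINT x:A|lborel. g x) = 0" if "A \<in> sigma_sets UNIV E" for A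
      using iE subset_UNIV[of E, folded Pow_UNIV] that
    proof (induction rule: sigma_sets_induct_disjoint)
      case (basic A) then show ?case by (rule gE)
    next
      case empty show ?case by (simp add: set_lebesgue_integral_def)
    next
      case (compl A)
      have A: "A \<in> sets borel"
        using compl(1) Es by blast
      have "(LINT x:UNIV|lborel. g x) = (LINT x:A \<union> (UNIV - A)|lborel. g x)" by simp
      also have "\<dots> = (LINT x:A|lborel. g x) + (LINT x:UNIV - A|lborel. g x)"
        using A by (intro set_integral_Un gA) auto
      finally show ?case using gE[OF UE] compl by simp
    next
      case (union A)
      have A: "A i \<in> sets borel" for i
        using union(2) Es by blast
      have "(LINT x:(\<Union>i. A i)|lborel. g x) = (\<Sum>i. (LINT x:(A i)|lborel. g x))"
        using A union(1) by (intro lebesgue_integral_countable_add gA) (auto simp: disjoint_family_on_def)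
      then show ?case using union by simp
    qed
    then have "AE x in lborel. g x = 0"
      using sE by (intro sigma_finite_measure.density_zero[OF sigma_finite_lborel] g) auto
    then have "AE x in lborel. l2_rep f x = 0"
    proof (rule AE_mp, intro AE_I2 impI)
      fix x assume "g x = 0" then show "l2_rep f x = 0" using \<rho>(1)[of x] by (simp add: g_def)
    qed
    then have "abs_l2 (l2_rep f) = abs_l2 (\<lambda>x. 0)" by (subst abs_l2_eq_iff[OF l2_rep_sqint sqint_zero])
    then show ?thesis by (simp add: l2_rep(2) zero_l2_def)
  qed
  ultimately show ?thesis using that by blast
qed

instance l2 :: (euclidean_space) second_countable_topology
proof
  obtain S :: "'a l2 set" where S: "countable S" "\<And>f. (\<And>s. s \<in> S \<Longrightarrow> inner f s = 0) \<Longrightarrow> f = 0"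
    using l2_total by blast
  obtain D :: "'a l2 set" where D: "countable D" "\<forall>x. \<forall>e>0. \<exists>d\<in>D. dist d x < e"
    using separable_if_total[OF S] by blast
  show "\<exists>B :: 'a l2 set set. countable B \<and> open = generate_topology B"
    by (rule second_countable_if_dense[OF D])
qed

instantiation l2 :: (euclidean_space) chilbert
begin

lift_definition scaleC_l2 :: "complex \<Rightarrow> 'a l2 \<Rightarrow> 'a l2" is "\<lambda>c f x. c * f x"
  by (auto simp: l2_eq_def sqint_scale)

instance
proof
  fix f g :: "'a l2" and a b c :: complex and r :: real
  show "c *\<^sub>C (f + g) = c *\<^sub>C f + c *\<^sub>C g"
    by transfer (auto simp: l2_eq_def sqint_add sqint_scale distrib_left)
  show "(a + b) *\<^sub>C f = a *\<^sub>C f + b *\<^sub>C f"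
    by transfer (auto simp: l2_eq_def sqint_add sqint_scale distrib_right)
  show "a *\<^sub>C b *\<^sub>C f = (a * b) *\<^sub>C f"
    by transfer (auto simp: l2_eq_def sqint_scale mult.assoc)
  show "complex_of_real r *\<^sub>C f = r *\<^sub>R f"
    by transfer (auto simp: l2_eq_def sqint_scale)
  have "(norm (c *\<^sub>C f))\<^sup>2 = (cmod c * norm f)\<^sup>2"
  proof -
    have "c *\<^sub>C f = abs_l2 (\<lambda>x. c * l2_rep f x)"
      using scaleC_l2.abs_eq[OF l2_rep(1), of c f] by (simp add: l2_rep(2))
    then have "(norm (c *\<^sub>C f))\<^sup>2 = (\<integral>x. (cmod (c * l2_rep f x))\<^sup>2 \<partial>lborel)"
      by (simp only: norm_l2_abs[OF sqint_scale[OF l2_rep_sqint]])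
    also have "\<dots> = (cmod c)\<^sup>2 * (norm f)\<^sup>2"
      by (simp add: norm_l2_rep norm_mult power_mult_distrib)
    finally show ?thesis by (simp add: power_mult_distrib)
  qed
  then show "norm (c *\<^sub>C f) = cmod c * norm f" by (simp add: power2_eq_iff_nonneg)
qed

end

subclass (in chilbert) banach ..

lemma scaleC_zero_right [simp]: "c *\<^sub>C 0 = (0 :: 'a::chilbert)"
  using scaleC_add_right[of c 0 "0::'a"] by simp

lemma scaleC_scaleR: "c *\<^sub>C (r *\<^sub>R x) = r *\<^sub>R (c *\<^sub>C x)" for x :: "'a::chilbert"
  by (simp flip: scaleC_of_real add: scaleC_scaleC mult.commute)

typedef (overloaded) 'a antidual =
  "{F :: 'a::chilbert \<Rightarrow>\<^sub>L complex. \<forall>c x. blinfun_apply F (c *\<^sub>C x) = cnj c * blinfun_apply F x}"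
  by (rule exI[of _ 0]) simp

setup_lifting type_definition_antidual

instantiation antidual :: (chilbert) real_vector
begin

lift_definition zero_antidual :: "'a antidual" is 0 by simp
lift_definition plus_antidual :: "'a antidual \<Rightarrow> 'a antidual \<Rightarrow> 'a antidual" is "(+)"
  by (simp add: blinfun.add_left distrib_left)
lift_definition minus_antidual :: "'a antidual \<Rightarrow> 'a antidual \<Rightarrow> 'a antidual" is "(-)"
  by (simp add: blinfun.diff_left right_diff_distrib)
lift_definition uminus_antidual :: "'a antidual \<Rightarrow> 'a antidual" is uminus
  by (simp add: blinfun.minus_left)
lift_definition scaleR_antidual :: "real \<Rightarrow> 'a antidual \<Rightarrow> 'a antidual" is "(*\<^sub>R)"
  by (simp add: blinfun.scaleR_left)

instance
proof
  fix F G H :: "'a antidual" and r s :: real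
  show "F + G + H = F + (G + H)" by transfer simp
  show "F + G = G + F" by transfer simp
  show "0 + F = F" by transfer simp
  show "- F + F = 0" by transfer simp
  show "F - G = F + - G" by transfer simp
  show "r *\<^sub>R (F + G) = r *\<^sub>R F + r *\<^sub>R G" by transfer (rule scaleR_add_right)
  show "(r + s) *\<^sub>R F = r *\<^sub>R F + s *\<^sub>R F" by transfer (rule scaleR_add_left)
  show "r *\<^sub>R s *\<^sub>R F = (r * s) *\<^sub>R F" by transfer simp
  show "1 *\<^sub>R F = F" by transfer simp
qed

end

instantiation antidual :: (chilbert) real_normed_vector
begin

lift_definition norm_antidual :: "'a antidual \<Rightarrow> real" is norm .

definition sgn_antidual :: "'a antidual \<Rightarrow> 'a antidual" where "sgn_antidual F = scaleR (inverse (norm F)) F"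
definition dist_antidual :: "'a antidual \<Rightarrow> 'a antidual \<Rightarrow> real" where "dist_antidual F G = norm (F - G)"
definition uniformity_antidual :: "('a antidual \<times> 'a antidual) filter"
  where "uniformity_antidual = (INF e\<in>{0<..}. principal {(x, y). dist x y < e})"
definition open_antidual :: "'a antidual set \<Rightarrow> bool"
  where "open_antidual U = (\<forall>x\<in>U. \<forall>\<^sub>F (x', y) in uniformity. x' = x \<longrightarrow> y \<in> U)"

instance
proof
  fix F G H :: "'a antidual" and r s :: real
  show "dist F G = norm (F - G)" by (rule dist_antidual_def)
  show "sgn F = F /\<^sub>R norm F" by (rule sgn_antidual_def)
  show "uniformity = (INF e\<in>{0<..}. principal {(x, y::'a antidual). dist x y < e})" by (rule uniformity_antidual_def)
  show "open U = (\<forall>x\<in>U. \<forall>\<^sub>F (x', y) in uniformity. x' = x \<longrightarrow> y \<in> U)" for U :: "'a antidual set"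
    by (rule open_antidual_def)
  show "(norm F = 0) = (F = 0)" by transfer simp
  show "norm (F + G) \<le> norm F + norm G" by transfer (rule norm_triangle_ineq)
  show "norm (r *\<^sub>R F) = \<bar>r\<bar> * norm F" by transfer simp
qed

end

definition antidual_apply :: "'a::chilbert antidual \<Rightarrow> 'a \<Rightarrow> complex" where
  "antidual_apply F = blinfun_apply (Rep_antidual F)"

(* Only meaningful for bounded antilinear F, see antidual_apply_make. *)
definition make_antidual :: "('a::chilbert \<Rightarrow> complex) \<Rightarrow> 'a antidual" where
  "make_antidual F = Abs_antidual (Blinfun F)"

lemma antidual_apply_make:
  assumes "bounded_linear F" "\<And>c x. F (c *\<^sub>C x) = cnj c * F x"
  shows "antidual_apply (make_antidual F) = F"
  using assms by (simp add: antidual_apply_def make_antidual_def Abs_antidual_inverse bounded_linear_Blinfun_apply)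

lemma complete_space_by_embedding:
  fixes R :: "'a::metric_space \<Rightarrow> 'b::complete_space" and X :: "nat \<Rightarrow> 'a"
  assumes R: "\<And>x y. dist (R x) (R y) = dist x y" "closed (range R)" and X: "Cauchy X"
  shows "convergent X"
proof -
  have "Cauchy (\<lambda>n. R (X n))" using X by (simp only: Cauchy_def R(1))
  then obtain y where y: "(\<lambda>n. R (X n)) \<longlonglongrightarrow> y" by (auto simp: Cauchy_convergent_iff convergent_def)
  have "y \<in> range R" by (rule closed_sequentially[OF R(2) _ y]) blast
  then obtain x where x: "y = R x" by (rule rangeE)
  have "X \<longlonglongrightarrow> x" using y by (simp only: lim_sequentially x R(1))
  then show ?thesis by (rule convergentI)
qed

instance antidual :: (chilbert) complete_space
proof
  fix X :: "nat \<Rightarrow> 'a antidual" assume X: "Cauchy X"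
  show "convergent X"
  proof (rule complete_space_by_embedding[of Rep_antidual, OF _ _ X])
    show "dist (Rep_antidual F) (Rep_antidual G) = dist F G" for F G :: "'a antidual"
      by (simp add: dist_norm norm_antidual.rep_eq minus_antidual.rep_eq)
    have "range (Rep_antidual :: 'a antidual \<Rightarrow> _) = (\<Inter>c. \<Inter>x. {F. blinfun_apply F (c *\<^sub>C x) = cnj c * blinfun_apply F x})"
      by (auto simp: type_definition.Rep_range[OF type_definition_antidual])
    also have "closed \<dots>"
      by (intro closed_INT ballI closed_Collect_eq continuous_on_mult continuous_on_const
          linear_continuous_on[OF blinfun.bounded_linear_left])
    finally show "closed (range (Rep_antidual :: 'a antidual \<Rightarrow> _))" .
  qed
qed

instance antidual :: (chilbert) banach ..

lemma cnj_phase: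
  assumes "z \<noteq> 0" shows "cnj (sgn z) * z = complex_of_real (cmod z)"
proof -
  have "cnj (sgn z) * z = (z * cnj z) / complex_of_real (cmod z)"
    by (simp add: sgn_eq)
  also have "\<dots> = complex_of_real (cmod z)"
    unfolding complex_norm_square[symmetric] using assms by (simp add: power2_eq_square)
  finally show ?thesis .
qed

instance antidual :: (chilbert) second_countable_topology
proof
  have ex: "\<exists>v. \<forall>w. Re (blinfun_apply (Rep_antidual F) w) = inner v w" for F :: "'a antidual"
  proof -
    have "bounded_linear (\<lambda>w. Re (blinfun_apply (Rep_antidual F) w))"
      using blinfun.bounded_linear_right[of "Rep_antidual F"] by (rule bounded_linear_compose[OF bounded_linear_Re])
    then show ?thesis by (rule riesz_representation)
  qed
  define J where "J = (\<lambda>F :: 'a antidual. SOME v. \<forall>w. Re (blinfun_apply (Rep_antidual F) w) = inner v w)"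
  have J: "Re (blinfun_apply (Rep_antidual F) w) = inner (J F) w" for F w
    unfolding J_def by (rule someI_ex[OF ex[of F], THEN spec])
  have bd: "dist F G \<le> 1 * dist (J F) (J G)" for F G :: "'a antidual"
  proof -
    define H where "H = Rep_antidual (F - G)"
    have H: "blinfun_apply H (c *\<^sub>C x) = cnj c * blinfun_apply H x" for c x
      using Rep_antidual[of "F - G"] by (simp add: H_def)
    have ReH: "Re (blinfun_apply H w) = inner (J F - J G) w" for w
      by (simp add: H_def minus_antidual.rep_eq blinfun.diff_left J inner_diff_left)
    have "norm (blinfun_apply H w) \<le> norm (J F - J G) * norm w" for w
    proof (cases "blinfun_apply H w = 0")
      case False
      define c where "c = sgn (blinfun_apply H w)"
      have nc: "cmod c = 1" using False by (simp add: c_def norm_sgn)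
      have "cnj c * blinfun_apply H w = complex_of_real (cmod (blinfun_apply H w))"
        unfolding c_def by (rule cnj_phase[OF False])
      then have "blinfun_apply H (c *\<^sub>C w) = complex_of_real (cmod (blinfun_apply H w))"
        by (simp only: H)
      then have "norm (blinfun_apply H w) = inner (J F - J G) (c *\<^sub>C w)"
        using ReH[of "c *\<^sub>C w"] by simp
      also have "\<dots> \<le> norm (J F - J G) * norm (c *\<^sub>C w)" by (rule norm_cauchy_schwarz)
      finally show ?thesis unfolding norm_scaleC nc by simp
    qed simp
    then have "norm H \<le> norm (J F - J G)" by (intro norm_blinfun_bound) auto
    then show ?thesis by (simp add: dist_norm norm_antidual.rep_eq H_def)
  qed
  obtain D :: "'a set" where D: "countable D" "\<forall>x. \<forall>e>0. \<exists>d\<in>D. dist d x < e"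
    by (rule exE[OF countable_dense_ex]) (elim conjE)
  obtain E :: "'a antidual set" where E: "countable E" "\<forall>x. \<forall>e>0. \<exists>d\<in>E. dist d x < e"
    using dense_pullback[OF D zero_less_one bd] by (elim exE conjE)
  show "\<exists>B :: 'a antidual set set. countable B \<and> open = generate_topology B"
    by (rule second_countable_if_dense[OF E])
qed

definition l2_pair :: "('a::euclidean_space \<Rightarrow> complex) \<Rightarrow> 'a l2 \<Rightarrow> complex" where
  "l2_pair \<psi> f = (\<integral>x. l2_rep f x * \<psi> x \<partial>lborel)"

lemma l2_pair_inner:
  assumes "square_integrable \<psi>"
  shows "l2_pair \<psi> f = complex_of_real (inner f (abs_l2 (\<lambda>x. cnj (\<psi> x))))
    + \<i> * complex_of_real (inner f (abs_l2 (\<lambda>x. cnj (- \<i> * \<psi> x))))"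
proof -
  have i: "integrable lborel (\<lambda>x. l2_rep f x * \<psi> x)" by (intro sqint_prod l2_rep_sqint assms)
  have "Re (l2_pair \<psi> f) = inner f (abs_l2 (\<lambda>x. cnj (\<psi> x)))"
    unfolding l2_pair_def integral_Re[OF i, symmetric]
    using inner_l2_abs[OF l2_rep_sqint[of f] sqint_cnj[OF assms]]
    by (simp only: l2_rep(2) complex_cnj_cnj)
  moreover have "(\<integral>x. Re (l2_rep f x * (- \<i> * \<psi> x)) \<partial>lborel) = (\<integral>x. Im (l2_rep f x * \<psi> x) \<partial>lborel)"
    by (intro Bochner_Integration.integral_cong refl) (simp add: algebra_simps)
  moreover have "Im (l2_pair \<psi> f) = inner f (abs_l2 (\<lambda>x. cnj (- \<i> * \<psi> x)))"
    unfolding l2_pair_def integral_Im[OF i, symmetric]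
    using inner_l2_abs[OF l2_rep_sqint[of f] sqint_cnj[OF sqint_scale[OF assms, of "-\<i>"]]] calculation(2)
    by (simp only: l2_rep(2) complex_cnj_cnj)
  ultimately show ?thesis by (simp add: complex_eq_iff)
qed

lemma bounded_linear_l2_pair:
  assumes "square_integrable \<psi>" shows "bounded_linear (l2_pair \<psi>)"
proof -
  have "bounded_linear (\<lambda>f. complex_of_real (inner f (abs_l2 (\<lambda>x. cnj (\<psi> x))))
    + \<i> * complex_of_real (inner f (abs_l2 (\<lambda>x. cnj (- \<i> * \<psi> x)))))"
    by (intro bounded_linear_add bounded_linear_const_mult
        bounded_linear_compose[OF bounded_linear_of_real bounded_linear_inner_left])
  then show ?thesis using l2_pair_inner[OF assms] by presburger
qed

lemma l2_rep_scaleC: "AE x in lborel. l2_rep (c *\<^sub>C f) x = c * l2_rep f x"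
proof -
  have "c *\<^sub>C f = abs_l2 (\<lambda>x. c * l2_rep f x)"
    using scaleC_l2.abs_eq[OF l2_rep(1), of c f] by (simp add: l2_rep(2))
  then show ?thesis using l2_rep_abs sqint_scale[OF l2_rep_sqint] by metis
qed

lemma l2_pair_scaleC:
  assumes "square_integrable \<psi>" shows "l2_pair \<psi> (c *\<^sub>C f) = c * l2_pair \<psi> f"
proof -
  have m: "(\<lambda>x. l2_rep g x * \<psi> x) \<in> borel_measurable lborel" for g
    by (intro borel_measurable_times sqint_measurable l2_rep_sqint assms)
  have "l2_pair \<psi> (c *\<^sub>C f) = (\<integral>x. c * (l2_rep f x * \<psi> x) \<partial>lborel)"
    unfolding l2_pair_def
    by (rule integral_cong_AE[OF m borel_measurable_times[OF borel_measurable_const m]])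
      (use l2_rep_scaleC[of c f] in \<open>auto simp: mult.assoc\<close>)
  then show ?thesis by (simp add: l2_pair_def)
qed

definition partial :: "'n::finite \<Rightarrow> (real^'n \<Rightarrow> complex) \<Rightarrow> real^'n \<Rightarrow> complex" where
  "partial i \<phi> x = frechet_derivative \<phi> (at x) (axis i 1)"

(* Frechet differentiability of all iterated partial derivatives, i.e. the class C-infinity. *)
definition smooth :: "(real^'n::finite \<Rightarrow> complex) \<Rightarrow> bool" where
  "smooth \<phi> \<longleftrightarrow> (\<forall>is x. fold partial is \<phi> differentiable (at x))"

definition test_function :: "(real^'n::finite \<Rightarrow> complex) \<Rightarrow> bool" where
  "test_function \<phi> \<longleftrightarrow> smooth \<phi> \<and> compact (closure {x. \<phi> x \<noteq> 0})"

lemma sqint_compact_support: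
  fixes \<psi> :: "'a::euclidean_space \<Rightarrow> complex"
  assumes "continuous_on UNIV \<psi>" "compact K" "\<And>x. x \<notin> K \<Longrightarrow> \<psi> x = 0"
  shows "square_integrable \<psi>"
  unfolding square_integrable_def
proof
  show m: "\<psi> \<in> borel_measurable lborel" using assms(1) by (simp add: borel_measurable_continuous_onI)
  have "integrable lborel (\<lambda>x. indicator K x *\<^sub>R (cmod (\<psi> x))\<^sup>2)"
    by (intro borel_integrable_compact assms continuous_intros continuous_on_subset[OF assms(1)]) auto
  then show "integrable lborel (\<lambda>x. (cmod (\<psi> x))\<^sup>2)"
    by (rule Bochner_Integration.integrable_cong[THEN iffD1, rotated 2]) (use assms(3) in \<open>auto simp: indicator_def\<close>)
qed

lemma test_function_sqint:
  fixes \<phi> :: "real^'n \<Rightarrow> complex"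
  assumes "test_function \<phi>"
  shows "square_integrable \<phi>" "square_integrable (partial i \<phi>)"
proof -
  have d: "fold partial is \<phi> differentiable (at x)" for "is" x
    using assms by (simp add: test_function_def smooth_def)
  have c: "continuous_on UNIV (fold partial is \<phi>)" for "is"
    using d by (simp add: continuous_on_eq_continuous_at differentiable_imp_continuous_within)
  let ?K = "closure {x. \<phi> x \<noteq> 0}"
  have K: "compact ?K" using assms by (simp add: test_function_def)
  have z: "\<phi> x = 0" if "x \<notin> ?K" for x using that closure_subset[of "{x. \<phi> x \<noteq> 0}"] by blast
  show "square_integrable \<phi>" using c[of "[]"] by (intro sqint_compact_support[OF _ K] z) simp_all
  have pz: "partial i \<phi> x = 0" if x: "x \<notin> ?K" for x
  proof -
    have "(\<phi> has_derivative (\<lambda>h. 0)) (at x)"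
      by (rule has_derivative_transform_within_open[OF has_derivative_const[of 0] open_Compl[OF closed_closure[of "{x. \<phi> x \<noteq> 0}"]]])
        (simp_all only: Compl_iff x not_False_eq_True z)
    from frechet_derivative_at[OF this] have "frechet_derivative \<phi> (at x) = (\<lambda>h. 0)" by (rule sym)
    then show ?thesis by (simp add: partial_def)
  qed
  show "square_integrable (partial i \<phi>)"
    using c[of "[i]"] by (intro sqint_compact_support[OF _ K] pz) simp_all
qed

definition weak_gradient :: "(real^'n::finite) l2 \<Rightarrow> (real^'n) l2^'n \<Rightarrow> bool" where
  "weak_gradient v g \<longleftrightarrow> (\<forall>\<phi> i. test_function \<phi> \<longrightarrow>
     (\<integral>x. l2_rep v x * partial i \<phi> x \<partial>lborel) = - (\<integral>x. l2_rep (g $ i) x * \<phi> x \<partial>lborel))"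

definition grad_defect :: "(real^'n::finite \<Rightarrow> complex) \<Rightarrow> 'n \<Rightarrow> (real^'n) l2 \<times> ((real^'n) l2^'n) \<Rightarrow> complex" where
  "grad_defect \<phi> i p = l2_pair (partial i \<phi>) (fst p) + l2_pair \<phi> (snd p $ i)"

lemma weak_gradient_iff:
  "weak_gradient (fst p) (snd p) \<longleftrightarrow> (\<forall>\<phi> i. test_function \<phi> \<longrightarrow> grad_defect \<phi> i p = 0)"
  by (simp add: weak_gradient_def grad_defect_def l2_pair_def eq_neg_iff_add_eq_0)

lemma bounded_linear_grad_defect:
  assumes "test_function \<phi>" shows "bounded_linear (grad_defect \<phi> i)"
  unfolding grad_defect_def
  by (intro bounded_linear_add bounded_linear_compose[OF bounded_linear_l2_pair]
      test_function_sqint[OF assms] bounded_linear_fst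
      bounded_linear_compose[OF bounded_linear_vec_nth bounded_linear_snd])

lemma subspace_h1: "subspace {p :: (real^'n::finite) l2 \<times> ((real^'n) l2^'n). weak_gradient (fst p) (snd p)}"
proof (rule subspaceI)
  note lin = bounded_linear.linear[OF bounded_linear_grad_defect]
  show "0 \<in> {p :: (real^'n::finite) l2 \<times> ((real^'n) l2^'n). weak_gradient (fst p) (snd p)}"
    unfolding mem_Collect_eq weak_gradient_iff using linear_0[OF lin] by blast
  fix p q :: "(real^'n::finite) l2 \<times> ((real^'n) l2^'n)" and r :: real
  assume p: "p \<in> {p. weak_gradient (fst p) (snd p)}"
  show "r *\<^sub>R p \<in> {p. weak_gradient (fst p) (snd p)}"
    unfolding mem_Collect_eq weak_gradient_iff
  proof (intro allI impI)
    fix \<phi> i assume t: "test_function (\<phi> :: real^'n \<Rightarrow> complex)"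
    show "grad_defect \<phi> i (r *\<^sub>R p) = 0"
      unfolding linear_cmul[OF lin[OF t]] using p t by (simp add: weak_gradient_iff)
  qed
  assume q: "q \<in> {p. weak_gradient (fst p) (snd p)}"
  show "p + q \<in> {p. weak_gradient (fst p) (snd p)}"
    unfolding mem_Collect_eq weak_gradient_iff
  proof (intro allI impI)
    fix \<phi> i assume t: "test_function (\<phi> :: real^'n \<Rightarrow> complex)"
    show "grad_defect \<phi> i (p + q) = 0"
      unfolding linear_add[OF lin[OF t]] using p q t by (simp add: weak_gradient_iff)
  qed
qed

(* The Sobolev space H1 is represented by its graph: an element is a class v in L2 together with its
   weak gradient, all of whose components lie in L2.  The weak gradient is determined by v, so the
   first projection h1_l2 identifies this type with the usual subspace of L2.  The norm inherited from
   the product is the square root of norm v squared plus norm (grad v) squared. *)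
typedef (overloaded) 'n h1 =
  "{p :: (real^'n::finite) l2 \<times> ((real^'n) l2^'n). weak_gradient (fst p) (snd p)}"
  using subspace_0[OF subspace_h1] by blast

setup_lifting type_definition_h1

instantiation h1 :: (finite) real_vector
begin

lift_definition zero_h1 :: "'a h1" is 0
  using subspace_0[OF subspace_h1, unfolded mem_Collect_eq] .
lift_definition plus_h1 :: "'a h1 \<Rightarrow> 'a h1 \<Rightarrow> 'a h1" is "(+)"
  using subspace_add[OF subspace_h1, unfolded mem_Collect_eq] .
lift_definition minus_h1 :: "'a h1 \<Rightarrow> 'a h1 \<Rightarrow> 'a h1" is "(-)"
  using subspace_diff[OF subspace_h1, unfolded mem_Collect_eq] .
lift_definition uminus_h1 :: "'a h1 \<Rightarrow> 'a h1" is uminus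
  using subspace_neg[OF subspace_h1, unfolded mem_Collect_eq] .
lift_definition scaleR_h1 :: "real \<Rightarrow> 'a h1 \<Rightarrow> 'a h1" is "(*\<^sub>R)"
  using subspace_scale[OF subspace_h1, unfolded mem_Collect_eq] .

instance
proof
  fix F G H :: "'a h1" and r s :: real
  show "F + G + H = F + (G + H)" by transfer (rule add.assoc)
  show "F + G = G + F" by transfer (rule add.commute)
  show "0 + F = F" by transfer (rule add_0_left)
  show "- F + F = 0" by transfer (rule left_minus)
  show "F - G = F + - G" by transfer (rule diff_conv_add_uminus)
  show "r *\<^sub>R (F + G) = r *\<^sub>R F + r *\<^sub>R G" by transfer (rule scaleR_add_right)
  show "(r + s) *\<^sub>R F = r *\<^sub>R F + s *\<^sub>R F" by transfer (rule scaleR_add_left)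
  show "r *\<^sub>R s *\<^sub>R F = (r * s) *\<^sub>R F" by transfer (rule scaleR_scaleR)
  show "1 *\<^sub>R F = F" by transfer (rule scaleR_one)
qed

end

instantiation h1 :: (finite) real_inner
begin

lift_definition norm_h1 :: "'a h1 \<Rightarrow> real" is norm .
lift_definition inner_h1 :: "'a h1 \<Rightarrow> 'a h1 \<Rightarrow> real" is inner .

definition sgn_h1 :: "'a h1 \<Rightarrow> 'a h1" where "sgn_h1 v = scaleR (inverse (norm v)) v"
definition dist_h1 :: "'a h1 \<Rightarrow> 'a h1 \<Rightarrow> real" where "dist_h1 v w = norm (v - w)"
definition uniformity_h1 :: "('a h1 \<times> 'a h1) filter"
  where "uniformity_h1 = (INF e\<in>{0<..}. principal {(x, y). dist x y < e})"
definition open_h1 :: "'a h1 set \<Rightarrow> bool"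
  where "open_h1 U = (\<forall>x\<in>U. \<forall>\<^sub>F (x', y) in uniformity. x' = x \<longrightarrow> y \<in> U)"

instance
proof
  fix F G H :: "'a h1" and r s :: real
  show "dist F G = norm (F - G)" by (rule dist_h1_def)
  show "sgn F = F /\<^sub>R norm F" by (rule sgn_h1_def)
  show "uniformity = (INF e\<in>{0<..}. principal {(x, y::'a h1). dist x y < e})" by (rule uniformity_h1_def)
  show "open U = (\<forall>x\<in>U. \<forall>\<^sub>F (x', y) in uniformity. x' = x \<longrightarrow> y \<in> U)" for U :: "'a h1 set"
    by (rule open_h1_def)
  show "inner F G = inner G F" by transfer (rule inner_commute)
  show "inner (F + G) H = inner F H + inner G H" by transfer (rule inner_add_left)
  show "inner (r *\<^sub>R F) G = r * inner F G" by transfer (rule inner_scaleR_left)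
  show "0 \<le> inner F F" by transfer (rule inner_ge_zero)
  show "(inner F F = 0) = (F = 0)" by transfer (rule inner_eq_zero_iff)
  show "norm F = sqrt (inner F F)" by transfer (rule norm_eq_sqrt_inner)
qed

end

lemma dist_h1_rep: "dist (Rep_h1 v) (Rep_h1 w) = dist v w"
  by (simp add: dist_norm norm_h1.rep_eq minus_h1.rep_eq)

instance h1 :: (finite) complete_space
proof
  fix X :: "nat \<Rightarrow> 'a h1" assume X: "Cauchy X"
  show "convergent X"
  proof (rule complete_space_by_embedding[of Rep_h1, OF dist_h1_rep _ X])
    have "range (Rep_h1 :: 'a h1 \<Rightarrow> _) = (\<Inter>\<phi>\<in>{\<phi>. test_function \<phi>}. \<Inter>i. {p. grad_defect \<phi> i p = 0})"
      by (auto simp: type_definition.Rep_range[OF type_definition_h1] weak_gradient_iff)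
    also have "closed \<dots>"
      by (intro closed_INT ballI closed_Collect_eq continuous_on_const
          linear_continuous_on[OF bounded_linear_grad_defect]) auto
    finally show "closed (range (Rep_h1 :: 'a h1 \<Rightarrow> _))" .
  qed
qed

lemma vec_dense_ex:
  "\<exists>D :: ('a::{real_normed_vector, second_countable_topology}^'n::finite) set.
     countable D \<and> (\<forall>x. \<forall>e>0. \<exists>d\<in>D. dist d x < e)"
proof -
  obtain D0 :: "'a set" where D0: "countable D0" "\<forall>x. \<forall>e>0. \<exists>d\<in>D0. dist d x < e"
    by (rule exE[OF countable_dense_ex]) (elim conjE)
  define D :: "('a^'n) set" where "D = (\<lambda>f. \<chi> i. f i) ` (PiE UNIV (\<lambda>_. D0))"
  have cD: "countable D" unfolding D_def
    by (intro countable_image countable_PiE) (use D0 in auto)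
  have dD: "\<exists>d\<in>D. dist d x < e" if e: "e > 0" for x :: "'a^'n" and e
  proof -
    have "\<exists>d\<in>D0. dist d (x $ i) < e / real CARD('n)" for i
      by (rule D0(2)[rule_format]) (use e in simp)
    then obtain d where d: "\<And>i. d i \<in> D0" "\<And>i. dist (d i) (x $ i) < e / real CARD('n)" by metis
    have "dist (\<chi> i. d i) x \<le> (\<Sum>i\<in>UNIV. dist (d i) (x $ i))"
      unfolding dist_vec_def by (rule order_trans[OF L2_set_le_sum]) auto
    also have "\<dots> < (\<Sum>i\<in>(UNIV :: 'n set). e / real CARD('n))"
      by (rule sum_strict_mono) (use d in auto)
    also have "\<dots> = e" by simp
    finally have "dist (\<chi> i. d i) x < e" .
    moreover have "(\<chi> i. d i) \<in> D" unfolding D_def using d by (intro imageI) auto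
    ultimately show ?thesis by blast
  qed
  show ?thesis using cD dD by (intro exI[of _ D] conjI allI impI)
qed

instance h1 :: (finite) second_countable_topology
proof
  obtain D1 :: "(real^'a) l2 set" where D1: "countable D1" "\<forall>x. \<forall>e>0. \<exists>d\<in>D1. dist d x < e"
    by (rule exE[OF countable_dense_ex]) (elim conjE)
  obtain D2 :: "((real^'a) l2^'a) set" where D2: "countable D2" "\<forall>x. \<forall>e>0. \<exists>d\<in>D2. dist d x < e"
    by (rule exE[OF vec_dense_ex]) (elim conjE)
  have c: "countable (D1 \<times> D2)" using D1 D2 by simp
  have d: "\<forall>x. \<forall>e>0. \<exists>d\<in>D1 \<times> D2. dist d x < e"
  proof (intro allI impI)
    fix x and e :: real assume e: "e > 0"
    obtain d1 d2 where d: "d1 \<in> D1" "d2 \<in> D2" "dist d1 (fst x) < e/2" "dist d2 (snd x) < e/2"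
      using D1(2)[rule_format, of "e/2" "fst x"] D2(2)[rule_format, of "e/2" "snd x"] e by auto
    have "dist (d1, d2) x \<le> dist d1 (fst x) + dist d2 (snd x)"
      unfolding dist_prod_def by (simp add: sqrt_sum_squares_le_sum)
    then have "dist (d1, d2) x < e" using d by linarith
    then show "\<exists>d\<in>D1 \<times> D2. dist d x < e" using d by blast
  qed
  have i: "dist x y \<le> 1 * dist (Rep_h1 x) (Rep_h1 y)" for x y :: "'a h1"
    by (simp add: dist_h1_rep)
  obtain E :: "'a h1 set" where E: "countable E" "\<forall>x. \<forall>e>0. \<exists>d\<in>E. dist d x < e"
    using dense_pullback[OF c d zero_less_one i] by (elim exE conjE)
  show "\<exists>B :: 'a h1 set set. countable B \<and> open = generate_topology B"
    by (rule second_countable_if_dense[OF E])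
qed

instantiation h1 :: (finite) chilbert
begin

lift_definition scaleC_h1 :: "complex \<Rightarrow> 'a h1 \<Rightarrow> 'a h1"
  is "\<lambda>c p. (c *\<^sub>C fst p, \<chi> i. c *\<^sub>C (snd p $ i))"
  unfolding weak_gradient_iff grad_defect_def
  by (simp add: l2_pair_scaleC test_function_sqint flip: distrib_left)

instance
proof
  fix v w :: "'a h1" and a b c :: complex and r :: real
  show "c *\<^sub>C (v + w) = c *\<^sub>C v + c *\<^sub>C w"
    by transfer (simp add: scaleC_add_right vec_eq_iff prod_eq_iff)
  show "(a + b) *\<^sub>C v = a *\<^sub>C v + b *\<^sub>C v"
    by transfer (simp add: scaleC_add_left vec_eq_iff prod_eq_iff)
  show "a *\<^sub>C b *\<^sub>C v = (a * b) *\<^sub>C v"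
    by transfer (simp add: scaleC_scaleC vec_eq_iff prod_eq_iff)
  show "complex_of_real r *\<^sub>C v = r *\<^sub>R v"
    by transfer (simp add: scaleC_of_real vec_eq_iff prod_eq_iff)
  have nv: "norm (\<chi> i. c *\<^sub>C (g $ i)) = cmod c * norm g" for c and g :: "(real^'a) l2^'a"
    by (simp add: norm_vec_def norm_scaleC L2_set_right_distrib)
  show "norm (c *\<^sub>C v) = cmod c * norm v"
  proof transfer
    fix c and p :: "(real^'a) l2 \<times> ((real^'a) l2^'a)"
    have "norm (c *\<^sub>C fst p, \<chi> i. c *\<^sub>C (snd p $ i))
        = sqrt ((cmod c * norm (fst p))\<^sup>2 + (cmod c * norm (snd p))\<^sup>2)"
      by (simp only: norm_prod_def fst_conv snd_conv norm_scaleC nv)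
    also have "\<dots> = sqrt ((cmod c)\<^sup>2 * ((norm (fst p))\<^sup>2 + (norm (snd p))\<^sup>2))"
      by (simp only: power_mult_distrib distrib_left)
    also have "\<dots> = cmod c * norm p"
      by (simp only: real_sqrt_mult real_sqrt_abs abs_norm_cancel norm_prod_def)
    finally show "norm (c *\<^sub>C fst p, \<chi> i. c *\<^sub>C (snd p $ i)) = cmod c * norm p" .
  qed
qed

end

definition h1_l2 :: "'n::finite h1 \<Rightarrow> (real^'n) l2" where
  "h1_l2 v = fst (Rep_h1 v)"

definition h1_grad :: "'n::finite h1 \<Rightarrow> real^'n \<Rightarrow> complex^'n" where
  "h1_grad v x = (\<chi> i. l2_rep (snd (Rep_h1 v) $ i) x)"

definition cdot :: "complex^'n::finite \<Rightarrow> complex^'n \<Rightarrow> complex" where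
  "cdot a b = (\<Sum>i\<in>UNIV. a $ i * cnj (b $ i))"

(* The embedding of L2 into H^(-1), which is the type of antilinear functionals on h1. *)
definition l2_antidual :: "(real^'n::finite) l2 \<Rightarrow> 'n h1 antidual" where
  "l2_antidual g = make_antidual (\<lambda>w. \<integral>x. l2_rep g x * cnj (l2_rep (h1_l2 w) x) \<partial>lborel)"

(* div (A grad v); for bounded Borel A the function below is bounded and antilinear in w,
   see antidual_apply_div_op. *)
definition div_op :: "(real^'n::finite \<Rightarrow> complex^'n^'n) \<Rightarrow> 'n h1 \<Rightarrow> 'n h1 antidual" where
  "div_op A v = make_antidual (\<lambda>w. - (\<integral>x. cdot (A x *v h1_grad v x) (h1_grad w x) \<partial>lborel))"

lemma integral_cnj_l2_pair:
  "(\<integral>x. \<psi> x * cnj (l2_rep f x) \<partial>lborel) = cnj (l2_pair (\<lambda>x. cnj (\<psi> x)) f)"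
  unfolding l2_pair_def by (simp only: Bochner_Integration.integral_cnj[symmetric] complex_cnj_mult complex_cnj_cnj mult.commute)

lemma antidual_apply_l2_antidual:
  "antidual_apply (l2_antidual g) w = (\<integral>x. l2_rep g x * cnj (l2_rep (h1_l2 w) x) \<partial>lborel)"
proof -
  have s: "square_integrable (\<lambda>x. cnj (l2_rep g x))" by (intro sqint_cnj l2_rep_sqint)
  have "norm (fst p) \<le> norm p" for p :: "(real^'a) l2 \<times> ((real^'a) l2^'a)"
    by (metis norm_fst_le prod.collapse)
  then have "bounded_linear (h1_l2 :: 'a h1 \<Rightarrow> _)"
    by (intro bounded_linear_intro[of _ 1])
      (simp_all add: h1_l2_def plus_h1.rep_eq scaleR_h1.rep_eq norm_h1.rep_eq)
  then have "bounded_linear (\<lambda>w. cnj (l2_pair (\<lambda>x. cnj (l2_rep g x)) (h1_l2 w)))"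
    by (intro bounded_linear_compose[OF bounded_linear_cnj] bounded_linear_compose[OF bounded_linear_l2_pair[OF s]])
  moreover have "h1_l2 (c *\<^sub>C w) = c *\<^sub>C h1_l2 w" for c and w :: "'a h1"
    by (simp add: h1_l2_def scaleC_h1.rep_eq)
  ultimately show ?thesis unfolding l2_antidual_def integral_cnj_l2_pair
    by (subst antidual_apply_make) (simp_all add: l2_pair_scaleC[OF s])
qed

lemma antidual_apply_div_op:
  fixes A :: "real^'n::finite \<Rightarrow> complex^'n^'n" and v w :: "'n h1"
  assumes A: "A \<in> borel_measurable borel" "\<And>x \<xi>. norm (A x *v \<xi>) \<le> \<Lambda> * norm \<xi>"
  shows "antidual_apply (div_op A v) w = - (\<integral>x. cdot (A x *v h1_grad v x) (h1_grad w x) \<partial>lborel)"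
proof -
  define F where "F = (\<lambda>x. A x *v h1_grad v x)"
  have gm: "(\<lambda>x. h1_grad v x $ j) \<in> borel_measurable borel" for j
    using sqint_measurable[OF l2_rep_sqint] by (simp add: h1_grad_def)
  have Am: "(\<lambda>x. A x $ i $ j) \<in> borel_measurable borel" for i j
  proof -
    have "(\<lambda>a :: complex^'n^'n. a $ i $ j) \<in> borel_measurable borel"
      by (intro borel_measurable_continuous_onI continuous_intros)
    from measurable_compose[OF A(1) this] show ?thesis .
  qed
  have Fm: "(\<lambda>x. F x $ i) \<in> borel_measurable lborel" for i
    unfolding F_def matrix_vector_mult_def vec_lambda_beta measurable_lborel2
    by (intro borel_measurable_sum borel_measurable_times Am gm)
  have gi: "integrable lborel (\<lambda>x. (norm (h1_grad v x))\<^sup>2)"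
  proof -
    have "(norm (h1_grad v x))\<^sup>2 = (\<Sum>i\<in>UNIV. (cmod (l2_rep (snd (Rep_h1 v) $ i) x))\<^sup>2)" for x
      by (simp add: norm_vec_def L2_set_def sum_nonneg h1_grad_def)
    moreover have "integrable lborel (\<lambda>x. \<Sum>i\<in>UNIV. (cmod (l2_rep (snd (Rep_h1 v) $ i) x))\<^sup>2)"
      by (intro Bochner_Integration.integrable_sum l2_rep_sqint[unfolded square_integrable_def, THEN conjunct2])
    ultimately show ?thesis by simp
  qed
  have Fs: "square_integrable (\<lambda>x. cnj (F x $ i))" for i
  proof (rule sqint_cnj, unfold square_integrable_def, intro conjI Fm)
    show "integrable lborel (\<lambda>x. (cmod (F x $ i))\<^sup>2)"
    proof (rule Bochner_Integration.integrable_bound[OF integrable_mult_right[OF gi, of "\<Lambda>\<^sup>2"]])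
      show "(\<lambda>x. (cmod (F x $ i))\<^sup>2) \<in> borel_measurable lborel"
        by (intro borel_measurable_power measurable_compose[OF Fm borel_measurable_norm])
      have "(cmod (F x $ i))\<^sup>2 \<le> \<Lambda>\<^sup>2 * (norm (h1_grad v x))\<^sup>2" for x
      proof -
        have "cmod (F x $ i) \<le> \<Lambda> * norm (h1_grad v x)"
          using Finite_Cartesian_Product.norm_nth_le[of "F x" i] A(2)[of x "h1_grad v x"]
          unfolding F_def by linarith
        from power_mono[OF this norm_ge_zero, of 2] show ?thesis by (simp only: power_mult_distrib)
      qed
      then show "AE x in lborel. norm ((cmod (F x $ i))\<^sup>2) \<le> norm (\<Lambda>\<^sup>2 * (norm (h1_grad v x))\<^sup>2)"
        by simp
    qed
  qed
  define G where "G = (\<lambda>w. - (\<Sum>i\<in>UNIV. cnj (l2_pair (\<lambda>x. cnj (F x $ i)) (snd (Rep_h1 w) $ i))))"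
  have "(\<integral>x. cdot (F x) (h1_grad w x) \<partial>lborel)
      = (\<Sum>i\<in>UNIV. cnj (l2_pair (\<lambda>x. cnj (F x $ i)) (snd (Rep_h1 w) $ i)))" for w
  proof -
    have "integrable lborel (\<lambda>x. F x $ i * cnj (l2_rep (snd (Rep_h1 w) $ i) x))" for i
      using sqint_prod[OF sqint_cnj[OF Fs] sqint_cnj[OF l2_rep_sqint]] by simp
    then show ?thesis unfolding cdot_def h1_grad_def vec_lambda_beta integral_cnj_l2_pair[symmetric]
      by (rule Bochner_Integration.integral_sum)
  qed
  then have G: "div_op A v = make_antidual G" "- (\<integral>x. cdot (A x *v h1_grad v x) (h1_grad w x) \<partial>lborel) = G w" for w
    by (simp_all add: div_op_def G_def F_def)
  have Rl: "bounded_linear (Rep_h1 :: 'n h1 \<Rightarrow> _)"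
    by (rule bounded_linear_intro[of _ 1]) (simp_all add: plus_h1.rep_eq scaleR_h1.rep_eq norm_h1.rep_eq)
  have "bounded_linear G" unfolding G_def
    by (intro bounded_linear_minus bounded_linear_sum bounded_linear_compose[OF bounded_linear_cnj]
        bounded_linear_compose[OF bounded_linear_l2_pair[OF Fs]]
        bounded_linear_compose[OF bounded_linear_vec_nth] bounded_linear_compose[OF bounded_linear_snd] Rl)
  moreover have "G (c *\<^sub>C w) = cnj c * G w" for c w
    by (simp add: G_def scaleC_h1.rep_eq l2_pair_scaleC[OF Fs] sum_distrib_left)
  ultimately show ?thesis unfolding G by (simp add: antidual_apply_make)
qed

(* Bochner spaces as sets of representatives; functions equal almost everywhere are not identified.
   The value spaces are separable, so Borel measurability is strong measurability. *)
definition bochner_L2 :: "real measure \<Rightarrow> (real \<Rightarrow> 'b::{banach, second_countable_topology}) set" where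
  "bochner_L2 M = {u. u \<in> borel_measurable M \<and> integrable M (\<lambda>t. (norm (u t))\<^sup>2)}"

definition bochner_Linf :: "real measure \<Rightarrow> (real \<Rightarrow> 'b::{banach, second_countable_topology}) set" where
  "bochner_Linf M = {u. u \<in> borel_measurable M \<and> (\<exists>C. AE t in M. norm (u t) \<le> C)}"

abbreviation I01 :: "real measure" where
  "I01 \<equiv> restrict_space lborel {0<..<1}"

definition test_function_01 :: "(real \<Rightarrow> real) \<Rightarrow> bool" where
  "test_function_01 \<phi> \<longleftrightarrow> (\<forall>k t. (deriv ^^ k) \<phi> field_differentiable (at t)) \<and>
     compact (closure {t. \<phi> t \<noteq> 0}) \<and> closure {t. \<phi> t \<noteq> 0} \<subseteq> {0<..<1}"

definition sobolev_H1 :: "(real \<Rightarrow> 'b::{banach, second_countable_topology}) set" where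
  "sobolev_H1 = {u \<in> bochner_L2 I01. \<exists>u' \<in> bochner_L2 I01. \<forall>\<phi>. test_function_01 \<phi> \<longrightarrow>
     (\<integral>t. deriv \<phi> t *\<^sub>R u t \<partial>I01) = - (\<integral>t. \<phi> t *\<^sub>R u' t \<partial>I01)}"

definition vderiv :: "(real \<Rightarrow> complex) \<Rightarrow> real \<Rightarrow> complex" where
  "vderiv \<phi> t = vector_derivative \<phi> (at t)"

definition schwartz :: "(real \<Rightarrow> complex) \<Rightarrow> bool" where
  "schwartz \<phi> \<longleftrightarrow> (\<forall>k t. (vderiv ^^ k) \<phi> differentiable (at t)) \<and>
     (\<forall>j k. bounded (range (\<lambda>t. t ^ j *\<^sub>R (vderiv ^^ k) \<phi> t)))"

definition fourier :: "(real \<Rightarrow> complex) \<Rightarrow> real \<Rightarrow> complex" where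
  "fourier \<phi> \<xi> = (\<integral>t. cis (- (\<xi> * t)) * \<phi> t \<partial>lborel)"

(* G is the Fourier transform of g in the sense of tempered distributions. *)
definition has_fourier_transform :: "(real \<Rightarrow> 'b::chilbert) \<Rightarrow> (real \<Rightarrow> 'b) \<Rightarrow> bool" where
  "has_fourier_transform g G \<longleftrightarrow> (\<forall>\<phi>. schwartz \<phi> \<longrightarrow>
     (\<integral>\<xi>. \<phi> \<xi> *\<^sub>C G \<xi> \<partial>lborel) = (\<integral>t. fourier \<phi> t *\<^sub>C g t \<partial>lborel))"

definition bessel_line :: "real \<Rightarrow> (real \<Rightarrow> 'b::chilbert) set" where
  "bessel_line \<nu> = {g \<in> bochner_L2 lborel. \<exists>G \<in> bochner_L2 lborel. has_fourier_transform g G \<and>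
     (\<lambda>\<xi>. (1 + \<xi>\<^sup>2) powr (\<nu> / 2) *\<^sub>R G \<xi>) \<in> bochner_L2 lborel}"

(* For 0 < nu < 1 this is the space of restrictions to (0,1) of the Bessel potential space on the
   real line; for nu = 1 it is the space defined through weak derivatives. *)
definition sobolev_H :: "real \<Rightarrow> (real \<Rightarrow> 'b::chilbert) set" where
  "sobolev_H \<nu> = (if \<nu> = 1 then sobolev_H1
     else {u \<in> bochner_L2 I01. \<exists>g \<in> bessel_line \<nu>. AE t in I01. g t = u t})"

(* Values of B at times outside [0,1] are irrelevant. *)
definition elliptic :: "(real \<Rightarrow> real^'n::finite \<Rightarrow> complex^'n^'n) \<Rightarrow> bool" where
  "elliptic B \<longleftrightarrow>
     (\<lambda>(t, x). B t x) \<in> borel_measurable (restrict_space borel ({0..1} \<times> UNIV)) \<and>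
     (\<exists>\<Lambda>>0. \<exists>\<mu>>0. \<forall>t\<in>{0..1}. \<forall>x \<xi>.
        norm (B t x *v \<xi>) \<le> \<Lambda> * norm \<xi> \<and> Re (cdot (B t x *v \<xi>) \<xi>) \<ge> \<mu> * (norm \<xi>)\<^sup>2)"

(* U is the continuous representative of u in H^(-1); t = 0 gives the initial condition U 0 = 0.
   Integrability of the divergence term is stated explicitly because the library's integral of a
   non-integrable function is 0. *)
definition is_solution ::
  "(real \<Rightarrow> real^'n::finite \<Rightarrow> complex^'n^'n) \<Rightarrow> (real \<Rightarrow> 'n h1 antidual) \<Rightarrow> (real \<Rightarrow> 'n h1) \<Rightarrow> bool" where
  "is_solution B f u \<longleftrightarrow>
     u \<in> bochner_L2 I01 \<and> (\<lambda>t. l2_antidual (h1_l2 (u t))) \<in> sobolev_H1 \<and>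
     set_integrable lborel {0<..<1} (\<lambda>\<tau>. div_op (B \<tau>) (u \<tau>)) \<and>
     (\<exists>U. continuous_on {0..1} U \<and> (AE t in I01. U t = l2_antidual (h1_l2 (u t))) \<and>
        (\<forall>t\<in>{0..1}. U t - (LINT \<tau>:{0<..<t}|lborel. div_op (B \<tau>) (u \<tau>))
           = (LINT \<tau>:{0<..<t}|lborel. f \<tau>)))"

end

theory Submission
  imports Defs "HOL-Probability.Probability"
begin

text \<open>
The exponent of time regularity is destroyed by one explicit complex-valued function.  Write
z = x_i + \<i> x_j for two distinguished coordinates, \<sigma> = |z|^2, \<tau> = |x|^2 and s = 1 - t, and put
  u(t,x) = t \<psi>(1 - \<tau>) z G_s(\<sigma>)  with  G_s(\<sigma>) = (\<sigma> + s) (\<sigma> + l s)^(\<gamma> - 2),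
where \<psi> is a smooth cutoff, \<gamma> = (\<nu> - 1/2)/4 and l = \<gamma>/4.  The profile is homogeneous,
G_{rs}(r\<sigma>) = r^(\<gamma>-1) G_s(\<sigma>), and it concentrates on \<sigma> = 0 as s decreases to 0.  On the region where
\<sigma> is comparable to s, which has area of order s in the (x_i,x_j)-plane, u changes by an amount of order
s^(1/2) s^(\<gamma>-1) between the times 1 - 2s and 1 - s.  Hence the increment of u in L2 is at least
c s^\<gamma> (increment_lower_bound).  But functions in H^\<nu>(0,1;L2) are Hoelder continuous
of every order \<theta> < \<nu> - 1/2 (bessel_line_Hoelder, and sobolev_H1_Hoelder for \<nu> = 1), and
\<gamma> < 2\<gamma> < \<nu> - 1/2.

It remains to find an elliptic B for which \<partial>_t u - div(B \<nabla> u) is bounded in L2.  Let X be the radial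
vector (x_i,x_j) and Y the rotated vector (-x_j,x_i).  A matrix
  (d X X^T + \<mu> Y Y^T - \<i> \<beta> (X Y^T + Y X^T)) / \<sigma>
has Re (B \<xi> . cnj \<xi>) = (d |X.\<xi>|^2 + \<mu> |Y.\<xi>|^2) / \<sigma>, because the symmetric
imaginary part contributes nothing to the real part of the form.  So \<beta> is free, and this is where
complex coefficients enter.  The gradient of z G has the radial component (1 + \<kappa>) z G and the
rotational component \<i> z G, and one is free to prescribe the radial component q z G of the flux
B \<nabla> u.  The equation \<partial>_t (z G) = div(flux) then determines the rotational component b, and comparing
components gives \<beta> = q - d (1 + \<kappa>) and \<mu> = b + \<beta> (1 + \<kappa>).  All these quantities are rational
functions of \<sigma> and s of degree 0, and for a suitable q one finds that \<mu> is bounded below by a positive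
constant (coefficient_bounds).  This gives ellipticity (elliptic_coeff_matrix).
The terms of \<partial>_t u - div(B \<nabla> u) that survive contain the derivative of the factor t or derivatives of the cutoff
(divergence_flux); they are bounded by a multiple of |z| G, and |z|^2 G^2 is dominated by the locally
integrable function \<sigma>^(\<gamma>-1).  Likewise |\<nabla> u|^2 is dominated by \<sigma>^(\<gamma>-1) s^(\<gamma>-1), which is
integrable in space and time (solution_estimates).

The function u is smooth for t < 1, so the equation holds classically, and integration by parts turns it into
the equation in the antidual of H1 (concentrating_equation, is_solution_if_classical).  Uniqueness
(solution_unique) is the energy argument; the Gram operator of the L2 product on H1 is not
invertible there, and it is replaced by partial sums of a Neumann series.
\<close>

section \<open>Smooth functions of one real variable\<close>

text \<open>
Smoothness is expressed by iterated existence of derivatives rather than by iterating the total function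
deriv: the recursion then closes under sums, products and compositions by plain induction.
\<close>

fun diff_times :: "nat \<Rightarrow> real set \<Rightarrow> (real \<Rightarrow> real) \<Rightarrow> bool" where
  "diff_times 0 S f \<longleftrightarrow> True"
| "diff_times (Suc n) S f \<longleftrightarrow>
     (\<exists>f'. (\<forall>x\<in>S. (f has_real_derivative f' x) (at x)) \<and> diff_times n S f')"

lemma diff_times_SucI:
  "(\<And>x. x \<in> S \<Longrightarrow> (f has_real_derivative f' x) (at x)) \<Longrightarrow> diff_times n S f' \<Longrightarrow> diff_times (Suc n) S f"
  by auto

lemma diff_times_Suc_imp: "diff_times (Suc n) S f \<Longrightarrow> diff_times n S f"
proof (induction n arbitrary: f)
  case (Suc n)
  then obtain f' where "\<forall>x\<in>S. (f has_real_derivative f' x) (at x)" "diff_times (Suc n) S f'"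
    by (auto simp only: diff_times.simps)
  with Suc.IH show ?case by auto
qed simp

lemma diff_times_cong:
  assumes "open S" "\<And>x. x \<in> S \<Longrightarrow> f x = g x" "diff_times n S f"
  shows "diff_times n S g"
proof (cases n)
  case (Suc m)
  then obtain f' where f': "\<forall>x\<in>S. (f has_real_derivative f' x) (at x)" "diff_times m S f'"
    using assms(3) by auto
  have "(g has_real_derivative f' x) (at x)" if "x \<in> S" for x
    by (rule has_field_derivative_transform_within_open[of f _ x S]) (use assms f' that in auto)
  then show ?thesis using f' Suc by auto
qed simp

lemma diff_times_const: "diff_times n S (\<lambda>x. c)"
  by (induction n arbitrary: c) (auto intro!: exI[of _ "\<lambda>x. 0"])

lemma diff_times_id: "diff_times n S (\<lambda>x. x)"
  by (cases n) (auto intro!: exI[of _ "\<lambda>x. 1"] diff_times_const)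

lemma diff_times_add:
  "diff_times n S f \<Longrightarrow> diff_times n S g \<Longrightarrow> diff_times n S (\<lambda>x. f x + g x)"
proof (induction n arbitrary: f g)
  case (Suc n)
  then obtain f' g' where "\<forall>x\<in>S. (f has_real_derivative f' x) (at x)" "diff_times n S f'"
    "\<forall>x\<in>S. (g has_real_derivative g' x) (at x)" "diff_times n S g'" by auto
  then show ?case using Suc.IH[of f' g']
    by (auto intro!: exI[of _ "\<lambda>x. f' x + g' x"] derivative_intros)
qed simp

lemma diff_times_mult:
  "diff_times n S f \<Longrightarrow> diff_times n S g \<Longrightarrow> diff_times n S (\<lambda>x. f x * g x)"
proof (induction n arbitrary: f g)
  case (Suc n)
  then obtain f' g' where *: "\<forall>x\<in>S. (f has_real_derivative f' x) (at x)" "diff_times n S f'"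
    "\<forall>x\<in>S. (g has_real_derivative g' x) (at x)" "diff_times n S g'" by auto
  have "diff_times n S (\<lambda>x. f' x * g x + f x * g' x)"
    using Suc diff_times_Suc_imp * by (intro diff_times_add Suc.IH) auto
  then show ?case using *
    by (auto intro!: exI[of _ "\<lambda>x. f' x * g x + f x * g' x"] derivative_eq_intros)
qed simp

lemma diff_times_compose:
  "diff_times n S f \<Longrightarrow> diff_times n S' g \<Longrightarrow> (\<And>x. x \<in> S' \<Longrightarrow> g x \<in> S) \<Longrightarrow> diff_times n S' (\<lambda>x. f (g x))"
proof (induction n arbitrary: f g)
  case (Suc n)
  then obtain f' g' where *: "\<forall>x\<in>S. (f has_real_derivative f' x) (at x)" "diff_times n S f'"
    "\<forall>x\<in>S'. (g has_real_derivative g' x) (at x)" "diff_times n S' g'" by auto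
  have "diff_times n S' (\<lambda>x. f' (g x) * g' x)"
    by (rule diff_times_mult[OF Suc.IH[OF *(2) diff_times_Suc_imp[OF Suc.prems(2)] Suc.prems(3)] *(4)])
  moreover have "((\<lambda>x. f (g x)) has_real_derivative f' (g x) * g' x) (at x)" if "x \<in> S'" for x
    using DERIV_chain2[of f "f' (g x)" g x "g' x" UNIV] * Suc.prems(3) that by auto
  ultimately show ?case by (rule diff_times_SucI[rotated])
qed simp

lemma diff_times_inverse: "0 \<notin> S \<Longrightarrow> diff_times n S (\<lambda>x. inverse x)"
proof (induction n)
  case (Suc n)
  then have i: "diff_times n S (\<lambda>x. inverse x)" by simp
  have "diff_times n S (\<lambda>x. (- 1) * (inverse x * inverse x))"
    by (intro diff_times_mult diff_times_const i)
  then show ?case using Suc.prems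
    by (auto intro!: exI[of _ "\<lambda>x. (- 1) * (inverse x * inverse x)"] derivative_eq_intros simp: field_simps power2_eq_square)
qed simp

lemma diff_times_powr: "S \<subseteq> {0<..} \<Longrightarrow> diff_times n S (\<lambda>x. x powr p)"
proof (induction n arbitrary: p)
  case (Suc n)
  have "diff_times n S (\<lambda>x. p * x powr (p - 1))"
    by (intro diff_times_mult diff_times_const Suc)
  then show ?case using Suc.prems
    by (auto intro!: exI[of _ "\<lambda>x. p * x powr (p - 1)"] has_real_derivative_powr)
qed simp

definition smooth_on :: "real set \<Rightarrow> (real \<Rightarrow> real) \<Rightarrow> bool" where
  "smooth_on S f \<longleftrightarrow> (\<forall>n. diff_times n S f)"

lemma smooth_on_intros [intro]:
  "smooth_on S (\<lambda>x. c)" "smooth_on S (\<lambda>x. x)"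
  "smooth_on S f \<Longrightarrow> smooth_on S g \<Longrightarrow> smooth_on S (\<lambda>x. f x + g x)"
  "smooth_on S f \<Longrightarrow> smooth_on S g \<Longrightarrow> smooth_on S (\<lambda>x. f x * g x)"
  by (auto simp: smooth_on_def diff_times_const diff_times_id diff_times_add diff_times_mult)

lemma smooth_on_minus: "smooth_on S f \<Longrightarrow> smooth_on S (\<lambda>x. - f x)"
  using smooth_on_intros(4)[OF smooth_on_intros(1)[of S "-1"], of f] by simp

lemma smooth_on_diff: "smooth_on S f \<Longrightarrow> smooth_on S g \<Longrightarrow> smooth_on S (\<lambda>x. f x - g x)"
  using smooth_on_intros(3)[OF _ smooth_on_minus, of S f g] by simp

lemma smooth_on_compose:
  "smooth_on S f \<Longrightarrow> smooth_on S' g \<Longrightarrow> (\<And>x. x \<in> S' \<Longrightarrow> g x \<in> S) \<Longrightarrow> smooth_on S' (\<lambda>x. f (g x))"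
  by (auto simp: smooth_on_def intro: diff_times_compose)

lemma smooth_on_divide:
  "smooth_on S f \<Longrightarrow> smooth_on S g \<Longrightarrow> (\<And>x. x \<in> S \<Longrightarrow> g x \<noteq> 0) \<Longrightarrow> smooth_on S (\<lambda>x. f x / g x)"
  unfolding divide_inverse
  by (intro smooth_on_intros smooth_on_compose[of "- {0}" inverse S g])
    (auto simp: smooth_on_def diff_times_inverse)

lemma smooth_on_powr:
  "smooth_on S f \<Longrightarrow> (\<And>x. x \<in> S \<Longrightarrow> f x > 0) \<Longrightarrow> smooth_on S (\<lambda>x. f x powr p)"
  by (intro smooth_on_compose[of "{0<..}" "\<lambda>x. x powr p" S f])
    (auto simp: smooth_on_def diff_times_powr)

lemma smooth_on_deriv:
  assumes "smooth_on S f" "open S"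
  shows "smooth_on S (deriv f)" "\<And>x. x \<in> S \<Longrightarrow> (f has_real_derivative deriv f x) (at x)"
proof -
  have *: "\<exists>f'. (\<forall>x\<in>S. (f has_real_derivative f' x) (at x)) \<and> diff_times n S f'" for n
    using assms(1) diff_times.simps(2)[of n S f] by (simp add: smooth_on_def)
  show d: "(f has_real_derivative deriv f x) (at x)" if "x \<in> S" for x
    using *[of 0] that DERIV_imp_deriv by force
  show "smooth_on S (deriv f)"
    unfolding smooth_on_def
  proof
    fix n
    obtain f' where f': "\<forall>x\<in>S. (f has_real_derivative f' x) (at x)" "diff_times n S f'" using *[of n] by blast
    show "diff_times n S (deriv f)"
      by (rule diff_times_cong[OF assms(2) _ f'(2)]) (use f'(1) DERIV_imp_deriv in force)
  qed
qed

lemma smooth_on_continuous: "smooth_on S f \<Longrightarrow> open S \<Longrightarrow> continuous_on S f"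
  by (meson DERIV_continuous_on smooth_on_deriv(2) has_field_derivative_at_within)

lemma smooth_on_field_differentiable:
  assumes "smooth_on UNIV f" shows "(deriv ^^ k) f field_differentiable (at t)"
proof -
  have "smooth_on UNIV ((deriv ^^ k) f)"
    by (induction k) (auto intro: assms smooth_on_deriv(1))
  then show ?thesis using smooth_on_deriv(2)[of UNIV _ t] by (auto simp: field_differentiable_def)
qed

text \<open>
The standard smooth function that is flat at 0.  All bump functions and cutoffs below are built from it.
\<close>

definition exp_inv :: "real \<Rightarrow> real" where
  "exp_inv x = (if x > 0 then exp (- (1 / x)) else 0)"

lemma poly_times_exp_tendsto_0: "((\<lambda>y. poly p y * exp (- y)) \<longlongrightarrow> 0) at_top" for p :: "real poly"
proof -
  have "((\<lambda>y. \<Sum>i\<le>degree p. coeff p i * (y ^ i / exp y)) \<longlongrightarrow> (\<Sum>i\<le>degree p. coeff p i * 0)) at_top"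
    by (intro tendsto_intros tendsto_power_div_exp_0)
  moreover have "(\<lambda>y. \<Sum>i\<le>degree p. coeff p i * (y ^ i / exp y)) = (\<lambda>y. poly p y * exp (- y))"
    by (simp add: poly_altdef sum_distrib_right exp_minus divide_inverse mult.assoc)
  ultimately show ?thesis by simp
qed

text \<open>
The functions p(1/x) exp(-1/x), with p a polynomial, are stable under differentiation, and all of them
tend to 0 at 0 because the exponential beats every power.
\<close>

lemma smooth_exp_inv_aux:
  "diff_times n UNIV (\<lambda>x. if x > 0 then poly p (1 / x) * exp (- (1 / x)) else 0)"
proof (induction n arbitrary: p)
  case (Suc n)
  define f where "f = (\<lambda>p x. if x > (0::real) then poly p (1 / x) * exp (- (1 / x)) else 0)"
  define q where "q = monom 1 2 * (p - pderiv p)"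
  have "(f p has_real_derivative f q x) (at x)" for x
  proof -
    consider "x > 0" | "x < 0" | "x = 0" by linarith
    then show ?thesis
    proof cases
      case 1
      have "((\<lambda>x. poly p (1 / x) * exp (- (1 / x))) has_real_derivative f q x) (at x)"
        using 1 by (auto intro!: derivative_eq_intros DERIV_chain2[OF poly_DERIV]
            simp: f_def q_def poly_monom field_simps power2_eq_square)
      then show ?thesis
        by (rule has_field_derivative_transform_within_open[where S = "{0<..}"]) (use 1 in \<open>auto simp: f_def\<close>)
    next
      case 2
      have "((\<lambda>x. 0) has_real_derivative f q x) (at x)" using 2 by (simp add: f_def)
      then show ?thesis
        by (rule has_field_derivative_transform_within_open[where S = "{..<0}"]) (use 2 in \<open>auto simp: f_def\<close>)
    next
      case 3
      have "((\<lambda>y. poly (monom 1 1 * p) y * exp (- y)) \<longlongrightarrow> 0) at_top" by (rule poly_times_exp_tendsto_0)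
      then have "((\<lambda>h. poly (monom 1 1 * p) (inverse h) * exp (- inverse h)) \<longlongrightarrow> 0) (at_right 0)"
        by (rule filterlim_compose) (rule filterlim_inverse_at_top_right)
      then have r: "((\<lambda>h. (f p h - f p 0) / (h - 0)) \<longlongrightarrow> 0) (at_right 0)"
        by (rule Lim_transform_eventually)
          (auto simp: eventually_at_filter f_def poly_monom field_simps intro!: always_eventually)
      have l: "((\<lambda>h. (f p h - f p 0) / (h - 0)) \<longlongrightarrow> 0) (at_left 0)"
        by (rule Lim_transform_eventually[OF tendsto_const])
          (auto simp: eventually_at_filter f_def intro!: always_eventually)
      show ?thesis unfolding has_field_derivative_iff 3
        using filterlim_split_at[OF l r] by (simp add: f_def)
    qed
  qed
  then show ?case using Suc[of q] unfolding f_def by (rule diff_times_SucI)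
qed simp

lemma smooth_exp_inv: "smooth_on UNIV exp_inv"
  unfolding smooth_on_def exp_inv_def[abs_def] using smooth_exp_inv_aux[of _ 1] by (simp only: poly_1 mult_1 simp_thms)

lemma exp_inv_le_1: "0 \<le> exp_inv x" "exp_inv x \<le> 1" "exp_inv x > 0 \<longleftrightarrow> x > 0" "x \<le> 0 \<Longrightarrow> exp_inv x = 0"
  by (auto simp: exp_inv_def)

section \<open>Smooth functions on Euclidean space\<close>

lemma partial_eq: "(f has_derivative D) (at x) \<Longrightarrow> partial i f x = D (axis i 1)"
  using frechet_derivative_at[of f D x] by (simp add: partial_def)

fun diff_times_vec :: "nat \<Rightarrow> (real^'n::finite \<Rightarrow> complex) \<Rightarrow> bool" where
  "diff_times_vec 0 f \<longleftrightarrow> True"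
| "diff_times_vec (Suc n) f \<longleftrightarrow> (\<forall>x. f differentiable (at x)) \<and> (\<forall>i. diff_times_vec n (partial i f))"

text \<open>
The recursive description allows the same inductions as in one variable.
\<close>

lemma smooth_iff: "smooth f \<longleftrightarrow> (\<forall>n. diff_times_vec n f)"
proof
  assume s: "smooth f"
  have "diff_times_vec n f" if "\<forall>is x. fold partial is f differentiable (at x)" for n
    using that
  proof (induction n arbitrary: f)
    case (Suc n)
    show ?case
      unfolding diff_times_vec.simps
    proof (intro conjI allI Suc.IH)
      show "f differentiable at x" for x using Suc.prems[THEN spec, of "[]"] by simp
      show "fold partial is (partial i f) differentiable at x" for i x "is"
        using Suc.prems[THEN spec, of "i # is"] by simp
    qed
  qed simp
  then show "\<forall>n. diff_times_vec n f" using s by (simp add: smooth_def)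
next
  assume a: "\<forall>n. diff_times_vec n f"
  have "fold partial is f differentiable (at x)" if "\<forall>n. diff_times_vec n f" for "is" x
    using that
  proof (induction "is" arbitrary: f)
    case Nil then show ?case using diff_times_vec.simps(2)[of 0 f] by auto
  next
    case (Cons i l)
    have "diff_times_vec n (partial i f)" for n using Cons.prems diff_times_vec.simps(2)[of n f] by blast
    then show ?case using Cons.IH[of "partial i f"] by simp
  qed
  then show "smooth f" using a by (simp add: smooth_def)
qed

lemma smooth_differentiable: "smooth f \<Longrightarrow> f differentiable (at x)"
  unfolding smooth_iff using diff_times_vec.simps(2)[of 0 f] by blast

lemma smooth_partial: "smooth f \<Longrightarrow> smooth (partial i f)"
  unfolding smooth_iff using diff_times_vec.simps(2) by blast

lemma smooth_continuous: "smooth f \<Longrightarrow> continuous_on UNIV f"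
  by (simp add: continuous_on_eq_continuous_at differentiable_imp_continuous_within smooth_differentiable)

lemma diff_times_vec_Suc_imp: "diff_times_vec (Suc n) f \<Longrightarrow> diff_times_vec n f"
  by (induction n arbitrary: f) auto

lemma partial_const: "partial i (\<lambda>x. c) = (\<lambda>x. 0)"
  using partial_eq[OF has_derivative_const] by fastforce

lemma partial_add: "f differentiable (at x) \<Longrightarrow> g differentiable (at x)
    \<Longrightarrow> partial i (\<lambda>x. f x + g x) x = partial i f x + partial i g x"
  unfolding frechet_derivative_works
  by (subst partial_eq[OF has_derivative_add]) (auto simp: partial_def)

lemma partial_mult: "f differentiable (at x) \<Longrightarrow> g differentiable (at x)
    \<Longrightarrow> partial i (\<lambda>x. f x * g x) x = partial i f x * g x + f x * partial i g x"
  unfolding frechet_derivative_works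
  by (subst partial_eq[OF has_derivative_mult]) (auto simp: partial_def)

lemma partial_cnj: "f differentiable (at x) \<Longrightarrow> partial i (\<lambda>x. cnj (f x)) x = cnj (partial i f x)"
  unfolding frechet_derivative_works
  by (subst partial_eq[OF bounded_linear.has_derivative[OF bounded_linear_cnj]]) (auto simp: partial_def)

lemma diff_times_vec_const: "diff_times_vec n (\<lambda>x. c)"
  by (induction n arbitrary: c) (auto simp: partial_const)

lemma diff_times_vec_add:
  "diff_times_vec n f \<Longrightarrow> diff_times_vec n g \<Longrightarrow> diff_times_vec n (\<lambda>x. f x + g x)"
proof (induction n arbitrary: f g)
  case (Suc n)
  then have "partial i (\<lambda>x. f x + g x) = (\<lambda>x. partial i f x + partial i g x)" for i
    by (intro ext partial_add) auto
  then show ?case using Suc by auto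
qed simp

lemma diff_times_vec_mult:
  "diff_times_vec n f \<Longrightarrow> diff_times_vec n g \<Longrightarrow> diff_times_vec n (\<lambda>x. f x * g x)"
proof (induction n arbitrary: f g)
  case (Suc n)
  then have "partial i (\<lambda>x. f x * g x) = (\<lambda>x. partial i f x * g x + f x * partial i g x)" for i
    by (intro ext partial_mult) auto
  moreover have "diff_times_vec n (\<lambda>x. partial i f x * g x + f x * partial i g x)" for i
    using Suc diff_times_vec_Suc_imp by (intro diff_times_vec_add Suc.IH) auto
  ultimately show ?case using Suc.prems by auto
qed simp

lemma diff_times_vec_cnj: "diff_times_vec n f \<Longrightarrow> diff_times_vec n (\<lambda>x. cnj (f x))"
proof (induction n arbitrary: f)
  case (Suc n)
  then have "partial i (\<lambda>x. cnj (f x)) = (\<lambda>x. cnj (partial i f x))" for i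
    by (intro ext partial_cnj) auto
  moreover have "(\<lambda>x. cnj (f x)) differentiable at x" for x
    by (rule differentiable_compose[OF bounded_linear_imp_differentiable[OF bounded_linear_cnj]]) (use Suc.prems in simp)
  ultimately show ?case using Suc by auto
qed simp

lemma has_derivative_coord: "((\<lambda>x::real^'n. complex_of_real (x $ j)) has_derivative (\<lambda>h. complex_of_real (h $ j))) (at x)"
  by (intro bounded_linear_imp_has_derivative bounded_linear_compose[OF bounded_linear_of_real bounded_linear_vec_nth])

lemma partial_coord: "partial i (\<lambda>x. complex_of_real (x $ j)) x = (if i = j then 1 else 0)"
  by (subst partial_eq[OF has_derivative_coord]) (auto simp: axis_def)

lemma diff_times_vec_coord: "diff_times_vec n (\<lambda>x. complex_of_real (x $ j))"
proof (cases n)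
  case (Suc m)
  have p: "partial i (\<lambda>x. complex_of_real (x $ j)) = (\<lambda>x. if i = j then 1 else 0)" for i
    by (intro ext partial_coord)
  have "(\<lambda>x. complex_of_real (x $ j)) differentiable at x" for x
    using has_derivative_coord differentiable_def by blast
  then show ?thesis using Suc by (simp add: p diff_times_vec_const)
qed simp

lemma has_derivative_compose_of_real:
  fixes s :: "real^'n::finite \<Rightarrow> real"
  assumes "(\<lambda>x. complex_of_real (s x)) differentiable (at x)" "(m has_real_derivative m') (at (s x))"
  shows "((\<lambda>x. complex_of_real (m (s x))) has_derivative
     (\<lambda>h. complex_of_real m' * frechet_derivative (\<lambda>x. complex_of_real (s x)) (at x) h)) (at x)"
proof -
  have a: "((\<lambda>x. complex_of_real (s x)) has_derivative frechet_derivative (\<lambda>x. complex_of_real (s x)) (at x)) (at x)" (is "(_ has_derivative ?D) _")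
    using assms(1) frechet_derivative_works by blast
  have s: "(s has_derivative (\<lambda>h. Re (?D h))) (at x)"
    using bounded_linear.has_derivative[OF bounded_linear_Re a] by simp
  have r: "((\<lambda>x. complex_of_real (s x)) has_derivative (\<lambda>h. complex_of_real (Re (?D h)))) (at x)"
    using bounded_linear.has_derivative[OF bounded_linear_of_real s] by simp
  have e: "complex_of_real (Re (?D h)) = ?D h" for h using has_derivative_unique[OF r a] by metis
  have "((\<lambda>x. m (s x)) has_derivative (\<lambda>h. Re (?D h) * m')) (at x)"
    by (rule has_derivative_compose[OF s]) (use assms(2) in \<open>simp add: has_field_derivative_def mult_commute_abs\<close>)
  from bounded_linear.has_derivative[OF bounded_linear_of_real this]
  have "((\<lambda>x. complex_of_real (m (s x))) has_derivative (\<lambda>h. complex_of_real (Re (?D h) * m'))) (at x)" .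
  then show ?thesis using e by (simp add: mult.commute)
qed

lemma partial_compose_of_real:
  fixes s :: "real^'n::finite \<Rightarrow> real"
  assumes "(\<lambda>x. complex_of_real (s x)) differentiable (at x)" "(m has_real_derivative m') (at (s x))"
  shows "partial i (\<lambda>x. complex_of_real (m (s x))) x = complex_of_real m' * partial i (\<lambda>x. complex_of_real (s x)) x"
  by (subst partial_eq[OF has_derivative_compose_of_real[OF assms]]) (simp add: partial_def)

lemma diff_times_vec_compose:
  fixes s :: "real^'n::finite \<Rightarrow> real"
  assumes "smooth (\<lambda>x. complex_of_real (s x))" "\<And>x. s x \<in> S"
  shows "diff_times n S m \<Longrightarrow> diff_times_vec n (\<lambda>x. complex_of_real (m (s x)))"
proof (induction n arbitrary: m)
  case (Suc n)
  then obtain m' where m': "\<And>x. x \<in> S \<Longrightarrow> (m has_real_derivative m' x) (at x)" "diff_times n S m'" by auto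
  note d = smooth_differentiable[OF assms(1)]
  have "partial i (\<lambda>x. complex_of_real (m (s x)))
      = (\<lambda>x. complex_of_real (m' (s x)) * partial i (\<lambda>x. complex_of_real (s x)) x)" for i
    by (intro ext partial_compose_of_real d m' assms)
  moreover have "diff_times_vec n (\<lambda>x. complex_of_real (m' (s x)) * partial i (\<lambda>x. complex_of_real (s x)) x)" for i
    using smooth_partial[OF assms(1)] by (intro diff_times_vec_mult Suc.IH m') (auto simp: smooth_iff)
  moreover have "(\<lambda>x. complex_of_real (m (s x))) differentiable (at x)" for x
    using has_derivative_compose_of_real[OF d m'(1)[OF assms(2)]] differentiable_def by blast
  ultimately show ?case by auto
qed simp

lemma smooth_intros:
  "smooth (\<lambda>x. c)" "smooth (\<lambda>x. complex_of_real (x $ j))"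
  "smooth f \<Longrightarrow> smooth g \<Longrightarrow> smooth (\<lambda>x. f x + g x)"
  "smooth f \<Longrightarrow> smooth g \<Longrightarrow> smooth (\<lambda>x. f x * g x)"
  "smooth f \<Longrightarrow> smooth (\<lambda>x. cnj (f x))"
  by (auto simp: smooth_iff diff_times_vec_const diff_times_vec_coord diff_times_vec_add diff_times_vec_mult diff_times_vec_cnj)

lemma smooth_compose:
  "smooth (\<lambda>x. complex_of_real (s x)) \<Longrightarrow> smooth_on S m \<Longrightarrow> (\<And>x. s x \<in> S) \<Longrightarrow> smooth (\<lambda>x. complex_of_real (m (s x)))"
  using diff_times_vec_compose[of s S] unfolding smooth_on_def smooth_iff[of "\<lambda>x. complex_of_real (m (s x))"] by blast

lemma smooth_sum: "(\<And>i. i \<in> I \<Longrightarrow> smooth (f i)) \<Longrightarrow> smooth (\<lambda>x. \<Sum>i\<in>I. f i x)"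
  by (induction I rule: infinite_finite_induct) (auto intro: smooth_intros)

lemma smooth_prod: "(\<And>i. i \<in> I \<Longrightarrow> smooth (f i)) \<Longrightarrow> smooth (\<lambda>x. \<Prod>i\<in>I. f i x)"
  by (induction I rule: infinite_finite_induct) (auto intro: smooth_intros)

section \<open>Test functions and weak gradients\<close>

lemma test_functionI:
  assumes "smooth \<phi>" "compact K" "\<And>x. x \<notin> K \<Longrightarrow> \<phi> x = 0"
  shows "test_function \<phi>"
proof -
  have "closure {x. \<phi> x \<noteq> 0} \<subseteq> K"
    using assms by (intro closure_minimal compact_imp_closed) auto
  then have "compact (closure {x. \<phi> x \<noteq> 0})"
    using compact_Int_closed[OF assms(2) closed_closure, of "{x. \<phi> x \<noteq> 0}"] by (simp add: Int_absorb1)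
  then show ?thesis using assms(1) by (simp add: test_function_def)
qed

lemma test_function_support:
  assumes "test_function \<phi>"
  obtains r where "r > 0" "\<And>x. norm x > r \<Longrightarrow> \<phi> x = 0"
proof -
  have "bounded (closure {x. \<phi> x \<noteq> 0})" using assms by (simp add: test_function_def compact_imp_bounded)
  then obtain r where "r > 0" "\<forall>x\<in>closure {x. \<phi> x \<noteq> 0}. norm x \<le> r" by (auto simp: bounded_pos)
  then show ?thesis using that[of r] closure_subset[of "{x. \<phi> x \<noteq> 0}"] by force
qed

lemma test_function_mult:
  assumes "smooth f" "test_function \<phi>" shows "test_function (\<lambda>x. f x * \<phi> x)"
proof (rule test_functionI[of _ "closure {x. \<phi> x \<noteq> 0}"])
  show "smooth (\<lambda>x. f x * \<phi> x)" using assms by (intro smooth_intros(4)) (simp_all add: test_function_def)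
  show "compact (closure {x. \<phi> x \<noteq> 0})" using assms by (simp add: test_function_def)
  show "f x * \<phi> x = 0" if "x \<notin> closure {x. \<phi> x \<noteq> 0}" for x
    using that closure_subset[of "{x. \<phi> x \<noteq> 0}"] by auto
qed

lemma test_function_cnj:
  assumes "test_function \<phi>" shows "test_function (\<lambda>x. cnj (\<phi> x))"
  using assms smooth_intros(5)[of \<phi>] by (simp add: test_function_def)

lemma test_function_partial:
  assumes "test_function \<phi>" shows "test_function (partial i \<phi>)"
proof (rule test_functionI)
  let ?K = "closure {x. \<phi> x \<noteq> 0}"
  show "smooth (partial i \<phi>)" "compact ?K" using assms by (auto simp: test_function_def smooth_partial)
  fix x assume x: "x \<notin> ?K"
  have z: "\<phi> x = 0" if "x \<notin> ?K" for x using that closure_subset[of "{x. \<phi> x \<noteq> 0}"] by blast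
  have "(\<phi> has_derivative (\<lambda>h. 0)) (at x)"
    by (rule has_derivative_transform_within_open[OF has_derivative_const[of 0] open_Compl[OF closed_closure[of "{x. \<phi> x \<noteq> 0}"]]])
      (simp_all only: Compl_iff x not_False_eq_True z)
  then show "partial i \<phi> x = 0" by (rule partial_eq)
qed

lemma integrable_compact_support:
  fixes \<psi> :: "'a::euclidean_space \<Rightarrow> 'b::{banach, second_countable_topology}"
  assumes "continuous_on UNIV \<psi>" "compact K" "\<And>x. x \<notin> K \<Longrightarrow> \<psi> x = 0"
  shows "integrable lborel \<psi>"
proof -
  have "integrable lborel (\<lambda>x. indicator K x *\<^sub>R \<psi> x)"
    by (intro borel_integrable_compact assms continuous_on_subset[OF assms(1)]) auto
  then show ?thesis
    by (rule Bochner_Integration.integrable_cong[THEN iffD1, rotated 2]) (use assms(3) in \<open>auto simp: indicator_def\<close>)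
qed

lemma test_function_integrable: assumes "test_function \<phi>" shows "integrable lborel \<phi>"
proof (rule integrable_compact_support[of _ "closure {x. \<phi> x \<noteq> 0}"])
  show "continuous_on UNIV \<phi>" "compact (closure {x. \<phi> x \<noteq> 0})"
    using assms by (simp_all add: test_function_def smooth_continuous)
  show "\<phi> x = 0" if "x \<notin> closure {x. \<phi> x \<noteq> 0}" for x
    using that closure_subset[of "{x. \<phi> x \<noteq> 0}"] by auto
qed

lemma test_function_bounded:
  assumes "test_function \<phi>" obtains M where "M \<ge> 0" "\<And>x. norm (\<phi> x) \<le> M"
proof -
  have "compact (\<phi> ` closure {x. \<phi> x \<noteq> 0})"
    using assms by (intro compact_continuous_image continuous_on_subset[OF smooth_continuous]) (auto simp: test_function_def)
  then obtain M where M: "M > 0" "\<forall>x\<in>closure {x. \<phi> x \<noteq> 0}. norm (\<phi> x) \<le> M"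
    using compact_imp_bounded by (force simp: bounded_pos)
  then have "norm (\<phi> x) \<le> M" for x
    using closure_subset[of "{x. \<phi> x \<noteq> 0}"] by (cases "\<phi> x = 0") auto
  then show ?thesis using that[of M] M by simp
qed

lemma lborel_integral_translate:
  fixes f :: "'a::euclidean_space \<Rightarrow> 'b::{banach, second_countable_topology}"
  assumes "f \<in> borel_measurable lborel"
  shows "(\<integral>x. f (x + a) \<partial>lborel) = (\<integral>x. f x \<partial>lborel)"
proof -
  have "(\<integral>x. f x \<partial>lborel) = (\<integral>x. f x \<partial>distr lborel borel ((+) a))"
    by (simp add: lborel_distr_plus)
  also have "\<dots> = (\<integral>x. f (a + x) \<partial>lborel)"
    using assms by (subst integral_distr) auto
  finally show ?thesis by (simp add: add.commute)
qed

lemma has_vector_derivative_axis: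
  assumes "smooth \<psi>"
  shows "((\<lambda>h::real. \<psi> (x + h *\<^sub>R axis i 1)) has_vector_derivative partial i \<psi> (x + h *\<^sub>R axis i 1)) (at h)"
proof -
  have D: "(\<psi> has_derivative frechet_derivative \<psi> (at (x + h *\<^sub>R axis i 1))) (at (x + h *\<^sub>R axis i 1))" (is "(_ has_derivative ?D) _")
    using smooth_differentiable[OF assms] frechet_derivative_works by blast
  have "((\<lambda>h::real. x + h *\<^sub>R axis i 1) has_derivative (\<lambda>k. k *\<^sub>R axis i 1)) (at h)"
    by (auto intro!: derivative_eq_intros)
  from has_derivative_compose[OF this D]
  have "((\<lambda>h. \<psi> (x + h *\<^sub>R axis i 1)) has_derivative (\<lambda>k. ?D (k *\<^sub>R axis i 1))) (at h)" .
  moreover have "?D (k *\<^sub>R axis i 1) = k *\<^sub>R partial i \<psi> (x + h *\<^sub>R axis i 1)" for k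
    unfolding partial_def using linear_cmul[OF has_derivative_linear[OF D]] by simp
  ultimately show ?thesis by (simp add: has_vector_derivative_def)
qed

text \<open>
By translation invariance of Lebesgue measure the integral of a difference quotient vanishes; the
difference quotients converge boundedly on a fixed ball.  This avoids Fubini's theorem on coordinates.
\<close>

lemma integral_partial_eq_0:
  assumes t: "test_function \<psi>"
  shows "(\<integral>x. partial i \<psi> x \<partial>lborel) = 0"
proof -
  have s: "smooth \<psi>" using t by (simp add: test_function_def)
  let ?e = "axis i 1 :: real^'a"
  obtain M where M: "M \<ge> 0" "\<And>x. norm (partial i \<psi> x) \<le> M"
    using test_function_bounded[OF test_function_partial[OF t]] by blast
  obtain r where r: "r > 0" "\<And>x. norm x > r \<Longrightarrow> \<psi> x = 0" using test_function_support[OF t] by blast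
  define h where "h = (\<lambda>n. 1 / real (Suc n))"
  have h: "h n > 0" "h n \<le> 1" "h \<longlonglongrightarrow> 0" for n
    using LIMSEQ_inverse_real_of_nat by (auto simp: h_def inverse_eq_divide)
  define D where "D = (\<lambda>n x. (1 / h n) *\<^sub>R (\<psi> (x + h n *\<^sub>R ?e) - \<psi> x))"
  have m: "\<psi> \<in> borel_measurable lborel"
    using smooth_continuous[OF s] by (simp add: borel_measurable_continuous_onI)
  have mt: "(\<lambda>x. \<psi> (x + a)) \<in> borel_measurable lborel" for a
    unfolding measurable_lborel2
    by (intro borel_measurable_continuous_onI continuous_on_compose2[OF smooth_continuous[OF s]] continuous_intros) auto
  have it: "integrable lborel (\<lambda>x. \<psi> (x + a))" for a
  proof (rule integrable_compact_support[of _ "cball 0 (r + norm a)"])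
    show "continuous_on UNIV (\<lambda>x. \<psi> (x + a))"
      by (rule continuous_on_compose2[OF smooth_continuous[OF s]]) (auto intro: continuous_intros)
    fix x :: "real^'a" assume "x \<notin> cball 0 (r + norm a)"
    then have "norm (x + a) > r" using norm_triangle_ineq4[of "x + a" a] by simp
    then show "\<psi> (x + a) = 0" by (rule r)
  qed auto
  have I0: "(\<integral>x. D n x \<partial>lborel) = 0" for n
    unfolding D_def integral_scaleR_right
    by (subst Bochner_Integration.integral_diff[OF it]) (use it[of 0] lborel_integral_translate[OF m] in auto)
  have lim: "(\<lambda>n. D n x) \<longlonglongrightarrow> partial i \<psi> x" for x
  proof -
    have "((\<lambda>k. \<psi> (x + k *\<^sub>R ?e)) has_vector_derivative partial i \<psi> x) (at 0)"
      using has_vector_derivative_axis[OF s, of x i 0] by simp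
    then have "((\<lambda>y. (\<psi> (x + y *\<^sub>R ?e) - \<psi> x - y *\<^sub>R partial i \<psi> x) /\<^sub>R norm y) \<longlongrightarrow> 0) (at 0)"
      by (simp add: has_vector_derivative_def has_derivative_at_within diff_diff_eq has_derivative_def)
    moreover have "filterlim h (at 0) sequentially"
      using h(1,3) by (intro filterlim_atI) (auto simp: less_imp_neq[THEN not_sym])
    ultimately have "(\<lambda>n. (\<psi> (x + h n *\<^sub>R ?e) - \<psi> x - h n *\<^sub>R partial i \<psi> x) /\<^sub>R norm (h n)) \<longlonglongrightarrow> 0"
      by (rule filterlim_compose)
    moreover have "(\<psi> (x + h n *\<^sub>R ?e) - \<psi> x - h n *\<^sub>R partial i \<psi> x) /\<^sub>R norm (h n) = D n x - partial i \<psi> x" for n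
      using h(1)[of n] by (simp add: D_def scaleR_diff_right inverse_eq_divide)
    ultimately show ?thesis using LIM_zero_iff by fastforce
  qed
  have bd: "norm (D n x) \<le> M * indicator (cball 0 (r + 1)) x" for n x
  proof (cases "norm x \<le> r + 1")
    case True
    have "norm (\<psi> (x + h n *\<^sub>R ?e) - \<psi> (x + 0 *\<^sub>R ?e)) \<le> M * norm (h n - 0)"
    proof (rule differentiable_bound[of "{0..h n}" "\<lambda>k. \<psi> (x + k *\<^sub>R ?e)" "\<lambda>k l. l *\<^sub>R partial i \<psi> (x + k *\<^sub>R ?e)"])
      show "((\<lambda>k. \<psi> (x + k *\<^sub>R ?e)) has_derivative (\<lambda>l. l *\<^sub>R partial i \<psi> (x + k *\<^sub>R ?e))) (at k within {0..h n})" for k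
        using has_vector_derivative_axis[OF s, of x i k] by (auto simp: has_vector_derivative_def intro: has_derivative_at_withinI)
      show "onorm (\<lambda>l. l *\<^sub>R partial i \<psi> (x + k *\<^sub>R ?e)) \<le> M" for k :: real
        by (rule onorm_bound[OF M(1)]) (use M(2)[of "x + k *\<^sub>R ?e"] in \<open>simp add: mult.commute[of M] mult_left_mono\<close>)
    qed (use h(1)[of n] in auto)
    then have "norm (D n x) \<le> (1 / h n) * (M * h n)"
      unfolding D_def norm_scaleR using h(1)[of n] by (intro mult_mono) auto
    then show ?thesis using True h(1)[of n] by simp
  next
    case False
    have "norm (h n *\<^sub>R ?e) \<le> 1" using h(1,2)[of n] by (simp add: norm_axis_1)
    then have "norm (x + h n *\<^sub>R ?e) > r" "norm x > r"
      using False norm_triangle_ineq4[of "x + h n *\<^sub>R ?e" "h n *\<^sub>R ?e"] by auto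
    then show ?thesis using r False by (simp add: D_def)
  qed
  have "(\<lambda>n. \<integral>x. D n x \<partial>lborel) \<longlonglongrightarrow> (\<integral>x. partial i \<psi> x \<partial>lborel)"
  proof (rule integral_dominated_convergence)
    show "partial i \<psi> \<in> borel_measurable lborel"
      using smooth_continuous[OF smooth_partial[OF s]] by (simp add: borel_measurable_continuous_onI)
    show "D n \<in> borel_measurable lborel" for n
      unfolding D_def using mt[of "h n *\<^sub>R ?e"] m by simp
    show "integrable lborel (\<lambda>x::real^'a. M * indicator (cball 0 (r + 1)) x)"
      by (intro integrable_mult_right integrable_real_indicator) (use emeasure_bounded_finite[OF bounded_cball[of "0::real^'a" "r + 1"]] in auto)
  qed (use lim bd in auto)
  then have "(\<lambda>n::nat. 0) \<longlonglongrightarrow> (\<integral>x. partial i \<psi> x \<partial>lborel)" by (simp only: I0)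
  then show ?thesis using LIMSEQ_unique[OF tendsto_const] by metis
qed

lemma integral_by_parts:
  assumes "smooth f" "test_function \<phi>"
  shows "(\<integral>x. f x * partial i \<phi> x \<partial>lborel) = - (\<integral>x. partial i f x * \<phi> x \<partial>lborel)"
proof -
  have "partial i (\<lambda>x. f x * \<phi> x) x = partial i f x * \<phi> x + f x * partial i \<phi> x" for x
    using assms by (intro partial_mult smooth_differentiable) (auto simp: test_function_def)
  then have "(\<integral>x. partial i f x * \<phi> x + f x * partial i \<phi> x \<partial>lborel) = 0"
    using integral_partial_eq_0[OF test_function_mult[OF assms], of i] by simp
  moreover have "integrable lborel (\<lambda>x. partial i f x * \<phi> x)" "integrable lborel (\<lambda>x. f x * partial i \<phi> x)"
    using assms by (auto intro!: test_function_integrable test_function_mult smooth_partial test_function_partial)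
  ultimately show ?thesis by (simp add: eq_neg_iff_add_eq_0 add.commute)
qed

definition h1_of :: "(real^'n::finite \<Rightarrow> complex) \<Rightarrow> 'n h1" where
  "h1_of \<phi> = Abs_h1 (abs_l2 \<phi>, \<chi> i. abs_l2 (partial i \<phi>))"

lemma Rep_h1_of:
  assumes t: "test_function \<phi>"
  shows "Rep_h1 (h1_of \<phi>) = (abs_l2 \<phi>, \<chi> i. abs_l2 (partial i \<phi>))"
proof -
  have s: "smooth \<phi>" using t by (simp add: test_function_def)
  have m: "(\<integral>x. l2_rep (abs_l2 f) x * e x \<partial>lborel) = (\<integral>x. f x * e x \<partial>lborel)"
    if a: "square_integrable f" "test_function e" for f e :: "real^'a \<Rightarrow> complex"
  proof (rule integral_cong_AE)
    note e = sqint_measurable[OF test_function_sqint(1)[OF a(2)]]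
    show "(\<lambda>x. l2_rep (abs_l2 f) x * e x) \<in> borel_measurable lborel"
      by (rule borel_measurable_times[OF sqint_measurable[OF l2_rep_sqint] e])
    show "(\<lambda>x. f x * e x) \<in> borel_measurable lborel"
      by (rule borel_measurable_times[OF sqint_measurable[OF a(1)] e])
    show "AE x in lborel. l2_rep (abs_l2 f) x * e x = f x * e x" using l2_rep_abs[OF a(1)] by eventually_elim simp
  qed
  have "weak_gradient (abs_l2 \<phi>) (\<chi> i. abs_l2 (partial i \<phi>))"
    unfolding weak_gradient_def
  proof (intro allI impI)
    fix \<eta> i assume c: "test_function (\<eta> :: real^'a \<Rightarrow> complex)"
    show "(\<integral>x. l2_rep (abs_l2 \<phi>) x * partial i \<eta> x \<partial>lborel) = - (\<integral>x. l2_rep ((\<chi> i. abs_l2 (partial i \<phi>)) $ i) x * \<eta> x \<partial>lborel)"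
      using integral_by_parts[OF s c, of i]
      by (simp add: m test_function_sqint[OF t] test_function_partial[OF c] c)
  qed
  then show ?thesis by (simp add: h1_of_def Abs_h1_inverse)
qed

lemma h1_l2_h1_of: "test_function \<phi> \<Longrightarrow> h1_l2 (h1_of \<phi>) = abs_l2 \<phi>"
  by (simp add: h1_l2_def Rep_h1_of)

lemma h1_grad_h1_of:
  assumes "test_function \<phi>"
  shows "AE x in lborel. h1_grad (h1_of \<phi>) x = (\<chi> i. partial i \<phi> x)"
proof -
  have "AE x in lborel. \<forall>i\<in>UNIV. l2_rep (abs_l2 (partial i \<phi>)) x = partial i \<phi> x"
    by (intro AE_finite_allI l2_rep_abs test_function_sqint assms) auto
  then show ?thesis by (simp add: h1_grad_def Rep_h1_of[OF assms] vec_eq_iff)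
qed

text \<open>
The definition of a weak gradient with the smooth vector field F as test function: the formula of Gauss
for a field F of test functions and an arbitrary w in H1.
\<close>

lemma weak_divergence:
  fixes w :: "'n::finite h1"
  assumes F: "\<And>k. test_function (F k)"
  shows "(\<integral>x. (\<Sum>k\<in>UNIV. F k x * cnj (h1_grad w x $ k)) \<partial>lborel)
       = - (\<integral>x. (\<Sum>k\<in>UNIV. partial k (F k) x) * cnj (l2_rep (h1_l2 w) x) \<partial>lborel)"
proof -
  have wg: "weak_gradient (fst (Rep_h1 w)) (snd (Rep_h1 w))" using Rep_h1[of w] by (rule CollectD)
  have k: "(\<integral>x. F k x * cnj (h1_grad w x $ k) \<partial>lborel) = - (\<integral>x. partial k (F k) x * cnj (l2_rep (h1_l2 w) x) \<partial>lborel)" for k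
  proof -
    have "partial k (\<lambda>x. cnj (F k x)) x = cnj (partial k (F k) x)" for x
      using F[of k] by (intro partial_cnj smooth_differentiable) (simp add: test_function_def)
    then have "(\<integral>x. l2_rep (h1_l2 w) x * cnj (partial k (F k) x) \<partial>lborel) = - (\<integral>x. h1_grad w x $ k * cnj (F k x) \<partial>lborel)"
      using wg[unfolded weak_gradient_def, rule_format, OF test_function_cnj[OF F[of k]], of k]
      by (simp add: h1_l2_def h1_grad_def)
    then have "cnj (\<integral>x. l2_rep (h1_l2 w) x * cnj (partial k (F k) x) \<partial>lborel) = - cnj (\<integral>x. h1_grad w x $ k * cnj (F k x) \<partial>lborel)" by simp
    then have "(\<integral>x. cnj (l2_rep (h1_l2 w) x * cnj (partial k (F k) x)) \<partial>lborel) = - (\<integral>x. cnj (h1_grad w x $ k * cnj (F k x)) \<partial>lborel)"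
      by (simp only: Bochner_Integration.integral_cnj)
    then show ?thesis by (simp add: mult.commute)
  qed
  have i1: "integrable lborel (\<lambda>x. F k x * cnj (h1_grad w x $ k))" for k
    unfolding h1_grad_def by (simp add: sqint_prod sqint_cnj l2_rep_sqint test_function_sqint F)
  have i2: "integrable lborel (\<lambda>x. partial k (F k) x * cnj (l2_rep (h1_l2 w) x))" for k
    by (intro sqint_prod sqint_cnj l2_rep_sqint test_function_sqint F)
  show ?thesis
    by (simp only: Bochner_Integration.integral_sum[OF i1] k sum_distrib_right Bochner_Integration.integral_sum[OF i2] sum_negf)
qed

section \<open>Test functions separate square-integrable functions\<close>

lemma exp_inv_scaled_tendsto: "(\<lambda>m. exp_inv (real m * y)) \<longlonglongrightarrow> (if y > 0 then 1 else 0)"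
proof (cases "y > 0")
  case True
  have "(\<lambda>m. exp (- (inverse (real m) * (1 / y)))) \<longlonglongrightarrow> exp (- (0 * (1 / y)))"
    by (intro tendsto_intros lim_inverse_n)
  moreover have "\<forall>\<^sub>F m in sequentially. exp (- (inverse (real m) * (1 / y))) = exp_inv (real m * y)"
    using eventually_gt_at_top[of 0] by eventually_elim (use True in \<open>simp add: exp_inv_def divide_inverse mult.commute\<close>)
  ultimately show ?thesis using True by (simp add: tendsto_cong)
next
  case False
  then have "exp_inv (real m * y) = 0" for m by (simp add: exp_inv_def not_less mult_nonneg_nonpos)
  then show ?thesis using False by simp
qed

definition box_bump :: "nat \<Rightarrow> real^'n::finite \<Rightarrow> real^'n \<Rightarrow> real^'n \<Rightarrow> real" where
  "box_bump m a b x = (\<Prod>i\<in>UNIV. exp_inv (real m * (x $ i - a $ i)) * exp_inv (real m * (b $ i - x $ i)))"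

lemma box_bump_range: "0 \<le> box_bump m a b x" "box_bump m a b x \<le> 1"
  unfolding box_bump_def by (auto intro!: prod_nonneg prod_le_1 mult_le_one exp_inv_le_1 mult_nonneg_nonneg)

lemma box_bump_eq_0: assumes "x \<notin> box a b" shows "box_bump m a b x = 0"
proof -
  obtain i where "\<not> (a $ i < x $ i \<and> x $ i < b $ i)" using assms by (auto simp: mem_box_cart)
  then have "exp_inv (real m * (x $ i - a $ i)) * exp_inv (real m * (b $ i - x $ i)) = 0"
    by (auto simp: exp_inv_def zero_less_mult_iff)
  then show ?thesis unfolding box_bump_def by (intro prod_zero) auto
qed

lemma box_bump_tendsto: "(\<lambda>m. box_bump m a b x) \<longlonglongrightarrow> indicator (box a b) x"
proof (cases "x \<in> box a b")
  case True
  have "(\<lambda>m. box_bump m a b x) \<longlonglongrightarrow> (\<Prod>i\<in>UNIV. (if x $ i - a $ i > 0 then 1 else 0) * (if b $ i - x $ i > 0 then 1 else 0))"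
    unfolding box_bump_def by (intro tendsto_prod tendsto_mult exp_inv_scaled_tendsto)
  then show ?thesis using True by (simp add: mem_box_cart)
qed (simp add: box_bump_eq_0)

lemma test_function_box_bump: "test_function (\<lambda>x. complex_of_real (box_bump m a b x))"
proof (rule test_functionI[of _ "cbox a b"])
  have "smooth (\<lambda>x. complex_of_real (exp_inv (real m * (x $ i - a $ i))))" for i :: 'a
    by (rule smooth_compose[OF smooth_intros(2), of UNIV "\<lambda>y. exp_inv (real m * (y - a $ i))"])
      (auto intro!: smooth_on_compose[OF smooth_exp_inv] smooth_on_intros smooth_on_diff)
  moreover have "smooth (\<lambda>x. complex_of_real (exp_inv (real m * (b $ i - x $ i))))" for i :: 'a
    by (rule smooth_compose[OF smooth_intros(2), of UNIV "\<lambda>y. exp_inv (real m * (b $ i - y))"])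
      (auto intro!: smooth_on_compose[OF smooth_exp_inv] smooth_on_intros smooth_on_diff)
  ultimately show "smooth (\<lambda>x. complex_of_real (box_bump m a b x))"
    unfolding box_bump_def of_real_prod of_real_mult by (intro smooth_prod smooth_intros(4))
  show "complex_of_real (box_bump m a b x) = 0" if "x \<notin> cbox a b" for x
    using that box_subset_cbox[of a b] box_bump_eq_0[of x a b m] by auto
qed auto

text \<open>
Bumps approximate indicators of boxes from below, so f has integral 0 over every box.  Boxes are stable
under intersection and generate the Borel sets, hence f integrates to 0 over all Borel subsets of a box.
\<close>

lemma l2_eq_0_if_orthogonal_test:
  fixes f :: "(real^'n::finite) l2"
  assumes z: "\<And>\<phi>. test_function \<phi> \<Longrightarrow> (\<integral>x. l2_rep f x * \<phi> x \<partial>lborel) = 0"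
  shows "f = 0"
proof -
  define F where "F = l2_rep f"
  have Fs: "square_integrable F" and Fm: "F \<in> borel_measurable lborel"
    unfolding F_def by (rule l2_rep_sqint, rule sqint_measurable[OF l2_rep_sqint])
  have ind: "square_integrable (indicator (box a b))" for a b :: "real^'n"
  proof -
    have "(cmod (indicator (box a b) x))\<^sup>2 = indicator (box a b) x" for x by (simp add: indicator_def)
    then show ?thesis unfolding square_integrable_def
      using emeasure_bounded_finite[OF bounded_box[of a b]] by auto
  qed
  have Fi: "integrable lborel (\<lambda>x. F x * indicator (box a b) x)" for a b
    by (rule sqint_prod[OF Fs ind])
  have box0: "(\<integral>x. F x * indicator (box a b) x \<partial>lborel) = 0" for a b
  proof -
    have "(\<lambda>m. \<integral>x. F x * complex_of_real (box_bump m a b x) \<partial>lborel) \<longlonglongrightarrow> (\<integral>x. F x * indicator (box a b) x \<partial>lborel)"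
    proof (rule integral_dominated_convergence[where w = "\<lambda>x. norm (F x * indicator (box a b) x)"])
      show "(\<lambda>x. F x * indicator (box a b) x) \<in> borel_measurable lborel" using Fi by auto
      show "(\<lambda>x. F x * complex_of_real (box_bump m a b x)) \<in> borel_measurable lborel" for m
        by (intro borel_measurable_times Fm sqint_measurable test_function_sqint test_function_box_bump)
      show "integrable lborel (\<lambda>x. norm (F x * indicator (box a b) x))" using Fi by auto
      have "(\<lambda>m. F x * complex_of_real (box_bump m a b x)) \<longlonglongrightarrow> F x * complex_of_real (indicator (box a b) x)" for x
        by (intro tendsto_intros tendsto_of_real box_bump_tendsto)
      then show "AE x in lborel. (\<lambda>m. F x * complex_of_real (box_bump m a b x)) \<longlonglongrightarrow> F x * indicator (box a b) x"
        unfolding indicator_def of_bool_def by (intro AE_I2) (simp only: if_distrib[of complex_of_real] of_real_1 of_real_0)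
      have "norm (F x * complex_of_real (box_bump m a b x)) \<le> norm (F x * indicator (box a b) x)" for m x
        using box_bump_range[of m a b x] box_bump_eq_0[of x a b m]
        by (cases "x \<in> box a b") (auto simp: norm_mult mult_left_le)
      then show "AE x in lborel. norm (F x * complex_of_real (box_bump m a b x)) \<le> norm (F x * indicator (box a b) x)" for m
        by simp
    qed
    moreover have "(\<integral>x. F x * complex_of_real (box_bump m a b x) \<partial>lborel) = 0" for m
      unfolding F_def by (rule z[OF test_function_box_bump])
    ultimately have "(\<lambda>m::nat. 0) \<longlonglongrightarrow> (\<integral>x. F x * indicator (box a b) x \<partial>lborel)" by simp
    then show ?thesis using LIMSEQ_unique[OF tendsto_const] by metis
  qed
  have AEbox: "AE x in lborel. F x * indicator (box c d) x = 0" for c d :: "real^'n"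
  proof -
    define g where "g = (\<lambda>x. F x * indicator (box c d) x)"
    have g: "integrable lborel g" unfolding g_def by (rule Fi)
    have gA: "set_integrable lborel A g" if "A \<in> sets borel" for A
      unfolding set_integrable_def using that g by (intro integrable_mult_indicator) auto
    define E where "E = range (\<lambda>(a, b :: real^'n). box a b)"
    have gE: "(LINT x:A|lborel. g x) = 0" if "A \<in> E" for A
    proof -
      obtain a b where A: "A = box a b" using \<open>A \<in> E\<close> by (auto simp: E_def)
      obtain p q where pq: "box a b \<inter> box c d = box p q" using Int_interval_cart(1)[of a b c d] box_Int_box[of a b c d] by blast
      have "(LINT x:A|lborel. g x) = (\<integral>x. F x * indicator (box p q) x \<partial>lborel)"
        unfolding set_lebesgue_integral_def A pq[symmetric] g_def
        by (intro Bochner_Integration.integral_cong refl) (auto simp: indicator_def)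
      then show ?thesis by (simp add: box0)
    qed
    have gU: "(LINT x:UNIV|lborel. g x) = 0"
      using box0[of c d] by (simp add: set_lebesgue_integral_def g_def)
    have iE: "Int_stable E"
    proof (rule Int_stableI)
      fix A B assume "A \<in> E" "B \<in> E"
      then obtain a b c d where "A = box a b" "B = box c d" by (auto simp: E_def)
      then show "A \<inter> B \<in> E" using box_Int_box[of a b c d] unfolding E_def by blast
    qed
    have sb: "sets (borel :: (real^'n) measure) = sigma_sets UNIV E"
      unfolding E_def by (subst borel_eq_box) (rule sets_measure_of, simp)
    have "(LINT x:A|lborel. g x) = 0" if "A \<in> sigma_sets UNIV E" for A
      using iE subset_UNIV[of E, folded Pow_UNIV] that
    proof (induction rule: sigma_sets_induct_disjoint)
      case (basic A) then show ?case by (rule gE)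
    next
      case empty show ?case by (simp add: set_lebesgue_integral_def)
    next
      case (compl A)
      have A: "A \<in> sets borel" using compl(1) sb by blast
      have "(LINT x:UNIV|lborel. g x) = (LINT x:A \<union> (UNIV - A)|lborel. g x)" by simp
      also have "\<dots> = (LINT x:A|lborel. g x) + (LINT x:UNIV - A|lborel. g x)"
        using A by (intro set_integral_Un gA) auto
      finally show ?case using gU compl by simp
    next
      case (union A)
      have A: "A i \<in> sets borel" for i using union(2) sb by blast
      have "(LINT x:(\<Union>i. A i)|lborel. g x) = (\<Sum>i. (LINT x:(A i)|lborel. g x))"
        using A union(1) by (intro lebesgue_integral_countable_add gA) (auto simp: disjoint_family_on_def)
      then show ?case using union by simp
    qed
    then have "AE x in lborel. g x = 0"
      using sb by (intro sigma_finite_measure.density_zero[OF sigma_finite_lborel] g) auto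
    then show ?thesis by (simp add: g_def)
  qed
  have "AE x in lborel. \<forall>m::nat. F x * indicator (box (- (\<chi> i. real m)) (\<chi> i. real m)) x = 0"
    by (subst AE_all_countable) (intro allI AEbox)
  then have "AE x in lborel. F x = 0"
  proof (rule AE_mp, intro AE_I2 impI)
    fix x :: "real^'n"
    assume *: "\<forall>m::nat. F x * indicator (box (- (\<chi> i. real m)) (\<chi> i. real m)) x = 0"
    obtain m :: nat where m: "real m > norm x" using reals_Archimedean2 by blast
    have "\<bar>x $ i\<bar> < real m" for i using component_le_norm_cart[of x i] m by linarith
    then have "x \<in> box (- (\<chi> i. real m)) (\<chi> i. real m)" by (auto simp: mem_box_cart abs_less_iff) (smt (verit))
    then show "F x = 0" using *[rule_format, of m] by simp
  qed
  then have "abs_l2 F = abs_l2 (\<lambda>x. 0)" by (subst abs_l2_eq_iff[OF Fs sqint_zero])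
  then show ?thesis by (simp add: l2_rep(2) zero_l2_def F_def)
qed

text \<open>
A weak gradient is determined by the function: this makes H1 a subspace of L2.
\<close>

lemma h1_l2_eq_0_imp:
  fixes p :: "'n::finite h1"
  assumes "h1_l2 p = 0" shows "p = 0"
proof -
  have wg: "weak_gradient (fst (Rep_h1 p)) (snd (Rep_h1 p))" using Rep_h1[of p] by (rule CollectD)
  have f0: "fst (Rep_h1 p) = 0" using assms by (simp add: h1_l2_def)
  have "snd (Rep_h1 p) $ i = 0" for i
  proof (rule l2_eq_0_if_orthogonal_test)
    fix \<phi> :: "real^'n \<Rightarrow> complex" assume t: "test_function \<phi>"
    have "l2_pair (partial i \<phi>) 0 = 0"
      using linear_0[OF bounded_linear.linear[OF bounded_linear_l2_pair[OF test_function_sqint(2)[OF t]]]] .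
    then show "(\<integral>x. l2_rep (snd (Rep_h1 p) $ i) x * \<phi> x \<partial>lborel) = 0"
      using wg[unfolded weak_gradient_iff, rule_format, OF t, of i]
      by (simp add: grad_defect_def f0 l2_pair_def)
  qed
  then have "Rep_h1 p = 0" using f0 by (simp add: prod_eq_iff vec_eq_iff)
  then show ?thesis by (metis Rep_h1_inject zero_h1.rep_eq)
qed

section \<open>The antidual and the Riesz map\<close>

lemma antidual_apply_simps:
  "antidual_apply (F + G) w = antidual_apply F w + antidual_apply G w"
  "antidual_apply (F - G) w = antidual_apply F w - antidual_apply G w"
  "antidual_apply (r *\<^sub>R F) w = r *\<^sub>R antidual_apply F w"
  "antidual_apply 0 w = 0"
  by (simp_all add: antidual_apply_def plus_antidual.rep_eq minus_antidual.rep_eq scaleR_antidual.rep_eq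
      zero_antidual.rep_eq blinfun.add_left blinfun.diff_left blinfun.scaleR_left)

lemma antidual_eqI: assumes "\<And>w. antidual_apply F w = antidual_apply G w" shows "F = G"
proof -
  have "Rep_antidual F = Rep_antidual G"
    by (rule blinfun_eqI) (rule assms[unfolded antidual_apply_def])
  then show ?thesis by (simp only: Rep_antidual_inject)
qed

lemma antidual_apply_scaleC: "antidual_apply F (c *\<^sub>C w) = cnj c * antidual_apply F w"
  using Rep_antidual[of F] unfolding antidual_apply_def mem_Collect_eq by (elim allE)

lemma norm_antidual_apply: "cmod (antidual_apply F w) \<le> norm F * norm w"
  unfolding antidual_apply_def norm_antidual.rep_eq by (rule norm_blinfun)

lemma norm_antidual_bound: "C \<ge> 0 \<Longrightarrow> (\<And>w. cmod (antidual_apply F w) \<le> C * norm w) \<Longrightarrow> norm F \<le> C"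
  unfolding antidual_apply_def norm_antidual.rep_eq by (rule norm_blinfun_bound)

text \<open>
The antidual carries no inner product of its own.  The real representative of Re F transports questions
about antilinear functionals to the Hilbert space, at no loss since Im F(w) = Re F(\<i> w).
\<close>

definition riesz :: "'a::chilbert antidual \<Rightarrow> 'a" where
  "riesz F = (SOME v. \<forall>w. Re (antidual_apply F w) = inner v w)"

lemma inner_riesz: "inner (riesz F) w = Re (antidual_apply F w)"
proof -
  have "bounded_linear (\<lambda>w. Re (antidual_apply F w))"
    unfolding antidual_apply_def by (intro bounded_linear_compose[OF bounded_linear_Re] blinfun.bounded_linear_right)
  then have "\<exists>v. \<forall>w. Re (antidual_apply F w) = inner v w" by (rule riesz_representation)
  from someI_ex[OF this, folded riesz_def, THEN spec, of w] show ?thesis by (rule sym)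
qed

lemma bounded_linear_riesz: "bounded_linear riesz"
proof (rule bounded_linear_intro[of _ 1])
  fix F G :: "'a antidual" and r :: real
  show "riesz (F + G) = riesz F + riesz G"
    by (simp add: vector_eq_rdot[symmetric] inner_add_left inner_riesz antidual_apply_simps)
  show "riesz (r *\<^sub>R F) = r *\<^sub>R riesz F"
    by (simp add: vector_eq_rdot[symmetric] inner_riesz antidual_apply_simps)
  have "norm (riesz F) * norm (riesz F) = Re (antidual_apply F (riesz F))"
    by (simp add: inner_riesz[symmetric] power2_norm_eq_inner[symmetric] power2_eq_square)
  also have "\<dots> \<le> norm F * norm (riesz F)"
    using complex_Re_le_cmod norm_antidual_apply order_trans by blast
  finally have le: "norm (riesz F) * norm (riesz F) \<le> norm F * norm (riesz F)" .
  show "norm (riesz F) \<le> norm F * 1"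
  proof (cases "norm (riesz F) > 0")
    case True
    from mult_right_le_imp_le[OF le this] show ?thesis by (simp only: mult_1_right)
  next
    case False
    then show ?thesis using norm_ge_zero[of F] by linarith
  qed
qed

lemma riesz_eq_0_imp: assumes "riesz F = 0" shows "F = 0"
proof (rule antidual_eqI)
  fix w
  have r: "Re (antidual_apply F v) = 0" for v
    unfolding inner_riesz[symmetric] assms by (rule inner_zero_left)
  have "Im (antidual_apply F w) = Re (antidual_apply F (\<i> *\<^sub>C w))"
    unfolding antidual_apply_scaleC by simp
  from trans[OF this r] have "antidual_apply F w = 0" using r[of w] by (intro complex_eqI) simp_all
  then show "antidual_apply F w = antidual_apply 0 w" by (simp only: antidual_apply_simps(4))
qed

section \<open>Bounds for the divergence-form operator\<close>

lemma norm_cdot: "cmod (cdot a b) \<le> norm a * norm b"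
proof -
  have "cmod (cdot a b) \<le> (\<Sum>i\<in>UNIV. cmod (a $ i * cnj (b $ i)))"
    unfolding cdot_def by (rule norm_sum)
  also have "\<dots> = (\<Sum>i\<in>UNIV. \<bar>cmod (a $ i)\<bar> * \<bar>cmod (b $ i)\<bar>)"
    by (simp only: norm_mult complex_mod_cnj abs_norm_cancel)
  also have "\<dots> \<le> norm a * norm b" unfolding norm_vec_def by (rule L2_set_mult_ineq)
  finally show ?thesis .
qed

lemma norm_grad_sq:
  "integrable lborel (\<lambda>x. (norm (h1_grad v x))\<^sup>2)"
  "(norm (snd (Rep_h1 v)))\<^sup>2 = (\<integral>x. (norm (h1_grad v x))\<^sup>2 \<partial>lborel)"
proof -
  have e: "(norm (h1_grad v x))\<^sup>2 = (\<Sum>i\<in>UNIV. (cmod (l2_rep (snd (Rep_h1 v) $ i) x))\<^sup>2)" for x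
    by (simp add: norm_vec_def L2_set_def sum_nonneg h1_grad_def)
  have i: "integrable lborel (\<lambda>x. (cmod (l2_rep (snd (Rep_h1 v) $ i) x))\<^sup>2)" for i
    using l2_rep_sqint[of "snd (Rep_h1 v) $ i"] by (simp add: square_integrable_def)
  show "integrable lborel (\<lambda>x. (norm (h1_grad v x))\<^sup>2)"
    unfolding e by (intro Bochner_Integration.integrable_sum i)
  have "(norm (snd (Rep_h1 v)))\<^sup>2 = (\<Sum>i\<in>UNIV. (norm (snd (Rep_h1 v) $ i))\<^sup>2)"
    by (simp add: norm_vec_def L2_set_def sum_nonneg)
  then show "(norm (snd (Rep_h1 v)))\<^sup>2 = (\<integral>x. (norm (h1_grad v x))\<^sup>2 \<partial>lborel)"
    unfolding e by (simp add: norm_l2_rep Bochner_Integration.integral_sum[OF i])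
qed

lemma h1_grad_measurable: "(\<lambda>x. h1_grad v x $ j) \<in> borel_measurable borel"
  using sqint_measurable[OF l2_rep_sqint[of "snd (Rep_h1 v) $ j"]] by (simp add: h1_grad_def)

lemma norm_h1_parts: "norm (h1_l2 v) \<le> norm v" "norm (snd (Rep_h1 v)) \<le> norm v"
  "(norm v)\<^sup>2 = (norm (h1_l2 v))\<^sup>2 + (norm (snd (Rep_h1 v)))\<^sup>2"
proof -
  show *: "(norm v)\<^sup>2 = (norm (h1_l2 v))\<^sup>2 + (norm (snd (Rep_h1 v)))\<^sup>2"
    by (simp add: norm_h1.rep_eq norm_prod_def h1_l2_def)
  show "norm (h1_l2 v) \<le> norm v" "norm (snd (Rep_h1 v)) \<le> norm v"
    by (rule power2_le_imp_le[OF _ norm_ge_zero], simp add: *)+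
qed

lemma div_op_bounds:
  fixes A :: "real^'n::finite \<Rightarrow> complex^'n^'n" and v w :: "'n h1"
  assumes A: "A \<in> borel_measurable borel" and L: "\<Lambda> \<ge> 0" "\<And>x \<xi>. norm (A x *v \<xi>) \<le> \<Lambda> * norm \<xi>"
  shows "integrable lborel (\<lambda>x. cdot (A x *v h1_grad v x) (h1_grad w x))"
    and "cmod (antidual_apply (div_op A v) w) \<le> \<Lambda> * norm (snd (Rep_h1 v)) * norm (snd (Rep_h1 w))"
    and "norm (div_op A v) \<le> \<Lambda> * norm v"
proof -
  have Am: "(\<lambda>x. A x $ i $ j) \<in> borel_measurable borel" for i j
  proof -
    have "(\<lambda>a :: complex^'n^'n. a $ i $ j) \<in> borel_measurable borel"
      by (intro borel_measurable_continuous_onI continuous_intros)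
    from measurable_compose[OF A this] show ?thesis .
  qed
  have m: "(\<lambda>x. cdot (A x *v h1_grad v x) (h1_grad w x)) \<in> borel_measurable lborel" for w
    unfolding cdot_def matrix_vector_mult_def vec_lambda_beta measurable_lborel2
    by (intro borel_measurable_sum borel_measurable_times Am h1_grad_measurable
        measurable_compose[OF h1_grad_measurable borel_measurable_continuous_onI] continuous_intros)
  define N where "N = (\<lambda>(u :: 'n h1) x. complex_of_real (norm (h1_grad u x)))"
  have nm: "(\<lambda>x. norm (h1_grad u x)) \<in> borel_measurable lborel" for u :: "'n h1"
  proof -
    have "norm (h1_grad u x) = sqrt (\<Sum>i\<in>UNIV. (cmod (h1_grad u x $ i))\<^sup>2)" for x
      by (simp add: norm_vec_def L2_set_def)
    then show ?thesis using h1_grad_measurable[of u] by simp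
  qed
  have N: "square_integrable (N u)" "norm (abs_l2 (N u)) = norm (snd (Rep_h1 u))" for u
  proof -
    show s: "square_integrable (N u)"
      unfolding square_integrable_def N_def using nm[of u] norm_grad_sq(1)[of u] by simp
    have "(norm (abs_l2 (N u)))\<^sup>2 = (norm (snd (Rep_h1 u)))\<^sup>2"
      unfolding norm_l2_abs[OF s] norm_grad_sq(2) by (simp add: N_def)
    then show "norm (abs_l2 (N u)) = norm (snd (Rep_h1 u))" by simp
  qed
  have b: "cmod (cdot (A x *v h1_grad v x) (h1_grad w x)) \<le> \<Lambda> * cmod (N v x * N w x)" for x w
  proof -
    have "cmod (cdot (A x *v h1_grad v x) (h1_grad w x)) \<le> (\<Lambda> * norm (h1_grad v x)) * norm (h1_grad w x)"
      by (rule order_trans[OF norm_cdot]) (intro mult_right_mono L norm_ge_zero)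
    then show ?thesis by (simp add: N_def norm_mult)
  qed
  have iN: "integrable lborel (\<lambda>x. \<Lambda> * cmod (N v x * N w x))" for w
    using sqint_prod[OF N(1) N(1)] by simp
  show i: "integrable lborel (\<lambda>x. cdot (A x *v h1_grad v x) (h1_grad w x))" for w
    by (rule Bochner_Integration.integrable_bound[OF iN m]) (use b L in \<open>auto simp: abs_mult\<close>)
  show c: "cmod (antidual_apply (div_op A v) w) \<le> \<Lambda> * norm (snd (Rep_h1 v)) * norm (snd (Rep_h1 w))" for w
  proof -
    have "cmod (antidual_apply (div_op A v) w) \<le> (\<integral>x. cmod (cdot (A x *v h1_grad v x) (h1_grad w x)) \<partial>lborel)"
      unfolding antidual_apply_div_op[OF A L(2)] norm_minus_cancel by (rule integral_norm_bound)
    also have "\<dots> \<le> (\<integral>x. \<Lambda> * cmod (N v x * N w x) \<partial>lborel)"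
      by (intro integral_mono integrable_norm i iN b)
    also have "\<dots> \<le> \<Lambda> * (norm (abs_l2 (N v)) * norm (abs_l2 (N w)))"
      unfolding integral_mult_right_zero by (intro mult_left_mono L l2_cauchy_bound N)
    finally show ?thesis by (simp add: N)
  qed
  show "norm (div_op A v) \<le> \<Lambda> * norm v"
  proof (rule norm_antidual_bound)
    show "0 \<le> \<Lambda> * norm v" by (intro mult_nonneg_nonneg L(1) norm_ge_zero)
    fix w :: "'n h1"
    have "\<Lambda> * norm (snd (Rep_h1 v)) * norm (snd (Rep_h1 w)) \<le> \<Lambda> * norm v * norm w"
      by (intro mult_mono norm_h1_parts(2) order_refl mult_nonneg_nonneg L(1) norm_ge_zero)
    then show "cmod (antidual_apply (div_op A v) w) \<le> \<Lambda> * norm v * norm w" using c[of w] by linarith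
  qed
qed

section \<open>Powers of a self-adjoint contraction\<close>

text \<open>
For 0 \<le> K \<le> 1 one has K^2 \<le> K.  Without square roots of operators:
K - K^2 = (1 - K) K (1 - K) + K (1 - K) K.
\<close>

lemma selfadjoint_sq_le:
  fixes K :: "'a::real_inner \<Rightarrow> 'a"
  assumes K: "bounded_linear K" and sym: "\<And>x y. inner (K x) y = inner x (K y)"
    and pos: "\<And>x. 0 \<le> inner (K x) x" and le: "\<And>x. inner (K x) x \<le> inner x x"
  shows "inner (K y) (K y) \<le> inner (K y) y"
proof -
  interpret K: bounded_linear K by (rule K)
  have "inner (K y) y - inner (K y) (K y) = inner (K (y - K y)) (y - K y) + (inner (K y) (K y) - inner (K (K y)) (K y))"
    by (simp add: K.diff inner_diff_left inner_diff_right sym)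
  then show ?thesis using pos[of "y - K y"] le[of "K y"] by linarith
qed

lemma selfadjoint_powers_contract:
  fixes K :: "'a::real_inner \<Rightarrow> 'a"
  assumes "bounded_linear K" "\<And>x y. inner (K x) y = inner x (K y)"
    "\<And>x. 0 \<le> inner (K x) x" "\<And>x. inner (K x) x \<le> inner x x"
  shows "norm ((K ^^ n) x) \<le> norm x"
proof (induction n)
  case (Suc n)
  have "norm (K y) \<le> norm y" for y
    using selfadjoint_sq_le[OF assms, of y] assms(4)[of y] by (simp add: norm_eq_sqrt_inner)
  then show ?case using Suc order_trans by fastforce
qed simp

text \<open>
The numbers a n = (K^n x, x) are nonnegative and decrease, and the squared distance of K^m x and K^n x is
a (2m) - 2 a (m+n) + a (2n), so the powers form a Cauchy sequence.
\<close>

lemma selfadjoint_powers_converge: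
  fixes K :: "'a::{real_inner, complete_space} \<Rightarrow> 'a"
  assumes K: "bounded_linear K" and sym: "\<And>x y. inner (K x) y = inner x (K y)"
    and pos: "\<And>x. 0 \<le> inner (K x) x" and le: "\<And>x. inner (K x) x \<le> inner x x"
  shows "\<exists>p. (\<lambda>n. (K ^^ n) x) \<longlonglongrightarrow> p \<and> K p = p"
proof -
  interpret K: bounded_linear K by (rule K)
  have symn: "inner ((K ^^ n) x) y = inner x ((K ^^ n) y)" for n x y
    by (induction n arbitrary: x y) (simp_all add: sym funpow_swap1)
  have sq: "inner (K y) (K y) \<le> inner (K y) y" for y
    by (rule selfadjoint_sq_le[OF assms])
  define a where "a = (\<lambda>n. inner ((K ^^ n) x) x)"
  have a_add: "inner ((K ^^ m) x) ((K ^^ n) x) = a (m + n)" for m n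
    by (simp add: a_def symn[symmetric] funpow_add add.commute[of m])
  have a_dec: "a (Suc n) \<le> a n" for n
  proof (cases "even n")
    case True
    then obtain k where n: "n = k + k" by (auto simp: mult_2 elim!: evenE)
    have "inner (K ((K ^^ k) x)) ((K ^^ k) x) \<le> inner ((K ^^ k) x) ((K ^^ k) x)" by (rule le)
    then show ?thesis using a_add[of "Suc k" k] a_add[of k k] n by simp
  next
    case False
    then obtain k where n: "n = Suc k + k" by (auto simp: mult_2 elim!: oddE)
    have "inner (K ((K ^^ k) x)) (K ((K ^^ k) x)) \<le> inner (K ((K ^^ k) x)) ((K ^^ k) x)" by (rule sq)
    then show ?thesis using a_add[of "Suc k" k] a_add[of "Suc k" "Suc k"] n by simp
  qed
  have a0: "0 \<le> a n" for n
  proof (cases "even n")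
    case True
    then obtain k where n: "n = k + k" by (auto simp: mult_2 elim!: evenE)
    show ?thesis using a_add[of k k] n by (metis inner_ge_zero)
  next
    case False
    then obtain k where n: "n = Suc k + k" by (auto simp: mult_2 elim!: oddE)
    show ?thesis using a_add[of "Suc k" k] n pos[of "(K ^^ k) x"] by simp
  qed
  have "decseq a" using a_dec by (rule decseq_SucI)
  then obtain L where L: "a \<longlonglongrightarrow> L" using decseq_convergent[OF \<open>decseq a\<close>, of 0] a0 by metis
  have aL: "L \<le> a n" for n using decseq_ge[OF \<open>decseq a\<close> L] .
  have "Cauchy (\<lambda>n. (K ^^ n) x)"
  proof (rule CauchyI)
    fix e :: real assume e: "e > 0"
    have "eventually (\<lambda>n. a n < L + e\<^sup>2 / 2) sequentially"
      using order_tendstoD(2)[OF L, of "L + e\<^sup>2 / 2"] e by simp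
    then obtain N where N: "\<And>n. n \<ge> N \<Longrightarrow> a n < L + e\<^sup>2 / 2" by (auto simp: eventually_sequentially)
    have "norm ((K ^^ m) x - (K ^^ n) x) < e" if "m \<ge> N" "n \<ge> N" for m n
    proof -
      have "(norm ((K ^^ m) x - (K ^^ n) x))\<^sup>2 = a (m + m) - 2 * a (m + n) + a (n + n)"
        by (simp add: power2_norm_eq_inner inner_diff_left inner_diff_right a_add add.commute[of n m])
      also have "\<dots> < e\<^sup>2" using N[of "m + m"] N[of "n + n"] aL[of "m + n"] that by linarith
      finally show ?thesis using e by (simp add: power_less_imp_less_base)
    qed
    then show "\<exists>M. \<forall>m\<ge>M. \<forall>n\<ge>M. norm ((K ^^ m) x - (K ^^ n) x) < e" by blast
  qed
  then obtain p where p: "(\<lambda>n. (K ^^ n) x) \<longlonglongrightarrow> p" by (auto simp: Cauchy_convergent_iff convergent_def)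
  have "(\<lambda>n. (K ^^ Suc n) x) \<longlonglongrightarrow> K p" using K.tendsto[OF p] by simp
  moreover have "(\<lambda>n. (K ^^ Suc n) x) \<longlonglongrightarrow> p" using p by (rule LIMSEQ_Suc)
  ultimately show ?thesis using p LIMSEQ_unique by blast
qed

section \<open>The square of a primitive\<close>

text \<open>
Energy identity in integrated form: if \<rho> is the primitive of r then the derivative of
(S \<rho>, \<rho>) is 2 (S r, \<rho>).  Only integrability of r is available, so instead of differentiating,
the square of the integral is split along the diagonal.
\<close>

lemma inner_primitive_square:
  fixes r :: "real \<Rightarrow> 'a::{real_inner, banach, second_countable_topology}"
  assumes r: "integrable lborel r" and S: "bounded_linear S" and sym: "\<And>x y. inner (S x) y = inner x (S y)"
  shows "inner (S (\<integral>t. r t \<partial>lborel)) (\<integral>t. r t \<partial>lborel)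
      = 2 * (\<integral>t. inner (S (r t)) (\<integral>s. indicator {..<t} s *\<^sub>R r s \<partial>lborel) \<partial>lborel)"
proof -
  interpret S: bounded_linear S by (rule S)
  define k where "k = (\<lambda>p. inner (S (r (fst p))) (r (snd p)))"
  let ?P = "lborel \<Otimes>\<^sub>M (lborel :: real measure)"
  have rm: "r \<in> borel_measurable lborel" using r by simp
  have rm1: "(\<lambda>p. r (fst p)) \<in> borel_measurable ?P" by (rule measurable_compose[OF measurable_fst rm])
  have rm2: "(\<lambda>p. r (snd p)) \<in> borel_measurable ?P" by (rule measurable_compose[OF measurable_snd rm])
  have Sm: "S \<in> borel_measurable borel" by (intro borel_measurable_continuous_onI S.continuous_on continuous_on_id)
  have km: "k \<in> borel_measurable ?P"
    unfolding k_def by (intro borel_measurable_inner rm2 measurable_compose[OF rm1 Sm])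
  obtain C where C: "\<And>x. norm (S x) \<le> norm x * C" "C > 0" using S.pos_bounded by blast
  have ki: "integrable ?P k"
  proof (rule Bochner_Integration.integrable_bound[of _ "\<lambda>p. C * (norm (r (fst p)) * norm (r (snd p)))"])
    have "integrable ?P (\<lambda>p. norm (r (fst p)) * norm (r (snd p)))"
    proof (rule lborel_pair.Fubini_integrable)
      show "(\<lambda>p. norm (r (fst p)) * norm (r (snd p))) \<in> borel_measurable ?P" using rm1 rm2 by measurable
      show "integrable lborel (\<lambda>x. \<integral>y. norm (norm (r (fst (x, y))) * norm (r (snd (x, y)))) \<partial>lborel)" using r by simp
      show "AE x in lborel. integrable lborel (\<lambda>y. norm (r (fst (x, y))) * norm (r (snd (x, y))))" using r by simp
    qed
    then show "integrable ?P (\<lambda>p. C * (norm (r (fst p)) * norm (r (snd p))))" by simp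
    have "\<bar>k p\<bar> \<le> C * (norm (r (fst p)) * norm (r (snd p)))" for p
    proof -
      have "\<bar>k p\<bar> \<le> norm (S (r (fst p))) * norm (r (snd p))" unfolding k_def by (rule Cauchy_Schwarz_ineq2)
      also have "\<dots> \<le> (norm (r (fst p)) * C) * norm (r (snd p))" by (intro mult_right_mono C norm_ge_zero)
      finally show ?thesis by (simp add: mult_ac)
    qed
    then show "AE p in ?P. norm (k p) \<le> norm (C * (norm (r (fst p)) * norm (r (snd p))))"
      using C(2) by (simp add: abs_mult)
  qed (rule km)
  have setm: "{p \<in> space ?P. snd p < fst p} \<in> sets ?P" "{p \<in> space ?P. fst p \<le> snd p} \<in> sets ?P"
    by measurable
  define k1 where "k1 = (\<lambda>p. indicator {p. snd p < fst p} p * k p)"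
  define k2 where "k2 = (\<lambda>p. indicator {p. fst p \<le> snd p} p * k p)"
  have i1: "integrable ?P k1" and i2: "integrable ?P k2"
  proof -
    have a: "{p :: real \<times> real. snd p < fst p} \<in> sets ?P" "{p :: real \<times> real. fst p \<le> snd p} \<in> sets ?P"
      using setm by (simp_all add: space_pair_measure)
    show "integrable ?P k1" "integrable ?P k2"
      using integrable_mult_indicator[OF a(1) ki] integrable_mult_indicator[OF a(2) ki] by (simp_all add: k1_def k2_def)
  qed
  define \<rho> where "\<rho> = (\<lambda>t. \<integral>s. indicator {..<t} s *\<^sub>R r s \<partial>lborel)"
  have ri: "integrable lborel (\<lambda>s. indicator {..<t} s *\<^sub>R r s)" for t
    by (rule integrable_mult_indicator[OF _ r]) simp
  have in1: "(\<integral>y. k1 (x, y) \<partial>lborel) = inner (S (r x)) (\<rho> x)" for x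
  proof -
    have "k1 (x, y) = inner (S (r x)) (indicator {..<x} y *\<^sub>R r y)" for y
      by (simp add: k1_def k_def indicator_def)
    then show ?thesis unfolding \<rho>_def using ri[of x] by (simp only: integral_inner_right)
  qed
  have in2: "(\<integral>x. k2 (x, y) \<partial>lborel) = inner (S (r y)) (\<rho> y)" for y
  proof -
    have "(\<integral>x. k2 (x, y) \<partial>lborel) = (\<integral>x. inner (indicator {..<y} x *\<^sub>R r x) (S (r y)) \<partial>lborel)"
    proof (rule integral_cong_AE)
      show "(\<lambda>x. k2 (x, y)) \<in> borel_measurable lborel"
        using measurable_compose[OF measurable_Pair2' borel_measurable_integrable[OF i2], of y] by simp
      show "(\<lambda>x. inner (indicator {..<y} x *\<^sub>R r x) (S (r y))) \<in> borel_measurable lborel"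
        by (intro borel_measurable_inner borel_measurable_integrable[OF ri] borel_measurable_const)
      show "AE x in lborel. k2 (x, y) = inner (indicator {..<y} x *\<^sub>R r x) (S (r y))"
        using AE_lborel_singleton[of y] by eventually_elim (auto simp: k2_def k_def indicator_def sym)
    qed
    also have "\<dots> = inner (\<rho> y) (S (r y))" unfolding \<rho>_def using ri[of y] by (simp only: integral_inner_left)
    finally show ?thesis by (simp add: inner_commute)
  qed
  have "inner (S (\<integral>t. r t \<partial>lborel)) (\<integral>t. r t \<partial>lborel) = (\<integral>x. inner (S (r x)) (\<integral>t. r t \<partial>lborel) \<partial>lborel)"
  proof -
    have i: "integrable lborel (\<lambda>t. S (r t))" using r by (rule integrable_bounded_linear[OF S])
    have "S (\<integral>t. r t \<partial>lborel) = (\<integral>t. S (r t) \<partial>lborel)" by (rule integral_bounded_linear[OF S r, symmetric])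
    then show ?thesis using i by (simp only: integral_inner_left)
  qed
  also have "\<dots> = (\<integral>x. (\<integral>y. k (x, y) \<partial>lborel) \<partial>lborel)" using r by (simp add: k_def)
  also have "\<dots> = (\<integral>p. k p \<partial>?P)" by (rule lborel_pair.integral_fst'[OF ki])
  also have "\<dots> = (\<integral>p. k1 p + k2 p \<partial>?P)"
    by (intro Bochner_Integration.integral_cong refl) (auto simp: k1_def k2_def indicator_def)
  also have "\<dots> = (\<integral>p. k1 p \<partial>?P) + (\<integral>p. k2 p \<partial>?P)" by (rule Bochner_Integration.integral_add[OF i1 i2])
  also have "(\<integral>p. k1 p \<partial>?P) = (\<integral>x. inner (S (r x)) (\<rho> x) \<partial>lborel)"
    by (simp only: lborel_pair.integral_fst'[OF i1, symmetric] in1)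
  also have "(\<integral>p. k2 p \<partial>?P) = (\<integral>y. inner (S (r y)) (\<rho> y) \<partial>lborel)"
  proof -
    have "integrable ?P (case_prod (\<lambda>x y. k2 (x, y)))" using i2 by simp
    from lborel_pair.integral_snd[OF this] show ?thesis by (simp add: in2)
  qed
  finally show ?thesis by (simp add: \<rho>_def)
qed

lemma inner_power_nonneg:
  fixes K :: "'a::real_inner \<Rightarrow> 'a"
  assumes sym: "\<And>x y. inner (K x) y = inner x (K y)" and pos: "\<And>x. 0 \<le> inner (K x) x"
  shows "inner ((K ^^ n) x) y = inner x ((K ^^ n) y)" and "0 \<le> inner ((K ^^ n) x) x"
proof -
  show symn: "inner ((K ^^ n) x) y = inner x ((K ^^ n) y)" for n x y
    by (induction n arbitrary: x y) (simp_all add: sym funpow_swap1)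
  have a: "inner ((K ^^ (m + k)) x) x = inner ((K ^^ m) x) ((K ^^ k) x)" for m k
    unfolding add.commute[of m k] funpow_add o_def by (rule symn)
  show "0 \<le> inner ((K ^^ n) x) x"
  proof (cases "even n")
    case True
    then obtain k where n: "n = k + k" by (auto simp: mult_2 elim!: evenE)
    show ?thesis unfolding n a by (rule inner_ge_zero)
  next
    case False
    then obtain k where n: "n = Suc k + k" by (auto simp: mult_2 elim!: oddE)
    show ?thesis unfolding n a using pos by simp
  qed
qed

section \<open>Uniqueness of solutions\<close>

lemma bounded_linear_h1_l2: "bounded_linear (h1_l2 :: 'n::finite h1 \<Rightarrow> _)"
  by (intro bounded_linear_intro[of _ 1])
    (simp_all add: h1_l2_def plus_h1.rep_eq scaleR_h1.rep_eq norm_h1_parts(1)[unfolded h1_l2_def])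

lemma l2_antidual_bound: "cmod (antidual_apply (l2_antidual g) w) \<le> norm g * norm (h1_l2 w)"
proof -
  have s: "square_integrable (\<lambda>x. cnj (l2_rep (h1_l2 w) x))" by (intro sqint_cnj l2_rep_sqint)
  have "(norm (abs_l2 (\<lambda>x. cnj (l2_rep (h1_l2 w) x))))\<^sup>2 = (norm (h1_l2 w))\<^sup>2"
    unfolding norm_l2_abs[OF s] norm_l2_rep[of "h1_l2 w"] by simp
  then have n: "norm (abs_l2 (\<lambda>x. cnj (l2_rep (h1_l2 w) x))) = norm (h1_l2 w)" by simp
  have "cmod (antidual_apply (l2_antidual g) w) \<le> (\<integral>x. cmod (l2_rep g x * cnj (l2_rep (h1_l2 w) x)) \<partial>lborel)"
    unfolding antidual_apply_l2_antidual by (rule integral_norm_bound)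
  also have "\<dots> \<le> norm (abs_l2 (l2_rep g)) * norm (abs_l2 (\<lambda>x. cnj (l2_rep (h1_l2 w) x)))"
    by (rule l2_cauchy_bound[OF l2_rep_sqint s])
  finally show ?thesis by (simp only: n l2_rep(2))
qed

lemma bounded_linear_l2_antidual: "bounded_linear (l2_antidual :: (real^'n::finite) l2 \<Rightarrow> _)"
proof (rule bounded_linear_intro[of _ 1])
  have p: "antidual_apply (l2_antidual g) w = l2_pair (\<lambda>x. cnj (l2_rep (h1_l2 w) x)) g" for g :: "(real^'n) l2" and w
    by (simp add: antidual_apply_l2_antidual l2_pair_def)
  have lin: "bounded_linear (l2_pair (\<lambda>x. cnj (l2_rep (h1_l2 w) x)))" for w :: "'n h1"
    by (intro bounded_linear_l2_pair sqint_cnj l2_rep_sqint)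
  note add = linear_add[OF bounded_linear.linear[OF lin]]
  note cmul = linear_cmul[OF bounded_linear.linear[OF lin]]
  fix g h :: "(real^'n) l2" and c :: real
  show "l2_antidual (g + h) = l2_antidual g + l2_antidual h"
    by (rule antidual_eqI) (simp only: antidual_apply_simps p add)
  show "l2_antidual (c *\<^sub>R g) = c *\<^sub>R l2_antidual g"
    by (rule antidual_eqI) (simp only: antidual_apply_simps p cmul)
  show "norm (l2_antidual g) \<le> norm g * 1"
  proof (rule norm_antidual_bound)
    fix w :: "'n h1"
    have "norm g * norm (h1_l2 w) \<le> norm g * 1 * norm w"
      using mult_left_mono[OF norm_h1_parts(1)[of w] norm_ge_zero[of g]] by simp
    then show "cmod (antidual_apply (l2_antidual g) w) \<le> norm g * 1 * norm w"
      using l2_antidual_bound[of g w] by linarith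
  qed simp
qed

lemma norm_l2_antidual: "norm (l2_antidual g :: 'n::finite h1 antidual) \<le> norm g"
proof (rule norm_antidual_bound)
  fix w :: "'n h1"
  have "norm g * norm (h1_l2 w) \<le> norm g * norm w"
    by (rule mult_left_mono[OF norm_h1_parts(1) norm_ge_zero])
  then show "cmod (antidual_apply (l2_antidual g) w) \<le> norm g * norm w"
    using l2_antidual_bound[of g w] by linarith
qed simp

text \<open>
The Gram operator of the L2 inner product on H1: the composition of the embedding of H1
into its antidual with the Riesz map.
\<close>

definition h1_gram :: "'n::finite h1 \<Rightarrow> 'n h1" where
  "h1_gram w = riesz (l2_antidual (h1_l2 w))"

lemma inner_h1_gram: "inner (h1_gram w) v = inner (h1_l2 w) (h1_l2 v)"
proof -
  have i: "integrable lborel (\<lambda>x. l2_rep (h1_l2 w) x * cnj (l2_rep (h1_l2 v) x))"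
    by (intro sqint_prod sqint_cnj l2_rep_sqint)
  show ?thesis unfolding h1_gram_def inner_riesz antidual_apply_l2_antidual inner_l2_rep
    by (rule integral_Re[OF i, symmetric])
qed

lemma bounded_linear_h1_gram: "bounded_linear h1_gram"
  unfolding h1_gram_def[abs_def]
  by (intro bounded_linear_compose[OF bounded_linear_riesz] bounded_linear_compose[OF bounded_linear_l2_antidual]
      bounded_linear_h1_l2)

text \<open>
The form of 1 - h1_gram is the squared L2 norm of the gradient, which lies between 0 and the squared H1
norm.  A limit p of its powers is fixed by it, so p has vanishing L2 norm.
\<close>

lemma h1_gram_complement:
  fixes K :: "'n::finite h1 \<Rightarrow> 'n h1"
  assumes K_def: "K = (\<lambda>x. x - h1_gram x)"
  shows "bounded_linear K" "inner (K x) y = inner x (K y)" "0 \<le> inner (K x) x" "inner (K x) x \<le> inner x x"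
    and "(\<lambda>n. (K ^^ n) x) \<longlonglongrightarrow> 0"
proof -
  show bl: "bounded_linear K"
    unfolding K_def by (intro bounded_linear_sub bounded_linear_ident bounded_linear_h1_gram)
  have e: "inner (h1_gram x) y = inner x (h1_gram y)" for x y
    by (metis inner_commute inner_h1_gram)
  show sym: "inner (K x) y = inner x (K y)" for x y
    by (simp add: K_def inner_diff_left inner_diff_right e)
  have i: "inner (K x) x = (norm (snd (Rep_h1 x)))\<^sup>2" for x
    using norm_h1_parts(3)[of x] by (simp add: K_def inner_diff_left inner_h1_gram power2_norm_eq_inner)
  show pos: "0 \<le> inner (K x) x" for x by (simp add: i)
  show le: "inner (K x) x \<le> inner x x" for x
    using norm_h1_parts(3)[of x] by (simp add: i power2_norm_eq_inner)
  obtain p where p: "(\<lambda>n. (K ^^ n) x) \<longlonglongrightarrow> p" "K p = p"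
    using selfadjoint_powers_converge[OF bl sym pos le] by blast
  have "inner (h1_l2 p) (h1_l2 p) = 0"
    using p(2) unfolding inner_h1_gram[symmetric] by (simp add: K_def)
  then have "p = 0" by (intro h1_l2_eq_0_imp) simp
  then show "(\<lambda>n. (K ^^ n) x) \<longlonglongrightarrow> 0" using p(1) by simp
qed

lemma h1_grad_diff: "AE x in lborel. h1_grad (u - v) x = h1_grad u x - h1_grad v x"
proof -
  have "AE x in lborel. \<forall>i\<in>UNIV. l2_rep (snd (Rep_h1 u) $ i - snd (Rep_h1 v) $ i) x
      = l2_rep (snd (Rep_h1 u) $ i) x - l2_rep (snd (Rep_h1 v) $ i) x"
    by (intro AE_finite_allI l2_rep_diff) auto
  then show ?thesis
    by eventually_elim (simp add: h1_grad_def minus_h1.rep_eq vec_eq_iff)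
qed

lemma div_op_diff:
  fixes A :: "real^'n::finite \<Rightarrow> complex^'n^'n" and u v :: "'n h1"
  assumes A: "A \<in> borel_measurable borel" and L: "\<Lambda> \<ge> 0" "\<And>x \<xi>. norm (A x *v \<xi>) \<le> \<Lambda> * norm \<xi>"
  shows "div_op A (u - v) = div_op A u - div_op A v"
proof (rule antidual_eqI)
  fix w
  note i = div_op_bounds(1)[OF A L]
  have c: "cdot (A x *v (a - b)) z = cdot (A x *v a) z - cdot (A x *v b) z" for a b z x
    by (simp add: cdot_def matrix_vector_mult_diff_distrib left_diff_distrib sum_subtractf)
  have "(\<integral>x. cdot (A x *v h1_grad (u - v) x) (h1_grad w x) \<partial>lborel)
      = (\<integral>x. cdot (A x *v h1_grad u x) (h1_grad w x) - cdot (A x *v h1_grad v x) (h1_grad w x) \<partial>lborel)"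
  proof (rule integral_cong_AE)
    show "AE x in lborel. cdot (A x *v h1_grad (u - v) x) (h1_grad w x)
        = cdot (A x *v h1_grad u x) (h1_grad w x) - cdot (A x *v h1_grad v x) (h1_grad w x)"
      using h1_grad_diff[of u v] by eventually_elim (simp only: c)
  qed (intro borel_measurable_integrable i borel_measurable_diff)+
  also have "\<dots> = (\<integral>x. cdot (A x *v h1_grad u x) (h1_grad w x) \<partial>lborel) - (\<integral>x. cdot (A x *v h1_grad v x) (h1_grad w x) \<partial>lborel)"
    by (rule Bochner_Integration.integral_diff[OF i i])
  finally show "antidual_apply (div_op A (u - v)) w = antidual_apply (div_op A u - div_op A v) w"
    by (simp only: antidual_apply_simps antidual_apply_div_op[OF A L(2)] minus_diff_minus)
qed

lemma elliptic_slice_measurable: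
  fixes B :: "real \<Rightarrow> real^'n::finite \<Rightarrow> complex^'n^'n"
  assumes "elliptic B" "t \<in> {0..1}" shows "B t \<in> borel_measurable borel"
proof -
  have m: "(\<lambda>(t, x). B t x) \<in> borel_measurable (restrict_space borel ({0..1} \<times> UNIV))"
    using assms(1) by (simp add: elliptic_def)
  have "(\<lambda>x :: real^'n. (t, x)) \<in> measurable borel (restrict_space borel ({0..1} \<times> UNIV))"
    using assms(2) by (intro measurable_restrict_space2 borel_measurable_continuous_onI continuous_intros) auto
  from measurable_compose[OF this m] show ?thesis by simp
qed

lemma I01_integrable_iff:
  fixes f :: "real \<Rightarrow> 'b::{banach, second_countable_topology}"
  shows "integrable I01 f \<longleftrightarrow> integrable lborel (\<lambda>t. indicator {0<..<1} t *\<^sub>R f t)"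
  by (rule integrable_restrict_space) simp

lemma I01_AE_iff: "(AE t in I01. P t) \<longleftrightarrow> (AE t in lborel. t \<in> {0<..<1} \<longrightarrow> P t)"
  by (subst AE_restrict_space_iff) auto

lemma I01_measurable_iff:
  fixes f :: "real \<Rightarrow> 'b::real_normed_vector"
  shows "f \<in> borel_measurable I01 \<longleftrightarrow> (\<lambda>t. indicator {0<..<1} t *\<^sub>R f t) \<in> borel_measurable lborel"
  by (rule borel_measurable_restrict_space_iff) simp

text \<open>
For the difference w of two solutions let r(t) represent div(B \<nabla> w(t)) and let \<rho> be its primitive
from 0, so that \<rho> = h1_gram w by the equation.  Formally, 2 \<integral>(r, w) is the value of the form of the
inverse of h1_gram at \<rho>(1), hence nonnegative.  The unbounded inverse is replaced by the
Neumann sum S = 1 + K + ... + K^(n-1) with K = 1 - h1_gram, for which S h1_gram = 1 - K^n tends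
strongly to 1.  So \<integral>(r, w) \<ge> 0, whereas ellipticity makes (r, w) at most
-\<mu> |\<nabla> w|^2.  Therefore \<nabla> w = 0, so r = 0, \<rho> = 0 and w = 0.
\<close>

theorem solution_unique:
  fixes u v :: "real \<Rightarrow> 'n::finite h1"
  assumes ell: "elliptic B" and u: "is_solution B F u" and v: "is_solution B F v"
  shows "AE t in I01. v t = u t"
proof -
  obtain \<Lambda> \<mu> where \<Lambda>: "\<Lambda> > 0" and \<mu>: "\<mu> > 0"
    and B1: "\<And>t x \<xi>. t \<in> {0..1} \<Longrightarrow> norm (B t x *v \<xi>) \<le> \<Lambda> * norm \<xi>"
    and B2: "\<And>t x \<xi>. t \<in> {0..1} \<Longrightarrow> \<mu> * (norm \<xi>)\<^sup>2 \<le> Re (cdot (B t x *v \<xi>) \<xi>)"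
    using ell unfolding elliptic_def by blast
  note Bm = elliptic_slice_measurable[OF ell]
  obtain U where U: "AE t in I01. U t = l2_antidual (h1_l2 (u t))"
    "\<And>t. t \<in> {0..1} \<Longrightarrow> U t - (LINT \<tau>:{0<..<t}|lborel. div_op (B \<tau>) (u \<tau>)) = (LINT \<tau>:{0<..<t}|lborel. F \<tau>)"
    using u unfolding is_solution_def by blast
  obtain V where V: "AE t in I01. V t = l2_antidual (h1_l2 (v t))"
    "\<And>t. t \<in> {0..1} \<Longrightarrow> V t - (LINT \<tau>:{0<..<t}|lborel. div_op (B \<tau>) (v \<tau>)) = (LINT \<tau>:{0<..<t}|lborel. F \<tau>)"
    using v unfolding is_solution_def by blast
  have iu: "set_integrable lborel {0<..<1} (\<lambda>\<tau>. div_op (B \<tau>) (u \<tau>))"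
    and iv: "set_integrable lborel {0<..<1} (\<lambda>\<tau>. div_op (B \<tau>) (v \<tau>))"
    using u v unfolding is_solution_def by blast+
  define I where "I = {0<..<1::real}"
  define w where "w = (\<lambda>t. indicator I t *\<^sub>R (u t - v t))"
  define G where "G = (\<lambda>t. indicator I t *\<^sub>R div_op (B t) (w t))"
  have wI: "w t = u t - v t" if "t \<in> I" for t using that by (simp add: w_def)
  have Geq: "G t = indicator I t *\<^sub>R div_op (B t) (u t) - indicator I t *\<^sub>R div_op (B t) (v t)" for t
  proof (cases "t \<in> I")
    case True
    then have t: "t \<in> {0..1}" by (simp add: I_def)
    show ?thesis using True div_op_diff[OF Bm[OF t] less_imp_le[OF \<Lambda>] B1[OF t], of "u t" "v t"] by (simp add: G_def wI)
  qed (simp add: G_def)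
  have G: "integrable lborel G"
    unfolding Geq[abs_def] using iu iv unfolding set_integrable_def I_def by (rule Bochner_Integration.integrable_diff)
  define r where "r = (\<lambda>t. riesz (G t))"
  have r: "integrable lborel r" unfolding r_def by (rule integrable_bounded_linear[OF bounded_linear_riesz G])
  have inr: "inner (r t) z = Re (antidual_apply (div_op (B t) (w t)) z)" if "t \<in> I" for t z
    using that by (simp add: r_def inner_riesz G_def)
  have G0: "G t = 0" "r t = 0" if "t \<notin> I" for t
    using that linear_0[OF bounded_linear.linear[OF bounded_linear_riesz]] by (simp_all add: r_def G_def)
  have nr: "norm (r t) \<le> \<Lambda> * norm (w t)" for t
  proof (cases "t \<in> I")
    case True
    then have t: "t \<in> {0..1}" by (simp add: I_def)
    have "norm (r t) * norm (r t) = Re (antidual_apply (G t) (r t))"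
      unfolding r_def by (simp only: inner_riesz[symmetric] power2_norm_eq_inner[symmetric] power2_eq_square)
    also have "\<dots> \<le> norm (G t) * norm (r t)"
      by (rule order_trans[OF complex_Re_le_cmod norm_antidual_apply])
    finally have "norm (r t) \<le> norm (G t)"
      using mult_right_le_imp_le[of "norm (r t)" "norm (r t)" "norm (G t)"] norm_ge_zero[of "G t"] by (cases "norm (r t) > 0") auto
    also have "\<dots> \<le> \<Lambda> * norm (w t)"
      using True div_op_bounds(3)[OF Bm[OF t] less_imp_le[OF \<Lambda>] B1[OF t], of "w t"] by (simp add: G_def)
    finally show ?thesis .
  qed (use \<Lambda> in \<open>simp add: G0\<close>)
  have wm: "w \<in> borel_measurable lborel" and wi: "integrable lborel (\<lambda>t. (norm (w t))\<^sup>2)"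
  proof -
    have m: "u \<in> borel_measurable I01" "v \<in> borel_measurable I01"
      and i: "integrable I01 (\<lambda>t. (norm (u t))\<^sup>2)" "integrable I01 (\<lambda>t. (norm (v t))\<^sup>2)"
      using u v by (auto simp: is_solution_def bochner_L2_def)
    have "(\<lambda>t. u t - v t) \<in> borel_measurable I01" using m by (rule borel_measurable_diff)
    then show wm: "w \<in> borel_measurable lborel" unfolding I01_measurable_iff w_def I_def .
    have "integrable lborel (\<lambda>t. 2 * (indicator I t *\<^sub>R (norm (u t))\<^sup>2) + 2 * (indicator I t *\<^sub>R (norm (v t))\<^sup>2))"
      using i unfolding I01_integrable_iff I_def by (intro Bochner_Integration.integrable_add integrable_mult_right)
    then show "integrable lborel (\<lambda>t. (norm (w t))\<^sup>2)"
    proof (rule Bochner_Integration.integrable_bound)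
      show "(\<lambda>t. (norm (w t))\<^sup>2) \<in> borel_measurable lborel" using wm by measurable
      have "(norm (a - b))\<^sup>2 \<le> 2 * (norm a)\<^sup>2 + 2 * (norm b)\<^sup>2" for a b :: "'n h1"
      proof -
        have "(norm (a - b))\<^sup>2 \<le> (norm a + norm b)\<^sup>2"
          by (intro power_mono norm_triangle_ineq4 norm_ge_zero)
        then show ?thesis using sum_squares_bound[of "norm a" "norm b"] by (simp add: power2_sum)
      qed
      then show "AE t in lborel. norm ((norm (w t))\<^sup>2) \<le> norm (2 * (indicator I t *\<^sub>R (norm (u t))\<^sup>2) + 2 * (indicator I t *\<^sub>R (norm (v t))\<^sup>2))"
        by (intro AE_I2) (auto simp: w_def indicator_def)
    qed
  qed
  define \<rho> where "\<rho> = (\<lambda>t. \<integral>s. indicator {..<t} s *\<^sub>R r s \<partial>lborel)"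
  have rho: "AE t in lborel. t \<in> I \<longrightarrow> \<rho> t = h1_gram (w t)"
    using U(1) V(1) unfolding I01_AE_iff
  proof eventually_elim
    fix t assume *: "t \<in> {0<..<1} \<longrightarrow> U t = l2_antidual (h1_l2 (u t))" "t \<in> {0<..<1} \<longrightarrow> V t = l2_antidual (h1_l2 (v t))"
    show "t \<in> I \<longrightarrow> \<rho> t = h1_gram (w t)"
    proof
      assume t: "t \<in> I"
      then have t': "t \<in> {0..1}" "t \<in> {0<..<1}" by (auto simp: I_def)
      have sub: "set_integrable lborel {0<..<t} f" if "set_integrable lborel {0<..<1} f" for f :: "real \<Rightarrow> 'n h1 antidual"
        by (rule set_integrable_subset[OF that]) (use t' in auto)
      have "\<rho> t = riesz (\<integral>s. indicator {..<t} s *\<^sub>R G s \<partial>lborel)"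
      proof -
        have i: "integrable lborel (\<lambda>s. indicator {..<t} s *\<^sub>R G s)" by (rule integrable_mult_indicator[OF _ G]) simp
        have "indicator {..<t} s *\<^sub>R r s = riesz (indicator {..<t} s *\<^sub>R G s)" for s
          unfolding r_def by (rule linear_cmul[OF bounded_linear.linear[OF bounded_linear_riesz], symmetric])
        then show ?thesis unfolding \<rho>_def by (simp only: integral_bounded_linear[OF bounded_linear_riesz i])
      qed
      also have "(\<integral>s. indicator {..<t} s *\<^sub>R G s \<partial>lborel)
          = (LINT \<tau>:{0<..<t}|lborel. div_op (B \<tau>) (u \<tau>) - div_op (B \<tau>) (v \<tau>))"
        unfolding set_lebesgue_integral_def Geq
        by (intro Bochner_Integration.integral_cong refl) (use t' in \<open>auto simp: indicator_def I_def\<close>)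
      also have "\<dots> = (LINT \<tau>:{0<..<t}|lborel. div_op (B \<tau>) (u \<tau>)) - (LINT \<tau>:{0<..<t}|lborel. div_op (B \<tau>) (v \<tau>))"
        by (rule set_integral_diff(2)[OF sub[OF iu] sub[OF iv]])
      also have "\<dots> = U t - V t" using U(2)[OF t'(1)] V(2)[OF t'(1)] by (simp add: algebra_simps)
      also have "\<dots> = l2_antidual (h1_l2 (u t - v t))"
        using * t'(2) linear_diff[OF bounded_linear.linear[OF bounded_linear_l2_antidual], of "h1_l2 (u t)" "h1_l2 (v t)"]
          linear_diff[OF bounded_linear.linear[OF bounded_linear_h1_l2], of "u t" "v t"] by simp
      finally show "\<rho> t = h1_gram (w t)" by (simp only: h1_gram_def wI[OF t])
    qed
  qed
  define K where "K = (\<lambda>x :: 'n h1. x - h1_gram x)"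
  note K = h1_gram_complement[OF K_def]
  \<comment> \<open>(r, S h1_gram w) for the Neumann sum S of length n\<close>
  define h where "h = (\<lambda>n t. inner (r t) (w t - (K ^^ n) (w t)))"
  have bn: "bounded_linear (K ^^ n)" for n
  proof (induction n)
    case (Suc n)
    show ?case unfolding funpow.simps o_def by (rule bounded_linear_compose[OF K(1) Suc])
  qed (simp add: id_def bounded_linear_ident)
  have h_nonneg: "0 \<le> (\<integral>t. h n t \<partial>lborel)" for n
  proof -
    define S where "S = (\<lambda>x. \<Sum>k<n. (K ^^ k) x)"
    have S: "bounded_linear S" unfolding S_def by (intro bounded_linear_sum bn)
    have Ssym: "inner (S x) y = inner x (S y)" for x y
      by (simp add: S_def inner_sum_left inner_sum_right inner_power_nonneg(1)[OF K(2,3)])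
    have Spos: "0 \<le> inner (S x) x" for x
      unfolding S_def inner_sum_left by (intro sum_nonneg inner_power_nonneg(2)[OF K(2,3)])
    have tel: "S (h1_gram x) = x - (K ^^ n) x" for x
    proof -
      have "(K ^^ k) (h1_gram x) = (K ^^ k) x - (K ^^ Suc k) x" for k
      proof -
        have "h1_gram x = x - K x" by (simp add: K_def)
        then show ?thesis using linear_diff[OF bounded_linear.linear[OF bn[of k]], of x "K x"] by (simp add: funpow_swap1)
      qed
      then show ?thesis unfolding S_def using sum_lessThan_telescope'[of "\<lambda>k. (K ^^ k) x" n] by simp
    qed
    have "0 \<le> 2 * (\<integral>t. inner (S (r t)) (\<rho> t) \<partial>lborel)"
      unfolding \<rho>_def inner_primitive_square[OF r S Ssym, symmetric] by (rule Spos)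
    also have "(\<integral>t. inner (S (r t)) (\<rho> t) \<partial>lborel) = (\<integral>t. h n t \<partial>lborel)"
    proof (rule Bochner_Integration.integral_cong_AE)
      have rm: "r \<in> borel_measurable lborel" using r by simp
      have Sm: "S \<in> borel_measurable borel" "(K ^^ n) \<in> borel_measurable borel"
        by (intro borel_measurable_continuous_onI bounded_linear.continuous_on[OF S] bounded_linear.continuous_on[OF bn] continuous_on_id)+
      have "(\<lambda>p. indicator {p :: real \<times> real. snd p < fst p} p *\<^sub>R r (snd p)) \<in> borel_measurable (lborel \<Otimes>\<^sub>M lborel)"
      proof (intro borel_measurable_scaleR borel_measurable_indicator)
        have "{p \<in> space (lborel \<Otimes>\<^sub>M (lborel :: real measure)). snd p < fst p} \<in> sets (lborel \<Otimes>\<^sub>M lborel)" by measurable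
        then show "{p :: real \<times> real. snd p < fst p} \<in> sets (lborel \<Otimes>\<^sub>M lborel)" by (simp add: space_pair_measure)
        show "(\<lambda>p. r (snd p)) \<in> borel_measurable (lborel \<Otimes>\<^sub>M lborel)" by (rule measurable_compose[OF measurable_snd rm])
      qed
      then have "(\<lambda>t. \<integral>s. indicator {p :: real \<times> real. snd p < fst p} (t, s) *\<^sub>R r (snd (t, s)) \<partial>lborel) \<in> borel_measurable lborel"
        by (intro sigma_finite_measure.borel_measurable_lebesgue_integral[OF sigma_finite_lborel]) (simp add: case_prod_beta')
      moreover have "(\<lambda>t. \<integral>s. indicator {p :: real \<times> real. snd p < fst p} (t, s) *\<^sub>R r (snd (t, s)) \<partial>lborel) = \<rho>"
        by (simp add: \<rho>_def indicator_def)
      ultimately have rhom: "\<rho> \<in> borel_measurable lborel" by simp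
      show "(\<lambda>t. inner (S (r t)) (\<rho> t)) \<in> borel_measurable lborel"
        by (intro borel_measurable_inner measurable_compose[OF rm Sm(1)] rhom)
      show "h n \<in> borel_measurable lborel"
        unfolding h_def by (intro borel_measurable_inner rm borel_measurable_diff wm measurable_compose[OF wm Sm(2)])
      show "AE t in lborel. inner (S (r t)) (\<rho> t) = h n t"
        using rho
      proof eventually_elim
        fix t assume t: "t \<in> I \<longrightarrow> \<rho> t = h1_gram (w t)"
        show "inner (S (r t)) (\<rho> t) = h n t"
          by (cases "t \<in> I") (simp_all add: t Ssym tel h_def G0)
      qed
    qed
    finally show ?thesis by simp
  qed
  define hl where "hl = (\<lambda>t. inner (r t) (w t))"
  have hlm: "hl \<in> borel_measurable lborel"
    unfolding hl_def using r by (intro borel_measurable_inner wm) simp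
  have h_bound: "\<bar>h n t\<bar> \<le> 2 * \<Lambda> * (norm (w t))\<^sup>2" "\<bar>hl t\<bar> \<le> 2 * \<Lambda> * (norm (w t))\<^sup>2" for n t
  proof -
    have "norm (w t - (K ^^ n) (w t)) \<le> norm (w t) + norm (w t)"
      using norm_triangle_ineq4[of "w t" "(K ^^ n) (w t)"] selfadjoint_powers_contract[OF K(1-4), of n "w t"] by linarith
    then have "\<bar>h n t\<bar> \<le> (\<Lambda> * norm (w t)) * (norm (w t) + norm (w t))"
      unfolding h_def using nr[of t] \<Lambda> by (intro order_trans[OF Cauchy_Schwarz_ineq2 mult_mono]) auto
    then show "\<bar>h n t\<bar> \<le> 2 * \<Lambda> * (norm (w t))\<^sup>2" by (simp add: power2_eq_square algebra_simps)
    have "\<bar>hl t\<bar> \<le> (\<Lambda> * norm (w t)) * norm (w t)"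
      unfolding hl_def using nr[of t] \<Lambda> by (intro order_trans[OF Cauchy_Schwarz_ineq2 mult_mono]) auto
    also have "\<dots> \<le> 2 * \<Lambda> * (norm (w t))\<^sup>2" using \<Lambda> by (simp add: power2_eq_square)
    finally show "\<bar>hl t\<bar> \<le> 2 * \<Lambda> * (norm (w t))\<^sup>2" .
  qed
  have dom: "integrable lborel (\<lambda>t. 2 * \<Lambda> * (norm (w t))\<^sup>2)" using wi by simp
  have hli: "integrable lborel hl"
    by (rule Bochner_Integration.integrable_bound[OF dom hlm]) (use h_bound(2) \<Lambda> in \<open>auto simp: abs_mult\<close>)
  have "(\<lambda>n. \<integral>t. h n t \<partial>lborel) \<longlonglongrightarrow> (\<integral>t. hl t \<partial>lborel)"
  proof (rule integral_dominated_convergence[OF hlm _ dom])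
    show "h n \<in> borel_measurable lborel" for n
    proof -
      have Sm: "(K ^^ n) \<in> borel_measurable borel"
        by (intro borel_measurable_continuous_onI bounded_linear.continuous_on[OF bn] continuous_on_id)
      show ?thesis unfolding h_def using r
        by (intro borel_measurable_inner borel_measurable_diff wm measurable_compose[OF wm Sm]) simp
    qed
    have "(\<lambda>n. h n t) \<longlonglongrightarrow> inner (r t) (w t - 0)" for t
      unfolding h_def by (intro tendsto_intros K(5))
    then show "AE t in lborel. (\<lambda>n. h n t) \<longlonglongrightarrow> hl t" by (simp add: hl_def)
    show "AE t in lborel. norm (h n t) \<le> 2 * \<Lambda> * (norm (w t))\<^sup>2" for n using h_bound(1) by simp
  qed
  then have lim: "0 \<le> (\<integral>t. hl t \<partial>lborel)" by (rule LIMSEQ_le_const) (use h_nonneg in auto)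
  have hl_le: "hl t \<le> - (\<mu> * (norm (snd (Rep_h1 (w t))))\<^sup>2)" if t: "t \<in> I" for t
  proof -
    have t': "t \<in> {0..1}" using t by (simp add: I_def)
    note i = div_op_bounds(1)[OF Bm[OF t'] less_imp_le[OF \<Lambda>] B1[OF t']]
    have "\<mu> * (norm (snd (Rep_h1 (w t))))\<^sup>2 = (\<integral>x. \<mu> * (norm (h1_grad (w t) x))\<^sup>2 \<partial>lborel)"
      by (simp add: norm_grad_sq(2))
    also have "\<dots> \<le> (\<integral>x. Re (cdot (B t x *v h1_grad (w t) x) (h1_grad (w t) x)) \<partial>lborel)"
      by (intro integral_mono integrable_mult_right norm_grad_sq(1) integrable_Re i B2 t')
    also have "\<dots> = - hl t"
      unfolding hl_def inr[OF t] antidual_apply_div_op[OF Bm[OF t'] B1[OF t']]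
      by (simp add: integral_Re[OF i])
    finally show ?thesis by linarith
  qed
  have hl_nonpos: "hl t \<le> 0" for t
  proof (cases "t \<in> I")
    case True
    have "0 \<le> \<mu> * (norm (snd (Rep_h1 (w t))))\<^sup>2" using \<mu> by simp
    then show ?thesis using hl_le[OF True] by linarith
  qed (simp add: hl_def G0)
  have "(\<integral>t. - hl t \<partial>lborel) = 0"
  proof -
    have "0 \<le> (\<integral>t. - hl t \<partial>lborel)" by (rule integral_nonneg_AE) (use hl_nonpos in simp)
    then show ?thesis using lim by simp
  qed
  then have "AE t in lborel. - hl t = 0"
    by (subst (asm) integral_nonneg_eq_0_iff_AE) (use hli hl_nonpos in auto)
  then have AEG: "AE t in lborel. r t = 0"
  proof eventually_elim
    fix t assume z: "- hl t = 0"
    show "r t = 0"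
    proof (cases "t \<in> I")
      case True
      then have t': "t \<in> {0..1}" by (simp add: I_def)
      have "\<mu> * (norm (snd (Rep_h1 (w t))))\<^sup>2 \<le> 0" using hl_le[OF True] z by linarith
      then have g0: "norm (snd (Rep_h1 (w t))) = 0" using \<mu> by (simp add: mult_le_0_iff)
      have "cmod (antidual_apply (div_op (B t) (w t)) z) \<le> 0" for z
        using div_op_bounds(2)[OF Bm[OF t'] less_imp_le[OF \<Lambda>] B1[OF t'], of "w t" z] unfolding g0 by simp
      then have "inner (r t) (r t) = 0" unfolding inr[OF True] by simp
      then show ?thesis by simp
    qed (rule G0)
  qed
  have rho0: "\<rho> t = 0" for t
    unfolding \<rho>_def by (rule integral_eq_zero_AE) (use AEG in eventually_elim, simp)
  show ?thesis unfolding I01_AE_iff using rho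
  proof eventually_elim
    fix t assume t: "t \<in> I \<longrightarrow> \<rho> t = h1_gram (w t)"
    show "t \<in> {0<..<1} \<longrightarrow> v t = u t"
    proof
      assume "t \<in> {0<..<1}"
      then have tI: "t \<in> I" by (simp add: I_def)
      then have "h1_gram (w t) = 0" using t rho0 by simp
      then have "inner (h1_l2 (w t)) (h1_l2 (w t)) = 0" unfolding inner_h1_gram[symmetric] by simp
      then have "w t = 0" by (intro h1_l2_eq_0_imp) simp
      then show "v t = u t" using wI[OF tI] by simp
    qed
  qed
qed

section \<open>Calculus for Hilbert-space valued functions of time\<close>

text \<open>
Only real-valued functions are integrated here: an injective bounded map into an inner product space
separates points by real functionals.  For the antidual of H1 this map is the Riesz map.
\<close>

lemma bochner_FTC:
  fixes F f :: "real \<Rightarrow> 'b::{banach, second_countable_topology}" and J :: "'b \<Rightarrow> 'h::real_inner"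
  assumes J: "bounded_linear J" "\<And>x. J x = 0 \<Longrightarrow> x = 0" and ab: "a \<le> b"
    and d: "\<And>t. t \<in> {a..b} \<Longrightarrow> (F has_vector_derivative f t) (at t)" and c: "continuous_on {a..b} f"
  shows "integrable lborel (\<lambda>t. indicator {a..b} t *\<^sub>R f t)"
    and "(\<integral>t. indicator {a..b} t *\<^sub>R f t \<partial>lborel) = F b - F a"
proof -
  show i: "integrable lborel (\<lambda>t. indicator {a..b} t *\<^sub>R f t)"
    by (rule borel_integrable_compact[OF compact_Icc c])
  interpret J: bounded_linear J by (rule J(1))
  define z where "z = (\<integral>t. indicator {a..b} t *\<^sub>R f t \<partial>lborel) - (F b - F a)"
  have "inner (J z) w = 0" for w
  proof -
    have bl: "bounded_linear (\<lambda>x. inner (J x) w)"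
      by (rule bounded_linear_compose[OF bounded_linear_inner_left J(1)])
    have "inner (J (\<integral>t. indicator {a..b} t *\<^sub>R f t \<partial>lborel)) w = (\<integral>t. inner (J (indicator {a..b} t *\<^sub>R f t)) w \<partial>lborel)"
      by (rule integral_bounded_linear[OF bl i, symmetric])
    also have "\<dots> = (\<integral>t. indicator {a..b} t *\<^sub>R inner (J (f t)) w \<partial>lborel)"
      by (simp add: J.scaleR)
    also have "\<dots> = inner (J (F b)) w - inner (J (F a)) w"
    proof (rule integral_FTC_atLeastAtMost[OF ab])
      fix t assume t: "a \<le> t" "t \<le> b"
      have "((\<lambda>t. inner (J (F t)) w) has_vector_derivative inner (J (f t)) w) (at t)"
        by (rule bounded_linear.has_vector_derivative[OF bl]) (use d t in auto)
      then show "((\<lambda>t. inner (J (F t)) w) has_vector_derivative inner (J (f t)) w) (at t within {a..b})"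
        by (rule has_vector_derivative_at_within)
    qed (rule bounded_linear.continuous_on[OF bl c])
    finally show ?thesis by (simp add: z_def J.diff inner_diff_left)
  qed
  then have "J z = 0" using inner_eq_zero_iff by blast
  then show "(\<integral>t. indicator {a..b} t *\<^sub>R f t \<partial>lborel) = F b - F a" using J(2)[of z] by (simp add: z_def)
qed

lemma test_function_01_support:
  assumes "test_function_01 \<phi>"
  obtains a b where "0 < a" "a < b" "b < 1" "\<And>t. t \<notin> {a..b} \<Longrightarrow> \<phi> t = 0" "\<And>t. t \<notin> {a..b} \<Longrightarrow> deriv \<phi> t = 0" "\<phi> a = 0" "\<phi> b = 0"
proof -
  let ?K = "closure {t. \<phi> t \<noteq> 0}"
  have K: "compact ?K" "?K \<subseteq> {0<..<1}" using assms by (auto simp: test_function_01_def)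
  have "\<exists>a b. 0 < a \<and> a < b \<and> b < 1 \<and> ?K \<subseteq> {a<..<b}"
  proof (cases "?K = {}")
    case True then show ?thesis by (intro exI[of _ "1/3"] exI[of _ "2/3"]) simp
  next
    case False
    obtain m where m: "m \<in> ?K" "\<And>t. t \<in> ?K \<Longrightarrow> m \<le> t" using compact_attains_inf[OF K(1) False] by blast
    obtain M where M: "M \<in> ?K" "\<And>t. t \<in> ?K \<Longrightarrow> t \<le> M" using compact_attains_sup[OF K(1) False] by blast
    have "0 < m" "M < 1" "m \<le> M" using m M K(2) by auto
    then have "0 < m / 2" "m / 2 < (M + 1) / 2" "(M + 1) / 2 < 1" "?K \<subseteq> {m / 2<..<(M + 1) / 2}"
      using m(2) M(2) by (auto simp: less_le_trans le_less_trans) (smt (verit) field_sum_of_halves)+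
    then show ?thesis by blast
  qed
  then obtain a b where ab: "0 < a" "a < b" "b < 1" "?K \<subseteq> {a<..<b}" by blast
  have z: "\<phi> t = 0" if "t \<notin> {a<..<b}" for t using that ab(4) closure_subset[of "{t. \<phi> t \<noteq> 0}"] by blast
  have "deriv \<phi> t = 0" if t: "t \<notin> {a..b}" for t
  proof -
    have "((\<lambda>t. 0 :: real) has_real_derivative 0) (at t)" by (rule DERIV_const)
    then have "(\<phi> has_real_derivative 0) (at t)"
      by (rule has_field_derivative_transform_within_open[where S = "- {a..b}"]) (use t z in \<open>auto simp: open_Compl\<close>)
    then show ?thesis by (rule DERIV_imp_deriv)
  qed
  moreover have "\<phi> t = 0" if "t \<notin> {a..b}" for t by (rule z) (use that in auto)
  moreover have "\<phi> a = 0" "\<phi> b = 0" by (rule z, simp)+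
  ultimately show ?thesis using that[of a b] ab(1-3) by blast
qed

lemma test_function_01_deriv:
  assumes "test_function_01 \<phi>"
  shows "(\<phi> has_real_derivative deriv \<phi> t) (at t)" "isCont \<phi> t" "isCont (deriv \<phi>) t"
proof -
  have d: "(deriv ^^ k) \<phi> field_differentiable (at t)" for k using assms by (simp add: test_function_01_def)
  show 1: "(\<phi> has_real_derivative deriv \<phi> t) (at t)" using d[of 0] by (simp add: DERIV_deriv_iff_field_differentiable)
  show "isCont \<phi> t" using d[of 0] by (simp add: field_differentiable_imp_continuous_at)
  show "isCont (deriv \<phi>) t" using d[of 1] by (simp add: field_differentiable_imp_continuous_at)
qed

lemma integral_I01:
  fixes f :: "real \<Rightarrow> 'b::{banach, second_countable_topology}"
  shows "(\<integral>t. f t \<partial>I01) = (\<integral>t. indicator {0<..<1} t *\<^sub>R f t \<partial>lborel)"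
  by (rule integral_restrict_space) simp

lemma classical_weak_derivative:
  fixes u u' :: "real \<Rightarrow> 'b::{banach, second_countable_topology}" and J :: "'b \<Rightarrow> 'h::real_inner"
  assumes J: "bounded_linear J" "\<And>x. J x = 0 \<Longrightarrow> x = 0"
    and d: "\<And>t. t \<in> {0<..<1} \<Longrightarrow> (u has_vector_derivative u' t) (at t)" and c: "continuous_on {0<..<1} u'"
    and \<phi>: "test_function_01 \<phi>"
  shows "(\<integral>t. deriv \<phi> t *\<^sub>R u t \<partial>I01) = - (\<integral>t. \<phi> t *\<^sub>R u' t \<partial>I01)"
proof -
  obtain a b where ab: "0 < a" "a < b" "b < 1" and z: "\<And>t. t \<notin> {a..b} \<Longrightarrow> \<phi> t = 0" "\<And>t. t \<notin> {a..b} \<Longrightarrow> deriv \<phi> t = 0" "\<phi> a = 0" "\<phi> b = 0"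
    using test_function_01_support[OF \<phi>] by blast
  note p = test_function_01_deriv[OF \<phi>]
  have sub: "{a..b} \<subseteq> {0<..<1}" using ab by auto
  have cu: "continuous_on {a..b} u"
    by (intro continuous_at_imp_continuous_on ballI has_vector_derivative_continuous[OF d]) (use ab in auto)
  have cu': "continuous_on {a..b} u'" by (rule continuous_on_subset[OF c sub])
  have c1: "continuous_on {a..b} (\<lambda>t. deriv \<phi> t *\<^sub>R u t)" and c2: "continuous_on {a..b} (\<lambda>t. \<phi> t *\<^sub>R u' t)"
    by (intro continuous_on_scaleR continuous_at_imp_continuous_on ballI p cu cu')+
  have i1: "integrable lborel (\<lambda>t. indicator {a..b} t *\<^sub>R (deriv \<phi> t *\<^sub>R u t))"
    and i2: "integrable lborel (\<lambda>t. indicator {a..b} t *\<^sub>R (\<phi> t *\<^sub>R u' t))"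
    by (rule borel_integrable_compact[OF compact_Icc c1], rule borel_integrable_compact[OF compact_Icc c2])
  have "(\<integral>t. indicator {a..b} t *\<^sub>R (\<phi> t *\<^sub>R u' t + deriv \<phi> t *\<^sub>R u t) \<partial>lborel) = \<phi> b *\<^sub>R u b - \<phi> a *\<^sub>R u a"
  proof (rule bochner_FTC(2)[OF J(1) _ less_imp_le[OF ab(2)]])
    show "\<And>x. J x = 0 \<Longrightarrow> x = 0" by (rule J(2))
    show "continuous_on {a..b} (\<lambda>t. \<phi> t *\<^sub>R u' t + deriv \<phi> t *\<^sub>R u t)" by (intro continuous_on_add c1 c2)
    show "((\<lambda>t. \<phi> t *\<^sub>R u t) has_vector_derivative \<phi> t *\<^sub>R u' t + deriv \<phi> t *\<^sub>R u t) (at t)" if "t \<in> {a..b}" for t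
      by (rule has_vector_derivative_scaleR[OF p(1) d]) (use that sub in auto)
  qed
  then have "(\<integral>t. indicator {a..b} t *\<^sub>R (\<phi> t *\<^sub>R u' t) \<partial>lborel) + (\<integral>t. indicator {a..b} t *\<^sub>R (deriv \<phi> t *\<^sub>R u t) \<partial>lborel) = 0"
    by (simp only: scaleR_add_right Bochner_Integration.integral_add[OF i2 i1] z scaleR_zero_left diff_self)
  moreover have "(\<integral>t. deriv \<phi> t *\<^sub>R u t \<partial>I01) = (\<integral>t. indicator {a..b} t *\<^sub>R (deriv \<phi> t *\<^sub>R u t) \<partial>lborel)"
    unfolding integral_I01 by (intro Bochner_Integration.integral_cong refl) (use sub z in \<open>auto simp: indicator_def\<close>)
  moreover have "(\<integral>t. \<phi> t *\<^sub>R u' t \<partial>I01) = (\<integral>t. indicator {a..b} t *\<^sub>R (\<phi> t *\<^sub>R u' t) \<partial>lborel)"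
    unfolding integral_I01 by (intro Bochner_Integration.integral_cong refl) (use sub z in \<open>auto simp: indicator_def\<close>)
  ultimately show ?thesis by (simp add: eq_neg_iff_add_eq_0 add.commute)
qed

lemma bochner_L2_integrable:
  assumes "v \<in> bochner_L2 I01"
  shows "integrable lborel (\<lambda>t. indicator {0<..<1} t *\<^sub>R v t)"
    and "integrable lborel (\<lambda>t. indicator {0<..<1} t *\<^sub>R (norm (v t))\<^sup>2)"
proof -
  have m: "(\<lambda>t. indicator {0<..<1} t *\<^sub>R v t) \<in> borel_measurable lborel"
    using assms unfolding I01_measurable_iff[symmetric] by (simp add: bochner_L2_def)
  show i: "integrable lborel (\<lambda>t. indicator {0<..<1} t *\<^sub>R (norm (v t))\<^sup>2)"
    using assms unfolding I01_integrable_iff[symmetric] by (simp add: bochner_L2_def)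
  have i1: "integrable lborel (\<lambda>t. indicator {0<..<1::real} t + indicator {0<..<1} t *\<^sub>R (norm (v t))\<^sup>2 :: real)"
    using i by (intro Bochner_Integration.integrable_add integrable_real_indicator) auto
  show "integrable lborel (\<lambda>t. indicator {0<..<1} t *\<^sub>R v t)"
  proof (rule Bochner_Integration.integrable_bound[OF i1 m])
    have "x \<le> 1 + x\<^sup>2" for x :: real using sum_squares_bound[of x 1] by (cases "x \<ge> 0") (auto simp: add_nonneg_nonneg intro: order_trans[of x 0])
    then show "AE t in lborel. norm (indicator {0<..<1} t *\<^sub>R v t) \<le> norm (indicator {0<..<1} t + indicator {0<..<1} t *\<^sub>R (norm (v t))\<^sup>2)"
      by (intro AE_I2) (auto simp: indicator_def)
  qed
qed

text \<open>
The weak derivative v agrees with the classical one in the sense of integrals over subintervals, which is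
seen with test functions increasing to the indicator of (s,t).  So u(t) - u(s) is the integral of v over
(s,t), and Cauchy-Schwarz gives the square root.
\<close>

lemma sobolev_H1_Hoelder:
  fixes u u' :: "real \<Rightarrow> 'b::chilbert"
  assumes H: "u \<in> sobolev_H1"
    and d: "\<And>t. t \<in> {0<..<1} \<Longrightarrow> (u has_vector_derivative u' t) (at t)" and c: "continuous_on {0<..<1} u'"
  shows "\<exists>C. \<forall>s\<in>{0<..<1}. \<forall>t\<in>{0<..<1}. s < t \<longrightarrow> norm (u t - u s) \<le> C * sqrt (t - s)"
proof -
  obtain v where v: "v \<in> bochner_L2 I01"
    "\<And>\<phi>. test_function_01 \<phi> \<Longrightarrow> (\<integral>t. deriv \<phi> t *\<^sub>R u t \<partial>I01) = - (\<integral>t. \<phi> t *\<^sub>R v t \<partial>I01)"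
    using H unfolding sobolev_H1_def by blast
  note vi = bochner_L2_integrable[OF v(1)]
  define V where "V = (\<integral>t. indicator {0<..<1} t *\<^sub>R (norm (v t))\<^sup>2 \<partial>lborel)"
  have "norm (u b - u a) \<le> (1 / 2 + V / 2) * sqrt (b - a)" if ab: "0 < a" "b < 1" "a < b" for a b
  proof -
    have sub: "{a..b} \<subseteq> {0<..<1}" using ab by auto
    define bump where "bump = (\<lambda>n t. exp_inv (real n * (t - a)) * exp_inv (real n * (b - t)))"
    have b0: "bump n t = 0" if "t \<notin> {a..b}" for n t
      using that by (auto simp: bump_def exp_inv_def zero_less_mult_iff)
    have b1: "0 \<le> bump n t" "bump n t \<le> 1" for n t
      unfolding bump_def using exp_inv_le_1(1,2) by (auto intro!: mult_le_one)
    have blim: "(\<lambda>n. bump n t) \<longlonglongrightarrow> (if t - a > 0 then 1 else 0) * (if b - t > 0 then 1 else 0)" for t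
      unfolding bump_def by (intro tendsto_mult exp_inv_scaled_tendsto)
    have bs: "smooth_on UNIV (bump n)" for n
      unfolding bump_def
      by (intro smooth_on_intros(4) smooth_on_compose[OF smooth_exp_inv] smooth_on_intros(1,2) smooth_on_diff) auto
    have bm: "bump n \<in> borel_measurable lborel" for n
      using smooth_on_continuous[OF bs[of n] open_UNIV] by (simp add: borel_measurable_continuous_onI)
    have bt: "test_function_01 (bump n)" for n
      unfolding test_function_01_def
    proof (intro conjI allI smooth_on_field_differentiable bs)
      have cl: "closure {t. bump n t \<noteq> 0} \<subseteq> {a..b}"
        by (rule closure_minimal[OF _ closed_real_atLeastAtMost]) (use b0 in blast)
      then show "closure {t. bump n t \<noteq> 0} \<subseteq> {0<..<1}" using sub by blast
      show "compact (closure {t. bump n t \<noteq> 0})"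
        using compact_Int_closed[OF compact_Icc closed_closure, of a b "{t. bump n t \<noteq> 0}"] cl by (simp add: Int_absorb1)
    qed
    have lim: "(\<lambda>n. \<integral>t. bump n t *\<^sub>R f t \<partial>I01) \<longlonglongrightarrow> (\<integral>t. indicator {a<..<b} t *\<^sub>R f t \<partial>lborel)"
      if f: "integrable lborel (\<lambda>t. indicator {a..b} t *\<^sub>R f t)" for f :: "real \<Rightarrow> 'b"
    proof -
      have "(\<integral>t. bump n t *\<^sub>R f t \<partial>I01) = (\<integral>t. bump n t *\<^sub>R (indicator {a..b} t *\<^sub>R f t) \<partial>lborel)" for n
        unfolding integral_I01 by (intro Bochner_Integration.integral_cong refl) (use sub b0 in \<open>auto simp: indicator_def\<close>)
      moreover have "(\<lambda>n. \<integral>t. bump n t *\<^sub>R (indicator {a..b} t *\<^sub>R f t) \<partial>lborel) \<longlonglongrightarrow> (\<integral>t. indicator {a<..<b} t *\<^sub>R f t \<partial>lborel)"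
      proof (rule integral_dominated_convergence[where w = "\<lambda>t. norm (indicator {a..b} t *\<^sub>R f t)"])
        have e: "indicator {a<..<b} t *\<^sub>R f t = indicator {a<..<b} t *\<^sub>R (indicator {a..b} t *\<^sub>R f t)" for t
          by (simp add: indicator_def)
        show "(\<lambda>t. indicator {a<..<b} t *\<^sub>R f t) \<in> borel_measurable lborel"
          unfolding e by (rule borel_measurable_integrable[OF integrable_mult_indicator[OF _ f]]) simp
        show "(\<lambda>t. bump n t *\<^sub>R (indicator {a..b} t *\<^sub>R f t)) \<in> borel_measurable lborel" for n
          by (intro borel_measurable_scaleR bm borel_measurable_integrable[OF f])
        have "(\<lambda>n. bump n t *\<^sub>R (indicator {a..b} t *\<^sub>R f t)) \<longlonglongrightarrow> ((if t - a > 0 then 1 else 0) * (if b - t > 0 then 1 else 0)) *\<^sub>R (indicator {a..b} t *\<^sub>R f t)" for t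
          by (intro tendsto_scaleR blim tendsto_const)
        then show "AE t in lborel. (\<lambda>n. bump n t *\<^sub>R (indicator {a..b} t *\<^sub>R f t)) \<longlonglongrightarrow> indicator {a<..<b} t *\<^sub>R f t"
        proof (intro AE_I2)
          fix t
          have "((if t - a > 0 then 1 else 0) * (if b - t > 0 then 1 else 0)) *\<^sub>R (indicator {a..b} t *\<^sub>R f t) = indicator {a<..<b} t *\<^sub>R f t"
            by (auto simp: indicator_def)
          then show "(\<lambda>n. bump n t *\<^sub>R (indicator {a..b} t *\<^sub>R f t)) \<longlonglongrightarrow> indicator {a<..<b} t *\<^sub>R f t"
            using \<open>\<And>t. (\<lambda>n. bump n t *\<^sub>R (indicator {a..b} t *\<^sub>R f t)) \<longlonglongrightarrow> ((if t - a > 0 then 1 else 0) * (if b - t > 0 then 1 else 0)) *\<^sub>R (indicator {a..b} t *\<^sub>R f t)\<close>[of t] by (simp only:)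
        qed
        show "AE t in lborel. norm (bump n t *\<^sub>R (indicator {a..b} t *\<^sub>R f t)) \<le> norm (indicator {a..b} t *\<^sub>R f t)" for n
        proof (intro AE_I2)
          fix t
          have "\<bar>bump n t\<bar> * norm (indicator {a..b} t *\<^sub>R f t) \<le> 1 * norm (indicator {a..b} t *\<^sub>R f t)"
            using b1[of n t] by (intro mult_right_mono) auto
          then show "norm (bump n t *\<^sub>R (indicator {a..b} t *\<^sub>R f t)) \<le> norm (indicator {a..b} t *\<^sub>R f t)"
            by (simp only: norm_scaleR[of "bump n t"] mult_1_left)
        qed
      qed (intro integrable_norm f)
      ultimately show ?thesis by simp
    qed
    have "u b - u a = (\<integral>t. indicator {a..b} t *\<^sub>R u' t \<partial>lborel)"
      by (rule bochner_FTC(2)[OF bounded_linear_ident _ _ d continuous_on_subset[OF c sub], symmetric]) (use ab sub in auto)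
    also have "\<dots> = (\<integral>t. indicator {a<..<b} t *\<^sub>R u' t \<partial>lborel)"
    proof (rule integral_cong_AE)
      have i: "integrable lborel (\<lambda>t. indicator {a..b} t *\<^sub>R u' t)"
        by (rule borel_integrable_compact[OF compact_Icc continuous_on_subset[OF c sub]])
      then show "(\<lambda>t. indicator {a..b} t *\<^sub>R u' t) \<in> borel_measurable lborel" by simp
      have e: "indicator {a<..<b} t *\<^sub>R u' t = indicator {a<..<b} t *\<^sub>R (indicator {a..b} t *\<^sub>R u' t)" for t
        by (simp add: indicator_def)
      show "(\<lambda>t. indicator {a<..<b} t *\<^sub>R u' t) \<in> borel_measurable lborel"
        unfolding e by (rule borel_measurable_integrable[OF integrable_mult_indicator[OF _ i]]) simp
      show "AE t in lborel. indicator {a..b} t *\<^sub>R u' t = indicator {a<..<b} t *\<^sub>R u' t"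
        using AE_lborel_singleton[of a] AE_lborel_singleton[of b] by eventually_elim (auto simp: indicator_def)
    qed
    also have "\<dots> = (\<integral>t. indicator {a<..<b} t *\<^sub>R v t \<partial>lborel)"
    proof (rule LIMSEQ_unique)
      show "(\<lambda>n. \<integral>t. bump n t *\<^sub>R u' t \<partial>I01) \<longlonglongrightarrow> (\<integral>t. indicator {a<..<b} t *\<^sub>R u' t \<partial>lborel)"
        by (intro lim borel_integrable_compact compact_Icc continuous_on_subset[OF c sub])
      have "integrable lborel (\<lambda>t. indicator {a..b} t *\<^sub>R (indicator {0<..<1} t *\<^sub>R v t))"
        by (rule integrable_mult_indicator[OF _ vi(1)]) simp
      moreover have "indicator {a..b} t *\<^sub>R (indicator {0<..<1} t *\<^sub>R v t) = indicator {a..b} t *\<^sub>R v t" for t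
        using ab by (auto simp: indicator_def)
      ultimately have "(\<lambda>n. \<integral>t. bump n t *\<^sub>R v t \<partial>I01) \<longlonglongrightarrow> (\<integral>t. indicator {a<..<b} t *\<^sub>R v t \<partial>lborel)"
        by (intro lim) (simp only:)
      moreover have "(\<integral>t. bump n t *\<^sub>R v t \<partial>I01) = (\<integral>t. bump n t *\<^sub>R u' t \<partial>I01)" for n
        using v(2)[OF bt[of n]] classical_weak_derivative[OF bounded_linear_ident _ d c bt[of n]] by simp
      ultimately show "(\<lambda>n. \<integral>t. bump n t *\<^sub>R u' t \<partial>I01) \<longlonglongrightarrow> (\<integral>t. indicator {a<..<b} t *\<^sub>R v t \<partial>lborel)" by simp
    qed
    finally have eq: "u b - u a = (\<integral>t. indicator {a<..<b} t *\<^sub>R v t \<partial>lborel)" .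
    define q where "q = sqrt (b - a)"
    have q: "q > 0" "q * q = b - a" using ab by (simp_all add: q_def)
    have "norm (u b - u a) \<le> (\<integral>t. norm (indicator {a<..<b} t *\<^sub>R v t) \<partial>lborel)"
      unfolding eq by (rule integral_norm_bound)
    also have "\<dots> \<le> (\<integral>t. (1 / (2 * q)) * indicator {a<..<b} t + (q / 2) * (indicator {0<..<1} t *\<^sub>R (norm (v t))\<^sup>2) \<partial>lborel)"
    proof (rule integral_mono_AE)
      have "integrable lborel (\<lambda>t. indicator {a<..<b} t *\<^sub>R (indicator {0<..<1} t *\<^sub>R v t))"
        by (rule integrable_mult_indicator[OF _ vi(1)]) simp
      moreover have "indicator {a<..<b} t *\<^sub>R (indicator {0<..<1} t *\<^sub>R v t) = indicator {a<..<b} t *\<^sub>R v t" for t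
        using ab by (auto simp: indicator_def)
      ultimately show "integrable lborel (\<lambda>t. norm (indicator {a<..<b} t *\<^sub>R v t))" by (intro integrable_norm) (simp only:)
      show "integrable lborel (\<lambda>t. (1 / (2 * q)) * indicator {a<..<b} t + (q / 2) * (indicator {0<..<1} t *\<^sub>R (norm (v t))\<^sup>2))"
        using vi(2) ab by (intro Bochner_Integration.integrable_add integrable_mult_right integrable_real_indicator) auto
      \<comment> \<open>the Cauchy-Schwarz inequality for the integral, in the form of Young's inequality with weight q\<close>
      have "x \<le> 1 / (2 * q) + (q / 2) * x\<^sup>2" for x :: real
      proof -
        have "0 \<le> (q * x - 1)\<^sup>2 / (2 * q)" using q by simp
        also have "\<dots> = 1 / (2 * q) + (q / 2) * x\<^sup>2 - x" using q(1) by (simp add: power2_eq_square field_simps)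
        finally show ?thesis by simp
      qed
      moreover have "0 \<le> (q / 2) * x\<^sup>2" for x using q by simp
      ultimately show "AE t in lborel. norm (indicator {a<..<b} t *\<^sub>R v t) \<le> (1 / (2 * q)) * indicator {a<..<b} t + (q / 2) * (indicator {0<..<1} t *\<^sub>R (norm (v t))\<^sup>2)"
        using ab by (intro AE_I2) (auto simp: indicator_def)
    qed
    also have "\<dots> = (1 / (2 * q)) * (q * q) + (q / 2) * V"
      using vi(2) ab unfolding q(2) V_def by (subst Bochner_Integration.integral_add) auto
    also have "\<dots> = (1 / 2 + V / 2) * sqrt (b - a)" using q(1) by (simp add: q_def[symmetric] field_simps)
    finally show ?thesis .
  qed
  then show ?thesis by (intro exI[of _ "1 / 2 + V / 2"]) auto
qed

section \<open>Gaussian test functions\<close>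

lemma scaleC_diff_left: "(a - b) *\<^sub>C x = a *\<^sub>C x - b *\<^sub>C (x :: 'a::chilbert)"
  using scaleC_add_left[of "a - b" b x] by (simp add: algebra_simps)

lemma bounded_linear_scaleC_right: "bounded_linear (\<lambda>x :: 'a::chilbert. c *\<^sub>C x)"
  by (rule bounded_linear_intro[of _ "cmod c"]) (simp_all add: scaleC_add_right scaleC_scaleR norm_scaleC mult.commute)

lemma scaleC_Re_Im: "c *\<^sub>C x = Re c *\<^sub>R x + Im c *\<^sub>R (\<i> *\<^sub>C (x :: 'a::chilbert))"
proof -
  have "c = complex_of_real (Re c) + complex_of_real (Im c) * \<i>" by (simp add: complex_eq_iff)
  then have "c *\<^sub>C x = (complex_of_real (Re c) + complex_of_real (Im c) * \<i>) *\<^sub>C x" by (rule arg_cong)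
  then show ?thesis by (simp only: scaleC_add_left scaleC_scaleC[symmetric] scaleC_of_real)
qed

lemma borel_measurable_scaleC:
  assumes "\<phi> \<in> borel_measurable M" "G \<in> borel_measurable M"
  shows "(\<lambda>\<xi>. \<phi> \<xi> *\<^sub>C (G \<xi> :: 'b::chilbert)) \<in> borel_measurable M"
proof -
  have "(\<lambda>x :: 'b. \<i> *\<^sub>C x) \<in> borel_measurable borel"
    by (intro borel_measurable_continuous_onI bounded_linear.continuous_on[OF bounded_linear_scaleC_right] continuous_on_id)
  from measurable_compose[OF assms(2) this] show ?thesis
    unfolding scaleC_Re_Im[of "\<phi> _"] using assms by measurable
qed

text \<open>
Polynomial times modulated Gaussian.  The polynomial factor is there only to make the class closed under
differentiation and multiplication by powers of the variable, which is what membership in the Schwartz class asks for.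
\<close>

definition gauss_wave :: "complex poly \<Rightarrow> real \<Rightarrow> real \<Rightarrow> real \<Rightarrow> complex" where
  "gauss_wave p a c \<xi> = poly p (complex_of_real \<xi>) * exp (\<i> * complex_of_real (a * \<xi>) - complex_of_real (c * \<xi>\<^sup>2))"

lemma gauss_wave_derivative:
  "(gauss_wave p a c has_vector_derivative gauss_wave (pderiv p + p * [:\<i> * complex_of_real a, - 2 * complex_of_real c:]) a c \<xi>) (at \<xi>)"
proof -
  let ?h = "\<lambda>z. poly p z * exp (\<i> * (complex_of_real a * z) - complex_of_real c * z\<^sup>2)"
  have "(?h has_field_derivative poly (pderiv p + p * [:\<i> * complex_of_real a, - 2 * complex_of_real c:]) z
      * exp (\<i> * (complex_of_real a * z) - complex_of_real c * z\<^sup>2)) (at z)" for z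
    by (auto intro!: derivative_eq_intros simp: algebra_simps)
  from has_vector_derivative_real_field[OF this[of "complex_of_real \<xi>"], of UNIV]
  show ?thesis by (simp add: gauss_wave_def[abs_def])
qed

lemma gauss_wave_bounded:
  assumes "c > 0" shows "bounded (range (gauss_wave p a c))"
proof -
  have m: "\<bar>\<xi>\<bar> ^ i * exp (- (c * \<xi>\<^sup>2)) \<le> exp ((real i)\<^sup>2 / (4 * c))" for i \<xi>
  proof -
    have "\<bar>\<xi>\<bar> \<le> exp \<bar>\<xi>\<bar>" using exp_ge_add_one_self[of "\<bar>\<xi>\<bar>"] by linarith
    then have "\<bar>\<xi>\<bar> ^ i \<le> exp \<bar>\<xi>\<bar> ^ i" by (intro power_mono) auto
    then have "\<bar>\<xi>\<bar> ^ i * exp (- (c * \<xi>\<^sup>2)) \<le> exp (real i * \<bar>\<xi>\<bar>) * exp (- (c * \<xi>\<^sup>2))"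
      by (simp add: exp_of_nat_mult)
    also have "\<dots> = exp (real i * \<bar>\<xi>\<bar> - c * \<xi>\<^sup>2)" by (simp add: exp_add[symmetric])
    also have "\<dots> \<le> exp ((real i)\<^sup>2 / (4 * c))"
    proof -
      have "0 \<le> (2 * c * \<bar>\<xi>\<bar> - real i)\<^sup>2 / (4 * c)" using assms by simp
      also have "\<dots> = (real i)\<^sup>2 / (4 * c) - (real i * \<bar>\<xi>\<bar> - c * \<xi>\<^sup>2)"
        using assms by (simp add: power2_eq_square field_simps abs_mult_self_eq)
      finally show ?thesis by simp
    qed
    finally show ?thesis .
  qed
  have "cmod (gauss_wave p a c \<xi>) \<le> (\<Sum>i\<le>degree p. cmod (coeff p i) * exp ((real i)\<^sup>2 / (4 * c)))" for \<xi>
  proof -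
    have "cmod (gauss_wave p a c \<xi>) = cmod (poly p (complex_of_real \<xi>)) * exp (- (c * \<xi>\<^sup>2))"
      by (simp add: gauss_wave_def norm_mult norm_exp_eq_Re power2_eq_square)
    also have "\<dots> \<le> (\<Sum>i\<le>degree p. cmod (coeff p i) * \<bar>\<xi>\<bar> ^ i) * exp (- (c * \<xi>\<^sup>2))"
      unfolding poly_altdef by (intro mult_right_mono order_trans[OF norm_sum]) (auto simp: norm_mult norm_power)
    also have "\<dots> = (\<Sum>i\<le>degree p. cmod (coeff p i) * (\<bar>\<xi>\<bar> ^ i * exp (- (c * \<xi>\<^sup>2))))"
      by (simp only: sum_distrib_right mult.assoc)
    also have "\<dots> \<le> (\<Sum>i\<le>degree p. cmod (coeff p i) * exp ((real i)\<^sup>2 / (4 * c)))"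
      by (intro sum_mono mult_left_mono m norm_ge_zero)
    finally show ?thesis .
  qed
  then show ?thesis unfolding bounded_iff by blast
qed

lemma schwartz_gauss_wave:
  assumes "c > 0" shows "schwartz (gauss_wave p a c)"
proof -
  have v: "vderiv (gauss_wave q a c) = gauss_wave (pderiv q + q * [:\<i> * complex_of_real a, - 2 * complex_of_real c:]) a c" for q
    unfolding vderiv_def[abs_def] by (intro ext vector_derivative_at gauss_wave_derivative)
  have it: "\<exists>q. (vderiv ^^ k) (gauss_wave p a c) = gauss_wave q a c" for k
    by (induction k) (auto simp: v)
  show ?thesis unfolding schwartz_def
  proof (intro conjI allI)
    fix j k t
    obtain q where q: "(vderiv ^^ k) (gauss_wave p a c) = gauss_wave q a c" using it by blast
    show "(vderiv ^^ k) (gauss_wave p a c) differentiable (at t)"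
      unfolding q using gauss_wave_derivative differentiableI_vector by blast
    have "(\<lambda>t. t ^ j *\<^sub>R gauss_wave q a c t) = gauss_wave (monom 1 j * q) a c"
      by (intro ext) (simp add: gauss_wave_def poly_monom scaleR_conv_of_real mult.assoc)
    then show "bounded (range (\<lambda>t. t ^ j *\<^sub>R (vderiv ^^ k) (gauss_wave p a c) t))"
      unfolding q by (simp only: gauss_wave_bounded[OF assms])
  qed
qed

text \<open>
The Fourier transform of a modulated Gaussian is the density of the normal distribution with mean t and
deviation e: it tests a function near the point t.
\<close>

lemma fourier_gauss_wave:
  assumes e: "e > 0"
  shows "fourier (gauss_wave [:1 / (2 * complex_of_real pi):] t (e\<^sup>2 / 2)) \<tau> = complex_of_real (normal_density t e \<tau>)"
proof -
  define y where "y = (t - \<tau>) / e"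
  have ch: "(\<integral>x. complex_of_real (std_normal_density x) * iexp (y * x) \<partial>lborel) = complex_of_real (exp (- (y\<^sup>2) / 2))"
  proof -
    have "char std_normal_distribution y = (\<integral>x. std_normal_density x *\<^sub>R iexp (y * x) \<partial>lborel)"
      unfolding char_def by (rule integral_density) auto
    then show ?thesis by (simp add: char_std_normal_distribution scaleR_conv_of_real)
  qed
  define f where "f = (\<lambda>\<xi>. cis (- (\<xi> * \<tau>)) * gauss_wave [:1 / (2 * complex_of_real pi):] t (e\<^sup>2 / 2) \<xi>)"
  have "(\<integral>\<xi>. f \<xi> \<partial>lborel) = \<bar>1 / e\<bar> *\<^sub>R (\<integral>x. f (0 + 1 / e * x) \<partial>lborel)"
    by (rule lborel_integral_real_affine) (use e in simp)
  then have "fourier (gauss_wave [:1 / (2 * complex_of_real pi):] t (e\<^sup>2 / 2)) \<tau>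
      = \<bar>1 / e\<bar> *\<^sub>R (\<integral>x. cis (- ((0 + 1 / e * x) * \<tau>)) * gauss_wave [:1 / (2 * complex_of_real pi):] t (e\<^sup>2 / 2) (0 + 1 / e * x) \<partial>lborel)"
    unfolding fourier_def f_def by (simp only: mult.commute[of _ \<tau>])
  also have "(\<lambda>x. cis (- ((0 + 1 / e * x) * \<tau>)) * gauss_wave [:1 / (2 * complex_of_real pi):] t (e\<^sup>2 / 2) (0 + 1 / e * x))
      = (\<lambda>x. complex_of_real (1 / sqrt (2 * pi)) * (complex_of_real (std_normal_density x) * iexp (y * x)))"
  proof
    fix x
    have s: "sqrt (2 * pi) * sqrt (2 * pi) = 2 * pi" by simp
    have "cis (- ((0 + 1 / e * x) * \<tau>)) * gauss_wave [:1 / (2 * complex_of_real pi):] t (e\<^sup>2 / 2) (0 + 1 / e * x)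
        = (1 / (2 * complex_of_real pi)) * (exp (\<i> * complex_of_real (- (x / e * \<tau>))) * exp (\<i> * complex_of_real (t * (x / e)) - complex_of_real (e\<^sup>2 / 2 * (x / e)\<^sup>2)))"
      by (simp add: gauss_wave_def cis_conv_exp mult_ac)
    also have "\<dots> = (1 / (2 * complex_of_real pi)) * exp (\<i> * complex_of_real (y * x) + complex_of_real (- x\<^sup>2 / 2))"
    proof -
      have r: "- (x / e * \<tau>) + t * (x / e) = y * x" "e\<^sup>2 / 2 * (x / e)\<^sup>2 = x\<^sup>2 / 2"
        using e by (simp_all add: y_def field_simps power2_eq_square)
      have "\<i> * complex_of_real (- (x / e * \<tau>)) + (\<i> * complex_of_real (t * (x / e)) - complex_of_real (e\<^sup>2 / 2 * (x / e)\<^sup>2))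
          = \<i> * complex_of_real (- (x / e * \<tau>) + t * (x / e)) - complex_of_real (e\<^sup>2 / 2 * (x / e)\<^sup>2)"
        by (simp add: algebra_simps)
      also have "\<dots> = \<i> * complex_of_real (y * x) + complex_of_real (- x\<^sup>2 / 2)"
        unfolding r by simp
      finally show ?thesis by (simp only: exp_add[symmetric])
    qed
    also have "\<dots> = (1 / (2 * complex_of_real pi)) * (complex_of_real (exp (- x\<^sup>2 / 2)) * iexp (y * x))"
      by (simp only: exp_add exp_of_real mult.commute[of "exp (\<i> * complex_of_real (y * x))"])
    also have "\<dots> = complex_of_real (1 / sqrt (2 * pi)) * (complex_of_real (1 / sqrt (2 * pi)) * (complex_of_real (exp (- x\<^sup>2 / 2)) * iexp (y * x)))"
    proof -
      have "1 / (2 * complex_of_real pi) = complex_of_real (1 / sqrt (2 * pi)) * complex_of_real (1 / sqrt (2 * pi))"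
        unfolding of_real_mult[symmetric] by (simp add: s)
      then show ?thesis by (simp only: mult.assoc)
    qed
    finally show "cis (- ((0 + 1 / e * x) * \<tau>)) * gauss_wave [:1 / (2 * complex_of_real pi):] t (e\<^sup>2 / 2) (0 + 1 / e * x)
      = complex_of_real (1 / sqrt (2 * pi)) * (complex_of_real (std_normal_density x) * iexp (y * x))"
      by (simp only: std_normal_density_def of_real_mult mult.assoc)
  qed
  also have "(\<integral>x. complex_of_real (1 / sqrt (2 * pi)) * (complex_of_real (std_normal_density x) * iexp (y * x)) \<partial>lborel)
      = complex_of_real (1 / sqrt (2 * pi)) * complex_of_real (exp (- (y\<^sup>2) / 2))"
    by (simp only: integral_mult_right_zero ch)
  also have "\<bar>1 / e\<bar> *\<^sub>R (complex_of_real (1 / sqrt (2 * pi)) * complex_of_real (exp (- (y\<^sup>2) / 2)))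
      = complex_of_real (1 / e * (1 / sqrt (2 * pi)) * exp (- (y\<^sup>2) / 2))"
    using e by (simp add: scaleR_conv_of_real)
  also have "1 / e * (1 / sqrt (2 * pi)) * exp (- (y\<^sup>2) / 2) = normal_density t e \<tau>"
    using e by (simp add: normal_density_def y_def real_sqrt_mult power_divide power2_commute[of t \<tau>] field_simps)
  finally show ?thesis .
qed

section \<open>Hoelder continuity of functions in Bessel potential spaces\<close>

lemma integrable_lborel_if_has_integral:
  fixes f :: "real \<Rightarrow> real"
  assumes m: "f \<in> borel_measurable borel" and S: "S \<in> sets borel" and pos: "\<And>x. x \<in> S \<Longrightarrow> 0 \<le> f x" and I: "(f has_integral I) S"
  shows "integrable lborel (\<lambda>x. if x \<in> S then f x else 0)"
proof (rule integrableI_nn_integral_finite)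
  have mm: "(\<lambda>x. if x \<in> S then f x else 0) \<in> borel_measurable borel" using m S by measurable
  then show "(\<lambda>x. if x \<in> S then f x else 0) \<in> borel_measurable lborel" by simp
  show "AE x in lborel. 0 \<le> (if x \<in> S then f x else 0)" using pos by simp
  show "(\<integral>\<^sup>+x. ennreal (if x \<in> S then f x else 0) \<partial>lborel) = ennreal I"
    by (rule nn_integral_has_integral_lborel[OF mm]) (use pos I in \<open>auto simp: has_integral_restrict_UNIV\<close>)
qed

text \<open>
Comparison with |x|^(-2p) outside the unit interval.
\<close>

lemma integrable_Japanese_bracket:
  assumes p: "p > 1 / 2" shows "integrable lborel (\<lambda>x::real. (1 + x\<^sup>2) powr (- p))"
proof -
  define k where "k = (\<lambda>x::real. if x \<in> {1..} then x powr (- 2 * p) else 0)"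
  have k: "integrable lborel k" unfolding k_def
    by (rule integrable_lborel_if_has_integral[OF _ _ _ has_integral_powr_to_inf]) (use p in auto)
  have k': "integrable lborel (\<lambda>x. k (- x))"
    using lborel_integrable_real_affine[OF k, of "-1" 0] by simp
  have i: "integrable lborel (\<lambda>x. indicator {-1..1} x + k x + k (- x))"
    by (intro Bochner_Integration.integrable_add k k' integrable_real_indicator) auto
  show ?thesis
  proof (rule Bochner_Integration.integrable_bound[OF i])
    show "(\<lambda>x::real. (1 + x\<^sup>2) powr (- p)) \<in> borel_measurable lborel" by measurable
    have b: "(1 + x\<^sup>2) powr (- p) \<le> indicator {-1..1} x + k x + k (- x)" for x :: real
    proof -
      have k0: "0 \<le> k y" for y by (simp add: k_def)
      have big: "(1 + y\<^sup>2) powr (- p) \<le> k y" if "y \<ge> 1" for y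
      proof -
        have "(1 + y\<^sup>2) powr (- p) \<le> (y\<^sup>2) powr (- p)" using that p by (intro powr_mono2') auto
        also have "y\<^sup>2 = y powr 2" using that by (simp add: powr_numeral)
        also have "(y powr 2) powr (- p) = y powr (2 * (- p))" by (rule powr_powr)
        finally show ?thesis using that by (simp add: k_def)
      qed
      consider "\<bar>x\<bar> \<le> 1" | "x \<ge> 1" | "- x \<ge> 1" by linarith
      then show ?thesis
      proof cases
        case 1
        have "(1 + x\<^sup>2) powr (- p) \<le> (1 + x\<^sup>2) powr 0" using p by (intro powr_mono) auto
        moreover have "(1 + x\<^sup>2) powr 0 = 1" by (simp add: add_nonneg_eq_0_iff)
        ultimately show ?thesis using 1 k0[of x] k0[of "- x"] by (simp add: abs_le_iff)
      next
        case 2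
        have "0 \<le> (indicator {-1..1} x :: real)" by simp
        with big[OF 2] k0[of "- x"] show ?thesis by linarith
      next
        case 3
        have "0 \<le> (indicator {-1..1} x :: real)" by simp
        moreover have "(1 + x\<^sup>2) powr (- p) \<le> k (- x)" using big[OF 3] by simp
        ultimately show ?thesis using k0[of x] by linarith
      qed
    qed
    show "AE x in lborel. norm ((1 + x\<^sup>2) powr (- p)) \<le> norm (indicator {-1..1} x + k x + k (- x))"
      by (intro AE_I2) (use b in \<open>auto intro: order_trans[OF _ abs_ge_self]\<close>)
  qed
qed

lemma le_one_plus_square: "x \<le> 1 + x\<^sup>2" for x :: real
proof -
  have "0 \<le> (x - 1 / 2)\<^sup>2" by simp
  then show ?thesis by (simp add: power2_eq_square algebra_simps)
qed

text \<open>
Normal densities form an approximate identity.  As g is merely square integrable away from the interval, the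
part with |\<tau> - t| \<ge> r is controlled through the variance e^2 of the density and through its sup norm
there, which is at most 2 e / r^2.
\<close>

lemma normal_mean_tendsto:
  fixes g u :: "real \<Rightarrow> 'b::chilbert"
  assumes g: "g \<in> bochner_L2 lborel" and ae: "AE t in I01. g t = u t"
    and c: "continuous_on {0<..<1} u" and t: "t \<in> {0<..<1}"
  shows "(\<lambda>n. \<integral>\<tau>. normal_density t (1 / real (Suc n)) \<tau> *\<^sub>R g \<tau> \<partial>lborel) \<longlonglongrightarrow> u t"
proof -
  have gm: "g \<in> borel_measurable lborel" and gi: "integrable lborel (\<lambda>t. (norm (g t))\<^sup>2)"
    using g by (auto simp: bochner_L2_def)
  define V where "V = (\<integral>\<tau>. (norm (g \<tau>))\<^sup>2 \<partial>lborel)"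
  define K where "K = 1 + norm (u t)"
  have bound: "norm ((\<integral>\<tau>. normal_density t e \<tau> *\<^sub>R g \<tau> \<partial>lborel) - u t) \<le> \<eta> + (K / r\<^sup>2) * e\<^sup>2 + (2 * V / r\<^sup>2) * e"
    if e: "e > 0" and \<eta>: "\<eta> > 0" and r: "r > 0" "\<And>\<tau>. \<bar>\<tau> - t\<bar> < r \<Longrightarrow> \<tau> \<in> {0<..<1} \<and> norm (u \<tau> - u t) \<le> \<eta>" for e \<eta> r
  proof -
    define n where "n = normal_density t e"
    have n0: "0 \<le> n \<tau>" and nm: "n \<in> borel_measurable lborel" for \<tau> by (simp_all add: n_def)
    have ni: "integrable lborel n" "(\<integral>\<tau>. n \<tau> \<partial>lborel) = 1"
      using e by (simp_all add: n_def integrable_normal_density)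
    have "1 * e \<le> sqrt (2 * pi * e\<^sup>2)"
      using e pi_gt3 by (intro real_le_rsqrt) (auto simp: power_mult_distrib)
    then have sq: "1 / sqrt (2 * pi * e\<^sup>2) \<le> 1 / e" using e by (intro divide_left_mono) auto
    have nb: "n \<tau> \<le> 1 / e" for \<tau>
    proof -
      have "n \<tau> \<le> (1 / e) * 1" unfolding n_def normal_density_def
        by (rule mult_mono[OF sq]) (use e in auto)
      then show ?thesis by simp
    qed
    have nfar: "n \<tau> \<le> 2 * e / r\<^sup>2" if far: "\<bar>\<tau> - t\<bar> \<ge> r" for \<tau>
    proof -
      define x where "x = (\<tau> - t)\<^sup>2 / (2 * e\<^sup>2)"
      have "r\<^sup>2 \<le> (\<tau> - t)\<^sup>2" using power_mono[OF far, of 2] r(1) by simp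
      then have x: "x \<ge> r\<^sup>2 / (2 * e\<^sup>2)" "x > 0" using e r(1) by (auto simp: x_def divide_right_mono intro!: divide_pos_pos)
      have "exp (- x) = 1 / exp x" by (simp add: exp_minus inverse_eq_divide)
      also have "\<dots> \<le> 1 / x"
      proof (rule divide_left_mono)
        show "x \<le> exp x" using exp_ge_add_one_self[of x] by linarith
      qed (use x(2) in auto)
      also have "\<dots> \<le> 1 / (r\<^sup>2 / (2 * e\<^sup>2))" using x e r(1) by (intro divide_left_mono) auto
      finally have ex: "exp (- x) \<le> 2 * e\<^sup>2 / r\<^sup>2" by simp
      have "n \<tau> = (1 / sqrt (2 * pi * e\<^sup>2)) * exp (- x)" by (simp add: n_def normal_density_def x_def)
      also have "\<dots> \<le> (1 / e) * (2 * e\<^sup>2 / r\<^sup>2)" by (rule mult_mono[OF sq ex]) (use e in auto)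
      also have "\<dots> = 2 * e / r\<^sup>2" using e by (simp add: power2_eq_square)
      finally show ?thesis .
    qed
    have m2: "integrable lborel (\<lambda>\<tau>. n \<tau> * (\<tau> - t)\<^sup>2)" "(\<integral>\<tau>. n \<tau> * (\<tau> - t)\<^sup>2 \<partial>lborel) = e\<^sup>2"
      using normal_moment_even[OF e, of t 1] e
      by (auto simp: n_def has_bochner_integral_iff)
    have ig: "integrable lborel (\<lambda>\<tau>. n \<tau> *\<^sub>R g \<tau>)"
    proof (rule Bochner_Integration.integrable_bound[of _ "\<lambda>\<tau>. n \<tau> + (1 / e) * (norm (g \<tau>))\<^sup>2"])
      show "integrable lborel (\<lambda>\<tau>. n \<tau> + (1 / e) * (norm (g \<tau>))\<^sup>2)" using ni gi by simp
      show "(\<lambda>\<tau>. n \<tau> *\<^sub>R g \<tau>) \<in> borel_measurable lborel" using nm gm by measurable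
      have "n \<tau> * norm (g \<tau>) \<le> n \<tau> + (1 / e) * (norm (g \<tau>))\<^sup>2" for \<tau>
      proof -
        have "norm (g \<tau>) \<le> 1 + (norm (g \<tau>))\<^sup>2"
          by (rule le_one_plus_square)
        then have "n \<tau> * norm (g \<tau>) \<le> n \<tau> * (1 + (norm (g \<tau>))\<^sup>2)" by (rule mult_left_mono[OF _ n0])
        also have "\<dots> \<le> n \<tau> + (1 / e) * (norm (g \<tau>))\<^sup>2"
          using mult_right_mono[OF nb[of \<tau>], of "(norm (g \<tau>))\<^sup>2"] by (simp add: distrib_left)
        finally show ?thesis .
      qed
      then show "AE \<tau> in lborel. norm (n \<tau> *\<^sub>R g \<tau>) \<le> norm (n \<tau> + (1 / e) * (norm (g \<tau>))\<^sup>2)"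
        using n0 e by (intro AE_I2) (simp add: abs_of_nonneg)
    qed
    have iu: "integrable lborel (\<lambda>\<tau>. n \<tau> *\<^sub>R u t)" "(\<integral>\<tau>. n \<tau> *\<^sub>R u t \<partial>lborel) = u t"
      using ni by (auto simp: integral_scaleR_left)
    have "(\<integral>\<tau>. n \<tau> *\<^sub>R g \<tau> \<partial>lborel) - u t = (\<integral>\<tau>. n \<tau> *\<^sub>R g \<tau> - n \<tau> *\<^sub>R u t \<partial>lborel)"
      by (simp only: Bochner_Integration.integral_diff[OF ig iu(1)] iu(2))
    then have "norm ((\<integral>\<tau>. n \<tau> *\<^sub>R g \<tau> \<partial>lborel) - u t) \<le> (\<integral>\<tau>. norm (n \<tau> *\<^sub>R g \<tau> - n \<tau> *\<^sub>R u t) \<partial>lborel)"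
      by (simp only: integral_norm_bound)
    also have "\<dots> \<le> (\<integral>\<tau>. \<eta> * n \<tau> + (K / r\<^sup>2) * (n \<tau> * (\<tau> - t)\<^sup>2) + (2 * e / r\<^sup>2) * (norm (g \<tau>))\<^sup>2 \<partial>lborel)"
    proof (rule integral_mono_AE)
      show "integrable lborel (\<lambda>\<tau>. norm (n \<tau> *\<^sub>R g \<tau> - n \<tau> *\<^sub>R u t))" using ig iu by simp
      show "integrable lborel (\<lambda>\<tau>. \<eta> * n \<tau> + (K / r\<^sup>2) * (n \<tau> * (\<tau> - t)\<^sup>2) + (2 * e / r\<^sup>2) * (norm (g \<tau>))\<^sup>2)"
        using ni m2 gi by simp
      show "AE \<tau> in lborel. norm (n \<tau> *\<^sub>R g \<tau> - n \<tau> *\<^sub>R u t) \<le> \<eta> * n \<tau> + (K / r\<^sup>2) * (n \<tau> * (\<tau> - t)\<^sup>2) + (2 * e / r\<^sup>2) * (norm (g \<tau>))\<^sup>2"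
        using ae unfolding I01_AE_iff
      proof eventually_elim
        fix \<tau> assume gu: "\<tau> \<in> {0<..<1} \<longrightarrow> g \<tau> = u \<tau>"
        have p: "0 \<le> \<eta> * n \<tau>" "0 \<le> (K / r\<^sup>2) * (n \<tau> * (\<tau> - t)\<^sup>2)" "0 \<le> (2 * e / r\<^sup>2) * (norm (g \<tau>))\<^sup>2"
          using \<eta> n0[of \<tau>] e by (auto simp: K_def)
        have eq: "norm (n \<tau> *\<^sub>R g \<tau> - n \<tau> *\<^sub>R u t) = n \<tau> * norm (g \<tau> - u t)"
          using n0[of \<tau>] by (simp add: scaleR_diff_right[symmetric])
        show "norm (n \<tau> *\<^sub>R g \<tau> - n \<tau> *\<^sub>R u t) \<le> \<eta> * n \<tau> + (K / r\<^sup>2) * (n \<tau> * (\<tau> - t)\<^sup>2) + (2 * e / r\<^sup>2) * (norm (g \<tau>))\<^sup>2"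
        proof (cases "\<bar>\<tau> - t\<bar> < r")
          case True
          then have "norm (g \<tau> - u t) \<le> \<eta>" using r(2)[OF True] gu by simp
          then have "n \<tau> * norm (g \<tau> - u t) \<le> n \<tau> * \<eta>" by (rule mult_left_mono[OF _ n0])
          then show ?thesis unfolding eq using p by (simp add: mult.commute)
        next
          case False
          have "norm (g \<tau>) \<le> 1 + (norm (g \<tau>))\<^sup>2"
            by (rule le_one_plus_square)
          then have "norm (g \<tau> - u t) \<le> K + (norm (g \<tau>))\<^sup>2"
            using norm_triangle_ineq4[of "g \<tau>" "u t"] by (simp add: K_def)
          then have "n \<tau> * norm (g \<tau> - u t) \<le> n \<tau> * (K + (norm (g \<tau>))\<^sup>2)" by (rule mult_left_mono[OF _ n0])
          moreover have "n \<tau> * K \<le> (K / r\<^sup>2) * (n \<tau> * (\<tau> - t)\<^sup>2)"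
          proof -
            have "r\<^sup>2 \<le> (\<tau> - t)\<^sup>2" using power_mono[of r "\<bar>\<tau> - t\<bar>" 2] False r(1) by simp
            then have "1 \<le> (\<tau> - t)\<^sup>2 / r\<^sup>2" using r(1) by simp
            from mult_left_mono[OF this, of "n \<tau> * K"] show ?thesis using n0[of \<tau>] by (simp add: K_def mult_ac)
          qed
          moreover have "n \<tau> * (norm (g \<tau>))\<^sup>2 \<le> (2 * e / r\<^sup>2) * (norm (g \<tau>))\<^sup>2"
            using False by (intro mult_right_mono nfar) auto
          ultimately show ?thesis unfolding eq using p(1) by (simp add: distrib_left)
        qed
      qed
    qed
    also have "\<dots> = \<eta> + (K / r\<^sup>2) * e\<^sup>2 + (2 * e / r\<^sup>2) * V"
      unfolding V_def using ni m2 gi by (simp add: Bochner_Integration.integral_add)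
    finally show ?thesis by (simp add: n_def mult_ac)
  qed
  show ?thesis
  proof (rule LIMSEQ_I)
    fix \<epsilon> :: real assume \<epsilon>: "\<epsilon> > 0"
    have "isCont u t" using continuous_on_interior[OF c] t by (simp add: interior_open)
    then obtain d where d: "d > 0" "\<And>\<tau>. \<bar>\<tau> - t\<bar> < d \<Longrightarrow> norm (u \<tau> - u t) < \<epsilon> / 2"
      using \<epsilon> unfolding continuous_at_eps_delta by (metis dist_norm half_gt_zero real_norm_def)
    define r where "r = min d (min t (1 - t))"
    have r: "r > 0" "\<And>\<tau>. \<bar>\<tau> - t\<bar> < r \<Longrightarrow> \<tau> \<in> {0<..<1} \<and> norm (u \<tau> - u t) \<le> \<epsilon> / 2"
      using d t by (auto simp: r_def less_imp_le)
    have "(\<lambda>n. \<epsilon> / 2 + (K / r\<^sup>2) * (inverse (real (Suc n)))\<^sup>2 + (2 * V / r\<^sup>2) * inverse (real (Suc n))) \<longlonglongrightarrow> \<epsilon> / 2 + (K / r\<^sup>2) * 0\<^sup>2 + (2 * V / r\<^sup>2) * 0"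
      by (intro tendsto_intros LIMSEQ_inverse_real_of_nat)
    then have "\<forall>\<^sub>F n in sequentially. \<epsilon> / 2 + (K / r\<^sup>2) * (inverse (real (Suc n)))\<^sup>2 + (2 * V / r\<^sup>2) * inverse (real (Suc n)) < \<epsilon>"
      by (rule order_tendstoD(2)) (use \<epsilon> in simp)
    then obtain N where N: "\<And>n. n \<ge> N \<Longrightarrow> \<epsilon> / 2 + (K / r\<^sup>2) * (1 / real (Suc n))\<^sup>2 + (2 * V / r\<^sup>2) * (1 / real (Suc n)) < \<epsilon>"
      unfolding eventually_sequentially inverse_eq_divide by blast
    have "norm ((\<integral>\<tau>. normal_density t (1 / real (Suc n)) \<tau> *\<^sub>R g \<tau> \<partial>lborel) - u t) < \<epsilon>" if "n \<ge> N" for n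
      using bound[of "1 / real (Suc n)" "\<epsilon> / 2" r] N[OF that] r \<epsilon> by fastforce
    then show "\<exists>N. \<forall>n\<ge>N. norm ((\<integral>\<tau>. normal_density t (1 / real (Suc n)) \<tau> *\<^sub>R g \<tau> \<partial>lborel) - u t) < \<epsilon>" by blast
  qed
qed

lemma iexp_diff_bound:
  assumes "0 < \<theta>" "\<theta> \<le> 1" shows "cmod (iexp x - iexp y) \<le> 2 * \<bar>x - y\<bar> powr \<theta>"
proof -
  have "iexp x - iexp y = iexp y * (iexp (x - y) - 1)"
    by (simp add: exp_diff right_diff_distrib of_real_diff)
  then have e: "cmod (iexp x - iexp y) = cmod (iexp (x - y) - 1)" by (simp add: norm_mult)
  have 1: "cmod (iexp (x - y) - 1) \<le> \<bar>x - y\<bar>" using iexp_approx1[of "x - y" 0] by simp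
  have 2: "cmod (iexp (x - y) - 1) \<le> 2" using norm_triangle_ineq4[of "iexp (x - y)" 1] by simp
  show ?thesis
  proof (cases "\<bar>x - y\<bar> \<le> 1")
    case True
    have "\<bar>x - y\<bar> \<le> \<bar>x - y\<bar> powr \<theta>"
      using powr_mono'[of \<theta> 1 "\<bar>x - y\<bar>"] True assms by simp
    moreover have "0 \<le> \<bar>x - y\<bar> powr \<theta>" by simp
    ultimately show ?thesis unfolding e using 1 by linarith
  next
    case False
    then have "1 \<le> \<bar>x - y\<bar> powr \<theta>" using assms by (intro ge_one_powr_ge_zero) auto
    then show ?thesis unfolding e using 2 by linarith
  qed
qed

text \<open>
The factor (1+\<xi>^2)^(\<theta>/2) G is integrable, because it is the product of the square integrable functions
(1+\<xi>^2)^(\<nu>/2) G and (1+\<xi>^2)^(-(\<nu>-\<theta>)/2), the latter since \<nu> - \<theta> > 1/2.  Integrating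
|exp(\<i> t \<xi>) - exp(\<i> s \<xi>)| \<le> 2 |t-s|^\<theta> |\<xi>|^\<theta> against it gives the Hoelder bound for Fourier
inversion.  Inversion is regularised by a Gaussian factor, which on the other side is the mean of g with
respect to a normal density; these means converge to the continuous function u.
\<close>

lemma bessel_line_Hoelder:
  fixes g u :: "real \<Rightarrow> 'b::chilbert"
  assumes g: "g \<in> bessel_line \<nu>" and \<theta>: "0 < \<theta>" "\<theta> \<le> 1" "\<theta> < \<nu> - 1 / 2"
    and ae: "AE t in I01. g t = u t" and c: "continuous_on {0<..<1} u"
  shows "\<exists>C. \<forall>s\<in>{0<..<1}. \<forall>t\<in>{0<..<1}. norm (u t - u s) \<le> C * \<bar>t - s\<bar> powr \<theta>"
proof -
  have gL: "g \<in> bochner_L2 lborel" using g by (simp add: bessel_line_def)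
  obtain G where G: "G \<in> bochner_L2 lborel" "has_fourier_transform g G"
    "(\<lambda>\<xi>. (1 + \<xi>\<^sup>2) powr (\<nu> / 2) *\<^sub>R G \<xi>) \<in> bochner_L2 lborel"
    using g unfolding bessel_line_def by blast
  have Gm: "G \<in> borel_measurable lborel" using G(1) by (simp add: bochner_L2_def)
  define h where "h = (\<lambda>\<xi>::real. (1 + \<xi>\<^sup>2) powr (\<theta> / 2) * norm (G \<xi>))"
  have hi: "integrable lborel h"
  proof (rule Bochner_Integration.integrable_bound)
    show "integrable lborel (\<lambda>\<xi>. (1 + \<xi>\<^sup>2) powr (- (\<nu> - \<theta>)) + (norm ((1 + \<xi>\<^sup>2) powr (\<nu> / 2) *\<^sub>R G \<xi>))\<^sup>2)"
    proof (rule Bochner_Integration.integrable_add)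
      show "integrable lborel (\<lambda>\<xi>::real. (1 + \<xi>\<^sup>2) powr (- (\<nu> - \<theta>)))"
        by (rule integrable_Japanese_bracket) (use \<theta> in linarith)
      show "integrable lborel (\<lambda>\<xi>. (norm ((1 + \<xi>\<^sup>2) powr (\<nu> / 2) *\<^sub>R G \<xi>))\<^sup>2)"
        using G(3) unfolding bochner_L2_def by blast
    qed
    show "h \<in> borel_measurable lborel" unfolding h_def using Gm by measurable
    have "h \<xi> \<le> (1 + \<xi>\<^sup>2) powr (- (\<nu> - \<theta>)) + (norm ((1 + \<xi>\<^sup>2) powr (\<nu> / 2) *\<^sub>R G \<xi>))\<^sup>2" for \<xi>
    proof -
      define a where "a = (1 + \<xi>\<^sup>2) powr (- (\<nu> - \<theta>) / 2)"
      define b where "b = (1 + \<xi>\<^sup>2) powr (\<nu> / 2) * norm (G \<xi>)"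
      have ab: "0 \<le> a" "0 \<le> b" by (simp_all add: a_def b_def)
      have "(1 + \<xi>\<^sup>2) powr (\<theta> / 2) = (1 + \<xi>\<^sup>2) powr (- (\<nu> - \<theta>) / 2) * (1 + \<xi>\<^sup>2) powr (\<nu> / 2)"
        unfolding powr_add[symmetric] by (rule arg_cong) (simp add: field_simps)
      then have "h \<xi> = a * b"
        by (simp only: h_def a_def b_def mult.assoc)
      also have "\<dots> \<le> a\<^sup>2 + b\<^sup>2" using sum_squares_bound[of a b] mult_nonneg_nonneg[OF ab] by linarith
      also have "a\<^sup>2 = (1 + \<xi>\<^sup>2) powr (- (\<nu> - \<theta>))"
        unfolding a_def power2_eq_square[of "_ powr _"] powr_add[symmetric] by (rule arg_cong) simp
      finally show ?thesis by (simp add: b_def)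
    qed
    moreover have "0 \<le> h \<xi>" for \<xi> by (simp add: h_def)
    ultimately show "AE \<xi> in lborel. norm (h \<xi>) \<le> norm ((1 + \<xi>\<^sup>2) powr (- (\<nu> - \<theta>)) + (norm ((1 + \<xi>\<^sup>2) powr (\<nu> / 2) *\<^sub>R G \<xi>))\<^sup>2)"
      by (intro AE_I2) (simp add: abs_of_nonneg order_trans[OF _ abs_ge_self])
  qed
  define \<phi> where "\<phi> = (\<lambda>e t. gauss_wave [:1 / (2 * complex_of_real pi):] t (e\<^sup>2 / 2))"
  have \<phi>eq: "\<phi> e t \<xi> = complex_of_real (exp (- (e\<^sup>2 / 2 * \<xi>\<^sup>2)) / (2 * pi)) * iexp (t * \<xi>)" for e t \<xi>
  proof -
    have "exp (\<i> * complex_of_real (t * \<xi>) - complex_of_real (e\<^sup>2 / 2 * \<xi>\<^sup>2))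
        = iexp (t * \<xi>) * complex_of_real (exp (- (e\<^sup>2 / 2 * \<xi>\<^sup>2)))"
      by (simp only: diff_conv_add_uminus exp_add of_real_minus[symmetric] exp_of_real)
    then show ?thesis by (simp add: \<phi>_def gauss_wave_def)
  qed
  have coef: "0 \<le> exp (- (e\<^sup>2 / 2 * \<xi>\<^sup>2)) / (2 * pi)" "exp (- (e\<^sup>2 / 2 * \<xi>\<^sup>2)) / (2 * pi) \<le> 1" for e \<xi> :: real
  proof -
    have "exp (- (e\<^sup>2 / 2 * \<xi>\<^sup>2)) \<le> 1" by simp
    moreover have "1 \<le> 2 * pi" using pi_gt3 by linarith
    ultimately have "exp (- (e\<^sup>2 / 2 * \<xi>\<^sup>2)) \<le> 2 * pi" by linarith
    then show "exp (- (e\<^sup>2 / 2 * \<xi>\<^sup>2)) / (2 * pi) \<le> 1" using pi_gt_zero by (simp only: divide_le_eq_1_pos mult_pos_pos zero_less_numeral)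
  qed simp
  have \<phi>m: "\<phi> e t \<in> borel_measurable lborel" for e t
    unfolding \<phi>eq[abs_def] by measurable
  have Gh: "norm (G \<xi>) \<le> h \<xi>" for \<xi>
  proof -
    have "1 \<le> (1 + \<xi>\<^sup>2) powr (\<theta> / 2)" using \<theta> by (intro ge_one_powr_ge_zero) auto
    from mult_right_mono[OF this, of "norm (G \<xi>)"] show ?thesis by (simp add: h_def)
  qed
  have \<phi>i: "integrable lborel (\<lambda>\<xi>. \<phi> e t \<xi> *\<^sub>C G \<xi>)" for e t
  proof (rule Bochner_Integration.integrable_bound[OF hi borel_measurable_scaleC[OF \<phi>m Gm]])
    have "cmod (\<phi> e t \<xi>) \<le> 1" for \<xi>
      unfolding \<phi>eq norm_mult norm_of_real norm_exp_i_times
      by (simp only: mult_1_right abs_of_nonneg[OF coef(1)] coef(2))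
    then have "cmod (\<phi> e t \<xi>) * norm (G \<xi>) \<le> 1 * h \<xi>" for \<xi>
      by (intro mult_mono Gh) auto
    then show "AE \<xi> in lborel. norm (\<phi> e t \<xi> *\<^sub>C G \<xi>) \<le> norm (h \<xi>)"
      by (intro AE_I2) (simp add: norm_scaleC order_trans[OF _ abs_ge_self])
  qed
  define m where "m = (\<lambda>e t. \<integral>\<xi>. \<phi> e t \<xi> *\<^sub>C G \<xi> \<partial>lborel)"
  define C where "C = 2 * (\<integral>\<xi>. h \<xi> \<partial>lborel)"
  have mdiff: "norm (m e t - m e s) \<le> C * \<bar>t - s\<bar> powr \<theta>" for e t s
  proof -
    have "m e t - m e s = (\<integral>\<xi>. (\<phi> e t \<xi> - \<phi> e s \<xi>) *\<^sub>C G \<xi> \<partial>lborel)"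
      unfolding m_def scaleC_diff_left by (rule Bochner_Integration.integral_diff[OF \<phi>i \<phi>i, symmetric])
    then have "norm (m e t - m e s) \<le> (\<integral>\<xi>. norm ((\<phi> e t \<xi> - \<phi> e s \<xi>) *\<^sub>C G \<xi>) \<partial>lborel)"
      by (simp only: integral_norm_bound)
    also have "\<dots> \<le> (\<integral>\<xi>. (2 * \<bar>t - s\<bar> powr \<theta>) * h \<xi> \<partial>lborel)"
    proof (rule integral_mono)
      show "integrable lborel (\<lambda>\<xi>. norm ((\<phi> e t \<xi> - \<phi> e s \<xi>) *\<^sub>C G \<xi>))"
        unfolding scaleC_diff_left by (intro integrable_norm Bochner_Integration.integrable_diff \<phi>i)
      show "integrable lborel (\<lambda>\<xi>. (2 * \<bar>t - s\<bar> powr \<theta>) * h \<xi>)" using hi by simp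
      fix \<xi> :: real
      have "\<phi> e t \<xi> - \<phi> e s \<xi> = complex_of_real (exp (- (e\<^sup>2 / 2 * \<xi>\<^sup>2)) / (2 * pi)) * (iexp (t * \<xi>) - iexp (s * \<xi>))"
        by (simp only: \<phi>eq right_diff_distrib)
      then have "cmod (\<phi> e t \<xi> - \<phi> e s \<xi>) \<le> 1 * cmod (iexp (t * \<xi>) - iexp (s * \<xi>))"
        using coef[of e \<xi>] by (simp only: norm_mult norm_of_real) (intro mult_right_mono, auto)
      also have "\<dots> \<le> 2 * \<bar>t * \<xi> - s * \<xi>\<bar> powr \<theta>" using iexp_diff_bound[OF \<theta>(1,2), of "t * \<xi>" "s * \<xi>"] by simp
      also have "\<bar>t * \<xi> - s * \<xi>\<bar> powr \<theta> = \<bar>t - s\<bar> powr \<theta> * \<bar>\<xi>\<bar> powr \<theta>"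
        by (simp add: left_diff_distrib[symmetric] abs_mult powr_mult)
      also have "\<bar>\<xi>\<bar> powr \<theta> \<le> (1 + \<xi>\<^sup>2) powr (\<theta> / 2)"
      proof -
        have "\<bar>\<xi>\<bar> powr \<theta> = (\<bar>\<xi>\<bar> powr 2) powr (\<theta> / 2)" unfolding powr_powr by simp
        also have "\<bar>\<xi>\<bar> powr 2 = \<xi>\<^sup>2" by (cases "\<xi> = 0") (simp_all add: powr_numeral)
        also have "(\<xi>\<^sup>2) powr (\<theta> / 2) \<le> (1 + \<xi>\<^sup>2) powr (\<theta> / 2)" using \<theta> by (intro powr_mono2) auto
        finally show ?thesis .
      qed
      finally have "cmod (\<phi> e t \<xi> - \<phi> e s \<xi>) \<le> 2 * (\<bar>t - s\<bar> powr \<theta> * (1 + \<xi>\<^sup>2) powr (\<theta> / 2))"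
        by (simp add: mult_left_mono)
      then have "cmod (\<phi> e t \<xi> - \<phi> e s \<xi>) * norm (G \<xi>) \<le> 2 * (\<bar>t - s\<bar> powr \<theta> * (1 + \<xi>\<^sup>2) powr (\<theta> / 2)) * norm (G \<xi>)"
        by (rule mult_right_mono) simp
      then show "norm ((\<phi> e t \<xi> - \<phi> e s \<xi>) *\<^sub>C G \<xi>) \<le> (2 * \<bar>t - s\<bar> powr \<theta>) * h \<xi>"
        by (simp add: norm_scaleC h_def mult_ac)
    qed
    also have "\<dots> = C * \<bar>t - s\<bar> powr \<theta>" by (simp add: C_def)
    finally show ?thesis .
  qed
  have meq: "m e t = (\<integral>\<tau>. normal_density t e \<tau> *\<^sub>R g \<tau> \<partial>lborel)" if e: "e > 0" for e t
  proof -
    have "schwartz (\<phi> e t)" unfolding \<phi>_def by (rule schwartz_gauss_wave) (use e in simp)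
    then have "m e t = (\<integral>\<tau>. fourier (\<phi> e t) \<tau> *\<^sub>C g \<tau> \<partial>lborel)"
      using G(2) unfolding has_fourier_transform_def m_def by blast
    then show ?thesis unfolding \<phi>_def by (simp only: fourier_gauss_wave[OF e] scaleC_of_real)
  qed
  have "norm (u t - u s) \<le> C * \<bar>t - s\<bar> powr \<theta>" if st: "s \<in> {0<..<1}" "t \<in> {0<..<1}" for s t
  proof (rule LIMSEQ_le_const2)
    have l: "(\<lambda>n. m (1 / real (Suc n)) t) \<longlonglongrightarrow> u t" if "t \<in> {0<..<1}" for t
      using normal_mean_tendsto[OF gL ae c that] by (subst meq) auto
    show "(\<lambda>n. norm (m (1 / real (Suc n)) t - m (1 / real (Suc n)) s)) \<longlonglongrightarrow> norm (u t - u s)"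
      by (intro tendsto_intros l st)
    show "\<exists>N. \<forall>n\<ge>N. norm (m (1 / real (Suc n)) t - m (1 / real (Suc n)) s) \<le> C * \<bar>t - s\<bar> powr \<theta>"
      using mdiff by blast
  qed
  then show ?thesis by blast
qed

section \<open>Time-dependent functions with values in L2\<close>

lemma sqint_unit_ball:
  fixes \<phi> :: "real^'n::finite \<Rightarrow> complex"
  assumes "continuous_on UNIV \<phi>" "\<And>x. norm x > 1 \<Longrightarrow> \<phi> x = 0"
  shows "square_integrable \<phi>"
  by (rule sqint_compact_support[OF assms(1) compact_cball[of 0 1]]) (use assms(2) in auto)

lemma norm_abs_l2_le_sup:
  fixes \<phi> :: "real^'n::finite \<Rightarrow> complex"
  assumes c: "continuous_on UNIV \<phi>" and z: "\<And>x. norm x > 1 \<Longrightarrow> \<phi> x = 0"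
    and e: "0 \<le> e" "\<And>x. norm x \<le> 1 \<Longrightarrow> cmod (\<phi> x) \<le> e"
  shows "norm (abs_l2 \<phi>) \<le> e * sqrt (measure lborel (cball (0 :: real^'n) 1))"
proof (rule power2_le_imp_le)
  have s: "square_integrable \<phi>" by (rule sqint_unit_ball[OF c z])
  have i: "integrable lborel (\<lambda>x :: real^'n. e\<^sup>2 * indicator (cball 0 1) x)"
    using emeasure_bounded_finite[OF bounded_cball[of "0 :: real^'n" 1]]
    by (intro integrable_mult_right integrable_real_indicator) auto
  have "(norm (abs_l2 \<phi>))\<^sup>2 \<le> (\<integral>x. e\<^sup>2 * indicator (cball (0 :: real^'n) 1) x \<partial>lborel)"
    unfolding norm_l2_abs[OF s]
  proof (rule integral_mono[OF _ i])
    show "integrable lborel (\<lambda>x. (cmod (\<phi> x))\<^sup>2)" using s by (simp add: square_integrable_def)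
    show "(cmod (\<phi> x))\<^sup>2 \<le> e\<^sup>2 * indicator (cball 0 1) x" for x
      using z[of x] power_mono[OF e(2)[of x], of 2] by (cases "norm x \<le> 1") auto
  qed
  also have "\<dots> = e\<^sup>2 * measure lborel (cball (0 :: real^'n) 1)" by simp
  finally show "(norm (abs_l2 \<phi>))\<^sup>2 \<le> (e * sqrt (measure lborel (cball (0 :: real^'n) 1)))\<^sup>2"
    by (simp add: power_mult_distrib)
  show "0 \<le> e * sqrt (measure lborel (cball (0 :: real^'n) 1))" using e by simp
qed

text \<open>
Uniform continuity on the product of a compact time interval with the closed unit ball.
\<close>

lemma uniform_in_time:
  fixes \<Phi> :: "real \<Rightarrow> real^'n::finite \<Rightarrow> complex"
  assumes c: "continuous_on ({0<..<1} \<times> UNIV) (\<lambda>p. \<Phi> (fst p) (snd p))" and t: "t \<in> {0<..<1}" and e: "e > 0"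
  shows "\<exists>\<delta>>0. \<forall>r. \<bar>r - t\<bar> < \<delta> \<longrightarrow> r \<in> {0<..<1} \<and> (\<forall>x. norm x \<le> 1 \<longrightarrow> cmod (\<Phi> r x - \<Phi> t x) < e)"
proof -
  define \<rho> where "\<rho> = min t (1 - t) / 2"
  have \<rho>: "\<rho> > 0" "\<rho> < t" "\<rho> < 1 - t" using t by (auto simp: \<rho>_def min_def)
  have "r \<in> {0<..<1}" if "r \<in> cball t \<rho>" for r
  proof -
    have "\<bar>t - r\<bar> \<le> \<rho>" using that by (simp add: dist_real_def)
    then show ?thesis using \<rho> by (simp add: abs_le_iff)
  qed
  then have \<rho>s: "cball t \<rho> \<subseteq> {0<..<1}" by blast
  have "compact (cball t \<rho> \<times> cball (0 :: real^'n) 1)" by (intro compact_Times compact_cball)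
  moreover have "continuous_on (cball t \<rho> \<times> cball 0 1) (\<lambda>p. \<Phi> (fst p) (snd p))"
    by (rule continuous_on_subset[OF c]) (use \<rho>s in auto)
  ultimately have "uniformly_continuous_on (cball t \<rho> \<times> cball 0 1) (\<lambda>p. \<Phi> (fst p) (snd p))"
    by (intro compact_uniformly_continuous)
  from uniformly_continuous_onE[OF this e] obtain \<delta> where \<delta>: "\<delta> > 0"
    "\<And>p p'. p \<in> cball t \<rho> \<times> cball 0 1 \<Longrightarrow> p' \<in> cball t \<rho> \<times> cball 0 1 \<Longrightarrow> dist p' p < \<delta> \<Longrightarrow> dist (\<Phi> (fst p') (snd p')) (\<Phi> (fst p) (snd p)) < e"
    by metis
  show ?thesis
  proof (intro exI[of _ "min \<delta> \<rho>"] conjI allI impI)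
    fix r assume r: "\<bar>r - t\<bar> < min \<delta> \<rho>"
    then have rt: "r \<in> cball t \<rho>" by (auto simp: dist_real_def)
    then show "r \<in> {0<..<1}" using \<rho>s by blast
    fix x :: "real^'n" assume "norm x \<le> 1"
    then have "dist (\<Phi> r x) (\<Phi> t x) < e"
      using \<delta>(2)[of "(t, x)" "(r, x)"] rt \<rho> r by (simp add: dist_Pair_Pair dist_real_def)
    then show "cmod (\<Phi> r x - \<Phi> t x) < e" by (simp add: dist_norm)
  qed (use \<delta> \<rho> in simp)
qed

lemma slice_continuous:
  assumes "continuous_on ({0<..<1} \<times> UNIV) (\<lambda>p. \<Phi> (fst p) (snd p))" and "t \<in> {0<..<1}"
  shows "continuous_on UNIV (\<Phi> t)"
  using continuous_on_compose2[OF assms(1), of UNIV "\<lambda>x. (t, x)"] assms(2) by (simp add: image_subset_iff continuous_intros)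

lemma abs_l2_continuous_in_time:
  fixes \<Phi> :: "real \<Rightarrow> real^'n::finite \<Rightarrow> complex"
  assumes c: "continuous_on ({0<..<1} \<times> UNIV) (\<lambda>p. \<Phi> (fst p) (snd p))"
    and z: "\<And>t x. norm x > 1 \<Longrightarrow> \<Phi> t x = 0"
  shows "continuous_on {0<..<1} (\<lambda>t. abs_l2 (\<Phi> t))"
  unfolding continuous_on_iff
proof (intro ballI allI impI)
  fix t e :: real assume t: "t \<in> {0<..<1}" and e: "0 < e"
  define V where "V = sqrt (measure lborel (cball (0 :: real^'n) 1)) + 1"
  have V: "V > 0" by (simp add: V_def add_nonneg_pos)
  obtain \<delta> where \<delta>: "\<delta> > 0" "\<And>r x. \<bar>r - t\<bar> < \<delta> \<Longrightarrow> norm x \<le> 1 \<Longrightarrow> cmod (\<Phi> r x - \<Phi> t x) < e / V"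
    using uniform_in_time[OF c t, of "e / V"] e V by auto
  note sl = slice_continuous[OF c]
  show "\<exists>d>0. \<forall>r\<in>{0<..<1}. dist r t < d \<longrightarrow> dist (abs_l2 (\<Phi> r)) (abs_l2 (\<Phi> t)) < e"
  proof (intro exI[of _ \<delta>] conjI ballI impI)
    fix r assume r: "r \<in> {0<..<1}" "dist r t < \<delta>"
    have "abs_l2 (\<Phi> r) - abs_l2 (\<Phi> t) = abs_l2 (\<lambda>x. \<Phi> r x - \<Phi> t x)"
      by (intro minus_l2_abs sqint_unit_ball sl r t z)
    then have "norm (abs_l2 (\<Phi> r) - abs_l2 (\<Phi> t)) = norm (abs_l2 (\<lambda>x. \<Phi> r x - \<Phi> t x))" by simp
    also have "\<dots> \<le> e / V * sqrt (measure lborel (cball (0 :: real^'n) 1))"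
      by (rule norm_abs_l2_le_sup) (use \<delta>(2)[of r] r e V z in \<open>auto intro!: continuous_on_diff sl t less_imp_le simp: dist_real_def\<close>)
    also have "\<dots> < e / V * V" using e V by (intro mult_strict_left_mono) (auto simp: V_def)
    also have "\<dots> = e" using V by simp
    finally show "dist (abs_l2 (\<Phi> r)) (abs_l2 (\<Phi> t)) < e" by (simp add: dist_norm)
  qed (rule \<delta>(1))
qed

text \<open>
Pointwise differentiability in t and joint continuity of the derivative give the linear approximation
uniformly in x, and on functions supported in the unit ball the sup norm controls the norm of L2.
\<close>

lemma abs_l2_has_vector_derivative:
  fixes \<Phi> \<Phi>' :: "real \<Rightarrow> real^'n::finite \<Rightarrow> complex"
  assumes c: "continuous_on ({0<..<1} \<times> UNIV) (\<lambda>p. \<Phi> (fst p) (snd p))"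
    and c': "continuous_on ({0<..<1} \<times> UNIV) (\<lambda>p. \<Phi>' (fst p) (snd p))"
    and z: "\<And>t x. norm x > 1 \<Longrightarrow> \<Phi> t x = 0" and z': "\<And>t x. norm x > 1 \<Longrightarrow> \<Phi>' t x = 0"
    and d: "\<And>t x. t \<in> {0<..<1} \<Longrightarrow> ((\<lambda>t. \<Phi> t x) has_vector_derivative \<Phi>' t x) (at t)"
    and t: "t \<in> {0<..<1}"
  shows "((\<lambda>t. abs_l2 (\<Phi> t)) has_vector_derivative abs_l2 (\<Phi>' t)) (at t)"
  unfolding has_vector_derivative_def has_derivative_within_alt
proof (intro conjI allI impI bounded_linear_scaleR_left)
  fix e :: real assume e: "0 < e"
  define V where "V = sqrt (measure lborel (cball (0 :: real^'n) 1)) + 1"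
  have V: "V > 0" by (simp add: V_def add_nonneg_pos)
  obtain \<delta> where \<delta>: "\<delta> > 0" "\<And>r x. \<bar>r - t\<bar> < \<delta> \<Longrightarrow> r \<in> {0<..<1}"
    "\<And>r x. \<bar>r - t\<bar> < \<delta> \<Longrightarrow> norm x \<le> 1 \<Longrightarrow> cmod (\<Phi>' r x - \<Phi>' t x) < e / V"
    using uniform_in_time[OF c' t, of "e / V"] e V by auto
  note sl = slice_continuous[OF c] and sl' = slice_continuous[OF c']
  show "\<exists>\<delta>>0. \<forall>r\<in>UNIV. norm (r - t) < \<delta> \<longrightarrow> norm (abs_l2 (\<Phi> r) - abs_l2 (\<Phi> t) - (r - t) *\<^sub>R abs_l2 (\<Phi>' t)) \<le> e * norm (r - t)"
  proof (intro exI[of _ \<delta>] conjI ballI impI)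
    fix r :: real assume r: "norm (r - t) < \<delta>"
    then have r1: "r \<in> {0<..<1}" using \<delta>(2) by simp
    define \<phi> where "\<phi> = (\<lambda>x. \<Phi> r x - \<Phi> t x - complex_of_real (r - t) * \<Phi>' t x)"
    have b: "cmod (\<phi> x) \<le> \<bar>r - t\<bar> * (e / V)" if x: "norm x \<le> 1" for x
    proof -
      have seg: "\<bar>y - t\<bar> \<le> \<bar>r - t\<bar>" if "y \<in> closed_segment t r" for y
        using that by (auto simp: closed_segment_eq_real_ivl split: if_splits)
      have "norm (\<Phi> r x - \<Phi> t x - (r - t) *\<^sub>R \<Phi>' t x) \<le> norm (r - t) * (e / V)"
      proof (rule vector_differentiable_bound_linearization[where S = "closed_segment t r" and f' = "\<lambda>y. \<Phi>' y x"])
        fix y assume y: "y \<in> closed_segment t r"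
        then have yd: "\<bar>y - t\<bar> < \<delta>" using seg[OF y] r by simp
        show "((\<lambda>y. \<Phi> y x) has_vector_derivative \<Phi>' y x) (at y within closed_segment t r)"
          by (rule has_vector_derivative_at_within[OF d[OF \<delta>(2)[OF yd]]])
        show "norm (\<Phi>' y x - \<Phi>' t x) \<le> e / V" using \<delta>(3)[OF yd x] by simp
      qed auto
      then show ?thesis by (simp add: \<phi>_def scaleR_conv_of_real)
    qed
    have sc: "square_integrable (\<Phi> r)" "square_integrable (\<Phi> t)" "square_integrable (\<Phi>' t)"
      by (rule sqint_unit_ball[OF sl[OF r1] z], assumption, rule sqint_unit_ball[OF sl[OF t] z], assumption,
          rule sqint_unit_ball[OF sl'[OF t] z'], assumption)
    have "(r - t) *\<^sub>R abs_l2 (\<Phi>' t) = abs_l2 (\<lambda>x. complex_of_real (r - t) * \<Phi>' t x)"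
      using sc(3) by (simp add: scaleR_l2.abs_eq l2_eq_def)
    then have "abs_l2 (\<Phi> r) - abs_l2 (\<Phi> t) - (r - t) *\<^sub>R abs_l2 (\<Phi>' t) = abs_l2 \<phi>"
      unfolding \<phi>_def using sc by (simp add: minus_l2_abs sqint_diff sqint_scale)
    also have "norm (abs_l2 \<phi>) \<le> (\<bar>r - t\<bar> * (e / V)) * sqrt (measure lborel (cball (0 :: real^'n) 1))"
    proof (rule norm_abs_l2_le_sup)
      show "continuous_on UNIV \<phi>" unfolding \<phi>_def by (intro continuous_intros sl sl' r1 t)
      show "\<phi> x = 0" if "norm x > 1" for x using z[OF that] z'[OF that] by (simp add: \<phi>_def)
    qed (use b e V in auto)
    also have "\<dots> \<le> (\<bar>r - t\<bar> * (e / V)) * V" using e V by (intro mult_left_mono) (auto simp: V_def)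
    also have "\<dots> = e * norm (r - t)" using V by simp
    finally show "norm (abs_l2 (\<Phi> r) - abs_l2 (\<Phi> t) - (r - t) *\<^sub>R abs_l2 (\<Phi>' t)) \<le> e * norm (r - t)" .
  qed (rule \<delta>(1))
qed

lemma h1_of_continuous_in_time:
  fixes \<Phi> :: "real \<Rightarrow> real^'n::finite \<Rightarrow> complex"
  assumes tf: "\<And>t. t \<in> {0<..<1} \<Longrightarrow> test_function (\<Phi> t)"
    and c: "continuous_on {0<..<1} (\<lambda>t. abs_l2 (\<Phi> t))"
    and c': "\<And>k. continuous_on {0<..<1} (\<lambda>t. abs_l2 (partial k (\<Phi> t)))"
  shows "continuous_on {0<..<1} (\<lambda>t. h1_of (\<Phi> t))"
proof -
  have "continuous_on {0<..<1} (\<lambda>t. (abs_l2 (\<Phi> t), \<chi> k. abs_l2 (partial k (\<Phi> t))))"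
    by (intro continuous_on_Pair c continuous_on_vec_lambda c')
  then have "continuous_on {0<..<1} (\<lambda>t. Rep_h1 (h1_of (\<Phi> t)))"
    by (rule continuous_on_cong[THEN iffD1, OF refl, rotated]) (simp add: Rep_h1_of tf)
  then show ?thesis unfolding continuous_on_iff dist_h1_rep .
qed

section \<open>A locally integrable weight\<close>

lemma AE_coordinate_nonzero: "AE x :: real^'n::finite in lborel. x $ i \<noteq> 0"
proof -
  have b: "{x :: real^'n. x $ i = 0} \<in> sets borel"
    by (intro borel_closed closed_Collect_eq continuous_intros)
  have "{x :: real^'n. x $ i = 0} \<in> null_sets lebesgue"
    using negligible_standard_hyperplane_cart[of i] by (simp add: negligible_iff_null_sets)
  then have "{x :: real^'n. x $ i = 0} \<in> null_sets lborel" using b by (simp add: null_sets_completion_iff)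
  from AE_not_in[OF this] show ?thesis by simp
qed

lemma nn_integral_weight_1d:
  assumes "0 < \<gamma>"
  shows "(\<integral>\<^sup>+y. (if y = 0 then \<infinity> else ennreal (\<bar>y\<bar> powr (\<gamma> - 1))) * indicator {-1..1} y \<partial>lborel) < \<infinity>"
proof -
  define k where "k = (\<lambda>y::real. if y \<in> {0..1} then y powr (\<gamma> - 1) else 0)"
  have k: "integrable lborel k" unfolding k_def
    by (rule integrable_lborel_if_has_integral[OF _ _ _ has_integral_powr_from_0]) (use assms in auto)
  have k': "integrable lborel (\<lambda>y. k (- y))"
    using lborel_integrable_real_affine[OF k, of "-1" 0] by simp
  have "(\<integral>\<^sup>+y. (if y = 0 then \<infinity> else ennreal (\<bar>y\<bar> powr (\<gamma> - 1))) * indicator {-1..1} y \<partial>lborel)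
      \<le> (\<integral>\<^sup>+y. ennreal (k y + k (- y)) \<partial>lborel)"
  proof (rule nn_integral_mono_AE)
    show "AE y in lborel. (if y = 0 then \<infinity> else ennreal (\<bar>y\<bar> powr (\<gamma> - 1))) * indicator {-1..1} y \<le> ennreal (k y + k (- y))"
      using AE_lborel_singleton[of 0]
    proof eventually_elim
      fix y :: real assume "y \<noteq> 0"
      then show "(if y = 0 then \<infinity> else ennreal (\<bar>y\<bar> powr (\<gamma> - 1))) * indicator {-1..1} y \<le> ennreal (k y + k (- y))"
        by (cases "y > 0") (auto simp: k_def indicator_def)
    qed
  qed
  also have "\<dots> = ennreal (\<integral>y. k y + k (- y) \<partial>lborel)"
    using k k' by (intro nn_integral_eq_integral Bochner_Integration.integrable_add) (auto simp: k_def)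
  also have "\<dots> < \<infinity>" by simp
  finally show ?thesis .
qed

text \<open>
Since |x_i| |x_j| \<le> x_i^2 + x_j^2, the weight is at most |x_i|^(\<gamma>-1) |x_j|^(\<gamma>-1), a product of
functions of one coordinate each.
\<close>

lemma integrable_weight:
  fixes i j :: "'n::finite"
  assumes \<gamma>: "0 < \<gamma>" "\<gamma> \<le> 1" and ij: "i \<noteq> j"
  shows "integrable lborel (\<lambda>x :: real^'n. ((x $ i)\<^sup>2 + (x $ j)\<^sup>2) powr (\<gamma> - 1) * indicator (cball 0 1) x)"
proof (rule integrableI_bounded)
  let ?w = "\<lambda>x :: real^'n. ((x $ i)\<^sup>2 + (x $ j)\<^sup>2) powr (\<gamma> - 1) * indicator (cball 0 1) x"
  \<comment> \<open>the value at 0 is infinite, so that the comparison with the product also holds where x_i = 0 or x_j = 0;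
       there the factor 0 powr (\<gamma> - 1) would be 0\<close>
  define e1 where "e1 = (\<lambda>y::real. (if y = 0 then \<infinity> else ennreal (\<bar>y\<bar> powr (\<gamma> - 1))) * indicator {-1..1} y)"
  define e2 where "e2 = (\<lambda>y::real. indicator {-1..1} y :: ennreal)"
  define f where "f = (\<lambda>b :: real^'n. if b = axis i 1 \<or> b = axis j 1 then e1 else e2)"
  have xm: "(\<lambda>x :: real^'n. x $ k) \<in> borel_measurable borel" for k
    by (intro borel_measurable_continuous_onI continuous_intros)
  have "(\<lambda>x :: real^'n. ((x $ i)\<^sup>2 + (x $ j)\<^sup>2) powr (\<gamma> - 1)) \<in> borel_measurable lborel"
    using xm[of i] xm[of j] by measurable
  then show "?w \<in> borel_measurable lborel" by (intro borel_measurable_times borel_measurable_indicator) auto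
  have "(\<integral>\<^sup>+x. ennreal (norm (?w x)) \<partial>lborel) \<le> (\<integral>\<^sup>+x. (\<Prod>b\<in>Basis. f b (x \<bullet> b)) \<partial>lborel)"
  proof (rule nn_integral_mono)
    fix x :: "real^'n"
    show "ennreal (norm (?w x)) \<le> (\<Prod>b\<in>Basis. f b (x \<bullet> b))"
    proof (cases "norm x \<le> 1")
      case True
      have c: "\<bar>x $ k\<bar> \<le> 1" for k using component_le_norm_cart[of x k] True by linarith
      have ax: "(axis i 1 :: real^'n) \<in> Basis" "(axis j 1 :: real^'n) \<in> Basis - {axis i 1}"
        using ij by (auto simp: Basis_vec_def axis_eq_axis)
      have "(\<Prod>b\<in>Basis. f b (x \<bullet> b)) = f (axis i 1) (x \<bullet> axis i 1) * (f (axis j 1) (x \<bullet> axis j 1) * (\<Prod>b\<in>Basis - {axis i 1} - {axis j 1}. f b (x \<bullet> b)))"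
        using prod.remove[OF finite_Basis ax(1), of "\<lambda>b. f b (x \<bullet> b)"] prod.remove[OF finite_Diff[OF finite_Basis] ax(2), of "\<lambda>b. f b (x \<bullet> b)"] by simp
      also have "(\<Prod>b\<in>Basis - {axis i 1} - {axis j 1}. f b (x \<bullet> b)) = 1"
      proof (rule prod.neutral, rule ballI)
        fix b :: "real^'n" assume b: "b \<in> Basis - {axis i 1} - {axis j 1}"
        then obtain k where "b = axis k 1" by (auto simp: Basis_vec_def)
        then show "f b (x \<bullet> b) = 1" using b c[of k] by (auto simp: f_def e2_def inner_axis abs_le_iff)
      qed
      finally have P: "(\<Prod>b\<in>Basis. f b (x \<bullet> b)) = e1 (x $ i) * e1 (x $ j)"
        by (simp add: f_def inner_axis)
      show ?thesis
      proof (cases "x $ i = 0 \<or> x $ j = 0")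
        case True
        then have "e1 (x $ i) * e1 (x $ j) = \<infinity>"
        proof -
          have nz: "e1 y \<noteq> 0" if "\<bar>y\<bar> \<le> 1" for y using that by (auto simp: e1_def abs_le_iff)
          have inf: "e1 0 = \<infinity>" by (simp add: e1_def)
          show ?thesis using True nz[OF c[of i]] nz[OF c[of j]] inf by (auto simp: ennreal_top_mult ennreal_mult_top)
        qed
        then show ?thesis by (simp add: P)
      next
        case False
        have "0 < \<bar>x $ i\<bar> * \<bar>x $ j\<bar>" using False by simp
        moreover have "\<bar>x $ i\<bar> * \<bar>x $ j\<bar> \<le> (x $ i)\<^sup>2 + (x $ j)\<^sup>2"
          using sum_squares_bound[of "\<bar>x $ i\<bar>" "\<bar>x $ j\<bar>"] calculation
          unfolding power2_abs mult.assoc by linarith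
        ultimately have "((x $ i)\<^sup>2 + (x $ j)\<^sup>2) powr (\<gamma> - 1) \<le> (\<bar>x $ i\<bar> * \<bar>x $ j\<bar>) powr (\<gamma> - 1)"
          using \<gamma> by (intro powr_mono2') auto
        also have "\<dots> = \<bar>x $ i\<bar> powr (\<gamma> - 1) * \<bar>x $ j\<bar> powr (\<gamma> - 1)" by (simp add: powr_mult)
        finally show ?thesis using False True c[of i] c[of j] unfolding P
          by (simp add: e1_def abs_le_iff ennreal_mult'[symmetric] ennreal_leI)
      qed
    qed simp
  qed
  also have "\<dots> = (\<Prod>b\<in>Basis. \<integral>\<^sup>+y. f b y \<partial>lborel)"
  proof (rule nn_integral_lborel_prod)
    have "e1 \<in> borel_measurable borel" "e2 \<in> borel_measurable borel" unfolding e1_def e2_def by measurable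
    then show "f b \<in> borel_measurable borel" for b by (simp add: f_def)
  qed simp
  also have "\<dots> < \<infinity>"
  proof -
    have "(\<integral>\<^sup>+y. e1 y \<partial>lborel) < \<infinity>" unfolding e1_def by (rule nn_integral_weight_1d[OF \<gamma>(1)])
    moreover have "(\<integral>\<^sup>+y. e2 y \<partial>lborel) < \<infinity>" by (simp add: e2_def)
    ultimately have "(\<integral>\<^sup>+y. f b y \<partial>lborel) < \<infinity>" for b by (simp add: f_def)
    then have fin: "(\<integral>\<^sup>+y. f b y \<partial>lborel) < \<infinity>" for b by blast
    have "(\<Prod>b\<in>I. \<integral>\<^sup>+y. f b y \<partial>lborel) < \<infinity>" for I
      by (induction I rule: infinite_finite_induct) (use fin in \<open>auto simp: ennreal_mult_less_top\<close>)
    then show ?thesis .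
  qed
  finally show "(\<integral>\<^sup>+x. ennreal (norm (?w x)) \<partial>lborel) < \<infinity>" .
qed

section \<open>Classical solutions are solutions\<close>

lemma continuous_I01_measurable:
  fixes f :: "real \<Rightarrow> 'b::real_normed_vector"
  assumes "continuous_on {0<..<1} f" shows "f \<in> borel_measurable I01"
proof -
  have "sets I01 = sets (restrict_space borel {0<..<1::real})" by (simp add: sets_restrict_space)
  then show ?thesis using borel_measurable_continuous_on_restrict[OF assms] measurable_cong_sets by blast
qed

lemma integrable_I01_const: "integrable I01 (\<lambda>t. c :: real)"
proof -
  have "indicator {0<..<1} t *\<^sub>R c = c * indicator {0<..<1} t" for t :: real by simp
  moreover have "integrable lborel (\<lambda>t::real. c * indicator {0<..<1} t)" by (intro integrable_mult_right integrable_real_indicator) auto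
  ultimately show ?thesis unfolding I01_integrable_iff by (simp only:)
qed

lemma bochner_L2_I01_dominated:
  fixes f :: "real \<Rightarrow> 'b::{banach, second_countable_topology}" and k :: "real \<Rightarrow> real"
  assumes f: "f \<in> borel_measurable I01" and k: "integrable I01 k" "\<And>t. t \<in> {0<..<1} \<Longrightarrow> (norm (f t))\<^sup>2 \<le> k t"
  shows "f \<in> bochner_L2 I01"
proof -
  have "(\<lambda>t. (norm (f t))\<^sup>2) \<in> borel_measurable I01" using f by measurable
  moreover have "AE t in I01. norm ((norm (f t))\<^sup>2) \<le> norm (k t)"
    unfolding I01_AE_iff using k(2) by (auto intro!: AE_I2 order_trans[OF k(2)])
  ultimately have "integrable I01 (\<lambda>t. (norm (f t))\<^sup>2)" by (rule Bochner_Integration.integrable_bound[OF k(1)])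
  then show ?thesis using f by (simp add: bochner_L2_def)
qed

lemma measurable_indicator_scaleR_subset:
  fixes g :: "real \<Rightarrow> 'b::{banach, second_countable_topology}"
  assumes g: "(\<lambda>t. indicator T t *\<^sub>R g t) \<in> borel_measurable lborel" and S: "S \<subseteq> T" "S \<in> sets borel"
  shows "(\<lambda>t. indicator S t *\<^sub>R g t) \<in> borel_measurable lborel"
proof -
  have "indicator S t *\<^sub>R g t = indicator S t *\<^sub>R (indicator T t *\<^sub>R g t)" for t
    using S(1) by (cases "t \<in> S") auto
  moreover have "(\<lambda>t. indicator S t *\<^sub>R (indicator T t *\<^sub>R g t)) \<in> borel_measurable lborel"
    by (rule borel_measurable_scaleR[OF borel_measurable_indicator g]) (use S(2) in simp)
  ultimately show ?thesis by presburger
qed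

lemma set_integral_interval_limit:
  fixes g :: "real \<Rightarrow> 'b::{banach, second_countable_topology}"
  assumes g: "integrable lborel (\<lambda>t. indicator {0<..<1} t *\<^sub>R g t)"
    and ab: "a \<longlonglongrightarrow> a0" "b \<longlonglongrightarrow> b0" and r: "\<And>n. 0 \<le> a n" "\<And>n. b n \<le> 1"
  shows "(\<lambda>n. \<integral>t. indicator {a n<..<b n} t *\<^sub>R g t \<partial>lborel) \<longlonglongrightarrow> (\<integral>t. indicator {a0<..<b0} t *\<^sub>R g t \<partial>lborel)"
proof (rule integral_dominated_convergence[where w = "\<lambda>t. norm (indicator {0<..<1} t *\<^sub>R g t)"])
  have r0: "0 \<le> a0" "b0 \<le> 1" using LIMSEQ_le_const[OF ab(1)] LIMSEQ_le_const2[OF ab(2)] r by blast+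
  note m = measurable_indicator_scaleR_subset[OF borel_measurable_integrable[OF g]]
  show "(\<lambda>t. indicator {a0<..<b0} t *\<^sub>R g t) \<in> borel_measurable lborel" by (rule m) (use r0 in auto)
  show "(\<lambda>t. indicator {a n<..<b n} t *\<^sub>R g t) \<in> borel_measurable lborel" for n
  proof (rule m)
    show "{a n<..<b n} \<subseteq> {0<..<1}" using r(1)[of n] r(2)[of n] by auto
  qed simp
  show "integrable lborel (\<lambda>t. norm (indicator {0<..<1} t *\<^sub>R g t))" using g by (rule integrable_norm)
  show "AE t in lborel. norm (indicator {a n<..<b n} t *\<^sub>R g t) \<le> norm (indicator {0<..<1} t *\<^sub>R g t)" for n
    using r(1)[of n] r(2)[of n] by (intro AE_I2) (auto simp: indicator_def)
  show "AE t in lborel. (\<lambda>n. indicator {a n<..<b n} t *\<^sub>R g t) \<longlonglongrightarrow> indicator {a0<..<b0} t *\<^sub>R g t"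
    using AE_lborel_singleton[of a0] AE_lborel_singleton[of b0]
  proof eventually_elim
    fix t assume t: "t \<noteq> a0" "t \<noteq> b0"
    have "\<forall>\<^sub>F n in sequentially. (a n < t) = (a0 < t)"
      using t order_tendstoD[OF ab(1), of t] by (cases "a0 < t") (auto elim!: eventually_mono)
    moreover have "\<forall>\<^sub>F n in sequentially. (t < b n) = (t < b0)"
      using t order_tendstoD[OF ab(2), of t] by (cases "t < b0") (auto elim!: eventually_mono)
    ultimately have "\<forall>\<^sub>F n in sequentially. indicator {a n<..<b n} t *\<^sub>R g t = indicator {a0<..<b0} t *\<^sub>R g t"
      by eventually_elim (auto simp: indicator_def)
    then show "(\<lambda>n. indicator {a n<..<b n} t *\<^sub>R g t) \<longlonglongrightarrow> indicator {a0<..<b0} t *\<^sub>R g t" by (rule tendsto_eventually)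
  qed
qed

text \<open>
A function that solves the equation classically on the open interval is a solution up to both ends as soon as
its H1 norm is square integrable and it vanishes in L2 as t tends to 0.  The continuous
representative in the antidual is the primitive of its time derivative; this covers t = 1, where u itself
may blow up in H1.
\<close>

lemma is_solution_if_classical:
  fixes B :: "real \<Rightarrow> real^'n::finite \<Rightarrow> complex^'n^'n" and u :: "real \<Rightarrow> 'n h1" and f w' :: "real \<Rightarrow> (real^'n) l2"
  assumes ell: "elliptic B"
    and u: "continuous_on {0<..<1} u" and k: "integrable I01 k" "\<And>t. t \<in> {0<..<1} \<Longrightarrow> (norm (u t))\<^sup>2 \<le> k t"
    and d: "\<And>t. t \<in> {0<..<1} \<Longrightarrow> ((\<lambda>t. h1_l2 (u t)) has_vector_derivative w' t) (at t)" and w': "continuous_on {0<..<1} w'"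
    and f: "continuous_on {0<..<1} f" "\<And>t. t \<in> {0<..<1} \<Longrightarrow> norm (f t) \<le> K"
    and pde: "\<And>t. t \<in> {0<..<1} \<Longrightarrow> div_op (B t) (u t) + l2_antidual (f t) = l2_antidual (w' t)"
    and ini: "\<And>t. t \<in> {0<..<1} \<Longrightarrow> norm (h1_l2 (u t)) \<le> C * t"
  shows "is_solution B (\<lambda>t. l2_antidual (f t)) u"
proof -
  define g where "g = (\<lambda>t. l2_antidual (w' t) :: 'n h1 antidual)"
  define V where "V = (\<lambda>t. l2_antidual (h1_l2 (u t)) :: 'n h1 antidual)"
  define F where "F = (\<lambda>t. l2_antidual (f t) :: 'n h1 antidual)"
  define D where "D = (\<lambda>t. div_op (B t) (u t))"
  note J = bounded_linear_riesz riesz_eq_0_imp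
  note e = bounded_linear_l2_antidual
  have gc: "continuous_on {0<..<1} g" unfolding g_def by (rule bounded_linear.continuous_on[OF e w'])
  have Fc: "continuous_on {0<..<1} F" unfolding F_def by (rule bounded_linear.continuous_on[OF e f(1)])
  have Vd: "(V has_vector_derivative g t) (at t)" if "t \<in> {0<..<1}" for t
    unfolding V_def g_def by (rule bounded_linear.has_vector_derivative[OF e d[OF that]])
  have Vc: "continuous_on {0<..<1} V"
    by (intro continuous_at_imp_continuous_on ballI has_vector_derivative_continuous[OF Vd])
  have DF: "g t = D t + F t" if "t \<in> {0<..<1}" for t using pde[OF that] by (simp add: g_def D_def F_def)
  obtain \<Lambda> where L: "\<Lambda> > 0" "\<And>t x \<xi>. t \<in> {0..1} \<Longrightarrow> norm (B t x *v \<xi>) \<le> \<Lambda> * norm \<xi>"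
    using ell unfolding elliptic_def by blast
  have Dn: "norm (D t) \<le> \<Lambda> * norm (u t)" if "t \<in> {0<..<1}" for t
    unfolding D_def by (rule div_op_bounds(3)) (use that L in \<open>auto intro!: elliptic_slice_measurable[OF ell]\<close>)
  have Fn: "norm (F t) \<le> K" if "t \<in> {0<..<1}" for t
    unfolding F_def using norm_l2_antidual[of "f t"] f(2)[OF that] by linarith
  note ci = integrable_I01_const
  have uL: "u \<in> bochner_L2 I01" by (rule bochner_L2_I01_dominated[OF continuous_I01_measurable[OF u] k])
  have gL: "g \<in> bochner_L2 I01"
  proof (rule bochner_L2_I01_dominated[OF continuous_I01_measurable[OF gc]])
    show "integrable I01 (\<lambda>t. 2 * \<Lambda>\<^sup>2 * k t + 2 * K\<^sup>2)" by (intro Bochner_Integration.integrable_add integrable_mult_right k ci)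
    show "(norm (g t))\<^sup>2 \<le> 2 * \<Lambda>\<^sup>2 * k t + 2 * K\<^sup>2" if t: "t \<in> {0<..<1}" for t
    proof -
      have "norm (g t) \<le> \<Lambda> * norm (u t) + K"
        unfolding DF[OF t] using norm_triangle_ineq[of "D t" "F t"] Dn[OF t] Fn[OF t] by linarith
      then have "(norm (g t))\<^sup>2 \<le> (\<Lambda> * norm (u t) + K)\<^sup>2" by (rule power_mono) simp
      also have "\<dots> \<le> 2 * (\<Lambda> * norm (u t))\<^sup>2 + 2 * K\<^sup>2"
        using sum_squares_bound[of "\<Lambda> * norm (u t)" K] by (simp add: power2_sum)
      also have "\<dots> \<le> 2 * \<Lambda>\<^sup>2 * k t + 2 * K\<^sup>2"
        using mult_left_mono[OF k(2)[OF t], of "2 * \<Lambda>\<^sup>2"] by (simp add: power_mult_distrib)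
      finally show ?thesis .
    qed
  qed
  have VL: "V \<in> bochner_L2 I01"
  proof (rule bochner_L2_I01_dominated[OF continuous_I01_measurable[OF Vc] ci[of "C\<^sup>2"]])
    show "(norm (V t))\<^sup>2 \<le> C\<^sup>2" if t: "t \<in> {0<..<1}" for t
    proof -
      have "norm (V t) \<le> C * t" unfolding V_def using norm_l2_antidual[of "h1_l2 (u t)"] ini[OF t] by linarith
      then have a: "norm (V t) \<le> C * t" "0 \<le> C * t" using norm_ge_zero[of "V t"] by linarith+
      then have "0 \<le> C" using t by (simp add: zero_le_mult_iff)
      then have "norm (V t) \<le> C" using t a(1) mult_left_mono[of t 1 C] by auto
      then show ?thesis by (rule power_mono) simp
    qed
  qed
  have VH: "V \<in> sobolev_H1"
    unfolding sobolev_H1_def using VL gL classical_weak_derivative[OF J Vd gc] by blast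
  have FL: "F \<in> bochner_L2 I01"
    by (rule bochner_L2_I01_dominated[OF continuous_I01_measurable[OF Fc] ci[of "K\<^sup>2"]]) (intro power_mono Fn norm_ge_zero)
  note gi = bochner_L2_integrable(1)[OF gL] and Fi = bochner_L2_integrable(1)[OF FL]
  have Di: "integrable lborel (\<lambda>t. indicator {0<..<1} t *\<^sub>R D t)"
  proof -
    have "indicator {0<..<1} t *\<^sub>R D t = indicator {0<..<1} t *\<^sub>R g t - indicator {0<..<1} t *\<^sub>R F t" for t
      using DF[of t] by (cases "t \<in> {0<..<1}") simp_all
    then show ?thesis using gi Fi by simp
  qed
  define U where "U = (\<lambda>t. \<integral>\<tau>. indicator {0<..<t} \<tau> *\<^sub>R g \<tau> \<partial>lborel)"
  have sub: "integrable lborel (\<lambda>\<tau>. indicator {0<..<t} \<tau> *\<^sub>R h \<tau>)"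
    if t: "t \<in> {0..1}" and h: "integrable lborel (\<lambda>t. indicator {0<..<1} t *\<^sub>R h t)" for t and h :: "real \<Rightarrow> 'n h1 antidual"
  proof -
    have "integrable lborel (\<lambda>\<tau>. indicator {0<..<t} \<tau> *\<^sub>R (indicator {0<..<1} \<tau> *\<^sub>R h \<tau>))"
      by (rule integrable_mult_indicator[OF _ h]) simp
    moreover have "indicator {0<..<t} \<tau> *\<^sub>R (indicator {0<..<1} \<tau> *\<^sub>R h \<tau>) = indicator {0<..<t} \<tau> *\<^sub>R h \<tau>" for \<tau>
      using t by (cases "\<tau> \<in> {0<..<t}") simp_all
    ultimately show ?thesis by (simp only:)
  qed
  have Uc: "continuous_on {0..1} U"
    unfolding continuous_on_sequentially comp_def U_def
  proof (intro allI ballI impI, elim conjE)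
    fix x and a assume "a \<in> {0..1::real}" "\<forall>n. x n \<in> {0..1}" "x \<longlonglongrightarrow> a"
    then show "(\<lambda>n. \<integral>\<tau>. indicator {0<..<x n} \<tau> *\<^sub>R g \<tau> \<partial>lborel) \<longlonglongrightarrow> (\<integral>\<tau>. indicator {0<..<a} \<tau> *\<^sub>R g \<tau> \<partial>lborel)"
      by (intro set_integral_interval_limit gi) auto
  qed
  have UV: "U t = V t" if t: "t \<in> {0<..<1}" for t
  proof -
    define \<epsilon> where "\<epsilon> = (\<lambda>n. t / real (Suc n))"
    have \<epsilon>: "0 < \<epsilon> n" "\<epsilon> n \<le> t" for n using t by (auto simp: \<epsilon>_def field_simps)
    have \<epsilon>0: "\<epsilon> \<longlonglongrightarrow> 0" unfolding \<epsilon>_def divide_inverse by (rule tendsto_mult_right_zero[OF LIMSEQ_inverse_real_of_nat])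
    have i: "(\<integral>\<tau>. indicator {\<epsilon> n<..<t} \<tau> *\<^sub>R g \<tau> \<partial>lborel) = V t - V (\<epsilon> n)" for n
    proof -
      have s: "{\<epsilon> n..t} \<subseteq> {0<..<1}" using \<epsilon>(1)[of n] t by auto
      have "(\<integral>\<tau>. indicator {\<epsilon> n<..<t} \<tau> *\<^sub>R g \<tau> \<partial>lborel) = (\<integral>\<tau>. indicator {\<epsilon> n..t} \<tau> *\<^sub>R g \<tau> \<partial>lborel)"
      proof (rule integral_cong_AE)
        note mg = measurable_indicator_scaleR_subset[OF borel_measurable_integrable[OF gi]]
        show "(\<lambda>\<tau>. indicator {\<epsilon> n<..<t} \<tau> *\<^sub>R g \<tau>) \<in> borel_measurable lborel" by (rule mg) (use s in auto)
        show "(\<lambda>\<tau>. indicator {\<epsilon> n..t} \<tau> *\<^sub>R g \<tau>) \<in> borel_measurable lborel" by (rule mg) (use s in auto)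
        show "AE \<tau> in lborel. indicator {\<epsilon> n<..<t} \<tau> *\<^sub>R g \<tau> = indicator {\<epsilon> n..t} \<tau> *\<^sub>R g \<tau>"
          using AE_lborel_singleton[of "\<epsilon> n"] AE_lborel_singleton[of t]
          by eventually_elim (auto simp: indicator_def)
      qed
      also have "\<dots> = V t - V (\<epsilon> n)"
        by (rule bochner_FTC(2)[OF J \<epsilon>(2)]) (use s Vd continuous_on_subset[OF gc s] in auto)
      finally show ?thesis .
    qed
    have "(\<lambda>n. V (\<epsilon> n)) \<longlonglongrightarrow> 0"
    proof (rule Lim_null_comparison)
      show "\<forall>\<^sub>F n in sequentially. norm (V (\<epsilon> n)) \<le> C * \<epsilon> n"
      proof (intro always_eventually allI)
        fix n
        show "norm (V (\<epsilon> n)) \<le> C * \<epsilon> n" unfolding V_def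
          using norm_l2_antidual[of "h1_l2 (u (\<epsilon> n))"] ini[of "\<epsilon> n"] \<epsilon>[of n] t by force
      qed
      show "(\<lambda>n. C * \<epsilon> n) \<longlonglongrightarrow> 0" using tendsto_mult_right_zero[OF \<epsilon>0] .
    qed
    then have "(\<lambda>n. V t - V (\<epsilon> n)) \<longlonglongrightarrow> V t - 0" by (intro tendsto_diff tendsto_const)
    moreover have "(\<lambda>n. V t - V (\<epsilon> n)) \<longlonglongrightarrow> U t"
      unfolding i[symmetric] U_def by (rule set_integral_interval_limit[OF gi \<epsilon>0 tendsto_const]) (use \<epsilon> t in \<open>auto intro: less_imp_le\<close>)
    ultimately show ?thesis using LIMSEQ_unique by fastforce
  qed
  have eq: "U t - (\<integral>\<tau>. indicator {0<..<t} \<tau> *\<^sub>R D \<tau> \<partial>lborel) = (\<integral>\<tau>. indicator {0<..<t} \<tau> *\<^sub>R F \<tau> \<partial>lborel)" if t: "t \<in> {0..1}" for t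
  proof -
    have "U t = (\<integral>\<tau>. indicator {0<..<t} \<tau> *\<^sub>R D \<tau> + indicator {0<..<t} \<tau> *\<^sub>R F \<tau> \<partial>lborel)"
      unfolding U_def by (intro Bochner_Integration.integral_cong refl) (use t DF in \<open>auto simp: indicator_def\<close>)
    then show ?thesis using Bochner_Integration.integral_add[OF sub[OF t Di] sub[OF t Fi]] by simp
  qed
  show ?thesis unfolding is_solution_def
  proof (intro conjI exI[of _ U] uL Uc)
    show "(\<lambda>t. l2_antidual (h1_l2 (u t)) :: 'n h1 antidual) \<in> sobolev_H1" using VH by (simp add: V_def)
    show "set_integrable lborel {0<..<1} (\<lambda>\<tau>. div_op (B \<tau>) (u \<tau>))" using Di by (simp add: set_integrable_def D_def)
    show "AE t in I01. U t = l2_antidual (h1_l2 (u t))" unfolding I01_AE_iff using UV by (auto simp: V_def)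
    show "\<forall>t\<in>{0..1}. U t - (LINT \<tau>:{0<..<t}|lborel. div_op (B \<tau>) (u \<tau>)) = (LINT \<tau>:{0<..<t}|lborel. l2_antidual (f \<tau>))"
      using eq unfolding set_lebesgue_integral_def D_def F_def by blast
  qed
qed

section \<open>The coefficient matrix\<close>

locale concentrating_profile =
  fixes \<gamma> :: real and i j :: "'n::finite"
  assumes \<gamma>: "0 < \<gamma>" "\<gamma> \<le> 1 / 8" and ij: "i \<noteq> j"
begin

text \<open>
The constants: \<l> is small against \<gamma>, so that the term \<gamma> A in the bound for \<mu> absorbs 2 \<l> A;
\<c> is small against \<l> \<gamma>, the size of that term where \<sigma> is at least comparable to \<l> s; and \<d> is
small against \<c>, so that the radial diffusion costs nothing in \<mu>.
\<close>

definition "\<l> = \<gamma> / 4"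
definition "\<c> = \<l> * \<gamma> / 64"
definition "\<d> = \<c> / 100"

text \<open>
log_deriv is the logarithmic derivative of the profile in \<sigma>, and log_rate the one in t = 1 - s; 1 + \<kappa> is
the radial logarithmic derivative of z prof; q is the prescribed radial component of the flux,
relative to z prof; q' its derivative in \<sigma>; and \<b> the rotational component that the equation then demands.
\<close>

definition "prof s \<sigma> = (\<sigma> + s) * (\<sigma> + \<l> * s) powr (\<gamma> - 2)"
definition "log_deriv s \<sigma> = 1 / (\<sigma> + s) - (2 - \<gamma>) / (\<sigma> + \<l> * s)"
definition "log_rate s \<sigma> = (2 - \<gamma>) * \<l> / (\<sigma> + \<l> * s) - 1 / (\<sigma> + s)"
definition "\<kappa> s \<sigma> = 2 * \<sigma> * log_deriv s \<sigma>"
definition "q s \<sigma> = \<sigma> / (4 * (\<sigma> + s)) + \<c> / 2"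
definition "q' s \<sigma> = s / (4 * (\<sigma> + s)\<^sup>2)"
definition "\<b> s \<sigma> = q s \<sigma> + 2 * \<sigma> * (q' s \<sigma> + q s \<sigma> * log_deriv s \<sigma>) - \<sigma> * log_rate s \<sigma>"
definition "\<beta> s \<sigma> = q s \<sigma> - \<d> * (1 + \<kappa> s \<sigma>)"
definition "\<mu> s \<sigma> = \<b> s \<sigma> + \<beta> s \<sigma> * (1 + \<kappa> s \<sigma>)"

lemma params: "0 < \<l>" "\<l> \<le> 1 / 32" "0 < \<c>" "\<c> \<le> 1 / 64" "0 < \<d>" "\<d> \<le> 1 / 64" "\<gamma> = 4 * \<l>"
  "\<l> * \<gamma> = 64 * \<c>" "\<c> = 100 * \<d>"
proof -
  have "\<l> * \<gamma> \<le> 1 * 1" using \<gamma> by (intro mult_mono) (auto simp: \<l>_def)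
  then show "\<c> \<le> 1 / 64" by (simp add: \<c>_def)
  then show "\<d> \<le> 1 / 64" using \<gamma> by (simp add: \<d>_def \<c>_def \<l>_def)
qed (use \<gamma> in \<open>auto simp: \<l>_def \<c>_def \<d>_def\<close>)

text \<open>
Everything depends only on A = \<sigma>/(\<sigma>+s) and b = \<sigma>/(\<sigma>+\<l>s), which lie in (0,1] and satisfy
b A + \<l> b = A + \<l> A b.  This relation eliminates the products and leaves
\<mu> = \<c> (1+\<kappa>) + A^2/2 + A (\<gamma> - (2-\<gamma>) \<l> b) - \<d> (1+\<kappa>)^2.
If b \<le> 1/8 then 1 + \<kappa> \<ge> 1/2 and the first term is positive; otherwise A is at least \<l>/8 and the third
term, which is at least A \<gamma>/2, dominates.
\<close>

lemma coefficient_bounds: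
  assumes s: "0 \<le> s" and \<sigma>: "0 < \<sigma>"
  shows "\<bar>1 + \<kappa> s \<sigma>\<bar> \<le> 3" "\<bar>q s \<sigma>\<bar> \<le> 1" "\<bar>\<beta> s \<sigma>\<bar> \<le> 2" "\<c> / 4 \<le> \<mu> s \<sigma>" "\<mu> s \<sigma> \<le> 2"
proof -
  define A where "A = \<sigma> / (\<sigma> + s)"
  define b where "b = \<sigma> / (\<sigma> + \<l> * s)"
  have pos: "\<sigma> + s > 0" "\<sigma> + \<l> * s > 0" using s \<sigma> params by (auto intro: add_pos_nonneg)
  have A: "0 < A" "A \<le> 1" and b: "0 < b" "b \<le> 1"
    using s \<sigma> params pos by (auto simp: A_def b_def)
  have k: "\<kappa> s \<sigma> = 2 * A - (4 - 2 * \<gamma>) * b"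
    by (simp add: \<kappa>_def log_deriv_def A_def b_def diff_divide_distrib algebra_simps)
  have ql: "q s \<sigma> = A / 4 + \<c> / 2" by (simp add: q_def A_def)
  have q': "2 * \<sigma> * q' s \<sigma> = A * (1 - A) / 2"
  proof -
    have "1 - A = s / (\<sigma> + s)" using pos by (simp add: A_def field_simps)
    then show ?thesis by (simp add: q'_def A_def power2_eq_square)
  qed
  have r: "\<sigma> * log_rate s \<sigma> = (2 - \<gamma>) * \<l> * b - A"
    by (simp add: log_rate_def A_def b_def diff_divide_distrib algebra_simps)
  have Ab: "b * A + \<l> * b = A + A * \<l> * b"
    unfolding A_def b_def using pos by (simp add: divide_simps) (simp add: algebra_simps)
  define D where "D = \<c> * (1 + \<kappa> s \<sigma>) + A\<^sup>2 / 2 + A * (\<gamma> - (2 - \<gamma>) * \<l> * b)"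
  have D: "\<b> s \<sigma> + q s \<sigma> * (1 + \<kappa> s \<sigma>) = D"
  proof -
    have "2 * \<sigma> * (q' s \<sigma> + q s \<sigma> * log_deriv s \<sigma>) = A * (1 - A) / 2 + q s \<sigma> * \<kappa> s \<sigma>"
      by (simp add: distrib_left q'[symmetric] \<kappa>_def)
    then have "\<b> s \<sigma> = q s \<sigma> + (A * (1 - A) / 2 + q s \<sigma> * \<kappa> s \<sigma>) - ((2 - \<gamma>) * \<l> * b - A)"
      by (simp only: \<b>_def r)
    then have "\<b> s \<sigma> + q s \<sigma> * (1 + \<kappa> s \<sigma>) - D = (2 - \<gamma>) * ((A + A * \<l> * b) - (b * A + \<l> * b))"
      unfolding D_def k ql by (simp add: power2_eq_square field_simps)
    then show ?thesis by (simp add: Ab)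
  qed
  have gb: "0 \<le> \<gamma> * b" "\<gamma> * b \<le> b" using \<gamma> b by (auto simp: mult_le_cancel_right1)
  have "\<kappa> s \<sigma> = 2 * A - 4 * b + 2 * (\<gamma> * b)" by (simp add: k algebra_simps)
  then have kb: "- 4 * b \<le> \<kappa> s \<sigma>" "\<kappa> s \<sigma> \<le> 2" using A gb b by linarith+
  show k3: "\<bar>1 + \<kappa> s \<sigma>\<bar> \<le> 3" using kb b by linarith
  show "\<bar>q s \<sigma>\<bar> \<le> 1" using A params(3,4) by (simp add: ql)
  have lb: "0 \<le> (2 - \<gamma>) * \<l> * b" "(2 - \<gamma>) * \<l> * b \<le> 2 * \<l>"
  proof -
    show "0 \<le> (2 - \<gamma>) * \<l> * b" using \<gamma> params b by simp
    have "(2 - \<gamma>) * (\<l> * b) \<le> 2 * (\<l> * 1)" using \<gamma> params b by (intro mult_mono) auto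
    then show "(2 - \<gamma>) * \<l> * b \<le> 2 * \<l>" by simp
  qed
  have ck: "\<bar>\<c> * (1 + \<kappa> s \<sigma>)\<bar> \<le> 3 * \<c>"
    using mult_left_mono[OF k3, of \<c>] params(3) by (simp add: abs_mult)
  have Ag: "A * (\<gamma> / 2) \<le> A * (\<gamma> - (2 - \<gamma>) * \<l> * b)"
    using lb params(7) A by (intro mult_left_mono) auto
  have Dlow: "\<c> / 2 \<le> D"
  proof (cases "b \<le> 1 / 8")
    case True
    then have "1 / 2 \<le> 1 + \<kappa> s \<sigma>" using kb by linarith
    from mult_left_mono[OF this, of \<c>] have "\<c> / 2 \<le> \<c> * (1 + \<kappa> s \<sigma>)" using params(3) by simp
    moreover have "0 \<le> A * (\<gamma> / 2)" using A \<gamma> by auto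
    moreover have "0 \<le> A\<^sup>2 / 2" by simp
    ultimately show ?thesis using Ag unfolding D_def by linarith
  next
    case False
    then have "\<l> * s \<le> 7 * \<sigma>" using pos by (simp add: b_def field_simps)
    moreover have "\<l> * \<sigma> \<le> \<sigma>" using params \<sigma> by (simp add: mult_le_cancel_right1)
    ultimately have "\<l> * (\<sigma> + s) \<le> 8 * \<sigma>" by (simp add: distrib_left)
    then have "\<l> / 8 \<le> A" using pos by (simp add: A_def field_simps)
    then have "\<l> / 8 * (\<gamma> / 2) \<le> A * (\<gamma> / 2)" using \<gamma> by (intro mult_right_mono) auto
    then have "4 * \<c> \<le> A * (\<gamma> / 2)" using params(8) by simp
    moreover have "0 \<le> A\<^sup>2 / 2" by simp
    ultimately show ?thesis using Ag ck params(3) unfolding D_def by linarith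
  qed
  have Dup: "D \<le> 3 / 2"
  proof -
    have "A\<^sup>2 \<le> 1" using A by (simp add: power_le_one)
    moreover have "A * (\<gamma> - (2 - \<gamma>) * \<l> * b) \<le> 1 * \<gamma>"
    proof (rule mult_mono)
      show "\<gamma> - (2 - \<gamma>) * \<l> * b \<le> \<gamma>" "0 \<le> \<gamma> - (2 - \<gamma>) * \<l> * b"
        using lb params(7,1) by linarith+
    qed (use A in auto)
    ultimately show ?thesis using ck params(3,4) \<gamma> unfolding D_def by linarith
  qed
  have dk: "\<bar>\<d> * (1 + \<kappa> s \<sigma>)\<bar> \<le> 3 * \<d>"
    using mult_left_mono[OF k3, of \<d>] params(5) by (simp add: abs_mult)
  show "\<bar>\<beta> s \<sigma>\<bar> \<le> 2" using dk \<open>\<bar>q s \<sigma>\<bar> \<le> 1\<close> params(6) unfolding \<beta>_def by linarith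
  have m: "\<mu> s \<sigma> = D - \<d> * (1 + \<kappa> s \<sigma>)\<^sup>2"
    unfolding \<mu>_def \<beta>_def D[symmetric] by (simp add: power2_eq_square algebra_simps)
  have "(1 + \<kappa> s \<sigma>)\<^sup>2 \<le> 9" using power_mono[OF k3, of 2] by simp
  from mult_left_mono[OF this, of \<d>] have "\<d> * (1 + \<kappa> s \<sigma>)\<^sup>2 \<le> 9 * \<d>" using params(5) by simp
  moreover have "0 \<le> \<d> * (1 + \<kappa> s \<sigma>)\<^sup>2" using params(5) by simp
  ultimately show "\<c> / 4 \<le> \<mu> s \<sigma>" "\<mu> s \<sigma> \<le> 2" using Dlow Dup params(9,5) unfolding m by linarith+
qed

text \<open>
Here sg is the square of the modulus of zc = x_i + \<i> x_j.  The vector x is split into its part pX in the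
(x_i,x_j)-plane and the remaining part pZ; pY is pX rotated by a right angle, and ec is the
gradient of zc.
\<close>

definition sg :: "real^'n \<Rightarrow> real" where "sg x = (x $ i)\<^sup>2 + (x $ j)\<^sup>2"
definition zc :: "real^'n \<Rightarrow> complex" where "zc x = complex_of_real (x $ i) + \<i> * complex_of_real (x $ j)"
definition pX :: "real^'n \<Rightarrow> 'n \<Rightarrow> real" where "pX x k = (if k = i \<or> k = j then x $ k else 0)"
definition pY :: "real^'n \<Rightarrow> 'n \<Rightarrow> real" where "pY x k = (if k = i then - x $ j else if k = j then x $ i else 0)"
definition pZ :: "real^'n \<Rightarrow> 'n \<Rightarrow> real" where "pZ x k = (if k = i \<or> k = j then 0 else x $ k)"
definition ec :: "'n \<Rightarrow> complex" where "ec k = (if k = i then 1 else if k = j then \<i> else 0)"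

text \<open>
The identity on the coordinates other than i and j, and on the set sg x = 0, which has measure zero.
\<close>

definition coeff_matrix :: "real \<Rightarrow> real^'n \<Rightarrow> complex^'n^'n" where
  "coeff_matrix t x = (\<chi> k m. if sg x = 0 then (if k = m then 1 else 0) else
     complex_of_real ((\<d> * pX x k * pX x m + \<mu> (1 - t) (sg x) * pY x k * pY x m) / sg x)
     - \<i> * complex_of_real (\<beta> (1 - t) (sg x) * (pX x k * pY x m + pY x k * pX x m) / sg x)
     + (if k = m \<and> k \<noteq> i \<and> k \<noteq> j then 1 else 0))"

lemma sum_split_ij: "(\<Sum>k\<in>UNIV. f k) = f i + f j + (\<Sum>k\<in>- {i, j}. f k)" for f :: "'n \<Rightarrow> 'b::ab_group_add"
proof -
  have "(\<Sum>k\<in>UNIV. f k) = (\<Sum>k\<in>{i, j}. f k) + (\<Sum>k\<in>- {i, j}. f k)"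
    by (subst sum.union_disjoint[symmetric]) auto
  then show ?thesis using ij by simp
qed

lemma coeff_matrix_mult:
  fixes t :: real and x :: "real^'n"
  assumes "sg x \<noteq> 0"
  defines "s \<equiv> 1 - t" and "\<sigma> \<equiv> sg x"
  shows "(coeff_matrix t x *v v) $ k
     = (complex_of_real (\<d> * pX x k) * (complex_of_real (x $ i) * v $ i + complex_of_real (x $ j) * v $ j)
        + complex_of_real (\<mu> s \<sigma> * pY x k) * (complex_of_real (x $ i) * v $ j - complex_of_real (x $ j) * v $ i)
        - \<i> * complex_of_real (\<beta> s \<sigma>) * (complex_of_real (pX x k) * (complex_of_real (x $ i) * v $ j - complex_of_real (x $ j) * v $ i)
            + complex_of_real (pY x k) * (complex_of_real (x $ i) * v $ i + complex_of_real (x $ j) * v $ j))) / complex_of_real \<sigma>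
       + (if k \<noteq> i \<and> k \<noteq> j then v $ k else 0)"
proof -
  have z: "pX x m = 0" "pY x m = 0" if "m \<in> - {i, j}" for m using that by (auto simp: pX_def pY_def)
  have "(\<Sum>m\<in>- {i, j}. coeff_matrix t x $ k $ m * v $ m) = (\<Sum>m\<in>- {i, j}. (if k = m then v $ m else 0))"
    using assms(1) z by (intro sum.cong refl) (auto simp: coeff_matrix_def)
  also have "\<dots> = (if k \<noteq> i \<and> k \<noteq> j then v $ k else 0)" by (simp add: sum.delta)
  finally have r: "(\<Sum>m\<in>- {i, j}. coeff_matrix t x $ k $ m * v $ m) = (if k \<noteq> i \<and> k \<noteq> j then v $ k else 0)" .
  have n: "\<not> (k = i \<and> k \<noteq> i \<and> k \<noteq> j)" "\<not> (k = j \<and> k \<noteq> i \<and> k \<noteq> j)" by auto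
  have X: "pX x i = x $ i" "pX x j = x $ j" "pY x i = - x $ j" "pY x j = x $ i" using ij by (auto simp: pX_def pY_def)
  show ?thesis
    unfolding matrix_vector_mult_def vec_lambda_beta sum_split_ij r
    using assms(1) n unfolding coeff_matrix_def vec_lambda_beta X s_def \<sigma>_def
    by (auto simp add: X add_divide_distrib diff_divide_distrib algebra_simps)
qed

lemma coeff_matrix_elliptic:
  assumes t: "t \<in> {0..1}"
  shows "\<c> / 4 * \<d> * (norm \<xi>)\<^sup>2 \<le> Re (cdot (coeff_matrix t x *v \<xi>) \<xi>)"
proof (cases "sg x = 0")
  case True
  have "coeff_matrix t x = mat 1" using True by (simp add: coeff_matrix_def mat_def vec_eq_iff)
  then have e: "Re (cdot (coeff_matrix t x *v \<xi>) \<xi>) = (norm \<xi>)\<^sup>2"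
    by (simp add: cdot_def norm_vec_def L2_set_def sum_nonneg cmod_power2 power2_eq_square[symmetric])
  have "\<c> / 4 * \<d> \<le> 1 * 1" using params by (intro mult_mono) auto
  then show ?thesis unfolding e using mult_right_mono[of "\<c> / 4 * \<d>" 1 "(norm \<xi>)\<^sup>2"] by simp
next
  case False
  define \<sigma> where "\<sigma> = sg x"
  have \<sigma>: "\<sigma> > 0" using False sum_power2_ge_zero[of "x $ i" "x $ j"] unfolding \<sigma>_def sg_def by linarith
  define p where "p = complex_of_real (x $ i) * \<xi> $ i + complex_of_real (x $ j) * \<xi> $ j"
  define r where "r = complex_of_real (x $ i) * \<xi> $ j - complex_of_real (x $ j) * \<xi> $ i"
  define m where "m = \<mu> (1 - t) \<sigma>"
  define be where "be = \<beta> (1 - t) \<sigma>"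
  have m: "\<c> / 4 \<le> m" unfolding m_def using t \<sigma> by (intro coefficient_bounds) auto
  note M = coeff_matrix_mult[OF False, of t \<xi>, folded \<sigma>_def, folded p_def r_def m_def be_def]
  have X: "pX x i = x $ i" "pX x j = x $ j" "pY x i = - x $ j" "pY x j = x $ i" using ij by (auto simp: pX_def pY_def)
  have "cdot (coeff_matrix t x *v \<xi>) \<xi> = (complex_of_real \<d> * (p * cnj p) + complex_of_real m * (r * cnj r)
      - \<i> * complex_of_real be * (r * cnj p + p * cnj r)) / complex_of_real \<sigma> + (\<Sum>k\<in>- {i, j}. \<xi> $ k * cnj (\<xi> $ k))"
  proof -
    have "(\<Sum>k\<in>- {i, j}. (coeff_matrix t x *v \<xi>) $ k * cnj (\<xi> $ k)) = (\<Sum>k\<in>- {i, j}. \<xi> $ k * cnj (\<xi> $ k))"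
      by (intro sum.cong refl) (auto simp: M pX_def pY_def)
    moreover have "(coeff_matrix t x *v \<xi>) $ i * cnj (\<xi> $ i) + (coeff_matrix t x *v \<xi>) $ j * cnj (\<xi> $ j)
      = (complex_of_real \<d> * (p * cnj p) + complex_of_real m * (r * cnj r) - \<i> * complex_of_real be * (r * cnj p + p * cnj r)) / complex_of_real \<sigma>"
    proof -
      have cp: "cnj p = complex_of_real (x $ i) * cnj (\<xi> $ i) + complex_of_real (x $ j) * cnj (\<xi> $ j)"
        and cr: "cnj r = complex_of_real (x $ i) * cnj (\<xi> $ j) - complex_of_real (x $ j) * cnj (\<xi> $ i)"
        by (simp_all add: p_def r_def)
      show ?thesis unfolding M X cp cr using \<sigma> by (simp add: field_simps)
    qed
    ultimately show ?thesis unfolding cdot_def sum_split_ij by simp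
  qed
  moreover have "Re ((complex_of_real \<d> * (p * cnj p) + complex_of_real m * (r * cnj r)
      - \<i> * complex_of_real be * (r * cnj p + p * cnj r)) / complex_of_real \<sigma>) = (\<d> * (cmod p)\<^sup>2 + m * (cmod r)\<^sup>2) / \<sigma>"
  proof -
    have "Im (r * cnj p + p * cnj r) = 0" by simp
    then show ?thesis by (simp add: Re_divide_of_real complex_mult_cnj cmod_power2 del: times_complex.sel plus_complex.sel)
        (simp add: cmod_power2 power2_eq_square)
  qed
  moreover have "Re (\<Sum>k\<in>- {i, j}. \<xi> $ k * cnj (\<xi> $ k)) = (\<Sum>k\<in>- {i, j}. (cmod (\<xi> $ k))\<^sup>2)"
    unfolding Re_sum cmod_power2 by (simp add: power2_eq_square)
  ultimately have R: "Re (cdot (coeff_matrix t x *v \<xi>) \<xi>) = (\<d> * (cmod p)\<^sup>2 + m * (cmod r)\<^sup>2) / \<sigma> + (\<Sum>k\<in>- {i, j}. (cmod (\<xi> $ k))\<^sup>2)"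
    by simp
  have pr: "(cmod p)\<^sup>2 + (cmod r)\<^sup>2 = \<sigma> * ((cmod (\<xi> $ i))\<^sup>2 + (cmod (\<xi> $ j))\<^sup>2)"
    unfolding p_def r_def cmod_power2 \<sigma>_def sg_def by (simp add: power2_eq_square algebra_simps)
  define e where "e = \<c> / 4 * \<d>"
  have "e \<le> 1 * 1" unfolding e_def using params by (intro mult_mono) auto
  then have e: "e \<le> \<d>" "e \<le> \<c> / 4" "e \<le> 1" "0 \<le> e"
    using params mult_left_mono[of \<d> 1 "\<c> / 4"] mult_right_mono[of "\<c> / 4" 1 \<d>] by (auto simp: e_def)
  have "e * ((cmod (\<xi> $ i))\<^sup>2 + (cmod (\<xi> $ j))\<^sup>2) = (e * (cmod p)\<^sup>2 + e * (cmod r)\<^sup>2) / \<sigma>"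
    using \<sigma> by (simp add: distrib_left[symmetric] pr)
  also have "\<dots> \<le> (\<d> * (cmod p)\<^sup>2 + m * (cmod r)\<^sup>2) / \<sigma>"
    using e m \<sigma> by (intro divide_right_mono add_mono mult_right_mono) auto
  finally have 1: "e * ((cmod (\<xi> $ i))\<^sup>2 + (cmod (\<xi> $ j))\<^sup>2) \<le> (\<d> * (cmod p)\<^sup>2 + m * (cmod r)\<^sup>2) / \<sigma>" .
  have 2: "e * (\<Sum>k\<in>- {i, j}. (cmod (\<xi> $ k))\<^sup>2) \<le> 1 * (\<Sum>k\<in>- {i, j}. (cmod (\<xi> $ k))\<^sup>2)"
    using e by (intro mult_right_mono sum_nonneg) auto
  have "(norm \<xi>)\<^sup>2 = (\<Sum>k\<in>UNIV. (cmod (\<xi> $ k))\<^sup>2)" by (simp add: norm_vec_def L2_set_def sum_nonneg)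
  then have "e * (norm \<xi>)\<^sup>2 = e * ((cmod (\<xi> $ i))\<^sup>2 + (cmod (\<xi> $ j))\<^sup>2) + e * (\<Sum>k\<in>- {i, j}. (cmod (\<xi> $ k))\<^sup>2)"
    by (simp only: sum_split_ij distrib_left)
  then show ?thesis unfolding R e_def[symmetric] using 1 2 by linarith
qed

lemma coeff_matrix_bounded:
  assumes t: "t \<in> {0..1}"
  shows "norm (coeff_matrix t x *v \<xi>) \<le> (real CARD('n) * real CARD('n) * 9) * norm \<xi>"
proof -
  have entry: "cmod (coeff_matrix t x $ k $ m) \<le> 9" for k m
  proof (cases "sg x = 0")
    case False
    define \<sigma> where "\<sigma> = sg x"
    have \<sigma>: "\<sigma> > 0" using False sum_power2_ge_zero[of "x $ i" "x $ j"] unfolding \<sigma>_def sg_def by linarith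
    have b: "\<bar>\<mu> (1 - t) \<sigma>\<bar> \<le> 2" "\<bar>\<beta> (1 - t) \<sigma>\<bar> \<le> 2" "\<bar>\<d>\<bar> \<le> 1"
      using coefficient_bounds[of "1 - t" \<sigma>] t \<sigma> params by auto
    have sq: "\<bar>pX x k\<bar> \<le> sqrt \<sigma>" "\<bar>pY x k\<bar> \<le> sqrt \<sigma>" for k
      by (auto simp: pX_def pY_def \<sigma>_def sg_def intro!: real_le_rsqrt)
    have pr: "\<bar>a * b\<bar> \<le> \<sigma>" if "\<bar>a\<bar> \<le> sqrt \<sigma>" "\<bar>b\<bar> \<le> sqrt \<sigma>" for a b
      using mult_mono[OF that] \<sigma> by (simp add: abs_mult)
    have c: "\<bar>c * (a * b)\<bar> / \<sigma> \<le> K" if "\<bar>c\<bar> \<le> K" "\<bar>a\<bar> \<le> sqrt \<sigma>" "\<bar>b\<bar> \<le> sqrt \<sigma>" for a b c K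
    proof -
      have "\<bar>c * (a * b)\<bar> \<le> K * \<sigma>" unfolding abs_mult[of c] using that pr[OF that(2,3)] by (intro mult_mono) auto
      then show ?thesis using \<sigma> by (simp add: divide_le_eq)
    qed
    have e: "coeff_matrix t x $ k $ m = complex_of_real (\<d> * (pX x k * pX x m) / \<sigma>) + complex_of_real (\<mu> (1 - t) \<sigma> * (pY x k * pY x m) / \<sigma>)
      - \<i> * (complex_of_real (\<beta> (1 - t) \<sigma> * (pX x k * pY x m) / \<sigma>) + complex_of_real (\<beta> (1 - t) \<sigma> * (pY x k * pX x m) / \<sigma>))
      + (if k = m \<and> k \<noteq> i \<and> k \<noteq> j then 1 else 0)"
      using False by (simp add: coeff_matrix_def \<sigma>_def add_divide_distrib algebra_simps)
    define c1 where "c1 = complex_of_real (\<d> * (pX x k * pX x m) / \<sigma>)"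
    define c2 where "c2 = complex_of_real (\<mu> (1 - t) \<sigma> * (pY x k * pY x m) / \<sigma>)"
    define c3 where "c3 = complex_of_real (\<beta> (1 - t) \<sigma> * (pX x k * pY x m) / \<sigma>)"
    define c4 where "c4 = complex_of_real (\<beta> (1 - t) \<sigma> * (pY x k * pX x m) / \<sigma>)"
    define c5 where "c5 = (if k = m \<and> k \<noteq> i \<and> k \<noteq> j then 1 else 0 :: complex)"
    have n: "cmod c1 \<le> 1" "cmod c2 \<le> 2" "cmod c3 \<le> 2" "cmod c4 \<le> 2" "cmod c5 \<le> 1"
      unfolding c1_def c2_def c3_def c4_def c5_def norm_of_real abs_divide
      using \<sigma> c[OF b(3) sq(1) sq(1), of k m] c[OF b(1) sq(2) sq(2), of k m] c[OF b(2) sq(1) sq(2), of k m] c[OF b(2) sq(2) sq(1), of k m] by auto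
    have "cmod (c1 + c2 - \<i> * (c3 + c4) + c5) \<le> cmod c1 + cmod c2 + (cmod c3 + cmod c4) + cmod c5"
      using norm_triangle_ineq[of "c1 + c2 - \<i> * (c3 + c4)" c5] norm_triangle_ineq4[of "c1 + c2" "\<i> * (c3 + c4)"]
        norm_triangle_ineq[of c1 c2] norm_triangle_ineq[of c3 c4] by (simp add: norm_mult)
    then show ?thesis unfolding e c1_def[symmetric] c2_def[symmetric] c3_def[symmetric] c4_def[symmetric] c5_def[symmetric] using n by linarith
  qed (simp add: coeff_matrix_def)
  have comp: "cmod ((coeff_matrix t x *v \<xi>) $ k) \<le> real CARD('n) * 9 * norm \<xi>" for k
  proof -
    have "cmod ((coeff_matrix t x *v \<xi>) $ k) \<le> (\<Sum>m\<in>UNIV. cmod (coeff_matrix t x $ k $ m * \<xi> $ m))"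
      unfolding matrix_vector_mult_def vec_lambda_beta by (rule norm_sum)
    also have "\<dots> \<le> (\<Sum>m\<in>(UNIV :: 'n set). 9 * norm \<xi>)"
      unfolding norm_mult by (intro sum_mono mult_mono entry Finite_Cartesian_Product.norm_nth_le) auto
    finally show ?thesis by simp
  qed
  have "norm (coeff_matrix t x *v \<xi>) \<le> (\<Sum>k\<in>UNIV. cmod ((coeff_matrix t x *v \<xi>) $ k))"
    unfolding norm_vec_def by (rule L2_set_le_sum) simp
  also have "\<dots> \<le> (\<Sum>k\<in>(UNIV :: 'n set). real CARD('n) * 9 * norm \<xi>)" by (intro sum_mono comp)
  finally show ?thesis by (simp add: mult_ac)
qed

text \<open>
The action on vectors in the span of ec, zc pX and zc pZ, which contains the gradient of
every function of the form zc times a function of sg and of the norm.  In the plane it uses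
\<i> zc pY = sg ec - zc pX.
\<close>

lemma coeff_matrix_gradient:
  fixes t :: real and x :: "real^'n"
  assumes "sg x \<noteq> 0"
  defines "s \<equiv> 1 - t" and "\<sigma> \<equiv> sg x"
  shows "(coeff_matrix t x *v (\<chi> k. complex_of_real a * ec k + complex_of_real (b * pX x k) * zc x + complex_of_real (e * pZ x k) * zc x)) $ k
    = complex_of_real (a * (\<mu> s \<sigma> - \<beta> s \<sigma>) - b * \<beta> s \<sigma> * \<sigma>) * ec k
      + complex_of_real ((a * (\<d> + 2 * \<beta> s \<sigma> - \<mu> s \<sigma>) / \<sigma> + b * (\<d> + \<beta> s \<sigma>)) * pX x k) * zc x
      + complex_of_real (e * pZ x k) * zc x"
proof -
  have \<sigma>0: "\<sigma> \<noteq> 0" using assms by simp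
  have X: "pX x i = x $ i" "pX x j = x $ j" "pY x i = - x $ j" "pY x j = x $ i" "pZ x i = 0" "pZ x j = 0" "ec i = 1" "ec j = \<i>"
    using ij by (auto simp: pX_def pY_def pZ_def ec_def)
  have s2: "complex_of_real \<sigma> = complex_of_real (x $ i) * complex_of_real (x $ i) + complex_of_real (x $ j) * complex_of_real (x $ j)"
    by (simp add: \<sigma>_def sg_def power2_eq_square)
  define v where "v = (\<chi> k. complex_of_real a * ec k + complex_of_real (b * pX x k) * zc x + complex_of_real (e * pZ x k) * zc x)"
  have p: "complex_of_real (x $ i) * v $ i + complex_of_real (x $ j) * v $ j = (complex_of_real a + complex_of_real b * complex_of_real \<sigma>) * zc x"
    unfolding s2 by (simp add: v_def X zc_def algebra_simps)
  have r: "complex_of_real (x $ i) * v $ j - complex_of_real (x $ j) * v $ i = \<i> * complex_of_real a * zc x"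
    by (simp add: v_def X zc_def algebra_simps)
  note M = coeff_matrix_mult[OF assms(1), of t v k, folded s_def \<sigma>_def, unfolded p r]
  show ?thesis
  proof (cases "k = i \<or> k = j")
    case True
    have Y: "\<i> * complex_of_real (pY x k) * zc x = complex_of_real \<sigma> * ec k - complex_of_real (pX x k) * zc x"
      using True unfolding s2 by (auto simp: X zc_def algebra_simps)
    have Z: "pZ x k = 0" using True by (auto simp: pZ_def)
    have "(coeff_matrix t x *v v) $ k
       = (complex_of_real (pX x k) * zc x * (complex_of_real \<d> * (complex_of_real a + complex_of_real b * complex_of_real \<sigma>) + complex_of_real (\<beta> s \<sigma>) * complex_of_real a)
         + (\<i> * complex_of_real (pY x k) * zc x) * (complex_of_real (\<mu> s \<sigma>) * complex_of_real a - complex_of_real (\<beta> s \<sigma>) * (complex_of_real a + complex_of_real b * complex_of_real \<sigma>))) / complex_of_real \<sigma>"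
      unfolding M using True by (auto simp add: algebra_simps)
    also have "\<dots> = complex_of_real (a * (\<mu> s \<sigma> - \<beta> s \<sigma>) - b * \<beta> s \<sigma> * \<sigma>) * ec k
      + complex_of_real ((a * (\<d> + 2 * \<beta> s \<sigma> - \<mu> s \<sigma>) / \<sigma> + b * (\<d> + \<beta> s \<sigma>)) * pX x k) * zc x"
      unfolding Y using \<sigma>0 by (simp add: field_simps)
    finally show ?thesis by (simp add: v_def Z)
  next
    case False
    then have "pX x k = 0" "pY x k = 0" "ec k = 0" by (auto simp: pX_def pY_def ec_def)
    then show ?thesis using False M by (simp add: v_def)
  qed
qed

end

section \<open>The concentrating solution and its flux\<close>

lemma partial_smooth_simps:
  "smooth f \<Longrightarrow> smooth g \<Longrightarrow> partial a (\<lambda>x. f x + g x) x = partial a f x + partial a g x"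
  "smooth f \<Longrightarrow> smooth g \<Longrightarrow> partial a (\<lambda>x. f x * g x) x = partial a f x * g x + f x * partial a g x"
  by (intro partial_add partial_mult smooth_differentiable; assumption)+

lemma partial_cmult: "smooth f \<Longrightarrow> partial a (\<lambda>x. c * f x) x = c * partial a f x"
  using partial_smooth_simps(2)[OF smooth_intros(1)[of c], of f a x] by (simp add: partial_const)

lemma partial_sum:
  assumes "finite I" "\<And>k. k \<in> I \<Longrightarrow> smooth (f k)"
  shows "partial a (\<lambda>x. \<Sum>k\<in>I. f k x) x = (\<Sum>k\<in>I. partial a (f k) x)"
  using assms
proof (induction I rule: finite_induct)
  case (insert k I)
  have "smooth (f k)" "smooth (\<lambda>x. \<Sum>k\<in>I. f k x)" using insert.prems by (auto intro: smooth_sum)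
  from partial_smooth_simps(1)[OF this] show ?case using insert by simp
qed (simp add: partial_const)

context concentrating_profile
begin

definition tau :: "real^'n \<Rightarrow> real" where "tau x = (norm x)\<^sup>2"

lemma tau_sum: "tau x = (\<Sum>k\<in>UNIV. (x $ k)\<^sup>2)"
  by (simp add: tau_def norm_vec_def L2_set_def sum_nonneg)

lemma tau_minus_sg: "tau x - sg x = (\<Sum>k\<in>- {i, j}. (x $ k)\<^sup>2)"
  by (simp add: tau_sum sg_def sum_split_ij)

lemma sg_range: "0 \<le> sg x" "sg x \<le> tau x"
proof -
  show "0 \<le> sg x" by (simp add: sg_def)
  have "0 \<le> (\<Sum>k\<in>- {i, j}. (x $ k)\<^sup>2)" by (intro sum_nonneg) simp
  then show "sg x \<le> tau x" using tau_minus_sg[of x] by linarith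
qed

lemma smooth_coordinates:
  "smooth (\<lambda>x. complex_of_real (sg x))" "smooth (\<lambda>x. complex_of_real (tau x))" "smooth zc"
  "smooth (\<lambda>x. complex_of_real (pX x a))" "smooth (\<lambda>x. complex_of_real (pZ x a))"
proof -
  have s2: "smooth (\<lambda>x. complex_of_real (x $ k) * complex_of_real (x $ k))" for k by (intro smooth_intros)
  show "smooth (\<lambda>x. complex_of_real (sg x))"
    unfolding sg_def power2_eq_square of_real_add of_real_mult by (intro smooth_intros(3) s2)
  show "smooth (\<lambda>x. complex_of_real (tau x))"
    unfolding tau_sum power2_eq_square of_real_sum of_real_mult by (intro smooth_sum s2)
  show "smooth zc" unfolding zc_def[abs_def] by (intro smooth_intros)
  show "smooth (\<lambda>x. complex_of_real (pX x a))" by (cases "a = i \<or> a = j") (auto simp: pX_def smooth_intros)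
  show "smooth (\<lambda>x. complex_of_real (pZ x a))" by (cases "a = i \<or> a = j") (auto simp: pZ_def smooth_intros)
qed

lemma partial_coordinates:
  "partial a (\<lambda>x. complex_of_real (sg x)) x = complex_of_real (2 * pX x a)"
  "partial a (\<lambda>x. complex_of_real (tau x)) x = complex_of_real (2 * x $ a)"
  "partial a zc x = ec a"
proof -
  have s2: "smooth (\<lambda>x. complex_of_real (x $ k) * complex_of_real (x $ k))" for k by (intro smooth_intros)
  have p2: "partial a (\<lambda>x. complex_of_real (x $ k) * complex_of_real (x $ k)) x = (if a = k then complex_of_real (2 * x $ k) else 0)" for k
    by (subst partial_smooth_simps(2)[OF smooth_intros(2) smooth_intros(2)]) (simp add: partial_coord)
  show "partial a (\<lambda>x. complex_of_real (sg x)) x = complex_of_real (2 * pX x a)"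
    unfolding sg_def power2_eq_square of_real_add[of "_ * _"] of_real_mult[of "_ $ _"]
    by (subst partial_smooth_simps(1)[OF s2 s2]) (use ij in \<open>auto simp: p2 pX_def\<close>)
  show "partial a (\<lambda>x. complex_of_real (tau x)) x = complex_of_real (2 * x $ a)"
    unfolding tau_sum power2_eq_square of_real_sum of_real_mult[of "_ $ _"]
    by (subst partial_sum[OF finite s2]) (simp add: p2)
  show "partial a zc x = ec a"
    unfolding zc_def[abs_def]
    by (subst partial_smooth_simps(1)) (use ij in \<open>auto simp: partial_cmult smooth_intros partial_coord ec_def\<close>)
qed

text \<open>
Products of a function of sg and a function of tau.  Their partial derivatives stay in this class up to the
factors pX and x, which reduces the differential calculus below to functions of one variable.
\<close>

definition sep :: "(real \<Rightarrow> real) \<Rightarrow> (real \<Rightarrow> real) \<Rightarrow> real^'n \<Rightarrow> complex" where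
  "sep m k x = complex_of_real (m (sg x)) * complex_of_real (k (tau x))"

text \<open>
An open half-line on which both factors of the profile are positive.  It contains the value 0 of sg, so that
the profile is smooth across the set sg x = 0 as long as s > 0.
\<close>

definition dom :: "real \<Rightarrow> real set" where "dom s = {- (\<l> * s)<..}"

lemma dom_pos: assumes "0 < s" "\<sigma> \<in> dom s" shows "0 < \<sigma> + \<l> * s" "0 < \<sigma> + s"
proof -
  show a: "0 < \<sigma> + \<l> * s" using assms by (simp add: dom_def)
  have "\<l> * s \<le> 1 * s" using assms params by (intro mult_right_mono) auto
  then show "0 < \<sigma> + s" using a by linarith
qed

lemma sg_dom: "0 < s \<Longrightarrow> sg x \<in> dom s"
proof -
  assume "0 < s"
  then have "0 < \<l> * s" using params by simp
  then show ?thesis using sg_range(1)[of x] by (simp add: dom_def)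
qed

lemma open_dom: "open (dom s)" by (simp add: dom_def)

lemma smooth_sep:
  assumes "0 < s" "smooth_on (dom s) m" "smooth_on UNIV k"
  shows "smooth (sep m k)"
  unfolding sep_def[abs_def]
  by (intro smooth_intros(4) smooth_compose[OF smooth_coordinates(1) assms(2) sg_dom[OF assms(1)]]
      smooth_compose[OF smooth_coordinates(2) assms(3)]) auto

lemma partial_sep:
  assumes s: "0 < s" and m: "smooth_on (dom s) m" and k: "smooth_on UNIV k"
  shows "partial a (sep m k) x = complex_of_real (2 * pX x a) * sep (deriv m) k x + complex_of_real (2 * x $ a) * sep m (deriv k) x"
proof -
  have sm: "smooth (\<lambda>x. complex_of_real (m (sg x)))" "smooth (\<lambda>x. complex_of_real (k (tau x)))"
    by (rule smooth_compose[OF smooth_coordinates(1) m sg_dom[OF s]], rule smooth_compose[OF smooth_coordinates(2) k]) auto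
  have p1: "partial a (\<lambda>x. complex_of_real (m (sg x))) x = complex_of_real (deriv m (sg x)) * partial a (\<lambda>x. complex_of_real (sg x)) x"
    by (rule partial_compose_of_real[OF smooth_differentiable[OF smooth_coordinates(1)] smooth_on_deriv(2)[OF m open_dom sg_dom[OF s]]])
  have p2: "partial a (\<lambda>x. complex_of_real (k (tau x))) x = complex_of_real (deriv k (tau x)) * partial a (\<lambda>x. complex_of_real (tau x)) x"
    by (rule partial_compose_of_real[OF smooth_differentiable[OF smooth_coordinates(2)] smooth_on_deriv(2)[OF k open_UNIV]]) simp
  show ?thesis unfolding sep_def[abs_def]
    by (subst partial_smooth_simps(2)[OF sm]) (simp add: p1 p2 partial_coordinates algebra_simps)
qed

text \<open>
The divergences of the three kinds of vector fields that occur in the flux.  The coefficient 3 is 2, the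
divergence of pX, plus the degree of homogeneity 1 of zc.
\<close>

lemma divergence_pieces:
  fixes N :: "real^'n \<Rightarrow> complex" and N1 N2 :: complex
  assumes N: "smooth N" and p: "\<And>a. partial a N x = complex_of_real (2 * pX x a) * N1 + complex_of_real (2 * x $ a) * N2"
  shows "(\<Sum>a\<in>UNIV. partial a (\<lambda>x. zc x * complex_of_real (pX x a) * N x) x)
      = zc x * (3 * N x + 2 * complex_of_real (sg x) * (N1 + N2))"
    and "(\<Sum>a\<in>UNIV. partial a (\<lambda>x. ec a * N x) x) = zc x * (2 * (N1 + N2))"
    and "(\<Sum>a\<in>UNIV. partial a (\<lambda>x. zc x * complex_of_real (pZ x a) * N x) x)
      = zc x * (of_nat (card (- {i, j})) * N x + 2 * complex_of_real (tau x - sg x) * N2)"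
proof -
  have X: "pX x i = x $ i" "pX x j = x $ j" "ec i = 1" "ec j = \<i>" using ij by (auto simp: pX_def ec_def)
  have sgc: "complex_of_real (sg x) = complex_of_real (x $ i) * complex_of_real (x $ i) + complex_of_real (x $ j) * complex_of_real (x $ j)"
    by (simp add: sg_def power2_eq_square)
  have zx: "smooth (\<lambda>x. zc x * complex_of_real (x $ a))" for a by (intro smooth_intros smooth_coordinates)
  have pin: "partial a (\<lambda>x. zc x * complex_of_real (x $ a) * N x) x
      = (ec a * complex_of_real (x $ a) + zc x) * N x + zc x * complex_of_real (x $ a) * partial a N x" for a
    by (simp add: partial_smooth_simps(2)[OF zx N] partial_smooth_simps(2)[OF smooth_coordinates(3) smooth_intros(2)] partial_coordinates partial_coord)
  have z0: "(\<lambda>x. zc x * complex_of_real (pX x a) * N x) = (\<lambda>x. 0)" if "a \<in> - {i, j}" for a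
    using that by (auto simp: pX_def)
  have zi: "(\<lambda>x. zc x * complex_of_real (pX x a) * N x) = (\<lambda>x. zc x * complex_of_real (x $ a) * N x)" if "a = i \<or> a = j" for a
    using that by (auto simp: pX_def)
  have r0: "(\<Sum>a\<in>- {i, j}. partial a (\<lambda>x. zc x * complex_of_real (pX x a) * N x) x) = 0"
    by (intro sum.neutral ballI) (simp add: z0 partial_const)
  show "(\<Sum>a\<in>UNIV. partial a (\<lambda>x. zc x * complex_of_real (pX x a) * N x) x)
      = zc x * (3 * N x + 2 * complex_of_real (sg x) * (N1 + N2))"
    unfolding sum_split_ij r0 by (simp add: zi pin p X sgc) (simp add: zc_def algebra_simps)
  have r1: "(\<Sum>a\<in>- {i, j}. partial a (\<lambda>x. ec a * N x) x) = 0"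
    by (intro sum.neutral ballI) (auto simp: ec_def partial_const)
  show "(\<Sum>a\<in>UNIV. partial a (\<lambda>x. ec a * N x) x) = zc x * (2 * (N1 + N2))"
    unfolding sum_split_ij r1 by (simp add: partial_cmult[OF N] p X) (simp add: zc_def algebra_simps)
  have ziz: "(\<lambda>x. zc x * complex_of_real (pZ x a) * N x) = (\<lambda>x. 0)" if "a = i \<or> a = j" for a
    using that by (auto simp: pZ_def)
  have zr: "partial a (\<lambda>x. zc x * complex_of_real (pZ x a) * N x) x = zc x * N x + 2 * zc x * N2 * complex_of_real ((x $ a)\<^sup>2)"
    if a: "a \<in> - {i, j}" for a
  proof -
    have "(\<lambda>x. zc x * complex_of_real (pZ x a) * N x) = (\<lambda>x. zc x * complex_of_real (x $ a) * N x)" using a by (auto simp: pZ_def)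
    moreover have "ec a = 0" "pX x a = 0" using a by (auto simp: ec_def pX_def)
    ultimately show ?thesis by (simp add: pin p power2_eq_square)
  qed
  have "(\<Sum>a\<in>- {i, j}. partial a (\<lambda>x. zc x * complex_of_real (pZ x a) * N x) x)
      = (\<Sum>a\<in>- {i, j}. zc x * N x + 2 * zc x * N2 * complex_of_real ((x $ a)\<^sup>2))" by (intro sum.cong refl zr)
  also have "\<dots> = of_nat (card (- {i, j})) * (zc x * N x) + 2 * zc x * N2 * complex_of_real (tau x - sg x)"
    unfolding tau_minus_sg of_real_sum by (simp add: sum.distrib sum_distrib_left)
  finally show "(\<Sum>a\<in>UNIV. partial a (\<lambda>x. zc x * complex_of_real (pZ x a) * N x) x)
      = zc x * (of_nat (card (- {i, j})) * N x + 2 * complex_of_real (tau x - sg x) * N2)"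
  proof -
    assume S: "(\<Sum>a\<in>- {i, j}. partial a (\<lambda>x. zc x * complex_of_real (pZ x a) * N x) x)
      = of_nat (card (- {i, j})) * (zc x * N x) + 2 * zc x * N2 * complex_of_real (tau x - sg x)"
    have zz: "partial a (\<lambda>x. zc x * complex_of_real (pZ x a) * N x) x = 0" if "a = i \<or> a = j" for a
      unfolding ziz[OF that] by (simp add: partial_const)
    have "(\<Sum>a\<in>UNIV. partial a (\<lambda>x. zc x * complex_of_real (pZ x a) * N x) x)
      = of_nat (card (- {i, j})) * (zc x * N x) + 2 * zc x * N2 * complex_of_real (tau x - sg x)"
      unfolding sum_split_ij S by (simp only: zz simp_thms add_0_left)
    also have "\<dots> = zc x * (of_nat (card (- {i, j})) * N x + 2 * complex_of_real (tau x - sg x) * N2)"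
      by (simp only: distrib_left mult_ac)
    finally show ?thesis .
  qed
qed

lemma smooth_profile:
  assumes s: "0 < s"
  shows "smooth_on (dom s) (prof s)" "smooth_on (dom s) (log_deriv s)" "smooth_on (dom s) (log_rate s)"
    "smooth_on (dom s) (q s)" "smooth_on (dom s) (q' s)" "smooth_on (dom s) (\<kappa> s)" "smooth_on (dom s) (\<beta> s)"
proof -
  note pos = dom_pos[OF s]
  have n: "x + s \<noteq> 0" "x + \<l> * s \<noteq> 0" "4 * (x + s) \<noteq> 0" "4 * (x + s)\<^sup>2 \<noteq> 0" if "x \<in> dom s" for x
    using pos[OF that] by auto
  have l: "smooth_on (dom s) (\<lambda>x. x + c)" for c by (intro smooth_on_intros)
  show "smooth_on (dom s) (prof s)" unfolding prof_def[abs_def]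
    by (intro smooth_on_intros(4) smooth_on_powr l pos)
  show ld: "smooth_on (dom s) (log_deriv s)" unfolding log_deriv_def[abs_def]
    by (intro smooth_on_diff smooth_on_divide smooth_on_intros(1) l n)
  show "smooth_on (dom s) (log_rate s)" unfolding log_rate_def[abs_def]
    by (intro smooth_on_diff smooth_on_divide smooth_on_intros(1) l n)
  show q: "smooth_on (dom s) (q s)" unfolding q_def[abs_def]
    by (intro smooth_on_intros(3)[OF smooth_on_divide smooth_on_intros(1)] smooth_on_intros(2) smooth_on_intros(4)[OF smooth_on_intros(1)] l n)
  show "smooth_on (dom s) (q' s)" unfolding q'_def[abs_def] power2_eq_square
    by (intro smooth_on_divide smooth_on_intros(1) smooth_on_intros(4)[OF smooth_on_intros(1)] smooth_on_intros(4) l n(4)[unfolded power2_eq_square])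
  show k: "smooth_on (dom s) (\<kappa> s)" unfolding \<kappa>_def[abs_def]
    by (intro smooth_on_intros(4)[OF _ ld] smooth_on_intros(4)[OF smooth_on_intros(1)] smooth_on_intros(2))
  show "smooth_on (dom s) (\<beta> s)" unfolding \<beta>_def[abs_def]
    by (intro smooth_on_diff q smooth_on_intros(4)[OF smooth_on_intros(1)] smooth_on_intros(3)[OF smooth_on_intros(1)] k)
qed

lemma prof_derivatives:
  assumes s: "0 < s" and \<sigma>: "\<sigma> \<in> dom s"
  shows "(prof s has_real_derivative prof s \<sigma> * log_deriv s \<sigma>) (at \<sigma>)"
    and "(q s has_real_derivative q' s \<sigma>) (at \<sigma>)"
    and "((\<lambda>r. prof r \<sigma>) has_real_derivative - (prof s \<sigma> * log_rate s \<sigma>)) (at s)"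
proof -
  note pos = dom_pos[OF s \<sigma>]
  have pw: "(\<sigma> + \<l> * s) powr (\<gamma> - 2) = (\<sigma> + \<l> * s) powr (\<gamma> - 2 - 1) * (\<sigma> + \<l> * s)"
    using pos(1) powr_add[of "\<sigma> + \<l> * s" "\<gamma> - 2 - 1" 1] by simp
  define w where "w = (\<sigma> + \<l> * s) powr (\<gamma> - 2 - 1)"
  note pw = pw[folded w_def]
  have gen: "p * (w * r) * (1 / p - c / r) = w * r - p * (c * w)"
    "p * (w * r) * (c * \<l> / r - 1 / p) = p * (c * \<l> * w) - w * r" if "p \<noteq> 0" "r \<noteq> 0" for p r c :: real
    using that by (simp_all add: field_simps)
  have n0: "\<sigma> + s \<noteq> 0" "\<sigma> + \<l> * s \<noteq> 0" using pos by auto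
  have e1: "prof s \<sigma> * log_deriv s \<sigma> = w * (\<sigma> + \<l> * s) - (\<sigma> + s) * ((2 - \<gamma>) * w)"
    unfolding prof_def log_deriv_def pw by (rule gen(1)[OF n0])
  have e2: "prof s \<sigma> * log_rate s \<sigma> = (\<sigma> + s) * ((2 - \<gamma>) * \<l> * w) - w * (\<sigma> + \<l> * s)"
    unfolding prof_def log_rate_def pw by (rule gen(2)[OF n0])
  have d1: "((\<lambda>\<sigma>. (\<sigma> + \<l> * s) powr (\<gamma> - 2)) has_real_derivative (\<gamma> - 2) * w) (at \<sigma>)"
    using DERIV_fun_powr[of "\<lambda>\<sigma>. \<sigma> + \<l> * s" 1 \<sigma> "\<gamma> - 2"] pos by (auto intro!: derivative_eq_intros simp: w_def)
  have d2: "((\<lambda>r. (\<sigma> + \<l> * r) powr (\<gamma> - 2)) has_real_derivative (\<gamma> - 2) * w * \<l>) (at s)"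
    using DERIV_fun_powr[of "\<lambda>r. \<sigma> + \<l> * r" \<l> s "\<gamma> - 2"] pos by (auto intro!: derivative_eq_intros simp: w_def)
  show "(prof s has_real_derivative prof s \<sigma> * log_deriv s \<sigma>) (at \<sigma>)"
    unfolding e1 unfolding prof_def[abs_def]
    by (rule DERIV_cong[OF DERIV_mult[OF _ d1, where f = "\<lambda>\<sigma>. \<sigma> + s" and Da = 1]], (auto intro!: derivative_eq_intros)[1],
        simp only: pw, simp add: algebra_simps)
  show "((\<lambda>r. prof r \<sigma>) has_real_derivative - (prof s \<sigma> * log_rate s \<sigma>)) (at s)"
    unfolding e2 unfolding prof_def
    by (rule DERIV_cong[OF DERIV_mult[OF _ d2, where f = "\<lambda>r. \<sigma> + r" and Da = 1]], (auto intro!: derivative_eq_intros)[1],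
        simp only: pw, simp add: algebra_simps)
  show "(q s has_real_derivative q' s \<sigma>) (at \<sigma>)"
  proof -
    define p where "p = \<sigma> + s"
    have p: "p \<noteq> 0" "\<sigma> = p - s" using pos by (auto simp: p_def)
    have "((\<lambda>y. y / (4 * (y + s)) + \<c> / 2) has_real_derivative (1 * (4 * (\<sigma> + s)) - \<sigma> * 4) / (4 * (\<sigma> + s))\<^sup>2) (at \<sigma>)"
      using pos by (auto intro!: derivative_eq_intros simp: power2_eq_square)
    moreover have "(1 * (4 * (\<sigma> + s)) - \<sigma> * 4) / (4 * (\<sigma> + s))\<^sup>2 = s / (4 * (\<sigma> + s)\<^sup>2)"
      unfolding p_def[symmetric] unfolding p(2) using p(1) by (simp add: power2_eq_square)
    ultimately show ?thesis unfolding q_def[abs_def] q'_def by simp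
  qed
qed

text \<open>
The cutoff exp_inv (1 - \<tau>) and, up to sign, its first and second derivative in \<tau>.
\<close>

definition "\<psi>0 \<tau> = exp_inv (1 - \<tau>)"
definition "\<psi>1 \<tau> = deriv exp_inv (1 - \<tau>)"
definition "\<psi>2 \<tau> = deriv (deriv exp_inv) (1 - \<tau>)"

lemma smooth_cutoffs: "smooth_on UNIV \<psi>0" "smooth_on UNIV \<psi>1" "smooth_on UNIV \<psi>2"
proof -
  note e = smooth_exp_inv smooth_on_deriv(1)[OF smooth_exp_inv open_UNIV]
    smooth_on_deriv(1)[OF smooth_on_deriv(1)[OF smooth_exp_inv open_UNIV] open_UNIV]
  have l: "smooth_on UNIV (\<lambda>\<tau>::real. 1 - \<tau>)" by (intro smooth_on_diff smooth_on_intros)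
  show "smooth_on UNIV \<psi>0" "smooth_on UNIV \<psi>1" "smooth_on UNIV \<psi>2"
    unfolding \<psi>0_def[abs_def] \<psi>1_def[abs_def] \<psi>2_def[abs_def]
    by (rule smooth_on_compose[OF e(1) l UNIV_I], rule smooth_on_compose[OF e(2) l UNIV_I], rule smooth_on_compose[OF e(3) l UNIV_I])
qed

lemma deriv_cutoffs: "deriv \<psi>0 \<tau> = - \<psi>1 \<tau>" "deriv \<psi>1 \<tau> = - \<psi>2 \<tau>"
proof -
  have l: "((\<lambda>\<tau>::real. 1 - \<tau>) has_real_derivative - 1) (at \<tau>)" by (auto intro!: derivative_eq_intros)
  have d: "(exp_inv has_real_derivative deriv exp_inv y) (at y)" "(deriv exp_inv has_real_derivative deriv (deriv exp_inv) y) (at y)" for y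
    using smooth_on_deriv(2)[OF smooth_exp_inv open_UNIV] smooth_on_deriv(2)[OF smooth_on_deriv(1)[OF smooth_exp_inv open_UNIV] open_UNIV] by auto
  show "deriv \<psi>0 \<tau> = - \<psi>1 \<tau>" "deriv \<psi>1 \<tau> = - \<psi>2 \<tau>"
    using DERIV_imp_deriv[OF DERIV_chain2[OF d(1) l]] DERIV_imp_deriv[OF DERIV_chain2[OF d(2) l]]
    by (simp_all add: \<psi>0_def[abs_def] \<psi>1_def[abs_def] \<psi>2_def[abs_def])
qed

lemma cutoffs_eq_0: assumes "\<tau> > 1" shows "\<psi>0 \<tau> = 0" "\<psi>1 \<tau> = 0" "\<psi>2 \<tau> = 0"
proof -
  have z: "exp_inv y = 0" if "y \<in> {..<0}" for y using that by (simp add: exp_inv_def)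
  have z1: "deriv exp_inv y = 0" if "y \<in> {..<0}" for y
    by (rule DERIV_imp_deriv, rule has_field_derivative_transform_within_open[OF DERIV_const[of 0] open_lessThan[of 0] that]) (simp add: z)
  have z2: "deriv (deriv exp_inv) y = 0" if "y \<in> {..<0}" for y
    by (rule DERIV_imp_deriv, rule has_field_derivative_transform_within_open[OF DERIV_const[of 0] open_lessThan[of 0] that]) (simp add: z1)
  show "\<psi>0 \<tau> = 0" "\<psi>1 \<tau> = 0" "\<psi>2 \<tau> = 0" using assms by (simp_all add: \<psi>0_def \<psi>1_def \<psi>2_def z z1 z2)
qed

end

section \<open>The equation for the flux\<close>

context concentrating_profile
begin

definition mix :: "(real \<Rightarrow> real) \<Rightarrow> (real \<Rightarrow> real) \<Rightarrow> real^'n \<Rightarrow> complex" where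
  "mix m0 m1 x = sep m0 \<psi>0 x + sep m1 \<psi>1 x"

lemma smooth_mix:
  assumes "0 < s" "smooth_on (dom s) m0" "smooth_on (dom s) m1"
  shows "smooth (mix m0 m1)"
  unfolding mix_def[abs_def] by (intro smooth_intros(3) smooth_sep[OF assms(1)] assms smooth_cutoffs)

lemma partial_mix:
  assumes s: "0 < s" and m: "smooth_on (dom s) m0" "smooth_on (dom s) m1"
  shows "partial a (mix m0 m1) x = complex_of_real (2 * pX x a) * mix (deriv m0) (deriv m1) x
    + complex_of_real (2 * x $ a) * (- sep m0 \<psi>1 x - sep m1 \<psi>2 x)"
proof -
  have e: "deriv \<psi>0 = (\<lambda>\<tau>. - \<psi>1 \<tau>)" "deriv \<psi>1 = (\<lambda>\<tau>. - \<psi>2 \<tau>)" by (auto simp: deriv_cutoffs)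
  have n: "sep m (\<lambda>\<tau>. - k \<tau>) x = - sep m k x" for m k by (simp add: sep_def)
  show ?thesis unfolding mix_def[abs_def]
    by (subst partial_smooth_simps(1)[OF smooth_sep[OF s m(1) smooth_cutoffs(1)] smooth_sep[OF s m(2) smooth_cutoffs(2)]])
      (simp add: partial_sep[OF s m(1) smooth_cutoffs(1)] partial_sep[OF s m(2) smooth_cutoffs(2)] e n algebra_simps)
qed

text \<open>
A0 and P0 - \<sigma> A0 are the coefficients of zc pX and ec in the flux of zc prof without cutoff: P0
prescribes the radial component, and A0 solves A0 + 2 P0' = prof log_rate, which is the equation.
R0 and Q0 carry the contribution of the gradient of the cutoff.
\<close>

definition "A0 s \<sigma> = prof s \<sigma> * (log_rate s \<sigma> - 2 * (q' s \<sigma> + q s \<sigma> * log_deriv s \<sigma>))"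
definition "P0 s \<sigma> = q s \<sigma> * prof s \<sigma>"
definition "R0 s \<sigma> = prof s \<sigma> * \<beta> s \<sigma>"
definition "Q0 s \<sigma> = prof s \<sigma> * (\<d> + \<beta> s \<sigma>)"

definition "flux_X s = mix (A0 s) (\<lambda>\<sigma>. - 2 * Q0 s \<sigma>)"
definition "flux_E s = mix (\<lambda>\<sigma>. P0 s \<sigma> - \<sigma> * A0 s \<sigma>) (\<lambda>\<sigma>. 2 * (\<sigma> * R0 s \<sigma>))"
definition "flux_Z s = mix (\<lambda>\<sigma>. 0) (\<lambda>\<sigma>. - 2 * prof s \<sigma>)"

text \<open>
This is coeff_matrix applied to the gradient of sol, written so that smoothness across sg x = 0 is
visible (see coeff_matrix_sol).
\<close>

definition flux :: "real \<Rightarrow> 'n \<Rightarrow> real^'n \<Rightarrow> complex" where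
  "flux t a x = complex_of_real t * (zc x * complex_of_real (pX x a) * flux_X (1 - t) x + ec a * flux_E (1 - t) x
     + zc x * complex_of_real (pZ x a) * flux_Z (1 - t) x)"

definition sol :: "real \<Rightarrow> real^'n \<Rightarrow> complex" where
  "sol t x = complex_of_real t * (zc x * mix (prof (1 - t)) (\<lambda>\<sigma>. 0) x)"

definition sol' :: "real \<Rightarrow> real^'n \<Rightarrow> complex" where
  "sol' t x = zc x * complex_of_real (\<psi>0 (tau x) * prof (1 - t) (sg x) * (1 + t * log_rate (1 - t) (sg x)))"

text \<open>
The coefficients, relative to t zc prof, of the first and second derivative of the cutoff in the divergence of the
flux.
\<close>

definition "e1 s \<sigma> = - 2 * (\<d> + \<beta> s \<sigma>) - 4 * \<d> - 2 * \<d> * \<kappa> s \<sigma> - 2 * q s \<sigma> - 2 * real (card (- {i, j}))"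
definition "e2 \<sigma> \<tau> = 4 * \<sigma> * \<d> + 4 * (\<tau> - \<sigma>)"

text \<open>
What is left of sol' after subtraction of the divergence of the flux.
\<close>

definition force :: "real \<Rightarrow> real^'n \<Rightarrow> complex" where
  "force t x = zc x * complex_of_real (prof (1 - t) (sg x) *
     (\<psi>0 (tau x) - t * (\<psi>1 (tau x) * e1 (1 - t) (sg x) + \<psi>2 (tau x) * e2 (sg x) (tau x))))"

lemma smooth_flux_coefficients:
  assumes s: "0 < s"
  shows "smooth_on (dom s) (A0 s)" "smooth_on (dom s) (P0 s)" "smooth_on (dom s) (R0 s)" "smooth_on (dom s) (Q0 s)"
proof -
  note p = smooth_profile[OF s]
  show "smooth_on (dom s) (A0 s)" unfolding A0_def[abs_def]
    by (intro smooth_on_intros(4)[OF p(1)] smooth_on_diff p(3) smooth_on_intros(4)[OF smooth_on_intros(1)] smooth_on_intros(3) p(5) smooth_on_intros(4)[OF p(4)] p(2))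
  show "smooth_on (dom s) (P0 s)" unfolding P0_def[abs_def] by (intro smooth_on_intros(4) p)
  show "smooth_on (dom s) (R0 s)" unfolding R0_def[abs_def] by (intro smooth_on_intros(4) p)
  show "smooth_on (dom s) (Q0 s)" unfolding Q0_def[abs_def] by (intro smooth_on_intros(4) smooth_on_intros(3)[OF smooth_on_intros(1)] p)
qed

lemma smooth_flux_parts:
  assumes s: "0 < s"
  shows "smooth (flux_X s)" "smooth (flux_E s)" "smooth (flux_Z s)" "smooth (mix (prof s) (\<lambda>\<sigma>. 0))"
    "smooth_on (dom s) (\<lambda>\<sigma>. - 2 * Q0 s \<sigma>)" "smooth_on (dom s) (\<lambda>\<sigma>. P0 s \<sigma> - \<sigma> * A0 s \<sigma>)"
    "smooth_on (dom s) (\<lambda>\<sigma>. 2 * (\<sigma> * R0 s \<sigma>))" "smooth_on (dom s) (\<lambda>\<sigma>. - 2 * prof s \<sigma>)"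
proof -
  note c = smooth_flux_coefficients[OF s] smooth_profile(1)[OF s]
  show a: "smooth_on (dom s) (\<lambda>\<sigma>. - 2 * Q0 s \<sigma>)" by (intro smooth_on_intros(4)[OF smooth_on_intros(1)] c)
  show b: "smooth_on (dom s) (\<lambda>\<sigma>. P0 s \<sigma> - \<sigma> * A0 s \<sigma>)" by (intro smooth_on_diff smooth_on_intros(4)[OF smooth_on_intros(2)] c)
  show d: "smooth_on (dom s) (\<lambda>\<sigma>. 2 * (\<sigma> * R0 s \<sigma>))" by (intro smooth_on_intros(4)[OF smooth_on_intros(1)] smooth_on_intros(4)[OF smooth_on_intros(2)] c)
  show e: "smooth_on (dom s) (\<lambda>\<sigma>. - 2 * prof s \<sigma>)" by (intro smooth_on_intros(4)[OF smooth_on_intros(1)] c)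
  show "smooth (flux_X s)" "smooth (flux_E s)" "smooth (flux_Z s)" "smooth (mix (prof s) (\<lambda>\<sigma>. 0))"
    unfolding flux_X_def flux_E_def flux_Z_def by (intro smooth_mix[OF s] a b d e c smooth_on_intros(1))+
qed

lemma deriv_flux_coefficients:
  assumes s: "0 < s" and \<sigma>: "\<sigma> \<in> dom s"
  shows "deriv (\<lambda>\<sigma>. - 2 * Q0 s \<sigma>) \<sigma> = - 2 * (deriv (R0 s) \<sigma> + \<d> * (prof s \<sigma> * log_deriv s \<sigma>))"
    "deriv (\<lambda>\<sigma>. P0 s \<sigma> - \<sigma> * A0 s \<sigma>) \<sigma> = prof s \<sigma> * (q' s \<sigma> + q s \<sigma> * log_deriv s \<sigma>) - A0 s \<sigma> - \<sigma> * deriv (A0 s) \<sigma>"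
    "deriv (\<lambda>\<sigma>. 2 * (\<sigma> * R0 s \<sigma>)) \<sigma> = 2 * (R0 s \<sigma> + \<sigma> * deriv (R0 s) \<sigma>)"
    "deriv (prof s) \<sigma> = prof s \<sigma> * log_deriv s \<sigma>"
proof -
  note d = prof_derivatives(1,2)[OF s \<sigma>]
  have dA: "(A0 s has_real_derivative deriv (A0 s) \<sigma>) (at \<sigma>)" and dR: "(R0 s has_real_derivative deriv (R0 s) \<sigma>) (at \<sigma>)"
    using smooth_on_deriv(2)[OF smooth_flux_coefficients(1)[OF s] open_dom \<sigma>] smooth_on_deriv(2)[OF smooth_flux_coefficients(3)[OF s] open_dom \<sigma>] by auto
  have Q: "(\<lambda>\<sigma>. - 2 * Q0 s \<sigma>) = (\<lambda>\<sigma>. - 2 * (R0 s \<sigma> + \<d> * prof s \<sigma>))" by (auto simp: Q0_def R0_def algebra_simps)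
  show "deriv (\<lambda>\<sigma>. - 2 * Q0 s \<sigma>) \<sigma> = - 2 * (deriv (R0 s) \<sigma> + \<d> * (prof s \<sigma> * log_deriv s \<sigma>))"
    unfolding Q by (rule DERIV_imp_deriv) (auto intro!: derivative_eq_intros d dR)
  show "deriv (\<lambda>\<sigma>. P0 s \<sigma> - \<sigma> * A0 s \<sigma>) \<sigma> = prof s \<sigma> * (q' s \<sigma> + q s \<sigma> * log_deriv s \<sigma>) - A0 s \<sigma> - \<sigma> * deriv (A0 s) \<sigma>"
    unfolding P0_def by (rule DERIV_imp_deriv) (auto intro!: derivative_eq_intros d dA simp: algebra_simps)
  show "deriv (\<lambda>\<sigma>. 2 * (\<sigma> * R0 s \<sigma>)) \<sigma> = 2 * (R0 s \<sigma> + \<sigma> * deriv (R0 s) \<sigma>)"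
    by (rule DERIV_imp_deriv) (auto intro!: derivative_eq_intros dR simp: algebra_simps)
  show "deriv (prof s) \<sigma> = prof s \<sigma> * log_deriv s \<sigma>" by (rule DERIV_imp_deriv[OF d(1)])
qed

text \<open>
The terms with the undifferentiated cutoff add up to \<psi>0 prof log_rate by the choice of A0; the
derivatives of A0 and of R0 cancel between the pieces.
\<close>

lemma divergence_flux:
  assumes t: "t < 1"
  shows "(\<Sum>a\<in>UNIV. partial a (flux t a) x) = sol' t x - force t x"
proof -
  define s where "s = 1 - t"
  have s: "0 < s" using t by (simp add: s_def)
  note sm = smooth_flux_parts[OF s] smooth_flux_coefficients[OF s] smooth_profile(1)[OF s]
  have z: "smooth_on (dom s) (\<lambda>\<sigma>. 0)" by (rule smooth_on_intros(1))
  define \<sigma> \<tau> where "\<sigma> = sg x" "\<tau> = tau x"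
  have \<sigma>: "\<sigma> \<in> dom s" using sg_dom[OF s] by (simp add: \<sigma>_\<tau>_def)
  note D = deriv_flux_coefficients[OF s \<sigma>]
  have sX: "smooth (\<lambda>x. zc x * complex_of_real (pX x a) * flux_X s x)"
    and sE: "smooth (\<lambda>x. ec a * flux_E s x)" and sZ: "smooth (\<lambda>x. zc x * complex_of_real (pZ x a) * flux_Z s x)" for a
    by (intro smooth_intros(1,4) smooth_coordinates sm)+
  have "partial a (flux t a) x = complex_of_real t * (partial a (\<lambda>x. zc x * complex_of_real (pX x a) * flux_X s x) x
      + partial a (\<lambda>x. ec a * flux_E s x) x + partial a (\<lambda>x. zc x * complex_of_real (pZ x a) * flux_Z s x) x)" for a
    unfolding flux_def[abs_def] s_def[symmetric]
    by (subst partial_cmult, intro smooth_intros(3) sX sE sZ)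
      (simp only: partial_smooth_simps(1)[OF smooth_intros(3)[OF sX sE] sZ] partial_smooth_simps(1)[OF sX sE])
  moreover
  have pX': "partial a (flux_X s) x = complex_of_real (2 * pX x a) * mix (deriv (A0 s)) (deriv (\<lambda>\<sigma>. - 2 * Q0 s \<sigma>)) x
      + complex_of_real (2 * x $ a) * (- sep (A0 s) \<psi>1 x - sep (\<lambda>\<sigma>. - 2 * Q0 s \<sigma>) \<psi>2 x)"
   and pE': "partial a (flux_E s) x = complex_of_real (2 * pX x a) * mix (deriv (\<lambda>\<sigma>. P0 s \<sigma> - \<sigma> * A0 s \<sigma>)) (deriv (\<lambda>\<sigma>. 2 * (\<sigma> * R0 s \<sigma>))) x
      + complex_of_real (2 * x $ a) * (- sep (\<lambda>\<sigma>. P0 s \<sigma> - \<sigma> * A0 s \<sigma>) \<psi>1 x - sep (\<lambda>\<sigma>. 2 * (\<sigma> * R0 s \<sigma>)) \<psi>2 x)"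
   and pZ': "partial a (flux_Z s) x = complex_of_real (2 * pX x a) * mix (deriv (\<lambda>\<sigma>. 0)) (deriv (\<lambda>\<sigma>. - 2 * prof s \<sigma>)) x
      + complex_of_real (2 * x $ a) * (- sep (\<lambda>\<sigma>. 0) \<psi>1 x - sep (\<lambda>\<sigma>. - 2 * prof s \<sigma>) \<psi>2 x)" for a
    unfolding flux_X_def flux_E_def flux_Z_def by (intro partial_mix[OF s] sm z)+
  note dX = divergence_pieces(1)[OF sm(1) pX'] and dE = divergence_pieces(2)[OF sm(2) pE'] and dZ = divergence_pieces(3)[OF sm(3) pZ']
  ultimately have "(\<Sum>a\<in>UNIV. partial a (flux t a) x) = complex_of_real t *
      ((\<Sum>a\<in>UNIV. partial a (\<lambda>x. zc x * complex_of_real (pX x a) * flux_X s x) x)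
      + (\<Sum>a\<in>UNIV. partial a (\<lambda>x. ec a * flux_E s x) x) + (\<Sum>a\<in>UNIV. partial a (\<lambda>x. zc x * complex_of_real (pZ x a) * flux_Z s x) x))"
    by (simp only: sum_distrib_left[symmetric] sum.distrib)
  also have "\<dots> = complex_of_real t * (zc x * complex_of_real (
      3 * (A0 s \<sigma> * \<psi>0 \<tau> - 2 * Q0 s \<sigma> * \<psi>1 \<tau>)
      + 2 * \<sigma> * (deriv (A0 s) \<sigma> * \<psi>0 \<tau> - 2 * (deriv (R0 s) \<sigma> + \<d> * (prof s \<sigma> * log_deriv s \<sigma>)) * \<psi>1 \<tau> - A0 s \<sigma> * \<psi>1 \<tau> + 2 * Q0 s \<sigma> * \<psi>2 \<tau>)
      + 2 * ((prof s \<sigma> * (q' s \<sigma> + q s \<sigma> * log_deriv s \<sigma>) - A0 s \<sigma> - \<sigma> * deriv (A0 s) \<sigma>) * \<psi>0 \<tau>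
           + 2 * (R0 s \<sigma> + \<sigma> * deriv (R0 s) \<sigma>) * \<psi>1 \<tau> - (P0 s \<sigma> - \<sigma> * A0 s \<sigma>) * \<psi>1 \<tau> - 2 * (\<sigma> * R0 s \<sigma>) * \<psi>2 \<tau>)
      + (real (card (- {i, j})) * (- 2 * prof s \<sigma> * \<psi>1 \<tau>) + 2 * (\<tau> - \<sigma>) * (2 * prof s \<sigma> * \<psi>2 \<tau>))))"
    unfolding dX dE dZ
    unfolding mix_def flux_X_def flux_E_def flux_Z_def sep_def \<sigma>_\<tau>_def[symmetric] D deriv_const
    by (simp add: algebra_simps)
  also have "\<dots> = complex_of_real t * (zc x * complex_of_real (prof s \<sigma> * (\<psi>0 \<tau> * log_rate s \<sigma> + \<psi>1 \<tau> * e1 s \<sigma> + \<psi>2 \<tau> * e2 \<sigma> \<tau>)))"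
  proof -
    have k: "2 * \<d> * \<kappa> s \<sigma> = 4 * \<d> * \<sigma> * log_deriv s \<sigma>" by (simp add: \<kappa>_def)
    show ?thesis unfolding e1_def e2_def k A0_def P0_def Q0_def R0_def
      by (intro arg_cong[of _ _ "\<lambda>r. complex_of_real t * (zc x * complex_of_real r)"]) (simp add: algebra_simps)
  qed
  finally show ?thesis unfolding sol'_def force_def s_def[symmetric] \<sigma>_\<tau>_def[symmetric]
    by (simp add: algebra_simps)
qed

lemma partial_sol:
  assumes t: "t < 1"
  shows "partial a (sol t) x = complex_of_real t * (ec a * complex_of_real (prof (1 - t) (sg x) * \<psi>0 (tau x))
     + zc x * complex_of_real (2 * prof (1 - t) (sg x) * (pX x a * log_deriv (1 - t) (sg x) * \<psi>0 (tau x) - x $ a * \<psi>1 (tau x))))"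
proof -
  have s: "0 < 1 - t" using t by simp
  have z: "smooth_on (dom (1 - t)) (\<lambda>\<sigma>. 0)" by (rule smooth_on_intros(1))
  note P = smooth_flux_parts(4)[OF s]
  have zP: "smooth (\<lambda>x. zc x * mix (prof (1 - t)) (\<lambda>\<sigma>. 0) x)" by (intro smooth_intros(4) smooth_coordinates P)
  show ?thesis unfolding sol_def[abs_def]
    by (simp only: partial_cmult[OF zP] partial_smooth_simps(2)[OF smooth_coordinates(3) P] partial_coordinates
        partial_mix[OF s smooth_profile(1)[OF s] z])
      (simp add: mix_def sep_def deriv_flux_coefficients(4)[OF s sg_dom[OF s]] algebra_simps)
qed

text \<open>
Here the definitions of \<beta>, \<b> and \<mu> are used: they are equivalent to the equality of the radial and
the rotational components of both sides.
\<close>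

lemma coeff_matrix_sol:
  assumes t: "t < 1" and x: "sg x \<noteq> 0"
  shows "(coeff_matrix t x *v (\<chi> a. partial a (sol t) x)) $ k = flux t k x"
proof -
  define s \<sigma> where "s = 1 - t" "\<sigma> = sg x"
  define G L k0 k1 where "G = prof s \<sigma>" "L = log_deriv s \<sigma>" "k0 = \<psi>0 (tau x)" "k1 = \<psi>1 (tau x)"
  note d = s_\<sigma>_def G_L_k0_k1_def
  have \<sigma>0: "\<sigma> \<noteq> 0" using x by (simp add: d)
  define a b e where "a = t * (G * k0)" "b = t * (2 * (G * L * k0 - G * k1))" "e = t * (- 2 * (G * k1))"
  have xa: "x $ m = pX x m + pZ x m" for m by (simp add: pX_def pZ_def)
  have g: "(\<chi> m. partial m (sol t) x) = (\<chi> m. complex_of_real a * ec m + complex_of_real (b * pX x m) * zc x + complex_of_real (e * pZ x m) * zc x)"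
    unfolding vec_eq_iff vec_lambda_beta partial_sol[OF t] d[symmetric] a_b_e_def
    by (simp add: xa algebra_simps)
  define ka where "ka = \<kappa> s \<sigma>"
  have kap: "2 * \<sigma> * L = ka" by (simp add: ka_def \<kappa>_def d)
  have bb: "\<b> s \<sigma> = \<mu> s \<sigma> - \<beta> s \<sigma> * (1 + ka)" by (simp add: \<mu>_def ka_def)
  have qq: "q s \<sigma> = \<beta> s \<sigma> + \<d> * (1 + ka)" by (simp add: \<beta>_def ka_def)
  have bq: "\<sigma> * (log_rate s \<sigma> - 2 * (q' s \<sigma> + q s \<sigma> * L)) = q s \<sigma> - \<b> s \<sigma>"
    by (simp add: \<b>_def d algebra_simps)
  have A: "\<sigma> * A0 s \<sigma> = G * (\<beta> s \<sigma> + \<d> * (1 + ka) - (\<mu> s \<sigma> - \<beta> s \<sigma> * (1 + ka)))"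
    unfolding bb[symmetric] qq[symmetric] bq[symmetric] by (simp add: A0_def d)
  have c1: "a * (\<mu> s \<sigma> - \<beta> s \<sigma>) - b * \<beta> s \<sigma> * \<sigma> = t * ((P0 s \<sigma> - \<sigma> * A0 s \<sigma>) * k0 + 2 * (\<sigma> * R0 s \<sigma>) * k1)"
    unfolding A P0_def R0_def G_L_k0_k1_def(1)[symmetric] qq a_b_e_def kap[symmetric] by (simp add: algebra_simps)
  have "\<sigma> * (a * (\<d> + 2 * \<beta> s \<sigma> - \<mu> s \<sigma>) / \<sigma> + b * (\<d> + \<beta> s \<sigma>)) = a * (\<d> + 2 * \<beta> s \<sigma> - \<mu> s \<sigma>) + \<sigma> * b * (\<d> + \<beta> s \<sigma>)"
    using \<sigma>0 by (simp add: distrib_left)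
  also have "\<dots> = t * (\<sigma> * A0 s \<sigma> * k0 - 2 * (\<sigma> * Q0 s \<sigma>) * k1)"
    unfolding A Q0_def G_L_k0_k1_def(1)[symmetric] a_b_e_def kap[symmetric] by (simp add: algebra_simps)
  also have "\<dots> = \<sigma> * (t * (A0 s \<sigma> * k0 - 2 * Q0 s \<sigma> * k1))" by (simp add: algebra_simps)
  finally have c2: "a * (\<d> + 2 * \<beta> s \<sigma> - \<mu> s \<sigma>) / \<sigma> + b * (\<d> + \<beta> s \<sigma>) = t * (A0 s \<sigma> * k0 - 2 * Q0 s \<sigma> * k1)"
    using \<sigma>0 by (simp only: mult_cancel_left) blast
  have "(coeff_matrix t x *v (\<chi> m. partial m (sol t) x)) $ k
     = complex_of_real (t * ((P0 s \<sigma> - \<sigma> * A0 s \<sigma>) * k0 + 2 * (\<sigma> * R0 s \<sigma>) * k1)) * ec k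
      + complex_of_real (t * (A0 s \<sigma> * k0 - 2 * Q0 s \<sigma> * k1) * pX x k) * zc x + complex_of_real (e * pZ x k) * zc x"
    unfolding g coeff_matrix_gradient[OF x] s_\<sigma>_def[symmetric] c1 c2 by (rule refl)
  also have "\<dots> = flux t k x"
    unfolding flux_def flux_X_def flux_E_def flux_Z_def mix_def sep_def d[symmetric] a_b_e_def by (simp add: algebra_simps)
  finally show ?thesis .
qed

end

section \<open>Ellipticity\<close>

context concentrating_profile
begin

lemma coefficients_measurable:
  "(\<lambda>p :: real \<times> (real^'n). sg (snd p)) \<in> borel_measurable borel"
  "(\<lambda>p :: real \<times> (real^'n). pX (snd p) k) \<in> borel_measurable borel"
  "(\<lambda>p :: real \<times> (real^'n). pY (snd p) k) \<in> borel_measurable borel"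
  "(\<lambda>p :: real \<times> (real^'n). \<mu> (1 - fst p) (sg (snd p))) \<in> borel_measurable borel"
  "(\<lambda>p :: real \<times> (real^'n). \<beta> (1 - fst p) (sg (snd p))) \<in> borel_measurable borel"
proof -
  have x: "(\<lambda>p :: real \<times> (real^'n). snd p $ k) \<in> borel_measurable borel" for k
    by (intro borel_measurable_continuous_onI continuous_intros)
  have t[measurable]: "(\<lambda>p :: real \<times> (real^'n). fst p) \<in> borel_measurable borel"
    by (intro borel_measurable_continuous_onI continuous_intros)
  show s[measurable]: "(\<lambda>p :: real \<times> (real^'n). sg (snd p)) \<in> borel_measurable borel"
    unfolding sg_def using x[of i] x[of j] by measurable
  show "(\<lambda>p :: real \<times> (real^'n). pX (snd p) k) \<in> borel_measurable borel"
    using x[of k] by (cases "k = i \<or> k = j") (auto simp: pX_def)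
  show "(\<lambda>p :: real \<times> (real^'n). pY (snd p) k) \<in> borel_measurable borel"
    using x[of i] x[of j] ij by (cases "k = i"; cases "k = j") (auto simp: pY_def)
  have be[measurable]: "(\<lambda>p :: real \<times> (real^'n). \<beta> (1 - fst p) (sg (snd p))) \<in> borel_measurable borel"
    unfolding \<beta>_def q_def \<kappa>_def log_deriv_def by measurable
  then show "(\<lambda>p :: real \<times> (real^'n). \<beta> (1 - fst p) (sg (snd p))) \<in> borel_measurable borel" .
  show "(\<lambda>p :: real \<times> (real^'n). \<mu> (1 - fst p) (sg (snd p))) \<in> borel_measurable borel"
    unfolding \<mu>_def \<b>_def \<kappa>_def log_deriv_def log_rate_def q_def q'_def by measurable
qed

lemma elliptic_coeff_matrix: "elliptic (coeff_matrix)"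
  unfolding elliptic_def
proof (intro conjI)
  note [measurable] = coefficients_measurable
  have "(\<lambda>p. coeff_matrix (fst p) (snd p) $ k $ m) \<in> borel_measurable borel" for k m
    unfolding coeff_matrix_def vec_lambda_beta by measurable
  then have "(\<lambda>p. coeff_matrix (fst p) (snd p) $ k $ m \<bullet> b) \<in> borel_measurable borel" for k m b
    by (intro borel_measurable_inner) auto
  then have "(\<lambda>p. coeff_matrix (fst p) (snd p)) \<in> borel_measurable borel"
    by (subst borel_measurable_euclidean_space) (auto simp: Basis_vec_def inner_axis)
  then show "(\<lambda>(t, x). coeff_matrix t x) \<in> borel_measurable (restrict_space borel ({0..1} \<times> UNIV))"
    unfolding case_prod_beta' by (rule measurable_restrict_space1)
  show "\<exists>\<Lambda>>0. \<exists>\<mu>>0. \<forall>t\<in>{0..1}. \<forall>x \<xi>. norm (coeff_matrix t x *v \<xi>) \<le> \<Lambda> * norm \<xi> \<and> \<mu> * (norm \<xi>)\<^sup>2 \<le> Re (cdot (coeff_matrix t x *v \<xi>) \<xi>)"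
    using coeff_matrix_elliptic coeff_matrix_bounded params
    by (intro exI[of _ "real CARD('n) * real CARD('n) * 9"] exI[of _ "\<c> / 4 * \<d>"] conjI) auto
qed

end

section \<open>The concentrating function solves the equation\<close>

context concentrating_profile
begin

lemma outside_ball:
  assumes "norm x > 1"
  shows "sol t x = 0" "sol' t x = 0" "force t x = 0" "flux t a x = 0" "\<psi>0 (tau x) = 0" "\<psi>1 (tau x) = 0"
proof -
  have "tau x > 1" using assms one_less_power[of "norm x" 2] by (simp add: tau_def)
  note z = cutoffs_eq_0[OF this]
  show "sol t x = 0" "sol' t x = 0" "force t x = 0" "flux t a x = 0" "\<psi>0 (tau x) = 0" "\<psi>1 (tau x) = 0"
    by (simp_all add: z sol_def sol'_def force_def flux_def flux_X_def flux_E_def flux_Z_def mix_def sep_def)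
qed

lemma test_functions:
  assumes "t < 1"
  shows "test_function (sol t)" "test_function (flux t a)"
proof -
  have s: "0 < 1 - t" using assms by simp
  note sm = smooth_flux_parts[OF s]
  have "smooth (sol t)" unfolding sol_def[abs_def] by (intro smooth_intros(1,4) smooth_coordinates sm)
  then show "test_function (sol t)" by (rule test_functionI[OF _ compact_cball[of 0 1]]) (simp add: outside_ball)
  have "smooth (flux t a)" unfolding flux_def[abs_def] by (intro smooth_intros(1,3,4) smooth_coordinates sm)
  then show "test_function (flux t a)" by (rule test_functionI[OF _ compact_cball[of 0 1]]) (simp add: outside_ball)
qed

lemma jointly_continuous:
  "continuous_on ({0<..<1} \<times> UNIV) (\<lambda>p. sol (fst p) (snd p))"
  "continuous_on ({0<..<1} \<times> UNIV) (\<lambda>p. sol' (fst p) (snd p))"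
  "continuous_on ({0<..<1} \<times> UNIV) (\<lambda>p. force (fst p) (snd p))"
  "continuous_on ({0<..<1} \<times> UNIV) (\<lambda>p. partial a (sol (fst p)) (snd p))"
proof -
  let ?T = "{0<..<1} \<times> (UNIV :: (real^'n) set)"
  have pos: "sg (snd p) + (1 - fst p) \<noteq> 0" "sg (snd p) + \<l> * (1 - fst p) \<noteq> 0" if "p \<in> ?T" for p
  proof -
    have s: "0 < 1 - fst p" using that by auto
    show "sg (snd p) + (1 - fst p) \<noteq> 0" "sg (snd p) + \<l> * (1 - fst p) \<noteq> 0"
      using dom_pos[OF s sg_dom[OF s, of "snd p"]] by auto
  qed
  have sg: "continuous_on ?T (\<lambda>p. sg (snd p))" unfolding sg_def by (intro continuous_intros)
  have ta: "continuous_on ?T (\<lambda>p. tau (snd p))" unfolding tau_def by (intro continuous_intros)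
  have z: "continuous_on ?T (\<lambda>p. zc (snd p))" unfolding zc_def by (intro continuous_intros)
  have x: "continuous_on ?T (\<lambda>p. snd p $ a)" by (intro continuous_intros)
  have X: "continuous_on ?T (\<lambda>p. pX (snd p) a)"
    by (cases "a = i \<or> a = j") (auto simp: pX_def intro!: continuous_intros)
  have e: "continuous_on UNIV \<psi>0" "continuous_on UNIV \<psi>1" "continuous_on UNIV \<psi>2"
    by (intro smooth_on_continuous smooth_cutoffs open_UNIV)+
  have k: "continuous_on ?T (\<lambda>p. \<psi>0 (tau (snd p)))" "continuous_on ?T (\<lambda>p. \<psi>1 (tau (snd p)))" "continuous_on ?T (\<lambda>p. \<psi>2 (tau (snd p)))"
    using continuous_on_compose2[OF e(1) ta] continuous_on_compose2[OF e(2) ta] continuous_on_compose2[OF e(3) ta] by auto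
  have G: "continuous_on ?T (\<lambda>p. prof (1 - fst p) (sg (snd p)))"
    unfolding prof_def by (intro continuous_intros sg ballI pos)
  have L: "continuous_on ?T (\<lambda>p. log_deriv (1 - fst p) (sg (snd p)))"
    unfolding log_deriv_def by (intro continuous_intros sg ballI pos)
  have r: "continuous_on ?T (\<lambda>p. log_rate (1 - fst p) (sg (snd p)))"
    unfolding log_rate_def by (intro continuous_intros sg ballI pos)
  have q: "continuous_on ?T (\<lambda>p. q (1 - fst p) (sg (snd p)))"
    unfolding q_def by (intro continuous_intros sg ballI no_zero_divisors pos zero_neq_numeral[symmetric])
  have ka: "continuous_on ?T (\<lambda>p. \<kappa> (1 - fst p) (sg (snd p)))" unfolding \<kappa>_def by (intro continuous_intros sg L)
  have be: "continuous_on ?T (\<lambda>p. \<beta> (1 - fst p) (sg (snd p)))" unfolding \<beta>_def by (intro continuous_intros q ka)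
  show "continuous_on ?T (\<lambda>p. sol (fst p) (snd p))"
    unfolding sol_def mix_def sep_def by (intro continuous_intros z G k)
  show "continuous_on ?T (\<lambda>p. sol' (fst p) (snd p))"
    unfolding sol'_def by (intro continuous_intros z G k r)
  show "continuous_on ?T (\<lambda>p. force (fst p) (snd p))"
    unfolding force_def e1_def e2_def by (intro continuous_intros z G k be ka q sg ta)
  have "continuous_on ?T (\<lambda>p. complex_of_real (fst p) * (ec a * complex_of_real (prof (1 - fst p) (sg (snd p)) * \<psi>0 (tau (snd p)))
     + zc (snd p) * complex_of_real (2 * prof (1 - fst p) (sg (snd p)) * (pX (snd p) a * log_deriv (1 - fst p) (sg (snd p)) * \<psi>0 (tau (snd p)) - snd p $ a * \<psi>1 (tau (snd p))))))"
    by (intro continuous_intros z G k L X x)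
  then show "continuous_on ?T (\<lambda>p. partial a (sol (fst p)) (snd p))"
    by (rule continuous_on_cong[THEN iffD1, OF refl, rotated]) (auto simp: partial_sol)
qed

lemma sol_has_vector_derivative:
  assumes t: "t \<in> {0<..<1}"
  shows "((\<lambda>t. sol t x) has_vector_derivative sol' t x) (at t)"
proof -
  have s: "0 < 1 - t" using t by simp
  have l: "((\<lambda>t::real. 1 - t) has_real_derivative - 1) (at t)" by (auto intro!: derivative_eq_intros)
  have "((\<lambda>t. prof (1 - t) (sg x)) has_real_derivative prof (1 - t) (sg x) * log_rate (1 - t) (sg x)) (at t)"
    using DERIV_chain2[OF prof_derivatives(3)[OF s sg_dom[OF s]] l] by simp
  from DERIV_mult[OF DERIV_ident this]
  have "((\<lambda>t. t * prof (1 - t) (sg x)) has_vector_derivative prof (1 - t) (sg x) * (1 + t * log_rate (1 - t) (sg x))) (at t)"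
    unfolding has_real_derivative_iff_has_vector_derivative[symmetric] by (simp add: algebra_simps)
  then have "((\<lambda>t. complex_of_real (t * prof (1 - t) (sg x))) has_vector_derivative complex_of_real (prof (1 - t) (sg x) * (1 + t * log_rate (1 - t) (sg x)))) (at t)"
    by (rule bounded_linear.has_vector_derivative[OF bounded_linear_of_real])
  from has_vector_derivative_mult_right[OF this, of "zc x * complex_of_real (\<psi>0 (tau x))"]
  show ?thesis by (simp add: sol_def sol'_def mix_def sep_def mult_ac)
qed

lemma square_integrable_parts:
  assumes "t \<in> {0<..<1}"
  shows "square_integrable (sol t)" "square_integrable (sol' t)" "square_integrable (force t)" "square_integrable (partial a (sol t))"
proof -
  note c = jointly_continuous[THEN slice_continuous, OF assms]
  show "square_integrable (sol t)" by (rule sqint_unit_ball[OF c(1)]) (simp add: outside_ball)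
  show "square_integrable (sol' t)" by (rule sqint_unit_ball[OF c(2)]) (simp add: outside_ball)
  show "square_integrable (force t)" by (rule sqint_unit_ball[OF c(3)]) (simp add: outside_ball)
  show "square_integrable (partial a (sol t))"
    by (rule sqint_unit_ball[OF c(4)]) (use assms in \<open>simp add: outside_ball partial_sol\<close>)
qed

lemma AE_sg_nonzero: "AE x in lborel. sg x \<noteq> 0"
  using AE_coordinate_nonzero[of i]
proof eventually_elim
  fix x :: "real^'n" assume "x $ i \<noteq> 0"
  then have "0 < (x $ i)\<^sup>2" by simp
  then show "sg x \<noteq> 0" using zero_le_power2[of "x $ j"] unfolding sg_def by linarith
qed

text \<open>
The flux is a field of test functions even though coeff_matrix is discontinuous at sg x = 0, so the
weak divergence is the classical one.
\<close>

lemma concentrating_equation: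
  assumes t: "t \<in> {0<..<1}"
  shows "div_op (coeff_matrix t) (h1_of (sol t)) + l2_antidual (abs_l2 (force t)) = l2_antidual (abs_l2 (sol' t))"
proof (rule antidual_eqI)
  fix w :: "'n h1"
  have t1: "t < 1" "t \<in> {0..1}" using t by auto
  note tf = test_functions[OF t1(1)]
  note Am = elliptic_slice_measurable[OF elliptic_coeff_matrix t1(2)]
  have AE1: "AE x in lborel. cdot (coeff_matrix t x *v h1_grad (h1_of (sol t)) x) (h1_grad w x) = (\<Sum>k\<in>UNIV. flux t k x * cnj (h1_grad w x $ k))"
    using AE_sg_nonzero h1_grad_h1_of[OF tf(1)]
    by eventually_elim (simp add: cdot_def coeff_matrix_sol[OF t1(1)])
  have gw: "(\<lambda>x. cnj (h1_grad w x $ k)) \<in> borel_measurable lborel" for k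
    using sqint_measurable[OF sqint_cnj[OF l2_rep_sqint]] by (simp add: h1_grad_def)
  have hw: "(\<lambda>x. cnj (l2_rep (h1_l2 w) x)) \<in> borel_measurable lborel"
    by (rule sqint_measurable[OF sqint_cnj[OF l2_rep_sqint]])
  have fm: "flux t k \<in> borel_measurable lborel" for k
    by (rule sqint_measurable[OF test_function_sqint(1)[OF tf(2)]])
  have "(\<integral>x. cdot (coeff_matrix t x *v h1_grad (h1_of (sol t)) x) (h1_grad w x) \<partial>lborel) = (\<integral>x. (\<Sum>k\<in>UNIV. flux t k x * cnj (h1_grad w x $ k)) \<partial>lborel)"
  proof (rule integral_cong_AE[OF _ _ AE1])
    show "(\<lambda>x. cdot (coeff_matrix t x *v h1_grad (h1_of (sol t)) x) (h1_grad w x)) \<in> borel_measurable lborel"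
      by (rule borel_measurable_integrable, rule div_op_bounds(1)[OF Am, where \<Lambda> = "real CARD('n) * real CARD('n) * 9"])
        (auto intro!: coeff_matrix_bounded t1(2))
    show "(\<lambda>x. \<Sum>k\<in>UNIV. flux t k x * cnj (h1_grad w x $ k)) \<in> borel_measurable lborel"
      by (intro borel_measurable_sum borel_measurable_times fm gw)
  qed
  also have "\<dots> = - (\<integral>x. (sol' t x - force t x) * cnj (l2_rep (h1_l2 w) x) \<partial>lborel)"
    unfolding weak_divergence[OF tf(2)] divergence_flux[OF t1(1)] by (rule refl)
  finally have 1: "antidual_apply (div_op (coeff_matrix t) (h1_of (sol t))) w = (\<integral>x. (sol' t x - force t x) * cnj (l2_rep (h1_l2 w) x) \<partial>lborel)"
    by (subst antidual_apply_div_op[OF Am coeff_matrix_bounded[OF t1(2)]]) simp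
  note sq = square_integrable_parts[OF t]
  have l2: "antidual_apply (l2_antidual (abs_l2 g)) w = (\<integral>x. g x * cnj (l2_rep (h1_l2 w) x) \<partial>lborel)" if g: "square_integrable g" for g
    unfolding antidual_apply_l2_antidual
  proof (rule integral_cong_AE)
    show "(\<lambda>x. l2_rep (abs_l2 g) x * cnj (l2_rep (h1_l2 w) x)) \<in> borel_measurable lborel"
      "(\<lambda>x. g x * cnj (l2_rep (h1_l2 w) x)) \<in> borel_measurable lborel"
      by (intro borel_measurable_times hw sqint_measurable l2_rep_sqint g)+
    show "AE x in lborel. l2_rep (abs_l2 g) x * cnj (l2_rep (h1_l2 w) x) = g x * cnj (l2_rep (h1_l2 w) x)"
      using l2_rep_abs[OF g] by eventually_elim simp
  qed
  have "antidual_apply (div_op (coeff_matrix t) (h1_of (sol t))) w = antidual_apply (l2_antidual (abs_l2 (\<lambda>x. sol' t x - force t x))) w"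
    unfolding 1 by (rule l2[symmetric]) (intro sqint_diff sq)
  also have "abs_l2 (\<lambda>x. sol' t x - force t x) = abs_l2 (sol' t) - abs_l2 (force t)" by (simp add: minus_l2_abs sq)
  also have "l2_antidual \<dots> = (l2_antidual (abs_l2 (sol' t)) - l2_antidual (abs_l2 (force t)) :: 'n h1 antidual)"
    by (rule linear_diff[OF bounded_linear.linear[OF bounded_linear_l2_antidual]])
  finally show "antidual_apply (div_op (coeff_matrix t) (h1_of (sol t)) + l2_antidual (abs_l2 (force t))) w = antidual_apply (l2_antidual (abs_l2 (sol' t))) w"
    by (simp add: antidual_apply_simps)
qed

end

section \<open>Size of the solution and of the forcing\<close>

context concentrating_profile
begin

definition weight :: "real^'n \<Rightarrow> real" where "weight x = sg x powr (\<gamma> - 1) * indicator (cball 0 1) x"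
definition "W = (\<integral>x. weight x \<partial>lborel)"
definition "M = \<l> powr (\<gamma> - 2)"

lemma weight_facts: "integrable lborel weight" "0 \<le> weight x" "0 \<le> W" "0 < M"
proof -
  show "integrable lborel weight"
    using integrable_weight[of \<gamma> i j] \<gamma> ij by (simp add: weight_def[abs_def] sg_def)
  show w: "0 \<le> weight x" for x by (simp add: weight_def)
  show "0 \<le> W" unfolding W_def by (simp add: w)
  show "0 < M" using params by (simp add: M_def)
qed

lemma norm_abs_l2_le_weight:
  assumes \<phi>: "square_integrable \<phi>" "\<And>x. norm x > 1 \<Longrightarrow> \<phi> x = 0"
    and b: "\<And>x. norm x \<le> 1 \<Longrightarrow> 0 < sg x \<Longrightarrow> (cmod (\<phi> x))\<^sup>2 \<le> C * sg x powr (\<gamma> - 1)"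
  shows "(norm (abs_l2 \<phi>))\<^sup>2 \<le> C * W"
proof -
  have "(\<integral>x. (cmod (\<phi> x))\<^sup>2 \<partial>lborel) \<le> (\<integral>x. C * weight x \<partial>lborel)"
  proof (rule integral_mono_AE)
    show "integrable lborel (\<lambda>x. (cmod (\<phi> x))\<^sup>2)" using \<phi>(1) by (simp add: square_integrable_def)
    show "integrable lborel (\<lambda>x. C * weight x)" by (intro integrable_mult_right weight_facts)
    show "AE x in lborel. (cmod (\<phi> x))\<^sup>2 \<le> C * weight x"
      using AE_sg_nonzero
    proof eventually_elim
      fix x :: "real^'n" assume "sg x \<noteq> 0"
      then have "0 < sg x" using sg_range(1)[of x] by linarith
      then show "(cmod (\<phi> x))\<^sup>2 \<le> C * weight x" using b[of x] \<phi>(2)[of x] by (cases "norm x \<le> 1") (auto simp: weight_def)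
    qed
  qed
  then show ?thesis unfolding norm_l2_abs[OF \<phi>(1)] W_def by simp
qed

text \<open>
As \<sigma> + \<l> s is at least \<l> (\<sigma> + s), the profile is at most M (\<sigma> + s)^(\<gamma>-1).  Both \<sigma> and s are below
\<sigma> + s, which allows the weight to be distributed between them.
\<close>

lemma prof_bounds:
  assumes s: "0 < s" "s \<le> 1" and \<sigma>: "0 < \<sigma>" "\<sigma> \<le> 1"
  shows "0 \<le> prof s \<sigma>" "(prof s \<sigma>)\<^sup>2 \<le> M\<^sup>2 * s powr (\<gamma> - 1) * \<sigma> powr (\<gamma> - 1)"
    "\<sigma> * (prof s \<sigma>)\<^sup>2 \<le> 2 * M\<^sup>2 * \<sigma> powr (\<gamma> - 1)"
proof -
  define p where "p = \<sigma> + s"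
  have p: "0 < p" "p \<le> 2" "\<sigma> \<le> p" "s \<le> p" using s \<sigma> by (auto simp: p_def)
  show n: "0 \<le> prof s \<sigma>" using s \<sigma> by (simp add: prof_def)
  have "\<l> * \<sigma> \<le> 1 * \<sigma>" using params \<sigma> by (intro mult_right_mono) auto
  then have "\<l> * p \<le> \<sigma> + \<l> * s" by (simp add: p_def distrib_left)
  then have "(\<sigma> + \<l> * s) powr (\<gamma> - 2) \<le> (\<l> * p) powr (\<gamma> - 2)"
    using \<gamma> params p by (intro powr_mono2') auto
  also have "\<dots> = M * p powr (\<gamma> - 2)" using params p by (simp add: powr_mult M_def)
  finally have "prof s \<sigma> \<le> p * (M * p powr (\<gamma> - 2))" unfolding prof_def p_def[symmetric] using p by (intro mult_left_mono) auto
  also have "\<dots> = M * p powr (\<gamma> - 1)" using p powr_add[of p 1 "\<gamma> - 2"] by simp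
  finally have G: "prof s \<sigma> \<le> M * p powr (\<gamma> - 1)" .
  have a: "p powr (\<gamma> - 1) \<le> \<sigma> powr (\<gamma> - 1)" "p powr (\<gamma> - 1) \<le> s powr (\<gamma> - 1)"
    using \<gamma> p s \<sigma> by (intro powr_mono2'; simp)+
  have M: "0 < M" by (rule weight_facts)
  have "(prof s \<sigma>)\<^sup>2 \<le> (M * s powr (\<gamma> - 1)) * (M * \<sigma> powr (\<gamma> - 1))"
    unfolding power2_eq_square
  proof (rule mult_mono)
    show "prof s \<sigma> \<le> M * s powr (\<gamma> - 1)" "prof s \<sigma> \<le> M * \<sigma> powr (\<gamma> - 1)"
      using G mult_left_mono[OF a(1), of M] mult_left_mono[OF a(2), of M] M by linarith+
  qed (use n M in auto)
  then show "(prof s \<sigma>)\<^sup>2 \<le> M\<^sup>2 * s powr (\<gamma> - 1) * \<sigma> powr (\<gamma> - 1)" by (simp add: power2_eq_square mult_ac)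
  have "\<sigma> * prof s \<sigma> \<le> p * (M * p powr (\<gamma> - 1))" using G p \<sigma> n by (intro mult_mono) auto
  also have "\<dots> = M * p powr \<gamma>" using p powr_add[of p 1 "\<gamma> - 1"] by simp
  also have "\<dots> \<le> M * 2"
  proof (rule mult_left_mono)
    have "p powr \<gamma> \<le> 2 powr \<gamma>" using p \<gamma> by (intro powr_mono2) auto
    also have "\<dots> \<le> 2 powr 1" using \<gamma> by (intro powr_mono) auto
    finally show "p powr \<gamma> \<le> 2" by simp
  qed (use M in simp)
  finally have "(\<sigma> * prof s \<sigma>) * prof s \<sigma> \<le> (M * 2) * (M * \<sigma> powr (\<gamma> - 1))"
  proof (rule mult_mono)
    show "prof s \<sigma> \<le> M * \<sigma> powr (\<gamma> - 1)" using G mult_left_mono[OF a(1), of M] M by linarith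
  qed (use M n in auto)
  then show "\<sigma> * (prof s \<sigma>)\<^sup>2 \<le> 2 * M\<^sup>2 * \<sigma> powr (\<gamma> - 1)" by (simp add: power2_eq_square mult_ac)
qed

lemma cutoff_bounds: "\<exists>K\<ge>0. \<forall>\<tau>\<in>{0..1}. 0 \<le> \<psi>0 \<tau> \<and> \<psi>0 \<tau> \<le> 1 \<and> \<bar>\<psi>1 \<tau>\<bar> \<le> K \<and> \<bar>\<psi>2 \<tau>\<bar> \<le> K"
proof -
  have b: "\<exists>K. \<forall>\<tau>\<in>{0..1}. \<bar>k \<tau>\<bar> \<le> K" if "smooth_on UNIV k" for k :: "real \<Rightarrow> real"
  proof -
    have "continuous_on {0..1} k" by (rule continuous_on_subset[OF smooth_on_continuous[OF that open_UNIV]]) simp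
    then have "bounded (k ` {0..1})" by (intro compact_imp_bounded compact_continuous_image compact_Icc)
    then show ?thesis unfolding bounded_iff by auto
  qed
  obtain K1 K2 where "\<forall>\<tau>\<in>{0..1}. \<bar>\<psi>1 \<tau>\<bar> \<le> K1" "\<forall>\<tau>\<in>{0..1}. \<bar>\<psi>2 \<tau>\<bar> \<le> K2"
    using b[OF smooth_cutoffs(2)] b[OF smooth_cutoffs(3)] by blast
  then show ?thesis using exp_inv_le_1 by (intro exI[of _ "max 0 (max K1 K2)"]) (fastforce simp: \<psi>0_def)
qed

lemma cmod_zc: "(cmod (zc x))\<^sup>2 = sg x"
  by (simp add: zc_def sg_def cmod_power2)

lemma unit_ball_facts:
  assumes "norm x \<le> 1" shows "tau x \<in> {0..1}" "sg x \<le> 1" "cmod (zc x) \<le> 1" "\<bar>x $ a\<bar> \<le> 1" "\<bar>pX x a\<bar> \<le> cmod (zc x)"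
proof -
  show t: "tau x \<in> {0..1}" using assms by (simp add: tau_def power_le_one)
  then show s: "sg x \<le> 1" using sg_range(2)[of x] by simp
  then show "cmod (zc x) \<le> 1" using power2_le_imp_le[of "cmod (zc x)" 1] by (simp add: cmod_zc)
  show "\<bar>x $ a\<bar> \<le> 1" using component_le_norm_cart[of x a] assms by linarith
  have "(pX x a)\<^sup>2 \<le> (cmod (zc x))\<^sup>2" unfolding cmod_zc by (auto simp: pX_def sg_def)
  then show "\<bar>pX x a\<bar> \<le> cmod (zc x)" using abs_le_square_iff[of "pX x a" "cmod (zc x)"] by simp
qed

text \<open>
The solution and the forcing are bounded by multiples of |zc| prof, and the gradient by a multiple of
prof, because \<sigma> |log_deriv| \<le> 2.
\<close>

lemma solution_estimates:
  shows "\<exists>K\<ge>0. \<forall>t\<in>{0<..<1}. norm (abs_l2 (sol t)) \<le> K * t \<and> norm (abs_l2 (force t)) \<le> K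
      \<and> (\<forall>a. (norm (abs_l2 (partial a (sol t))))\<^sup>2 \<le> K * (1 - t) powr (\<gamma> - 1))"
proof -
  obtain Kc where Kc: "Kc \<ge> 0" "\<And>\<tau>. \<tau> \<in> {0..1} \<Longrightarrow> 0 \<le> \<psi>0 \<tau> \<and> \<psi>0 \<tau> \<le> 1 \<and> \<bar>\<psi>1 \<tau>\<bar> \<le> Kc \<and> \<bar>\<psi>2 \<tau>\<bar> \<le> Kc"
    using cutoff_bounds by blast
  define n where "n = real (card (- {i, j}))"
  define E where "E = 1 + Kc * (10 + 2 * n) + Kc * 8"
  have E0: "0 \<le> E" using Kc(1) by (simp add: E_def n_def)
  have b1: "norm (abs_l2 (sol t)) \<le> sqrt (2 * M\<^sup>2 * W) * t" if t: "t \<in> {0<..<1}" for t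
  proof -
    have "(norm (abs_l2 (sol t)))\<^sup>2 \<le> (t\<^sup>2 * (2 * M\<^sup>2)) * W"
    proof (rule norm_abs_l2_le_weight[OF square_integrable_parts(1)[OF t]])
      fix x :: "real^'n" assume x: "norm x \<le> 1" "0 < sg x"
      note B = unit_ball_facts[OF x(1)]
      define G where "G = prof (1 - t) (sg x)"
      have G: "0 \<le> G" "sg x * G\<^sup>2 \<le> 2 * M\<^sup>2 * sg x powr (\<gamma> - 1)"
        using prof_bounds[of "1 - t" "sg x"] t x B by (auto simp: G_def)
      have k: "(\<psi>0 (tau x))\<^sup>2 \<le> 1" using Kc(2)[OF B(1)] by (simp add: power_le_one)
      have "(cmod (sol t x))\<^sup>2 = t\<^sup>2 * (sg x * G\<^sup>2) * (\<psi>0 (tau x))\<^sup>2"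
        using t by (simp add: sol_def mix_def sep_def norm_mult power_mult_distrib cmod_zc G_def)
      also have "\<dots> \<le> t\<^sup>2 * (sg x * G\<^sup>2) * 1" using k x by (intro mult_left_mono) auto
      also have "\<dots> \<le> t\<^sup>2 * (2 * M\<^sup>2 * sg x powr (\<gamma> - 1))" using G by (simp add: mult_left_mono)
      finally show "(cmod (sol t x))\<^sup>2 \<le> t\<^sup>2 * (2 * M\<^sup>2) * sg x powr (\<gamma> - 1)" by (simp add: mult_ac)
    qed (simp add: outside_ball)
    then have "(norm (abs_l2 (sol t)))\<^sup>2 \<le> (sqrt (2 * M\<^sup>2 * W) * t)\<^sup>2"
      using weight_facts by (simp add: power_mult_distrib mult_ac)
    then show ?thesis by (rule power2_le_imp_le) (use t weight_facts in simp)
  qed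
  have b2: "norm (abs_l2 (force t)) \<le> sqrt (E\<^sup>2 * (2 * M\<^sup>2) * W)" if t: "t \<in> {0<..<1}" for t
  proof (rule real_le_rsqrt, rule norm_abs_l2_le_weight[OF square_integrable_parts(3)[OF t]])
    fix x :: "real^'n" assume x: "norm x \<le> 1" "0 < sg x"
    note B = unit_ball_facts[OF x(1)]
    define G where "G = prof (1 - t) (sg x)"
    have G: "0 \<le> G" "sg x * G\<^sup>2 \<le> 2 * M\<^sup>2 * sg x powr (\<gamma> - 1)"
      using prof_bounds[of "1 - t" "sg x"] t x B by (auto simp: G_def)
    define D where "D = \<psi>1 (tau x) * e1 (1 - t) (sg x) + \<psi>2 (tau x) * e2 (sg x) (tau x)"
    have e1: "\<bar>e1 (1 - t) (sg x)\<bar> \<le> 10 + 2 * n"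
    proof -
      have cb: "\<bar>1 + \<kappa> (1 - t) (sg x)\<bar> \<le> 3" "\<bar>q (1 - t) (sg x)\<bar> \<le> 1" "\<bar>\<beta> (1 - t) (sg x)\<bar> \<le> 2"
        using coefficient_bounds[of "1 - t" "sg x"] t x by auto
      define y where "y = 2 * \<d> * \<kappa> (1 - t) (sg x)"
      have "\<bar>y\<bar> \<le> (2 * (1 / 64)) * 4" unfolding y_def abs_mult using params cb by (intro mult_mono) auto
      then have y: "- 1 \<le> y" "y \<le> 1" by linarith+
      have n0: "n \<ge> 0" by (simp add: n_def)
      have b: "- 1 \<le> q (1 - t) (sg x)" "q (1 - t) (sg x) \<le> 1" "- 2 \<le> \<beta> (1 - t) (sg x)" "\<beta> (1 - t) (sg x) \<le> 2"
        using cb by linarith+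
      have gen: "\<bar>- 2 * (d + be) - 4 * d - y - 2 * r - 2 * n\<bar> \<le> 10 + 2 * n"
        if "0 < d" "d \<le> 1 / 64" "- 1 \<le> r" "r \<le> 1" "- 2 \<le> be" "be \<le> 2" "- 1 \<le> y" "y \<le> 1" "0 \<le> n" for d be r y n :: real
        using that by (simp add: abs_le_iff)
      show ?thesis unfolding e1_def n_def[symmetric] y_def[symmetric] by (rule gen[OF params(5,6) b y n0])
    qed
    have e2: "\<bar>e2 (sg x) (tau x)\<bar> \<le> 8"
    proof -
      have "\<bar>4 * sg x * \<d>\<bar> \<le> (4 * 1) * 1" unfolding abs_mult using params B(2) x by (intro mult_mono) auto
      then show ?thesis using B(1,2) sg_range[of x] unfolding e2_def by auto
    qed
    have "\<bar>\<psi>1 (tau x) * e1 (1 - t) (sg x)\<bar> \<le> Kc * (10 + 2 * n)" "\<bar>\<psi>2 (tau x) * e2 (sg x) (tau x)\<bar> \<le> Kc * 8"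
      unfolding abs_mult using Kc(1) Kc(2)[OF B(1)] e1 e2 by (intro mult_mono; simp)+
    then have "\<bar>D\<bar> \<le> Kc * (10 + 2 * n) + Kc * 8" unfolding D_def by linarith
    then have "\<bar>t * D\<bar> \<le> 1 * (Kc * (10 + 2 * n) + Kc * 8)" unfolding abs_mult using t by (intro mult_mono) auto
    then have tD: "\<bar>t * D\<bar> \<le> E - 1" unfolding E_def by simp
    have "\<bar>\<psi>0 (tau x)\<bar> \<le> 1" using Kc(2)[OF B(1)] by simp
    then have "\<bar>\<psi>0 (tau x) - t * D\<bar> \<le> E" using tD abs_triangle_ineq4[of "\<psi>0 (tau x)" "t * D"] by linarith
    from power_mono[OF this abs_ge_zero, of 2] have k: "(\<psi>0 (tau x) - t * D)\<^sup>2 \<le> E\<^sup>2" by simp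
    have "(cmod (force t x))\<^sup>2 = sg x * G\<^sup>2 * (\<psi>0 (tau x) - t * D)\<^sup>2"
      by (simp add: force_def norm_mult power_mult_distrib cmod_zc G_def D_def del: of_real_mult of_real_diff of_real_add)
    also have "\<dots> \<le> (2 * M\<^sup>2 * sg x powr (\<gamma> - 1)) * E\<^sup>2"
      by (rule mult_mono[OF G(2) k]) (use x in auto)
    finally show "(cmod (force t x))\<^sup>2 \<le> E\<^sup>2 * (2 * M\<^sup>2) * sg x powr (\<gamma> - 1)" by (simp add: mult_ac)
  qed (simp add: outside_ball)
  define H where "H = 5 + 2 * Kc"
  have b3: "(norm (abs_l2 (partial a (sol t))))\<^sup>2 \<le> (H\<^sup>2 * M\<^sup>2 * W) * (1 - t) powr (\<gamma> - 1)" if t: "t \<in> {0<..<1}" for t a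
  proof -
    have "(norm (abs_l2 (partial a (sol t))))\<^sup>2 \<le> (H\<^sup>2 * (M\<^sup>2 * (1 - t) powr (\<gamma> - 1))) * W"
    proof (rule norm_abs_l2_le_weight[OF square_integrable_parts(4)[OF t]])
      fix x :: "real^'n" assume x: "norm x \<le> 1" "0 < sg x"
      note B = unit_ball_facts[OF x(1)]
      define G where "G = prof (1 - t) (sg x)"
      define L where "L = log_deriv (1 - t) (sg x)"
      have G: "0 \<le> G" "G\<^sup>2 \<le> M\<^sup>2 * (1 - t) powr (\<gamma> - 1) * sg x powr (\<gamma> - 1)"
        using prof_bounds[of "1 - t" "sg x"] t x B by (auto simp: G_def)
      note k = Kc(2)[OF B(1)]
      have "\<bar>1 + \<kappa> (1 - t) (sg x)\<bar> \<le> 3" using coefficient_bounds(1)[of "1 - t" "sg x"] t x by auto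
      then have L: "sg x * \<bar>L\<bar> \<le> 2" using x(2) by (simp add: \<kappa>_def L_def abs_mult abs_le_iff) (auto simp: abs_if)
      have "cmod (zc x) * \<bar>pX x a\<bar> \<le> cmod (zc x) * cmod (zc x)" using B(5) by (rule mult_left_mono) simp
      then have "cmod (zc x) * \<bar>pX x a\<bar> \<le> sg x" by (simp add: cmod_zc[symmetric] power2_eq_square)
      then have "cmod (zc x) * \<bar>pX x a\<bar> * \<bar>L\<bar> \<le> sg x * \<bar>L\<bar>" by (rule mult_right_mono) simp
      then have zL: "cmod (zc x) * \<bar>pX x a\<bar> * \<bar>L\<bar> * \<psi>0 (tau x) \<le> 2 * 1"
        using L k by (intro mult_mono) auto
      have zx: "cmod (zc x) * \<bar>x $ a\<bar> * \<bar>\<psi>1 (tau x)\<bar> \<le> 1 * 1 * Kc"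
        using B k Kc(1) by (intro mult_mono) auto
      have "cmod (zc x) * \<bar>pX x a * L * \<psi>0 (tau x) - x $ a * \<psi>1 (tau x)\<bar>
          \<le> cmod (zc x) * (\<bar>pX x a * L * \<psi>0 (tau x)\<bar> + \<bar>x $ a * \<psi>1 (tau x)\<bar>)"
        by (intro mult_left_mono abs_triangle_ineq4) simp
      also have "\<dots> \<le> 2 + Kc" using zL zx k by (simp add: abs_mult distrib_left mult_ac)
      finally have z: "cmod (zc x) * \<bar>pX x a * L * \<psi>0 (tau x) - x $ a * \<psi>1 (tau x)\<bar> \<le> 2 + Kc" .
      define y where "y = pX x a * L * \<psi>0 (tau x) - x $ a * \<psi>1 (tau x)"
      have "cmod (partial a (sol t) x) = t * cmod (ec a * complex_of_real (G * \<psi>0 (tau x)) + zc x * complex_of_real (2 * G * y))"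
      proof -
        have "partial a (sol t) x = complex_of_real t * (ec a * complex_of_real (G * \<psi>0 (tau x)) + zc x * complex_of_real (2 * G * y))"
          unfolding G_def L_def y_def by (rule partial_sol) (use t in simp)
        then show ?thesis using t by (simp only: norm_mult norm_of_real) simp
      qed
      also have "\<dots> \<le> 1 * (cmod (ec a * complex_of_real (G * \<psi>0 (tau x))) + cmod (zc x * complex_of_real (2 * G * y)))"
        using t by (intro mult_mono norm_triangle_ineq) auto
      also have "\<dots> \<le> G * 1 + 2 * G * (2 + Kc)"
      proof -
        have "cmod (ec a) \<le> 1" by (simp add: ec_def)
        then have "cmod (ec a) * (G * \<psi>0 (tau x)) \<le> 1 * (G * 1)" using G(1) k by (intro mult_mono) auto
        moreover have "2 * G * (cmod (zc x) * \<bar>y\<bar>) \<le> 2 * G * (2 + Kc)" using z G(1) unfolding y_def by (intro mult_left_mono) auto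
        ultimately show ?thesis using G(1) k by (simp add: norm_mult abs_mult mult_ac)
      qed
      also have "\<dots> = H * G" by (simp add: H_def algebra_simps)
      finally have "(cmod (partial a (sol t) x))\<^sup>2 \<le> (H * G)\<^sup>2" by (rule power_mono) simp
      also have "\<dots> \<le> H\<^sup>2 * (M\<^sup>2 * (1 - t) powr (\<gamma> - 1) * sg x powr (\<gamma> - 1))"
        unfolding power_mult_distrib using G by (intro mult_left_mono) auto
      finally show "(cmod (partial a (sol t) x))\<^sup>2 \<le> H\<^sup>2 * (M\<^sup>2 * (1 - t) powr (\<gamma> - 1)) * sg x powr (\<gamma> - 1)" by (simp add: mult_ac)
    qed (use t in \<open>simp add: outside_ball partial_sol\<close>)
    then show ?thesis by (simp add: mult_ac)
  qed
  define K where "K = sqrt (2 * M\<^sup>2 * W) + sqrt (E\<^sup>2 * (2 * M\<^sup>2) * W) + H\<^sup>2 * M\<^sup>2 * W"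
  have K: "sqrt (2 * M\<^sup>2 * W) \<le> K" "sqrt (E\<^sup>2 * (2 * M\<^sup>2) * W) \<le> K" "H\<^sup>2 * M\<^sup>2 * W \<le> K" "0 \<le> K"
    using weight_facts(3) by (auto simp: K_def)
  show ?thesis
  proof (intro exI[of _ K] conjI ballI allI K)
    fix t :: real and a assume t: "t \<in> {0<..<1}"
    show "norm (abs_l2 (sol t)) \<le> K * t" by (rule order_trans[OF b1[OF t] mult_right_mono[OF K(1)]]) (use t in simp)
    show "norm (abs_l2 (force t)) \<le> K" using b2[OF t] K(2) by linarith
    show "(norm (abs_l2 (partial a (sol t))))\<^sup>2 \<le> K * (1 - t) powr (\<gamma> - 1)"
      using b3[OF t, of a] mult_right_mono[OF K(3), of "(1 - t) powr (\<gamma> - 1)"] by simp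
  qed
qed

end

section \<open>The solution as a function of time\<close>

lemma norm_h1_of:
  assumes "test_function \<phi>"
  shows "(norm (h1_of \<phi>))\<^sup>2 = (norm (abs_l2 \<phi>))\<^sup>2 + (\<Sum>a\<in>UNIV. (norm (abs_l2 (partial a \<phi>)))\<^sup>2)"
  by (simp add: norm_h1.rep_eq Rep_h1_of[OF assms] norm_prod_def norm_vec_def L2_set_def sum_nonneg)

lemma integrable_powr_reflected:
  assumes "0 < \<gamma>" shows "integrable I01 (\<lambda>t. (1 - t) powr (\<gamma> - 1))"
proof -
  define k where "k = (\<lambda>y::real. if y \<in> {0..1} then y powr (\<gamma> - 1) else 0)"
  have k: "integrable lborel k" unfolding k_def
    by (rule integrable_lborel_if_has_integral[OF _ _ _ has_integral_powr_from_0]) (use assms in auto)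
  have "integrable lborel (\<lambda>t. k (1 - t))" using lborel_integrable_real_affine[OF k, of "-1" 1] by simp
  then have "integrable lborel (\<lambda>t. indicator {0<..<1} t *\<^sub>R k (1 - t))" by (intro integrable_mult_indicator) auto
  moreover have "indicator {0<..<1} t *\<^sub>R k (1 - t) = indicator {0<..<1} t *\<^sub>R (1 - t) powr (\<gamma> - 1)" for t
    by (cases "t \<in> {0<..<1}") (auto simp: k_def)
  ultimately show ?thesis unfolding I01_integrable_iff by (simp only:)
qed

context concentrating_profile
begin

lemma sol_in_time:
  assumes "t \<in> {0<..<1}"
  shows "((\<lambda>t. h1_l2 (h1_of (sol t))) has_vector_derivative abs_l2 (sol' t)) (at t)"
    and "h1_l2 (h1_of (sol t)) = abs_l2 (sol t)"
proof -
  show "h1_l2 (h1_of (sol t)) = abs_l2 (sol t)" using assms by (intro h1_l2_h1_of test_functions) auto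
  have "((\<lambda>t. abs_l2 (sol t)) has_vector_derivative abs_l2 (sol' t)) (at t)"
    by (rule abs_l2_has_vector_derivative[OF jointly_continuous(1,2) _ _ sol_has_vector_derivative assms])
      (simp_all add: outside_ball)
  then show "((\<lambda>t. h1_l2 (h1_of (sol t))) has_vector_derivative abs_l2 (sol' t)) (at t)"
    by (rule has_vector_derivative_transform_within_open[OF _ open_lessThan[of 1]])
      (use assms in \<open>auto simp: h1_l2_h1_of test_functions\<close>)
qed

lemma continuous_in_time:
  "continuous_on {0<..<1} (\<lambda>t. abs_l2 (sol t))" "continuous_on {0<..<1} (\<lambda>t. abs_l2 (sol' t))"
  "continuous_on {0<..<1} (\<lambda>t. abs_l2 (force t))" "continuous_on {0<..<1} (\<lambda>t. h1_of (sol t))"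
proof -
  show c: "continuous_on {0<..<1} (\<lambda>t. abs_l2 (sol t))"
    by (rule abs_l2_continuous_in_time[OF jointly_continuous(1)]) (simp add: outside_ball)
  show "continuous_on {0<..<1} (\<lambda>t. abs_l2 (sol' t))"
    by (rule abs_l2_continuous_in_time[OF jointly_continuous(2)]) (simp add: outside_ball)
  show "continuous_on {0<..<1} (\<lambda>t. abs_l2 (force t))"
    by (rule abs_l2_continuous_in_time[OF jointly_continuous(3)]) (simp add: outside_ball)
  have "continuous_on {0<..<1} (\<lambda>t. abs_l2 (partial a (sol t)))" for a
  proof -
    define g where "g = (\<lambda>t. if t < 1 then partial a (sol t) else (\<lambda>x. 0))"
    have "continuous_on {0<..<1} (\<lambda>t. abs_l2 (g t))"
    proof (rule abs_l2_continuous_in_time)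
      show "continuous_on ({0<..<1} \<times> UNIV) (\<lambda>p. g (fst p) (snd p))"
        by (rule continuous_on_cong[THEN iffD2, OF refl _ jointly_continuous(4)[of a]]) (auto simp: g_def)
    qed (simp add: g_def partial_sol outside_ball)
    then show ?thesis by (rule continuous_on_cong[THEN iffD1, OF refl, rotated]) (simp add: g_def)
  qed
  then show "continuous_on {0<..<1} (\<lambda>t. h1_of (sol t))"
    by (intro h1_of_continuous_in_time test_functions c) auto
qed

lemma concentrating_solution:
  "is_solution coeff_matrix (\<lambda>t. l2_antidual (abs_l2 (force t))) (\<lambda>t. h1_of (sol t))"
  "(\<lambda>t. abs_l2 (force t)) \<in> bochner_Linf I01"
proof -
  obtain K where K: "K \<ge> 0" "\<And>t. t \<in> {0<..<1} \<Longrightarrow> norm (abs_l2 (sol t)) \<le> K * t"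
    "\<And>t. t \<in> {0<..<1} \<Longrightarrow> norm (abs_l2 (force t)) \<le> K"
    "\<And>t a. t \<in> {0<..<1} \<Longrightarrow> (norm (abs_l2 (partial a (sol t))))\<^sup>2 \<le> K * (1 - t) powr (\<gamma> - 1)"
    using solution_estimates by blast
  note ci = integrable_I01_const
  show "is_solution coeff_matrix (\<lambda>t. l2_antidual (abs_l2 (force t))) (\<lambda>t. h1_of (sol t))"
  proof (rule is_solution_if_classical[OF elliptic_coeff_matrix continuous_in_time(4)])
    show "integrable I01 (\<lambda>t. K\<^sup>2 + real CARD('n) * K * (1 - t) powr (\<gamma> - 1))"
      by (intro Bochner_Integration.integrable_add ci integrable_mult_right integrable_powr_reflected \<gamma>)
    fix t :: real assume t: "t \<in> {0<..<1}"
    have "norm (abs_l2 (sol t)) \<le> K * 1" using K(2)[OF t] mult_left_mono[of t 1 K] K(1) t by auto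
    then have "(norm (abs_l2 (sol t)))\<^sup>2 \<le> K\<^sup>2" by (intro power_mono) auto
    moreover have "(\<Sum>a\<in>UNIV. (norm (abs_l2 (partial a (sol t))))\<^sup>2) \<le> (\<Sum>a\<in>(UNIV :: 'n set). K * (1 - t) powr (\<gamma> - 1))"
      by (intro sum_mono K(4) t)
    moreover have "test_function (sol t)" by (rule test_functions) (use t in simp)
    ultimately show "(norm (h1_of (sol t)))\<^sup>2 \<le> K\<^sup>2 + real CARD('n) * K * (1 - t) powr (\<gamma> - 1)"
      by (simp add: norm_h1_of mult.assoc)
    show "((\<lambda>t. h1_l2 (h1_of (sol t))) has_vector_derivative abs_l2 (sol' t)) (at t)" by (rule sol_in_time[OF t])
    show "norm (abs_l2 (force t)) \<le> K" by (rule K(3)[OF t])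
    show "div_op (coeff_matrix t) (h1_of (sol t)) + l2_antidual (abs_l2 (force t)) = l2_antidual (abs_l2 (sol' t))"
      by (rule concentrating_equation[OF t])
    show "norm (h1_l2 (h1_of (sol t))) \<le> K * t" unfolding sol_in_time(2)[OF t] by (rule K(2)[OF t])
  qed (rule continuous_in_time)+
  show "(\<lambda>t. abs_l2 (force t)) \<in> bochner_Linf I01"
    unfolding bochner_Linf_def using continuous_I01_measurable[OF continuous_in_time(3)] K(3)
    by (auto simp: I01_AE_iff intro!: exI[of _ K])
qed

end

section \<open>Failure of time regularity\<close>

context concentrating_profile
begin

text \<open>
On this range of \<sigma> the profile grows by a factor of at least 16/15 from s to 2s: the first factor
of prof grows by at least 10/9, while the second loses at most (64/65)^2 since \<l> \<le> 1/32.  This outweighs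
the factor 1 - 2s \<ge> 49/50, which the linear growth in t contributes.
\<close>

lemma prof_increment:
  assumes s: "0 < s" "s \<le> 1 / 100" and \<sigma>: "2 * s \<le> \<sigma>" "\<sigma> \<le> 8 * s"
  shows "s powr (\<gamma> - 1) / 500 \<le> \<bar>(1 - s) * prof s \<sigma> - (1 - 2 * s) * prof (2 * s) \<sigma>\<bar>"
proof -
  define g1 where "g1 = prof s \<sigma>"
  define g2 where "g2 = prof (2 * s) \<sigma>"
  define b1 where "b1 = \<sigma> + \<l> * s"
  define b2 where "b2 = \<sigma> + \<l> * (2 * s)"
  have ls: "0 < \<l> * s" "\<l> * s \<le> 1 / 32 * s" using params s by (auto intro: mult_right_mono)
  have b: "0 < b1" "0 < b2" "b2 \<le> 65 / 64 * b1" "b2 \<le> \<sigma> + 2 * s"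
  proof -
    have e: "b2 = b1 + \<l> * s" by (simp add: b1_def b2_def)
    show "0 < b1" using ls s \<sigma> unfolding b1_def by linarith
    show "0 < b2" using \<open>0 < b1\<close> ls unfolding e by linarith
    have "\<sigma> \<le> b1" using ls unfolding b1_def by linarith
    then show "b2 \<le> 65 / 64 * b1" using ls s \<sigma> unfolding e by linarith
    show "b2 \<le> \<sigma> + 2 * s" using ls s unfolding e b1_def by linarith
  qed
  have "96 / 100 * b1 powr (\<gamma> - 2) \<le> (65 / 64) powr (\<gamma> - 2) * b1 powr (\<gamma> - 2)"
  proof (rule mult_right_mono)
    have "(65 / 64 :: real) powr (- 2) \<le> (65 / 64) powr (\<gamma> - 2)" using \<gamma> by (intro powr_mono) auto
    moreover have "(65 / 64 :: real) powr (- 2) = 64\<^sup>2 / 65\<^sup>2" by (simp add: powr_minus powr_numeral power_divide)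
    ultimately show "96 / 100 \<le> (65 / 64 :: real) powr (\<gamma> - 2)" by simp
  qed simp
  also have "\<dots> = (65 / 64 * b1) powr (\<gamma> - 2)" using b powr_mult[of "65 / 64" b1 "\<gamma> - 2"] by simp
  also have "\<dots> \<le> b2 powr (\<gamma> - 2)" using b \<gamma> by (intro powr_mono2') auto
  finally have pw: "96 / 100 * b1 powr (\<gamma> - 2) \<le> b2 powr (\<gamma> - 2)" .
  have "(10 / 9 * (\<sigma> + s)) * (96 / 100 * b1 powr (\<gamma> - 2)) \<le> (\<sigma> + 2 * s) * b2 powr (\<gamma> - 2)"
    using pw s \<sigma> by (intro mult_mono) auto
  moreover have "g1 = (\<sigma> + s) * b1 powr (\<gamma> - 2)" "g2 = (\<sigma> + 2 * s) * b2 powr (\<gamma> - 2)"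
    by (simp_all add: g1_def g2_def prof_def b1_def b2_def)
  moreover have "(10 / 9 * (\<sigma> + s)) * (96 / 100 * b1 powr (\<gamma> - 2)) = 16 / 15 * ((\<sigma> + s) * b1 powr (\<gamma> - 2))"
    by simp
  ultimately have r: "16 / 15 * g1 \<le> g2" by (simp only:)
  have g1: "0 \<le> g1" using s \<sigma> by (simp add: g1_def prof_def)
  have "s powr (\<gamma> - 1) / 10 \<le> g2"
  proof -
    have p: "0 < \<sigma> + 2 * s" using s \<sigma> by simp
    have "1 / 10 * s powr (\<gamma> - 1) \<le> 10 powr (\<gamma> - 1) * s powr (\<gamma> - 1)"
    proof (rule mult_right_mono)
      have "(10 :: real) powr (- 1) \<le> 10 powr (\<gamma> - 1)" using \<gamma> by (intro powr_mono) auto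
      then show "1 / 10 \<le> (10 :: real) powr (\<gamma> - 1)" by (simp add: powr_minus)
    qed simp
    also have "\<dots> = (10 * s) powr (\<gamma> - 1)" using s powr_mult[of 10 s "\<gamma> - 1"] by simp
    also have "\<dots> \<le> (\<sigma> + 2 * s) powr (\<gamma> - 1)" using p \<sigma> \<gamma> by (intro powr_mono2') auto
    also have "\<dots> = (\<sigma> + 2 * s) * (\<sigma> + 2 * s) powr (\<gamma> - 2)" using p powr_add[of "\<sigma> + 2 * s" 1 "\<gamma> - 2"] by simp
    also have "\<dots> \<le> g2" unfolding g2_def prof_def b2_def[symmetric]
      using p b \<gamma> by (intro mult_left_mono powr_mono2') auto
    finally show ?thesis by simp
  qed
  moreover have "2 * s * g2 \<le> 1 / 50 * g2" using s g1 r by (intro mult_right_mono) auto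
  moreover have "0 \<le> s * g1" using s g1 by simp
  ultimately have "s powr (\<gamma> - 1) / 500 \<le> (1 - 2 * s) * g2 - (1 - s) * g1"
    using r g1 by (simp add: left_diff_distrib)
  then show ?thesis unfolding g1_def g2_def by linarith
qed

text \<open>
The increment is estimated on a box whose sides in the directions i and j are [sqrt s, 2 sqrt s], so that
sg is between 2s and 8s, and whose other sides are so short that the cutoff stays at least exp_inv (1/2).  The
box has volume s V, and the square of the increment on it is at least of order s s^(2\<gamma>-2).
\<close>

lemma increment_lower_bound:
  "\<exists>c>0. \<forall>s. 0 < s \<longrightarrow> s \<le> 1 / 100 \<longrightarrow> c * s powr \<gamma> \<le> norm (abs_l2 (sol (1 - s)) - abs_l2 (sol (1 - 2 * s)))"
proof -
  define n where "n = real CARD('n)"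
  define k where "k = exp_inv (1 / 2)"
  define V where "V = (1 / (2 * n)) ^ card (- {i, j})"
  have n: "1 \<le> n" unfolding n_def by (simp add: Suc_leI)
  have k: "0 < k" by (simp add: k_def exp_inv_def)
  have V: "0 < V" using n by (simp add: V_def)
  define c where "c = 2 * k\<^sup>2 * V / 500\<^sup>2"
  have c: "0 < c" using k V by (simp add: c_def)
  have "sqrt c * s powr \<gamma> \<le> norm (abs_l2 (sol (1 - s)) - abs_l2 (sol (1 - 2 * s)))" if s: "0 < s" "s \<le> 1 / 100" for s
  proof -
    have t: "1 - s \<in> {0<..<1}" "1 - 2 * s \<in> {0<..<1}" using s by auto
    define \<phi> where "\<phi> = (\<lambda>x. sol (1 - s) x - sol (1 - 2 * s) x)"
    have sq: "square_integrable \<phi>" unfolding \<phi>_def by (intro sqint_diff square_integrable_parts t)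
    define a where "a = (\<chi> m. if m = i \<or> m = j then sqrt s else 0 :: real^'n)"
    define b where "b = (\<chi> m. if m = i \<or> m = j then 2 * sqrt s else 1 / (2 * n) :: real^'n)"
    have ab: "a $ m \<le> b $ m" for m using s n by (simp add: a_def b_def)
    have "measure lborel (cbox a b) = (\<Prod>m\<in>UNIV. b $ m - a $ m)"
      by (rule content_cbox_cart) (use ab in \<open>auto simp: interval_eq_empty_cart not_less\<close>)
    also have "\<dots> = (\<Prod>m\<in>{i, j}. b $ m - a $ m) * (\<Prod>m\<in>- {i, j}. b $ m - a $ m)"
      by (subst prod.union_disjoint[symmetric]) auto
    also have "(\<Prod>m\<in>- {i, j}. b $ m - a $ m) = V" unfolding V_def prod_constant[symmetric]
      by (rule prod.cong) (auto simp: a_def b_def)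
    also have "(\<Prod>m\<in>{i, j}. b $ m - a $ m) = s" using ij s by (simp add: a_def b_def)
    finally have vol: "measure lborel (cbox a b) = s * V" .
    define L where "L = 2 * s * (k * (s powr (\<gamma> - 1) / 500))\<^sup>2"
    have low: "L \<le> (cmod (\<phi> x))\<^sup>2" if x: "x \<in> cbox a b" for x
    proof -
      have xm: "a $ m \<le> x $ m" "x $ m \<le> b $ m" for m using x by (auto simp: mem_box_cart)
      have sqr: "s \<le> (x $ m)\<^sup>2" "(x $ m)\<^sup>2 \<le> 4 * s" if "m = i \<or> m = j" for m
      proof -
        have "sqrt s \<le> x $ m" "x $ m \<le> 2 * sqrt s" using xm[of m] that by (auto simp: a_def b_def)
        then have "(sqrt s)\<^sup>2 \<le> (x $ m)\<^sup>2" "(x $ m)\<^sup>2 \<le> (2 * sqrt s)\<^sup>2"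
          using s by (intro power_mono; simp add: order_trans[OF real_sqrt_ge_zero])+
        then show "s \<le> (x $ m)\<^sup>2" "(x $ m)\<^sup>2 \<le> 4 * s" using s by (auto simp: power_mult_distrib)
      qed
      have \<sigma>: "2 * s \<le> sg x" "sg x \<le> 8 * s" using sqr[of i] sqr[of j] by (auto simp: sg_def)
      have "tau x - sg x \<le> (\<Sum>m\<in>- {i, j}. (1 / (2 * n))\<^sup>2)"
        unfolding tau_minus_sg
      proof (rule sum_mono)
        fix m assume m: "m \<in> - {i, j}"
        then have "0 \<le> x $ m" "x $ m \<le> 1 / (2 * n)" using xm[of m] by (auto simp: a_def b_def)
        then show "(x $ m)\<^sup>2 \<le> (1 / (2 * n))\<^sup>2" by (intro power_mono)
      qed
      also have "\<dots> \<le> n * (1 / (2 * n))\<^sup>2"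
        unfolding sum_constant n_def by (intro mult_right_mono of_nat_mono card_mono) auto
      also have "\<dots> \<le> 1 / 4" using n by (simp add: power2_eq_square)
      finally have "1 / 2 \<le> 1 - tau x" using \<sigma> s by linarith
      then have \<psi>: "k \<le> \<psi>0 (tau x)"
        using frac_le[of 1 1 "1 / 2" "1 - tau x"] unfolding k_def \<psi>0_def exp_inv_def by simp
      define \<Delta> where "\<Delta> = (1 - s) * prof s (sg x) - (1 - 2 * s) * prof (2 * s) (sg x)"
      have D: "s powr (\<gamma> - 1) / 500 \<le> \<bar>\<Delta>\<bar>" unfolding \<Delta>_def by (rule prof_increment[OF s \<sigma>])
      have "\<phi> x = zc x * complex_of_real (\<psi>0 (tau x) * \<Delta>)"
        by (simp add: \<phi>_def sol_def mix_def sep_def \<Delta>_def algebra_simps)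
      then have "(cmod (\<phi> x))\<^sup>2 = sg x * (\<psi>0 (tau x) * \<bar>\<Delta>\<bar>)\<^sup>2"
        by (simp only: norm_mult norm_of_real power_mult_distrib cmod_zc power2_abs)
      moreover have "2 * s * (k * (s powr (\<gamma> - 1) / 500))\<^sup>2 \<le> sg x * (\<psi>0 (tau x) * \<bar>\<Delta>\<bar>)\<^sup>2"
        using \<sigma> D \<psi> k s by (intro mult_mono power_mono) auto
      ultimately show ?thesis by (simp add: L_def)
    qed
    have "L * (s * V) = (\<integral>x. L * indicator (cbox a b) x \<partial>lborel)" using vol by simp
    also have "\<dots> \<le> (\<integral>x. (cmod (\<phi> x))\<^sup>2 \<partial>lborel)"
    proof (rule integral_mono)
      show "integrable lborel (\<lambda>x. L * indicator (cbox a b) x)"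
        using emeasure_bounded_finite[OF bounded_cbox[of a b]] by (intro integrable_mult_right integrable_real_indicator) auto
      show "integrable lborel (\<lambda>x. (cmod (\<phi> x))\<^sup>2)" using sq by (simp add: square_integrable_def)
      show "L * indicator (cbox a b) x \<le> (cmod (\<phi> x))\<^sup>2" for x
        using low[of x] by (cases "x \<in> cbox a b") auto
    qed
    also have "\<dots> = (norm (abs_l2 \<phi>))\<^sup>2" by (rule norm_l2_abs[OF sq, symmetric])
    finally have "L * (s * V) \<le> (norm (abs_l2 \<phi>))\<^sup>2" .
    moreover have "L * (s * V) = (sqrt c * s powr \<gamma>)\<^sup>2"
    proof -
      have e: "s powr \<gamma> = s * s powr (\<gamma> - 1)" using s powr_add[of s 1 "\<gamma> - 1"] by simp
      show ?thesis unfolding e L_def using c by (simp add: power_mult_distrib power_divide c_def) (simp add: power2_eq_square)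
    qed
    ultimately have "(sqrt c * s powr \<gamma>)\<^sup>2 \<le> (norm (abs_l2 \<phi>))\<^sup>2" by (simp only:)
    then have "sqrt c * s powr \<gamma> \<le> norm (abs_l2 \<phi>)" by (rule power2_le_imp_le) simp
    also have "abs_l2 \<phi> = abs_l2 (sol (1 - s)) - abs_l2 (sol (1 - 2 * s))"
      unfolding \<phi>_def by (intro minus_l2_abs[symmetric] square_integrable_parts t)
    finally show ?thesis .
  qed
  then show ?thesis using c by (intro exI[of _ "sqrt c"]) auto
qed

lemma not_Hoelder:
  assumes \<theta>: "\<gamma> < \<theta>"
    and H: "\<And>s t. s \<in> {0<..<1} \<Longrightarrow> t \<in> {0<..<1} \<Longrightarrow> s < t \<Longrightarrow> norm (abs_l2 (sol t) - abs_l2 (sol s)) \<le> C * (t - s) powr \<theta>"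
  shows False
proof -
  obtain c where c: "c > 0" "\<And>s. 0 < s \<Longrightarrow> s \<le> 1 / 100 \<Longrightarrow> c * s powr \<gamma> \<le> norm (abs_l2 (sol (1 - s)) - abs_l2 (sol (1 - 2 * s)))"
    using increment_lower_bound by blast
  define \<delta> where "\<delta> = c / (2 * (\<bar>C\<bar> + 1))"
  define s where "s = min (1 / 100) (\<delta> powr (1 / (\<theta> - \<gamma>)))"
  have \<delta>: "0 < \<delta>" using c by (simp add: \<delta>_def)
  have s: "0 < s" "s \<le> 1 / 100" using \<delta> by (auto simp: s_def)
  have "s powr (\<theta> - \<gamma>) \<le> (\<delta> powr (1 / (\<theta> - \<gamma>))) powr (\<theta> - \<gamma>)"
    using s \<theta> by (intro powr_mono2) (auto simp: s_def)
  also have "\<dots> = \<delta>" using \<delta> \<theta> by (simp add: powr_powr)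
  finally have sd: "s powr (\<theta> - \<gamma>) \<le> \<delta>" .
  have "norm (abs_l2 (sol (1 - s)) - abs_l2 (sol (1 - 2 * s))) \<le> C * ((1 - s) - (1 - 2 * s)) powr \<theta>"
    by (rule H) (use s in auto)
  then have "c * s powr \<gamma> \<le> C * s powr \<theta>" using c(2)[OF s] by simp
  also have "\<dots> = C * s powr (\<theta> - \<gamma>) * s powr \<gamma>" using s by (simp add: powr_add[symmetric])
  finally have "c \<le> C * s powr (\<theta> - \<gamma>)" using s by simp
  also have "\<dots> \<le> (\<bar>C\<bar> + 1) * \<delta>" using sd by (intro mult_mono) auto
  also have "\<dots> = c / 2" by (simp add: \<delta>_def field_simps)
  finally show False using c by simp
qed

end

theorem theorem2p7:
  fixes \<nu> :: real
  assumes "CARD('n::finite) \<ge> 2" and "1 / 2 < \<nu>" and "\<nu> \<le> 1"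
  shows "\<exists>(B :: real \<Rightarrow> real^'n \<Rightarrow> complex^'n^'n) (f :: real \<Rightarrow> (real^'n) l2).
    elliptic B \<and> f \<in> bochner_Linf I01 \<and>
    (\<exists>u :: real \<Rightarrow> 'n h1.
       is_solution B (\<lambda>t. l2_antidual (f t)) u \<and>
       (\<forall>v. is_solution B (\<lambda>t. l2_antidual (f t)) v \<longrightarrow> (AE t in I01. v t = u t)) \<and>
       (\<lambda>t. h1_l2 (u t)) \<notin> sobolev_H \<nu>)"
proof -
  obtain i j :: 'n where ij: "i \<noteq> j"
  proof -
    have "\<exists>i j :: 'n. i \<noteq> j"
    proof (rule ccontr)
      assume "\<nexists>i j :: 'n. i \<noteq> j"
      then have "(UNIV :: 'n set) = {undefined}" by auto
      then have "CARD('n) = 1" by (metis card_1_singleton_iff One_nat_def)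
      then show False using assms(1) by simp
    qed
    then show ?thesis using that by blast
  qed
  \<comment> \<open>leaves room for the Hoelder exponent 2 \<gamma> strictly between \<gamma> and \<nu> - 1/2\<close>
  define \<gamma> where "\<gamma> = (\<nu> - 1 / 2) / 4"
  interpret concentrating_profile \<gamma> i j
    by unfold_locales (use assms ij in \<open>auto simp: \<gamma>_def\<close>)
  define u where "u = (\<lambda>t. h1_of (sol t))"
  have u: "h1_l2 (u t) = abs_l2 (sol t)" if "t \<in> {0<..<1}" for t unfolding u_def by (rule sol_in_time(2)[OF that])
  have "(\<lambda>t. h1_l2 (u t)) \<notin> sobolev_H \<nu>"
  proof
    assume H: "(\<lambda>t. h1_l2 (u t)) \<in> sobolev_H \<nu>"
    show False
    proof (cases "\<nu> = 1")
      case True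
      then have "(\<lambda>t. h1_l2 (u t)) \<in> sobolev_H1" using H by (simp add: sobolev_H_def)
      moreover have "((\<lambda>t. h1_l2 (u t)) has_vector_derivative abs_l2 (sol' t)) (at t)" if "t \<in> {0<..<1}" for t
        unfolding u_def by (rule sol_in_time(1)[OF that])
      ultimately have "\<exists>C. \<forall>s\<in>{0<..<1}. \<forall>t\<in>{0<..<1}. s < t \<longrightarrow> norm (h1_l2 (u t) - h1_l2 (u s)) \<le> C * sqrt (t - s)"
        by (rule sobolev_H1_Hoelder[OF _ _ continuous_in_time(2)])
      then
      obtain C where "\<forall>s\<in>{0<..<1}. \<forall>t\<in>{0<..<1}. s < t \<longrightarrow> norm (h1_l2 (u t) - h1_l2 (u s)) \<le> C * sqrt (t - s)"
        by blast
      then show False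
        by (intro not_Hoelder[of "1 / 2" C]) (use True in \<open>auto simp: u powr_half_sqrt \<gamma>_def\<close>)
    next
      case False
      then obtain g where g: "g \<in> bessel_line \<nu>" "AE t in I01. g t = h1_l2 (u t)" using H by (auto simp: sobolev_H_def)
      have "continuous_on {0<..<1} (\<lambda>t. h1_l2 (u t))"
        by (rule continuous_on_cong[THEN iffD1, OF refl _ continuous_in_time(1)]) (simp add: u)
      moreover have "0 < 2 * \<gamma>" "2 * \<gamma> \<le> 1" "2 * \<gamma> < \<nu> - 1 / 2" using assms by (auto simp: \<gamma>_def)
      ultimately obtain C where C: "\<forall>s\<in>{0<..<1}. \<forall>t\<in>{0<..<1}. norm (h1_l2 (u t) - h1_l2 (u s)) \<le> C * \<bar>t - s\<bar> powr (2 * \<gamma>)"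
        using bessel_line_Hoelder[OF g(1) _ _ _ g(2)] by blast
      show False
      proof (rule not_Hoelder[of "2 * \<gamma>" C])
        fix s t :: real assume st: "s \<in> {0<..<1}" "t \<in> {0<..<1}" "s < t"
        then show "norm (abs_l2 (sol t) - abs_l2 (sol s)) \<le> C * (t - s) powr (2 * \<gamma>)"
          using C[rule_format, OF st(1,2)] by (simp add: u)
      qed (use \<gamma> in simp)
    qed
  qed
  then show ?thesis
    using elliptic_coeff_matrix concentrating_solution solution_unique[OF elliptic_coeff_matrix concentrating_solution(1)]
    unfolding u_def by blast
qed

end
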